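(* If $\mathbf{u}\in H^1_0(\Omega,\Sigma_k)$ is a minimizer of problem (P), then $\mathbf{u}$ is $2$-non-degenerate, in the sense that $$\liminf_{r\to0^+}\frac{\|\mathbf{u}\|_{x_0,r}}{r^2}>0\qquad\text{for all }x_0\in Z(\mathbf{u}).$$ In particular, $\mathcal{O}(\mathbf{u},x_0)\in[1,2]$ for every $x_0\in Z(\mathbf{u})$, the set $Z(\mathbf{u})$ has empty interior, and $Z(\mathbf{u})=\Gamma(\mathbf{u})$.
   Context: $N\ge 2$, $\Omega\subset\mathbb{R}^N$ is a bounded smooth domain, $k\in\mathbb{N}$, $k\ge1$. $\Sigma_k:=\{\xi\in\mathbb{R}^k\mid\sum_{i\ne j}\xi_i^2\xi_j^2=0\}$, and $H^1_0(\Omega,\Sigma_k)$ is the set of $\mathbf{u}\in H^1_0(\Omega,\mathbb{R}^k)$ with $\mathbf{u}(x)\in\Sigma_k$ for a.e. $x$. Problem (P) is $$\inf\Big\{\int_\Omega|\nabla\mathbf{u}|^2\,dx\ \Big|\ \mathbf{u}\in H^1_0(\Omega,\Sigma_k),\ \mathbf{u}\ge0,\ \|u_i\|_{L^1(\Omega)}=1\text{ for every }i=1,\dots,k\Big\},$$ where $|\nabla\mathbf{u}|^2=\sum_i|\nabla u_i|^2$ and $\mathbf{u}\ge0$ is meant componentwise; minimizers are identified with their continuous representatives (they are Lipschitz continuous in $\overline\Omega$). The nodal set and the free boundary are $$Z(\mathbf{u}):=\{\mathbf{u}=0\}\cap\Omega,\qquad \Gamma(\mathbf{u}):=\bigcup_{i=1}^k\partial\{u_i>0\}\cap\Omega.$$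 For $x_0\in\Omega$ and small $r>0$, $$\|u\|_{x_0,r}^2:=\frac1{r^{N-2}}\int_{B_r(x_0)}|\nabla u|^2\,dx+\frac1{r^{N-1}}\int_{\partial B_r(x_0)}u^2\,d\sigma,\qquad \|\mathbf{u}\|^2_{x_0,r}:=\sum_{i=1}^k\|u_i\|^2_{x_0,r},$$ and the vanishing order of $\mathbf{u}$ at $x_0$ is $$\mathcal{O}(\mathbf{u},x_0):=\sup\Big\{\gamma>0\ \Big|\ \limsup_{r\to0^+}\frac{\|\mathbf{u}\|_{x_0,r}}{r^\gamma}<+\infty\Big\}.$$ *)

theory Defs
  imports "HOL-Analysis.Analysis"
begin

section \<open>Smooth functions and smooth domains\<close>

definition partial_deriv :: "'n::finite \<Rightarrow> (real^'n \<Rightarrow> real) \<Rightarrow> real^'n \<Rightarrow> real" where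
  "partial_deriv i f x = frechet_derivative f (at x) (axis i 1)"

definition gradient :: "(real^'n::finite \<Rightarrow> real) \<Rightarrow> real^'n \<Rightarrow> real^'n" where
  "gradient f x = (\<chi> i. partial_deriv i f x)"

text \<open>The class of \<open>m\<close> times continuously differentiable functions; meaningful for open sets only.\<close>

primrec Ck_on :: "nat \<Rightarrow> (real^'n::finite) set \<Rightarrow> (real^'n \<Rightarrow> real) \<Rightarrow> bool" where
  "Ck_on 0 S f \<longleftrightarrow> continuous_on S f"
| "Ck_on (Suc m) S f \<longleftrightarrow> (\<forall>x\<in>S. f differentiable (at x)) \<and> (\<forall>i. Ck_on m S (partial_deriv i f))"

definition smooth_on :: "(real^'n::finite) set \<Rightarrow> (real^'n \<Rightarrow> real) \<Rightarrow> bool" where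
  "smooth_on S f \<longleftrightarrow> (\<forall>m. Ck_on m S f)"

text \<open>The boundary is smooth in the sense of local defining functions: near each boundary point,
  the domain is a strict sublevel set of a smooth function without critical points (in particular
  it lies on one side of its boundary).\<close>

definition bounded_smooth_domain :: "(real^'n::finite) set \<Rightarrow> bool" where
  "bounded_smooth_domain \<Omega> \<longleftrightarrow>
     open \<Omega> \<and> connected \<Omega> \<and> \<Omega> \<noteq> {} \<and> bounded \<Omega> \<and>
     (\<forall>p\<in>frontier \<Omega>. \<exists>U \<psi>. open U \<and> p \<in> U \<and> smooth_on U \<psi> \<and>
        (\<forall>x\<in>U. gradient \<psi> x \<noteq> 0) \<and> \<Omega> \<inter> U = {x\<in>U. \<psi> x < 0})"


section \<open>Sobolev spaces\<close>

text \<open>Functions on \<open>\<Omega>\<close> are represented by total functions whose values outside \<open>\<Omega>\<close> are irrelevant,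
  and classes modulo null sets by their members.\<close>

definition test_functions :: "(real^'n::finite) set \<Rightarrow> (real^'n \<Rightarrow> real) set" where
  "test_functions \<Omega> =
     {\<phi>. smooth_on UNIV \<phi> \<and> compact (closure {x. \<phi> x \<noteq> 0}) \<and> closure {x. \<phi> x \<noteq> 0} \<subseteq> \<Omega>}"

definition locally_integrable :: "(real^'n::finite) set \<Rightarrow> (real^'n \<Rightarrow> 'b::euclidean_space) \<Rightarrow> bool" where
  "locally_integrable \<Omega> f \<longleftrightarrow> (\<forall>K. compact K \<and> K \<subseteq> \<Omega> \<longrightarrow> f absolutely_integrable_on K)"

definition square_integrable :: "(real^'n::finite) set \<Rightarrow> (real^'n \<Rightarrow> 'b::euclidean_space) \<Rightarrow> bool" where
  "square_integrable \<Omega> f \<longleftrightarrow>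
     f \<in> borel_measurable (lebesgue_on \<Omega>) \<and> integrable (lebesgue_on \<Omega>) (\<lambda>x. (norm (f x))\<^sup>2)"

definition has_weak_gradient ::
  "(real^'n::finite) set \<Rightarrow> (real^'n \<Rightarrow> real) \<Rightarrow> (real^'n \<Rightarrow> real^'n) \<Rightarrow> bool" where
  "has_weak_gradient \<Omega> f G \<longleftrightarrow>
     locally_integrable \<Omega> f \<and> locally_integrable \<Omega> G \<and>
     (\<forall>\<phi>\<in>test_functions \<Omega>. \<forall>i.
        (LINT x|lebesgue_on \<Omega>. f x * partial_deriv i \<phi> x) = - (LINT x|lebesgue_on \<Omega>. G x $ i * \<phi> x))"

text \<open>The weak gradient is unique only up to null sets; it is used only under integrals.\<close>

definition weak_gradient :: "(real^'n::finite) set \<Rightarrow> (real^'n \<Rightarrow> real) \<Rightarrow> real^'n \<Rightarrow> real^'n" where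
  "weak_gradient \<Omega> f = (SOME G. has_weak_gradient \<Omega> f G)"

definition H1 :: "(real^'n::finite) set \<Rightarrow> (real^'n \<Rightarrow> real) set" where
  "H1 \<Omega> = {f. square_integrable \<Omega> f \<and> (\<exists>G. has_weak_gradient \<Omega> f G \<and> square_integrable \<Omega> G)}"

definition H1_norm :: "(real^'n::finite) set \<Rightarrow> (real^'n \<Rightarrow> real) \<Rightarrow> real" where
  "H1_norm \<Omega> f =
     sqrt ((LINT x|lebesgue_on \<Omega>. (f x)\<^sup>2) + (LINT x|lebesgue_on \<Omega>. (norm (weak_gradient \<Omega> f x))\<^sup>2))"

definition H10 :: "(real^'n::finite) set \<Rightarrow> (real^'n \<Rightarrow> real) set" where
  "H10 \<Omega> = {f \<in> H1 \<Omega>. \<exists>\<phi>. (\<forall>m. \<phi> m \<in> test_functions \<Omega>) \<and>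
                        (\<lambda>m. H1_norm \<Omega> (\<lambda>x. f x - \<phi> m x)) \<longlonglongrightarrow> 0}"


section \<open>The variational problem\<close>

definition Sigma_k :: "(real^'k::finite) set" where
  "Sigma_k = {\<xi>. (\<Sum>(i,j)\<in>{(i,j). i \<noteq> j}. (\<xi> $ i)\<^sup>2 * (\<xi> $ j)\<^sup>2) = 0}"

definition H10_Sigma :: "(real^'n::finite) set \<Rightarrow> (real^'n \<Rightarrow> real^'k::finite) set" where
  "H10_Sigma \<Omega> = {u. (\<forall>i. (\<lambda>x. u x $ i) \<in> H10 \<Omega>) \<and> (AE x in lebesgue_on \<Omega>. u x \<in> Sigma_k)}"

definition energy :: "(real^'n::finite) set \<Rightarrow> (real^'n \<Rightarrow> real^'k::finite) \<Rightarrow> real" where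
  "energy \<Omega> u =
     (LINT x|lebesgue_on \<Omega>. (\<Sum>i\<in>UNIV. (norm (weak_gradient \<Omega> (\<lambda>y. u y $ i) x))\<^sup>2))"

definition admissible :: "(real^'n::finite) set \<Rightarrow> (real^'n \<Rightarrow> real^'k::finite) set" where
  "admissible \<Omega> = {u \<in> H10_Sigma \<Omega>. (AE x in lebesgue_on \<Omega>. \<forall>i. 0 \<le> u x $ i) \<and>
                                  (\<forall>i. (LINT x|lebesgue_on \<Omega>. \<bar>u x $ i\<bar>) = 1)}"

definition minimizer :: "(real^'n::finite) set \<Rightarrow> (real^'n \<Rightarrow> real^'k::finite) \<Rightarrow> bool" where
  "minimizer \<Omega> u \<longleftrightarrow> u \<in> admissible \<Omega> \<and>
     (\<forall>v :: real^'n \<Rightarrow> real^'k. v \<in> admissible \<Omega> \<longrightarrow> energy \<Omega> u \<le> energy \<Omega> v)"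

definition nodal_set :: "(real^'n::finite) set \<Rightarrow> (real^'n \<Rightarrow> real^'k::finite) \<Rightarrow> (real^'n) set" where
  "nodal_set \<Omega> u = {x \<in> \<Omega>. u x = 0}"

definition free_boundary :: "(real^'n::finite) set \<Rightarrow> (real^'n \<Rightarrow> real^'k::finite) \<Rightarrow> (real^'n) set" where
  "free_boundary \<Omega> u = (\<Union>i. frontier {x \<in> \<Omega>. u x $ i > 0} \<inter> \<Omega>)"


section \<open>Local norms and vanishing order\<close>

text \<open>Surface measure on the sphere of radius \<open>r > 0\<close> around \<open>x0\<close>, concentrated on that sphere.
  On the unit sphere it is given by polar coordinates, the area of a Borel set \<open>A\<close> being \<open>N\<close> times
  the volume of the cone over \<open>A\<close> in the unit ball; here it is transported to radius \<open>r\<close>.\<close>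

definition sphere_measure :: "real^'n::finite \<Rightarrow> real \<Rightarrow> (real^'n) measure" where
  "sphere_measure x0 r =
     distr (scale_measure (ennreal (real CARD('n) * r ^ (CARD('n) - 1)))
              (restrict_space lborel (ball 0 1)))
           borel (\<lambda>y. x0 + r *\<^sub>R sgn y)"

definition local_norm_sq ::
  "(real^'n::finite) set \<Rightarrow> (real^'n \<Rightarrow> real) \<Rightarrow> real^'n \<Rightarrow> real \<Rightarrow> real" where
  "local_norm_sq \<Omega> f x0 r =
     1 / r ^ (CARD('n) - 2) * (LINT x|lebesgue_on (ball x0 r). (norm (weak_gradient \<Omega> f x))\<^sup>2) +
     1 / r ^ (CARD('n) - 1) * (LINT x:sphere x0 r|sphere_measure x0 r. (f x)\<^sup>2)"

definition local_norm ::
  "(real^'n::finite) set \<Rightarrow> (real^'n \<Rightarrow> real^'k::finite) \<Rightarrow> real^'n \<Rightarrow> real \<Rightarrow> real" where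
  "local_norm \<Omega> u x0 r = sqrt (\<Sum>i\<in>UNIV. local_norm_sq \<Omega> (\<lambda>x. u x $ i) x0 r)"

definition vanishing_order ::
  "(real^'n::finite) set \<Rightarrow> (real^'n \<Rightarrow> real^'k::finite) \<Rightarrow> real^'n \<Rightarrow> ereal" where
  "vanishing_order \<Omega> u x0 =
     Sup {ereal \<gamma> | \<gamma>. \<gamma> > 0 \<and>
            Limsup (at_right 0) (\<lambda>r. ereal (local_norm \<Omega> u x0 r / r powr \<gamma>)) < \<infinity>}"

definition two_nondegenerate :: "(real^'n::finite) set \<Rightarrow> (real^'n \<Rightarrow> real^'k::finite) \<Rightarrow> bool" where
  "two_nondegenerate \<Omega> u \<longleftrightarrow>
     (\<forall>x0\<in>nodal_set \<Omega> u. Liminf (at_right 0) (\<lambda>r. ereal (local_norm \<Omega> u x0 r / r\<^sup>2)) > 0)"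

end

theory Submission
  imports Defs
begin

text \<open>
  The nonnegative vectors in \<open>\<Sigma>\<^sub>k\<close> form a tree, \<open>k\<close> half-lines glued at the origin, and a minimizer is
  compared with the images of itself under maps of this tree. Since the mass constraint can be restored by
  rescaling the components, at a cost proportional to the energy \<open>E\<close> times the change of mass, retracting a
  component towards the origin gives \<open>\<Delta>u\<^sub>i \<ge> - 3 E\<close>, and moving all points of the tree towards the end of the
  branch \<open>i\<close> gives \<open>\<Delta>(u\<^sub>i - \<Sum>\<^sub>j u\<^sub>j) \<le> 3 E\<close>, where \<open>j \<noteq> i\<close>.

  Non-degeneracy: moving the tree by a bump of height \<open>c r\<^sup>2\<close> on a ball of radius \<open>r\<close> increases the mass of
  the component \<open>i\<close> by about \<open>c r\<^sup>2\<close> times the volume. If the local norm is at most \<open>\<delta> r\<^sup>2\<close>, the energy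
  changes by \<open>O((c \<delta> + c\<^sup>2) r\<^sup>2)\<close> times the volume and the other components lose only \<open>O(\<delta> r\<^sup>2)\<close> times the
  volume, which contradicts minimality for small \<open>c\<close> and much smaller \<open>\<delta>\<close>.

  Vanishing order at least 1: by the two differential inequalities the tree distance \<open>D\<close> between \<open>u\<close> and its
  translate by \<open>h\<close> satisfies \<open>\<Delta>D \<ge> - 6 E\<close>. The mean value inequality at a zero of \<open>u\<close> bounds \<open>u(x\<^sub>0 + h)\<close> by
  \<open>|h|\<close> times the mean of the gradient on a ball, up to \<open>O(r\<^sup>2)\<close>. With the Caccioppoli inequality this controls the
  mean square of the gradient on the radius \<open>q r\<close> by that on the radius \<open>r\<close>, with a constant that does not
  depend on \<open>q\<close>; iteration for small \<open>q\<close> yields growth of order \<open>1 - \<epsilon>\<close> for every \<open>\<epsilon> > 0\<close>.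
\<close>

section \<open>Smooth functions\<close>

text \<open>The minimizer is only assumed continuous, so its decay at a zero has to be extracted
  from the two differential inequalities alone. As the vanishing order is a supremum, it suffices to
  reach every exponent below 1. The number 3 in \<open>3 * E\<close> is half of the 6 in
  \<open>1 / m^2 <= 1 + 6 e\<close>, the price of restoring a mass \<open>m >= 1 - e\<close>. The
  distance \<open>D\<close> to a translate is not itself a sum of components. Near a point where it
  is positive it dominates a difference \<open>f a (y + dp) - fh a (y + dq)\<close>, with equality
  at that point. Such touching from below is compatible with averaging around the point, but not
  with testing the weak inequality. The inequalities are therefore converted to mean values, patched
  together there, and converted back to the weak form; the way back needs one radius for all points,
  hence the truncation of \<open>D\<close> at \<open>\<epsilon>\<close>. Averages are taken with a
  smooth kernel whose derivative in the radius is a Laplacian of a bump, so that every function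
  tested is a genuine test function. Surface integrals are rewritten as volume integrals of
  0-homogeneous functions, which can be compared with \<open>u\<close> by contracting the
  ball.\<close>

definition flat :: "nat \<Rightarrow> real \<Rightarrow> real" where
  "flat n s = (if s > 0 then exp (- 1 / s) / s ^ n else 0)"

lemma flat_nonneg: "flat n s \<ge> 0"
  by (simp add: flat_def)

lemma flat_pos: "s > 0 \<Longrightarrow> flat n s > 0"
  by (simp add: flat_def)

lemma flat_nonpos [simp]: "s \<le> 0 \<Longrightarrow> flat n s = 0"
  by (simp add: flat_def)

lemma flat_at_right: "(flat n \<longlongrightarrow> 0) (at_right 0)"
proof -
  have "((\<lambda>y::real. y ^ n / exp y) \<longlongrightarrow> 0) at_top"
    by (rule tendsto_power_div_exp_0)
  then have "((\<lambda>s::real. inverse s ^ n / exp (inverse s)) \<longlongrightarrow> 0) (at_right 0)"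
    by (rule filterlim_compose) (rule filterlim_inverse_at_top_right)
  moreover have "\<forall>\<^sub>F s in at_right 0. inverse s ^ n / exp (inverse s) = flat n s"
    unfolding eventually_at_right_field
    by (intro exI[of _ 1]) (auto simp: flat_def exp_minus field_simps)
  ultimately show ?thesis
    by (rule Lim_transform_eventually)
qed

text \<open>The functions \<open>exp (- 1 / s) / s ^ n\<close> span a space that is closed under
  differentiation; carrying the exponent \<open>n\<close> along turns smoothness into an
  induction.\<close>

lemma has_real_derivative_flat:
  "(flat n has_real_derivative (flat (n + 2) s - n * flat (n + 1) s)) (at s)"
proof -
  consider "s > 0" | "s < 0" | "s = 0" by linarith
  then show ?thesis
  proof cases
    case 1
    have "((\<lambda>s. exp (- 1 / s) / s ^ n) has_real_derivative
        (exp (-1/s) * (1 / s^2) * s ^ n - exp (-1/s) * (n * s ^ (n - 1))) / (s ^ n * s ^ n)) (at s)"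
      using 1 by (auto intro!: derivative_eq_intros simp: power2_eq_square)
    moreover have "(exp (-1/s) * (1 / s^2) * s ^ n - exp (-1/s) * (n * s ^ (n - 1))) / (s ^ n * s ^ n)
      = flat (n + 2) s - n * flat (n + 1) s"
      using 1 by (cases n) (auto simp: flat_def field_simps power2_eq_square)
    ultimately have "((\<lambda>s. exp (- 1 / s) / s ^ n) has_real_derivative (flat (n + 2) s - n * flat (n + 1) s)) (at s)"
      by simp
    then show ?thesis
      by (rule has_field_derivative_transform_within_open[where S="{0<..}"]) (use 1 in \<open>auto simp: flat_def\<close>)
  next
    case 2
    have "((\<lambda>s. 0) has_real_derivative 0) (at s)" by simp
    then have "(flat n has_real_derivative 0) (at s)"
      by (rule has_field_derivative_transform_within_open[where S="{..<0}"]) (use 2 in \<open>auto simp: flat_def\<close>)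
    then show ?thesis using 2 by simp
  next
    case 3
    \<comment> \<open>At 0 the difference quotient from the right is \<open>flat (Suc n)\<close> and
      from the left it is 0, so the derivative is 0, in agreement with the formula.\<close>
    have "((\<lambda>h. flat n h / h) \<longlongrightarrow> 0) (at_right 0)"
    proof (rule Lim_transform_eventually[OF flat_at_right])
      show "\<forall>\<^sub>F x in at_right 0. flat (Suc n) x = flat n x / x"
        unfolding eventually_at_right_field
        by (intro exI[of _ 1]) (auto simp: flat_def)
    qed
    moreover have "((\<lambda>h. flat n h / h) \<longlongrightarrow> 0) (at_left 0)"
    proof (rule Lim_transform_eventually[OF tendsto_const])
      show "\<forall>\<^sub>F x in at_left 0. 0 = flat n x / x"
        unfolding eventually_at_left_field
        by (intro exI[of _ "-1"]) (auto simp: flat_def)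
    qed
    ultimately have "((\<lambda>h. flat n h / h) \<longlongrightarrow> 0) (at 0)"
      by (simp add: filterlim_split_at)
    then show ?thesis
      using 3 by (simp add: has_field_derivative_iff)
  qed
qed

section \<open>Calculus of partial derivatives and of the classes \<open>Ck_on\<close>\<close>

lemma partial_deriv_eqI:
  assumes "(f has_derivative f') (at x)"
  shows "partial_deriv i f x = f' (axis i 1)"
  using assms frechet_derivative_at unfolding partial_deriv_def by metis

text \<open>The product rule leaves undifferentiated factors, which have to be lowered to order
  \<open>m\<close>. The base case is continuity of differentiable functions.\<close>

lemma Ck_on_Suc_imp: "Ck_on (Suc m) UNIV f \<Longrightarrow> Ck_on m UNIV f"
proof (induction m arbitrary: f)
  case 0
  then show ?case
    by (auto simp: continuous_on_eq_continuous_at differentiable_imp_continuous_within)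
next
  case (Suc m)
  then show ?case by (metis Ck_on.simps(2))
qed

lemma Ck_on_const: "Ck_on m UNIV (\<lambda>x. c)"
proof (induction m arbitrary: c)
  case (Suc m)
  have "partial_deriv i (\<lambda>x::real^'a. c) = (\<lambda>x. 0)" for i
    by (rule ext) (subst partial_deriv_eqI[where f'="\<lambda>x. 0"], auto)
  then show ?case using Suc by simp
qed auto

lemma Ck_on_add: "Ck_on m UNIV f \<Longrightarrow> Ck_on m UNIV g \<Longrightarrow> Ck_on m UNIV (\<lambda>x. f x + g x)"
proof (induction m arbitrary: f g)
  case 0
  then show ?case by (auto intro: continuous_on_add)
next
  case (Suc m)
  have "partial_deriv i (\<lambda>x. f x + g x) = (\<lambda>x. partial_deriv i f x + partial_deriv i g x)" for i
  proof
    fix x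
    have "((\<lambda>x. f x + g x) has_derivative (\<lambda>h. frechet_derivative f (at x) h + frechet_derivative g (at x) h)) (at x)"
      using Suc.prems by (auto intro!: has_derivative_add simp: frechet_derivative_works[symmetric])
    from partial_deriv_eqI[OF this]
    show "partial_deriv i (\<lambda>x. f x + g x) x = partial_deriv i f x + partial_deriv i g x"
      by (simp add: partial_deriv_def)
  qed
  then show ?case using Suc by (auto intro: differentiable_add)
qed

lemma partial_deriv_mult:
  assumes "f differentiable (at x)" "g differentiable (at x)"
  shows "partial_deriv i (\<lambda>x. f x * g x) x = f x * partial_deriv i g x + partial_deriv i f x * g x"
proof -
  have "((\<lambda>x. f x * g x) has_derivative (\<lambda>h. f x * frechet_derivative g (at x) h + frechet_derivative f (at x) h * g x)) (at x)"
    using assms by (auto intro!: has_derivative_mult simp: frechet_derivative_works[symmetric])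
  from partial_deriv_eqI[OF this] show ?thesis
    by (simp add: partial_deriv_def)
qed

lemma Ck_on_mult: "Ck_on m UNIV f \<Longrightarrow> Ck_on m UNIV g \<Longrightarrow> Ck_on m UNIV (\<lambda>x. f x * g x)"
proof (induction m arbitrary: f g)
  case 0
  then show ?case by (auto intro: continuous_on_mult)
next
  case (Suc m)
  have "partial_deriv i (\<lambda>x. f x * g x) = (\<lambda>x. f x * partial_deriv i g x + partial_deriv i f x * g x)" for i
    using Suc.prems by (intro ext partial_deriv_mult) auto
  moreover have "Ck_on m UNIV f" "Ck_on m UNIV g"
    using Suc.prems Ck_on_Suc_imp by blast+
  ultimately show ?case using Suc by (auto intro!: differentiable_mult Ck_on_add)
qed

lemma partial_deriv_compose:
  assumes "f differentiable (at x)" "(h has_real_derivative h') (at (f x))"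
  shows "partial_deriv i (\<lambda>x. h (f x)) x = h' * partial_deriv i f x"
proof -
  have "((\<lambda>x. h (f x)) has_derivative (\<lambda>v. h' * frechet_derivative f (at x) v)) (at x)"
    using assms has_derivative_compose[of f "frechet_derivative f (at x)" x UNIV h "\<lambda>v. h' * v"]
    by (auto simp: frechet_derivative_works[symmetric] has_field_derivative_def)
  from partial_deriv_eqI[OF this] show ?thesis
    by (simp add: partial_deriv_def)
qed

text \<open>The derivative of \<open>flat n\<close> involves \<open>flat (n + 1)\<close> and
  \<open>flat (n + 2)\<close>, hence the induction on the order runs for all \<open>n\<close> at
  once.\<close>

lemma Ck_on_flat: "Ck_on m UNIV q \<Longrightarrow> Ck_on m UNIV (\<lambda>x. flat n (q x))"
proof (induction m arbitrary: n)
  case 0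
  have "isCont (flat n) s" for s
    using has_real_derivative_flat DERIV_isCont by blast
  then have "continuous_on UNIV (flat n)"
    by (simp add: continuous_at_imp_continuous_on)
  then show ?case using 0
    by (auto intro: continuous_on_compose2)
next
  case (Suc m)
  have d: "q differentiable (at x)" for x using Suc.prems by auto
  have p: "partial_deriv i (\<lambda>x. flat n (q x)) =
      (\<lambda>x. (flat (n+2) (q x) + (- real n) * flat (n + 1) (q x)) * partial_deriv i q x)" for i
    by (rule ext, subst partial_deriv_compose[OF d has_real_derivative_flat]) simp
  have q: "Ck_on m UNIV q" using Suc.prems Ck_on_Suc_imp by blast
  have f: "(\<lambda>x. flat n (q x)) differentiable (at x)" for x
  proof -
    have "flat n differentiable at (q x)"
      using has_real_derivative_flat real_differentiable_def by blast
    then show ?thesis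
      using differentiable_chain_at[OF d[of x], of "flat n"] by (auto simp: o_def)
  qed
  have "Ck_on m UNIV (partial_deriv i (\<lambda>x. flat n (q x)))" for i
    unfolding p
    by (rule Ck_on_mult[OF Ck_on_add[OF Suc.IH[OF q] Ck_on_mult[OF Ck_on_const Suc.IH[OF q]]]])
       (use Suc.prems in auto)
  with f show ?case by simp
qed

lemma partial_deriv_nth: "partial_deriv i (\<lambda>x. x $ j) x = (if i = j then 1 else 0)"
proof -
  have "((\<lambda>x::real^'a. x $ j) has_derivative (\<lambda>x. x $ j)) (at x)"
    by (rule bounded_linear_imp_has_derivative) (rule bounded_linear_vec_nth)
  from partial_deriv_eqI[OF this] show ?thesis
    by (auto simp: axis_def)
qed

lemma Ck_on_nth: "Ck_on m UNIV (\<lambda>x. x $ j)"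
proof (cases m)
  case 0
  then show ?thesis by (auto intro: continuous_intros)
next
  case (Suc k)
  have "partial_deriv i (\<lambda>x::real^'a. x $ j) = (\<lambda>x. if i = j then 1 else 0)" for i
    by (rule ext) (rule partial_deriv_nth)
  then show ?thesis using Suc
    by (auto intro: Ck_on_const bounded_linear_imp_differentiable bounded_linear_vec_nth)
qed

lemma smooth_const [simp, intro]: "smooth_on UNIV (\<lambda>x. c)"
  and smooth_add [intro]: "smooth_on UNIV f \<Longrightarrow> smooth_on UNIV g \<Longrightarrow> smooth_on UNIV (\<lambda>x. f x + g x)"
  and smooth_mult [intro]: "smooth_on UNIV f \<Longrightarrow> smooth_on UNIV g \<Longrightarrow> smooth_on UNIV (\<lambda>x. f x * g x)"
  and smooth_flat [intro]: "smooth_on UNIV f \<Longrightarrow> smooth_on UNIV (\<lambda>x. flat n (f x))"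
  and smooth_nth [simp, intro]: "smooth_on UNIV (\<lambda>x. x $ j)"
  by (auto simp: smooth_on_def Ck_on_const Ck_on_add Ck_on_mult Ck_on_flat Ck_on_nth)

lemma smooth_minus [intro]: "smooth_on UNIV f \<Longrightarrow> smooth_on UNIV (\<lambda>x. - f x)"
  using smooth_mult[OF smooth_const[of "-1"], of f] by simp

lemma smooth_diff [intro]: "smooth_on UNIV f \<Longrightarrow> smooth_on UNIV g \<Longrightarrow> smooth_on UNIV (\<lambda>x. f x - g x)"
  using smooth_add[OF _ smooth_minus, of f g] by simp

lemma smooth_sum [intro]:
  "(\<And>i. i \<in> A \<Longrightarrow> smooth_on UNIV (f i)) \<Longrightarrow> smooth_on UNIV (\<lambda>x. \<Sum>i\<in>A. f i x)"
  by (induction A rule: infinite_finite_induct) auto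

lemma smooth_partial_deriv [intro]: "smooth_on UNIV f \<Longrightarrow> smooth_on UNIV (partial_deriv i f)"
  unfolding smooth_on_def by (metis Ck_on.simps(2))

lemma smooth_differentiable: "smooth_on UNIV f \<Longrightarrow> f differentiable (at x)"
  unfolding smooth_on_def by (metis Ck_on.simps(2) UNIV_I)

lemma smooth_continuous: "smooth_on UNIV f \<Longrightarrow> continuous_on A f"
  unfolding smooth_on_def by (metis Ck_on.simps(1) continuous_on_subset subset_UNIV)

lemma smooth_norm_sq: "smooth_on UNIV (\<lambda>x. (norm (x - a))\<^sup>2)"
proof -
  have "(norm (x - a))\<^sup>2 = (\<Sum>i\<in>UNIV. (x $ i - a $ i) * (x $ i - a $ i))" for x :: "real^'a"
    by (simp add: power2_norm_eq_inner inner_vec_def)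
  then show ?thesis by (auto intro!: smooth_sum smooth_mult smooth_diff)
qed

lemma partial_deriv_add:
  "f differentiable (at x) \<Longrightarrow> g differentiable (at x) \<Longrightarrow>
   partial_deriv i (\<lambda>x. f x + g x) x = partial_deriv i f x + partial_deriv i g x"
  by (subst partial_deriv_eqI[where f'="\<lambda>h. frechet_derivative f (at x) h + frechet_derivative g (at x) h"])
     (auto intro!: has_derivative_add simp: frechet_derivative_works[symmetric] partial_deriv_def)

lemma partial_deriv_const [simp]: "partial_deriv i (\<lambda>x. c) x = 0"
  by (subst partial_deriv_eqI[where f'="\<lambda>x. 0"]) auto

lemma partial_deriv_cmult:
  "f differentiable (at x) \<Longrightarrow> partial_deriv i (\<lambda>x. c * f x) x = c * partial_deriv i f x"
  using partial_deriv_mult[of "\<lambda>x. c" x f i] by simp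

lemma partial_deriv_diff:
  "f differentiable (at x) \<Longrightarrow> g differentiable (at x) \<Longrightarrow>
   partial_deriv i (\<lambda>x. f x - g x) x = partial_deriv i f x - partial_deriv i g x"
  by (subst partial_deriv_eqI[where f'="\<lambda>h. frechet_derivative f (at x) h - frechet_derivative g (at x) h"])
     (auto intro!: has_derivative_diff simp: frechet_derivative_works[symmetric] partial_deriv_def)

lemma partial_deriv_norm_sq: "partial_deriv i (\<lambda>x. (norm (x - a))\<^sup>2) x = 2 * (x $ i - a $ i)"
proof -
  have "((\<lambda>x. (x - a) \<bullet> (x - a)) has_derivative (\<lambda>h. 2 * ((x - a) \<bullet> h))) (at x)"
    by (auto intro!: derivative_eq_intros simp: inner_commute)
  from partial_deriv_eqI[OF this] show ?thesis
    by (simp add: power2_norm_eq_inner inner_axis)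
qed

lemma has_derivative_gradient:
  assumes "f differentiable (at x)"
  shows "(f has_derivative (\<lambda>h. gradient f x \<bullet> h)) (at x)"
proof -
  have d: "(f has_derivative frechet_derivative f (at x)) (at x)"
    using assms by (simp add: frechet_derivative_works[symmetric])
  have l: "linear (frechet_derivative f (at x))"
    using assms by (rule linear_frechet_derivative)
  have "frechet_derivative f (at x) h = gradient f x \<bullet> h" for h
  proof -
    have "h = (\<Sum>i\<in>UNIV. h $ i *\<^sub>R axis i 1)"
      by (rule basis_expansion[of h, unfolded scalar_mult_eq_scaleR, symmetric])
    then have "frechet_derivative f (at x) h = frechet_derivative f (at x) (\<Sum>i\<in>UNIV. h $ i *\<^sub>R axis i 1)"
      by (rule arg_cong)
    also have "\<dots> = (\<Sum>i\<in>UNIV. h $ i * frechet_derivative f (at x) (axis i 1))"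
      by (simp add: linear_sum[OF l] linear_scale[OF l])
    finally have "frechet_derivative f (at x) h = (\<Sum>i\<in>UNIV. h $ i * frechet_derivative f (at x) (axis i 1))" .
    then show ?thesis
      by (simp add: gradient_def inner_vec_def partial_deriv_def mult.commute)
  qed
  then have "frechet_derivative f (at x) = (\<lambda>h. gradient f x \<bullet> h)" by auto
  with d show ?thesis by simp
qed

section \<open>Test functions\<close>

text \<open>Any compact set outside which the function vanishes may stand for the closure of its
  support; supports of sums and products are then handled by unions and subsets.\<close>

lemma test_functionsI:
  assumes "smooth_on UNIV \<phi>" "compact K" "K \<subseteq> \<Omega>" "\<And>x. x \<notin> K \<Longrightarrow> \<phi> x = 0"
  shows "\<phi> \<in> test_functions \<Omega>"
proof -
  have "closure {x. \<phi> x \<noteq> 0} \<subseteq> K"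
    using assms by (intro closure_minimal compact_imp_closed) auto
  moreover have "closed (closure {x. \<phi> x \<noteq> 0})" by simp
  ultimately show ?thesis
    using assms compact_Int_closed[of K "closure {x. \<phi> x \<noteq> 0}"]
    by (simp add: test_functions_def Int_absorb1)
qed

lemma test_functionsE:
  assumes "\<phi> \<in> test_functions \<Omega>"
  obtains K where "compact K" "K \<subseteq> \<Omega>" "\<And>x. x \<notin> K \<Longrightarrow> \<phi> x = 0"
proof (rule that)
  show "compact (closure {x. \<phi> x \<noteq> 0})" "closure {x. \<phi> x \<noteq> 0} \<subseteq> \<Omega>"
    using assms by (auto simp: test_functions_def)
  show "\<phi> x = 0" if "x \<notin> closure {x. \<phi> x \<noteq> 0}" for x
    using that closure_subset[of "{x. \<phi> x \<noteq> 0}"] by auto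
qed

lemma test_smooth: "\<phi> \<in> test_functions \<Omega> \<Longrightarrow> smooth_on UNIV \<phi>"
  by (simp add: test_functions_def)

lemma test_outside: "\<phi> \<in> test_functions \<Omega> \<Longrightarrow> x \<notin> \<Omega> \<Longrightarrow> \<phi> x = 0"
  by (rule test_functionsE) auto

lemma test_mono: "\<phi> \<in> test_functions \<Omega> \<Longrightarrow> \<Omega> \<subseteq> \<Omega>' \<Longrightarrow> \<phi> \<in> test_functions \<Omega>'"
  by (auto simp: test_functions_def)

lemma test_add:
  assumes "\<phi> \<in> test_functions \<Omega>" "\<psi> \<in> test_functions \<Omega>"
  shows "(\<lambda>x. \<phi> x + \<psi> x) \<in> test_functions \<Omega>"
proof -
  obtain K where K: "compact K" "K \<subseteq> \<Omega>" "\<And>x. x \<notin> K \<Longrightarrow> \<phi> x = 0"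
    using test_functionsE[OF assms(1)] by blast
  obtain L where L: "compact L" "L \<subseteq> \<Omega>" "\<And>x. x \<notin> L \<Longrightarrow> \<psi> x = 0"
    using test_functionsE[OF assms(2)] by blast
  show ?thesis
    by (rule test_functionsI[where K="K \<union> L"]) (use K L assms in \<open>auto intro: test_smooth\<close>)
qed

lemma test_mult_left:
  assumes "smooth_on UNIV f" "\<phi> \<in> test_functions \<Omega>"
  shows "(\<lambda>x. f x * \<phi> x) \<in> test_functions \<Omega>"
proof -
  obtain K where K: "compact K" "K \<subseteq> \<Omega>" "\<And>x. x \<notin> K \<Longrightarrow> \<phi> x = 0"
    using test_functionsE[OF assms(2)] by blast
  show ?thesis
    by (rule test_functionsI[where K=K]) (use K assms in \<open>auto intro: test_smooth\<close>)
qed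

lemma test_cmult: "\<phi> \<in> test_functions \<Omega> \<Longrightarrow> (\<lambda>x. c * \<phi> x) \<in> test_functions \<Omega>"
  using test_mult_left[OF smooth_const] by blast

lemma test_zero: "(\<lambda>x. 0) \<in> test_functions \<Omega>"
  by (rule test_functionsI[where K="{}"]) auto

lemma test_partial_deriv:
  assumes "\<phi> \<in> test_functions \<Omega>"
  shows "partial_deriv i \<phi> \<in> test_functions \<Omega>"
proof -
  obtain K where K: "compact K" "K \<subseteq> \<Omega>" "\<And>x. x \<notin> K \<Longrightarrow> \<phi> x = 0"
    using test_functionsE[OF assms(1)] by blast
  have "partial_deriv i \<phi> x = 0" if "x \<notin> K" for x
  proof -
    have "((\<lambda>x. 0) has_derivative (\<lambda>h. 0)) (at x)" by simp
    then have "(\<phi> has_derivative (\<lambda>h. 0)) (at x)"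
      by (rule has_derivative_transform_within_open[where s="- K"])
         (use K that in \<open>auto simp: compact_imp_closed\<close>)
    from partial_deriv_eqI[OF this] show ?thesis by simp
  qed
  then show ?thesis
    using K assms by (intro test_functionsI[where K=K]) (auto intro: test_smooth)
qed

lemma test_differentiable: "\<phi> \<in> test_functions \<Omega> \<Longrightarrow> \<phi> differentiable (at x)"
  by (simp add: smooth_differentiable test_smooth)

lemma test_continuous: "\<phi> \<in> test_functions \<Omega> \<Longrightarrow> continuous_on A \<phi>"
  by (simp add: smooth_continuous test_smooth)

lemma test_borel [measurable_dest]: "\<phi> \<in> test_functions \<Omega> \<Longrightarrow> \<phi> \<in> borel_measurable borel"
  by (rule borel_measurable_continuous_onI) (rule test_continuous)

lemma test_bounded:
  assumes "\<phi> \<in> test_functions \<Omega>"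
  obtains B where "B \<ge> 0" "\<And>x. \<bar>\<phi> x\<bar> \<le> B"
proof -
  obtain K where K: "compact K" "K \<subseteq> \<Omega>" "\<And>x. x \<notin> K \<Longrightarrow> \<phi> x = 0"
    using test_functionsE[OF assms(1)] by blast
  have "compact (\<phi> ` K)"
    using K assms by (intro compact_continuous_image test_continuous)
  then obtain B where B: "\<And>x. x \<in> K \<Longrightarrow> norm (\<phi> x) \<le> B"
    using compact_imp_bounded[of "\<phi> ` K"] unfolding bounded_iff by auto
  show ?thesis
    by (rule that[of "max B 0"]) (auto simp: le_max_iff_disj, metis B K(3) abs_zero real_norm_def order_refl)
qed

lemma compact_support_integrable:
  fixes f :: "'a::euclidean_space \<Rightarrow> 'b::{banach, second_countable_topology}"
  assumes "continuous_on UNIV f" "compact K" "\<And>x. x \<notin> K \<Longrightarrow> f x = 0"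
  shows "integrable lborel f"
proof -
  have "integrable lborel (\<lambda>x. indicator K x *\<^sub>R f x)"
    using assms by (intro borel_integrable_compact) (auto intro: continuous_on_subset)
  moreover have "(\<lambda>x. indicator K x *\<^sub>R f x) = f"
    using assms(3) by (auto simp: fun_eq_iff indicator_def)
  ultimately show ?thesis by simp
qed

lemma test_integrable: "\<phi> \<in> test_functions \<Omega> \<Longrightarrow> integrable lborel \<phi>"
  by (rule test_functionsE) (auto intro: compact_support_integrable test_continuous)

lemma gradient_test_bounded:
  assumes "\<phi> \<in> test_functions \<Omega>"
  obtains B where "B \<ge> 0" "\<And>x. norm (gradient \<phi> x) \<le> B"
proof -
  have "\<exists>B. \<forall>x. \<bar>partial_deriv i \<phi> x\<bar> \<le> B" for i
    using test_bounded[OF test_partial_deriv[OF assms]] by metis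
  then obtain B where B: "\<And>i x. \<bar>partial_deriv i \<phi> x\<bar> \<le> B i" by metis
  have *: "norm (gradient \<phi> x) \<le> (\<Sum>i\<in>UNIV. B i)" for x
    using norm_le_l1_cart[of "gradient \<phi> x"] sum_mono[of UNIV "\<lambda>i. \<bar>gradient \<phi> x $ i\<bar>" B] B
    by (auto simp: gradient_def)
  moreover have "0 \<le> (\<Sum>i\<in>UNIV. B i)" using *[of 0] norm_ge_zero order_trans by blast
  ultimately show ?thesis using that by blast
qed

lemma test_lipschitz:
  assumes "\<phi> \<in> test_functions \<Omega>"
  obtains B where "B \<ge> 0" "\<And>x y. \<bar>\<phi> x - \<phi> y\<bar> \<le> B * norm (x - y)"
proof -
  obtain B where B: "B \<ge> 0" "\<And>x. norm (gradient \<phi> x) \<le> B"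
    using gradient_test_bounded[OF assms] by blast
  have "norm (\<phi> x - \<phi> y) \<le> B * norm (x - y)" for x y
  proof (rule differentiable_bound[where S=UNIV])
    show "(\<phi> has_derivative (\<lambda>h. gradient \<phi> x \<bullet> h)) (at x within UNIV)" for x
      by (simp add: has_derivative_gradient test_differentiable[OF assms])
    show "onorm (\<lambda>h. gradient \<phi> x \<bullet> h) \<le> B" for x
    proof (rule onorm_le)
      fix h
      have "norm (gradient \<phi> x \<bullet> h) \<le> norm (gradient \<phi> x) * norm h"
        using Cauchy_Schwarz_ineq2 by simp
      also have "\<dots> \<le> B * norm h" using B by (simp add: mult_right_mono)
      finally show "norm (gradient \<phi> x \<bullet> h) \<le> B * norm h" .
    qed
  qed auto
  then show ?thesis using that B by auto
qed

lemma lborel_integral_translate: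
  fixes f :: "'a::euclidean_space \<Rightarrow> real"
  assumes [measurable]: "f \<in> borel_measurable borel"
  shows "(LINT x|lborel. f (c + x)) = (LINT x|lborel. f x)"
  by (subst (2) lborel_distr_plus[of c, symmetric]) (simp add: integral_distr)

text \<open>By translation invariance every difference quotient of \<open>\<phi>\<close> has
  integral 0; the quotients converge to the partial derivative under a common integrable
  bound.\<close>

lemma integral_partial_deriv_test:
  assumes t: "\<phi> \<in> test_functions \<Omega>"
  shows "(LINT x|lborel. partial_deriv i \<phi> x) = 0"
proof -
  define e :: "real^'a" where "e = axis i 1"
  define h :: "nat \<Rightarrow> real" where "h n = 1 / (n + 1)" for n
  have h0: "h n > 0" "h n \<le> 1" for n by (auto simp: h_def field_simps)
  have hlim: "h \<longlonglongrightarrow> 0"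
    unfolding h_def using LIMSEQ_inverse_real_of_nat by (simp add: inverse_eq_divide add.commute)
  obtain B where B: "B \<ge> 0" "\<And>x y. \<bar>\<phi> x - \<phi> y\<bar> \<le> B * norm (x - y)"
    using test_lipschitz[OF t] by blast
  obtain K where K: "compact K" "K \<subseteq> \<Omega>" "\<And>x. x \<notin> K \<Longrightarrow> \<phi> x = 0"
    using test_functionsE[OF t] by blast
  obtain R where R: "K \<subseteq> cball 0 R"
    using compact_imp_bounded[OF K(1)] unfolding bounded_iff by (auto simp: subset_iff)
  note [measurable] = test_borel[OF t] test_borel[OF test_partial_deriv[OF t]]
  have "(\<lambda>n. LINT x|lborel. (\<phi> (h n *\<^sub>R e + x) - \<phi> x) / h n) \<longlonglongrightarrow> (LINT x|lborel. partial_deriv i \<phi> x)"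
  \<comment> \<open>The increments \<open>h n\<close> are at most 1, so all quotients vanish outside
    the ball of radius \<open>R + 1\<close> and are bounded there by the Lipschitz constant.\<close>
  proof (rule integral_dominated_convergence[where w="\<lambda>x. indicator (cball 0 (R + 1)) x * B"])
    show "integrable lborel (\<lambda>x. indicator (cball (0::real^'a) (R + 1)) x * B :: real)"
      using borel_integrable_compact[of "cball (0::real^'a) (R + 1)" "\<lambda>x. B"] by (simp only: real_scaleR_def compact_cball continuous_on_const True_implies_equals)
    show "AE x in lborel. (\<lambda>n. (\<phi> (h n *\<^sub>R e + x) - \<phi> x) / h n) \<longlonglongrightarrow> partial_deriv i \<phi> x"
    proof (rule AE_I2)
      fix x
      have "((\<lambda>s. \<phi> (x + s *\<^sub>R e)) has_derivative (\<lambda>s. gradient \<phi> x \<bullet> (s *\<^sub>R e))) (at 0)"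
      proof -
        have g: "(\<phi> has_derivative (\<lambda>h. gradient \<phi> x \<bullet> h)) (at (x + 0 *\<^sub>R e))"
          using has_derivative_gradient[OF test_differentiable[OF t], of x] by simp
        have l: "((\<lambda>s. x + s *\<^sub>R e) has_derivative (\<lambda>s. s *\<^sub>R e)) (at (0::real))"
          by (auto intro!: derivative_eq_intros)
        from has_derivative_compose[OF l g] show ?thesis by simp
      qed
      then have "((\<lambda>s. \<phi> (x + s *\<^sub>R e)) has_real_derivative partial_deriv i \<phi> x) (at 0)"
        by (simp add: has_field_derivative_def e_def inner_axis gradient_def mult.commute[of _ "partial_deriv i \<phi> x"])
      then have "((\<lambda>s. (\<phi> (x + s *\<^sub>R e) - \<phi> x) / s) \<longlongrightarrow> partial_deriv i \<phi> x) (at 0)"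
        by (simp add: has_field_derivative_iff)
      moreover have "filterlim h (at 0) sequentially"
        using hlim h0 by (auto simp: filterlim_at intro!: always_eventually) (metis less_irrefl)
      ultimately have "(\<lambda>n. (\<phi> (x + h n *\<^sub>R e) - \<phi> x) / h n) \<longlonglongrightarrow> partial_deriv i \<phi> x"
        by (rule filterlim_compose)
      then show "(\<lambda>n. (\<phi> (h n *\<^sub>R e + x) - \<phi> x) / h n) \<longlonglongrightarrow> partial_deriv i \<phi> x"
        by (simp add: add.commute)
    qed
    show "AE x in lborel. norm ((\<phi> (h n *\<^sub>R e + x) - \<phi> x) / h n) \<le> indicator (cball 0 (R + 1)) x * B" for n
    proof (rule AE_I2)
      fix x
      have ne: "norm e = 1" by (simp add: e_def)
      show "norm ((\<phi> (h n *\<^sub>R e + x) - \<phi> x) / h n) \<le> indicator (cball 0 (R + 1)) x * B"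
      proof (cases "norm x \<le> R + 1")
        case True
        have "\<bar>\<phi> (h n *\<^sub>R e + x) - \<phi> x\<bar> \<le> B * h n"
          using B(2)[of "h n *\<^sub>R e + x" x] h0[of n] ne by simp
        then show ?thesis using True h0[of n] by (simp add: field_simps)
      next
        case False
        have "norm x \<le> norm (h n *\<^sub>R e + x) + norm (h n *\<^sub>R e)"
          using norm_triangle_ineq4[of "h n *\<^sub>R e + x" "h n *\<^sub>R e"] by simp
        then have "norm (h n *\<^sub>R e + x) > R" using False h0[of n] ne by simp
        then have "h n *\<^sub>R e + x \<notin> K" "x \<notin> K" using R False by (auto simp: subset_iff)
        then show ?thesis using K(3) B by simp
      qed
    qed
  qed measurable
  moreover have "(LINT x|lborel. (\<phi> (h n *\<^sub>R e + x) - \<phi> x) / h n) = 0" for n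
  proof -
    have i: "integrable lborel (\<lambda>x. \<phi> (h n *\<^sub>R e + x))"
    proof (rule compact_support_integrable[where K="(\<lambda>x. - (h n *\<^sub>R e) + x) ` K"])
      show "continuous_on UNIV (\<lambda>x. \<phi> (h n *\<^sub>R e + x))"
        by (intro continuous_on_compose2[OF test_continuous[OF t, of UNIV]] continuous_intros) auto
      show "compact ((\<lambda>x. - (h n *\<^sub>R e) + x) ` K)" by (rule compact_translation[OF K(1)])
      show "\<phi> (h n *\<^sub>R e + x) = 0" if "x \<notin> (\<lambda>x. - (h n *\<^sub>R e) + x) ` K" for x
      proof (rule K(3), rule notI)
        assume "h n *\<^sub>R e + x \<in> K"
        then have "- (h n *\<^sub>R e) + (h n *\<^sub>R e + x) \<in> (\<lambda>x. - (h n *\<^sub>R e) + x) ` K" by blast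
        then show False using that by simp
      qed
    qed
    show ?thesis
      using lborel_integral_translate[of \<phi> "h n *\<^sub>R e"] i test_integrable[OF t]
      by (simp add: Bochner_Integration.integral_diff)
  qed
  ultimately show ?thesis by (simp only: LIMSEQ_const_iff)
qed

section \<open>Gradient and Laplacian of test functions\<close>

lemma gradient_nth [simp]: "gradient f x $ i = partial_deriv i f x"
  by (simp add: gradient_def)

definition laplacian :: "(real^'n::finite \<Rightarrow> real) \<Rightarrow> real^'n \<Rightarrow> real" where
  "laplacian \<phi> x = (\<Sum>i\<in>UNIV. partial_deriv i (partial_deriv i \<phi>) x)"

lemma test_sum:
  "(\<And>i. i \<in> A \<Longrightarrow> f i \<in> test_functions \<Omega>) \<Longrightarrow> (\<lambda>x. \<Sum>i\<in>A. f i x) \<in> test_functions \<Omega>"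
  by (induction A rule: infinite_finite_induct) (auto intro: test_zero test_add)

lemma test_laplacian: "\<phi> \<in> test_functions \<Omega> \<Longrightarrow> laplacian \<phi> \<in> test_functions \<Omega>"
  unfolding laplacian_def[abs_def] by (intro test_sum test_partial_deriv)

lemma gradient_cmult: "\<phi> differentiable (at x) \<Longrightarrow> gradient (\<lambda>x. c * \<phi> x) x = c *\<^sub>R gradient \<phi> x"
  by (simp add: vec_eq_iff partial_deriv_cmult)

lemma gradient_add:
  "\<phi> differentiable (at x) \<Longrightarrow> \<psi> differentiable (at x) \<Longrightarrow>
   gradient (\<lambda>x. \<phi> x + \<psi> x) x = gradient \<phi> x + gradient \<psi> x"
  by (simp add: vec_eq_iff partial_deriv_add)

lemma gradient_mult:
  "\<phi> differentiable (at x) \<Longrightarrow> \<psi> differentiable (at x) \<Longrightarrow>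
   gradient (\<lambda>x. \<phi> x * \<psi> x) x = \<phi> x *\<^sub>R gradient \<psi> x + \<psi> x *\<^sub>R gradient \<phi> x"
  by (simp add: vec_eq_iff partial_deriv_mult)

lemma gradient_test_continuous: "\<phi> \<in> test_functions \<Omega> \<Longrightarrow> continuous_on A (gradient \<phi>)"
  unfolding gradient_def[abs_def]
  by (intro continuous_on_vec_lambda test_continuous[OF test_partial_deriv])

lemma gradient_test_borel [measurable_dest]:
  "\<phi> \<in> test_functions \<Omega> \<Longrightarrow> gradient \<phi> \<in> borel_measurable borel"
  by (rule borel_measurable_continuous_onI) (rule gradient_test_continuous)

section \<open>Square-integrable functions\<close>

text \<open>Square integrability over an arbitrary measure, so that the same estimates serve
  \<open>lebesgue_on \<Omega>\<close> and \<open>lborel\<close>.\<close>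

definition L2 :: "'a measure \<Rightarrow> ('a \<Rightarrow> 'b::euclidean_space) \<Rightarrow> bool" where
  "L2 M f \<longleftrightarrow> f \<in> borel_measurable M \<and> integrable M (\<lambda>x. (norm (f x))\<^sup>2)"

lemma square_integrable_L2: "square_integrable \<Omega> f \<longleftrightarrow> L2 (lebesgue_on \<Omega>) f"
  by (simp add: square_integrable_def L2_def)

lemma L2_measurable [measurable_dest]: "L2 M f \<Longrightarrow> f \<in> borel_measurable M"
  by (simp add: L2_def)

lemma L2_integrable: "L2 M f \<Longrightarrow> integrable M (\<lambda>x. (norm (f x))\<^sup>2)"
  by (simp add: L2_def)

lemma L2_bound:
  fixes f :: "'a \<Rightarrow> 'b::euclidean_space" and g :: "'a \<Rightarrow> 'c::euclidean_space"
  assumes g: "L2 M g" and [measurable]: "f \<in> borel_measurable M"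
    and le: "AE x in M. norm (f x) \<le> c * norm (g x)"
  shows "L2 M f"
  unfolding L2_def
proof
  show "integrable M (\<lambda>x. (norm (f x))\<^sup>2)"
  proof (rule Bochner_Integration.integrable_bound)
    show "integrable M (\<lambda>x. c\<^sup>2 * (norm (g x))\<^sup>2)"
      using L2_integrable[OF g] by simp
    show "AE x in M. norm ((norm (f x))\<^sup>2) \<le> norm (c\<^sup>2 * (norm (g x))\<^sup>2)"
      using le
    proof eventually_elim
      case (elim x)
      then have "(norm (f x))\<^sup>2 \<le> (c * norm (g x))\<^sup>2" by (intro power_mono) auto
      then show ?case by (simp add: power_mult_distrib)
    qed
  qed measurable
qed fact

lemma L2_norm_mult_integrable:
  fixes f :: "'a \<Rightarrow> 'b::euclidean_space" and g :: "'a \<Rightarrow> 'c::euclidean_space"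
  assumes f: "L2 M f" and g: "L2 M g"
  shows "integrable M (\<lambda>x. norm (f x) * norm (g x))"
proof (rule Bochner_Integration.integrable_bound)
  note [measurable] = L2_measurable[OF f] L2_measurable[OF g]
  show "integrable M (\<lambda>x. (norm (f x))\<^sup>2 + (norm (g x))\<^sup>2)"
    using f g by (intro Bochner_Integration.integrable_add L2_integrable)
  show "(\<lambda>x. norm (f x) * norm (g x)) \<in> borel_measurable M" by measurable
  show "AE x in M. norm (norm (f x) * norm (g x)) \<le> norm ((norm (f x))\<^sup>2 + (norm (g x))\<^sup>2)"
  proof (rule AE_I2)
    fix x
    have "2 * (norm (f x) * norm (g x)) \<le> (norm (f x))\<^sup>2 + (norm (g x))\<^sup>2"
      using sum_squares_bound[of "norm (f x)" "norm (g x)"] by (simp add: mult.assoc)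
    moreover have "0 \<le> norm (f x) * norm (g x)" by simp
    ultimately show "norm (norm (f x) * norm (g x)) \<le> norm ((norm (f x))\<^sup>2 + (norm (g x))\<^sup>2)"
      by (simp del: mult_nonneg_nonneg)
  qed
qed

lemma L2_add:
  fixes f g :: "'a \<Rightarrow> 'b::euclidean_space"
  assumes f: "L2 M f" and g: "L2 M g"
  shows "L2 M (\<lambda>x. f x + g x)"
  unfolding L2_def
proof
  note [measurable] = L2_measurable[OF f] L2_measurable[OF g]
  show "(\<lambda>x. f x + g x) \<in> borel_measurable M" by measurable
  show "integrable M (\<lambda>x. (norm (f x + g x))\<^sup>2)"
  proof (rule Bochner_Integration.integrable_bound)
    show "integrable M (\<lambda>x. (norm (f x))\<^sup>2 + (norm (g x))\<^sup>2 + 2 * (norm (f x) * norm (g x)))"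
      using f g L2_norm_mult_integrable[OF f g]
      by (intro Bochner_Integration.integrable_add L2_integrable) auto
    show "AE x in M. norm ((norm (f x + g x))\<^sup>2) \<le> norm ((norm (f x))\<^sup>2 + (norm (g x))\<^sup>2 + 2 * (norm (f x) * norm (g x)))"
    proof (rule AE_I2)
      fix x
      have "(norm (f x + g x))\<^sup>2 \<le> (norm (f x) + norm (g x))\<^sup>2"
        by (intro power_mono norm_triangle_ineq) auto
      then show "norm ((norm (f x + g x))\<^sup>2) \<le> norm ((norm (f x))\<^sup>2 + (norm (g x))\<^sup>2 + 2 * (norm (f x) * norm (g x)))"
        by (simp add: power2_sum)
    qed
  qed measurable
qed

lemma L2_scaleR: "L2 M f \<Longrightarrow> L2 M (\<lambda>x. c *\<^sub>R f x)"
  by (rule L2_bound[where c="\<bar>c\<bar>" and g=f]) (auto intro: borel_measurable_scaleR L2_measurable)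

lemma L2_cmult: "L2 M f \<Longrightarrow> L2 M (\<lambda>x. c * f x :: real)"
  using L2_scaleR[of M f c] by simp

lemma L2_minus: "L2 M f \<Longrightarrow> L2 M (\<lambda>x. - f x)"
  using L2_scaleR[of M f "-1"] by simp

lemma L2_diff:
  assumes "L2 M f" "L2 M g" shows "L2 M (\<lambda>x. f x - g x)"
  using L2_add[OF assms(1) L2_minus[OF assms(2)]] by simp

lemma L2_zero [simp]: "L2 M (\<lambda>x. 0)"
  by (simp add: L2_def)

lemma L2_inner_integrable:
  fixes f g :: "'a \<Rightarrow> 'b::euclidean_space"
  assumes f: "L2 M f" and g: "L2 M g"
  shows "integrable M (\<lambda>x. f x \<bullet> g x)"
proof (rule Bochner_Integration.integrable_bound[OF L2_norm_mult_integrable[OF f g]])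
  note [measurable] = L2_measurable[OF f] L2_measurable[OF g]
  show "(\<lambda>x. f x \<bullet> g x) \<in> borel_measurable M" by measurable
  show "AE x in M. norm (f x \<bullet> g x) \<le> norm (norm (f x) * norm (g x))"
    by (rule AE_I2) (simp add: Cauchy_Schwarz_ineq2)
qed

lemma L2_mult_integrable:
  fixes f g :: "'a \<Rightarrow> real"
  assumes "L2 M f" "L2 M g"
  shows "integrable M (\<lambda>x. f x * g x)"
  using L2_inner_integrable[OF assms] by simp

text \<open>With \<open>A\<close>, \<open>B\<close>, \<open>C\<close> as below, the square of
  \<open>B * norm (f x) - C * norm (g x)\<close> has the integral \<open>B * (A * B - C^2)\<close>.
  This settles \<open>B > 0\<close>; for \<open>B = 0\<close> the function \<open>g\<close> vanishes
  almost everywhere.\<close>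

lemma L2_norm_CS:
  fixes f :: "'a \<Rightarrow> 'b::euclidean_space" and g :: "'a \<Rightarrow> 'c::euclidean_space"
  assumes f: "L2 M f" and g: "L2 M g"
  shows "(\<integral>x. norm (f x) * norm (g x) \<partial>M) \<le> sqrt (\<integral>x. (norm (f x))\<^sup>2 \<partial>M) * sqrt (\<integral>x. (norm (g x))\<^sup>2 \<partial>M)"
proof -
  note [measurable] = L2_measurable[OF f] L2_measurable[OF g]
  define A B C where "A = (\<integral>x. (norm (f x))\<^sup>2 \<partial>M)" and "B = (\<integral>x. (norm (g x))\<^sup>2 \<partial>M)"
    and "C = (\<integral>x. norm (f x) * norm (g x) \<partial>M)"
  have ABC: "A \<ge> 0" "B \<ge> 0" "C \<ge> 0" unfolding A_def B_def C_def by (auto intro!: Bochner_Integration.integral_nonneg)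
  have q: "0 \<le> B\<^sup>2 * A - 2 * B * C * C + C\<^sup>2 * B"
  proof -
    have "0 \<le> (\<integral>x. (B * norm (f x) - C * norm (g x))\<^sup>2 \<partial>M)"
      by (rule Bochner_Integration.integral_nonneg) simp
    also have "(\<integral>x. (B * norm (f x) - C * norm (g x))\<^sup>2 \<partial>M)
      = (\<integral>x. B\<^sup>2 * (norm (f x))\<^sup>2 - 2 * B * C * (norm (f x) * norm (g x)) + C\<^sup>2 * (norm (g x))\<^sup>2 \<partial>M)"
      by (intro Bochner_Integration.integral_cong refl) (simp add: power2_diff power_mult_distrib algebra_simps)
    also have "\<dots> = B\<^sup>2 * A - 2 * B * C * C + C\<^sup>2 * B"
      unfolding A_def B_def C_def using L2_integrable[OF f] L2_integrable[OF g] L2_norm_mult_integrable[OF f g] by simp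
    finally show ?thesis .
  qed
  have "C\<^sup>2 \<le> A * B"
  proof (cases "B = 0")
    case True
    then have "AE x in M. (norm (g x))\<^sup>2 = 0"
      unfolding B_def by (subst (asm) integral_nonneg_eq_0_iff_AE[OF L2_integrable[OF g]]) auto
    then have "AE x in M. norm (f x) * norm (g x) = 0" by eventually_elim simp
    then have "C = 0" unfolding C_def by (rule integral_eq_zero_AE)
    then show ?thesis using ABC by simp
  next
    case False
    then have "B > 0" using ABC by simp
    have "0 \<le> B * (A * B - C\<^sup>2)" using q by (simp add: power2_eq_square algebra_simps)
    then show ?thesis using \<open>B > 0\<close> by (simp add: zero_le_mult_iff)
  qed
  then have "C \<le> sqrt (A * B)" by (rule real_le_rsqrt)
  then show ?thesis by (simp add: A_def B_def C_def real_sqrt_mult)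
qed

lemma L2_inner_CS:
  fixes f g :: "'a \<Rightarrow> 'b::euclidean_space"
  assumes f: "L2 M f" and g: "L2 M g"
  shows "\<bar>\<integral>x. f x \<bullet> g x \<partial>M\<bar> \<le> sqrt (\<integral>x. (norm (f x))\<^sup>2 \<partial>M) * sqrt (\<integral>x. (norm (g x))\<^sup>2 \<partial>M)"
proof -
  have "norm (\<integral>x. f x \<bullet> g x \<partial>M) \<le> (\<integral>x. norm (f x) * norm (g x) \<partial>M)"
    by (rule order_trans[OF integral_norm_bound])
      (intro integral_mono integrable_norm L2_inner_integrable[OF f g] L2_norm_mult_integrable[OF f g],
        simp add: Cauchy_Schwarz_ineq2)
  then show ?thesis using L2_norm_CS[OF f g] by simp
qed

lemma L2_dist_triangle:
  fixes f g h :: "'a \<Rightarrow> 'b::euclidean_space"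
  assumes f: "L2 M f" and g: "L2 M g" and h: "L2 M h"
  shows "(\<integral>x. (norm (f x - h x))\<^sup>2 \<partial>M) \<le> 2 * (\<integral>x. (norm (f x - g x))\<^sup>2 \<partial>M) + 2 * (\<integral>x. (norm (g x - h x))\<^sup>2 \<partial>M)"
proof -
  note i = L2_integrable[OF L2_diff[OF f g]] L2_integrable[OF L2_diff[OF g h]] L2_integrable[OF L2_diff[OF f h]]
  have "(norm (f x - h x))\<^sup>2 \<le> 2 * (norm (f x - g x))\<^sup>2 + 2 * (norm (g x - h x))\<^sup>2" for x
  proof -
    have "norm (f x - h x) \<le> norm (f x - g x) + norm (g x - h x)"
      using norm_triangle_ineq[of "f x - g x" "g x - h x"] by simp
    then have "(norm (f x - h x))\<^sup>2 \<le> (norm (f x - g x) + norm (g x - h x))\<^sup>2"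
      by (intro power_mono) auto
    then show ?thesis
      using sum_squares_bound[of "norm (f x - g x)" "norm (g x - h x)"] by (simp add: power2_sum)
  qed
  then have "(\<integral>x. (norm (f x - h x))\<^sup>2 \<partial>M) \<le> (\<integral>x. 2 * (norm (f x - g x))\<^sup>2 + 2 * (norm (g x - h x))\<^sup>2 \<partial>M)"
    using i by (intro integral_mono) auto
  then show ?thesis using i by simp
qed

text \<open>The error is a combination of the products of \<open>f - F n\<close> with
  \<open>g - G n\<close>, of \<open>f - F n\<close> with \<open>g\<close>, and of \<open>f\<close>
  with \<open>g - G n\<close>, each controlled by Cauchy-Schwarz.\<close>

lemma L2_tendsto_inner:
  fixes f g :: "'a \<Rightarrow> 'b::euclidean_space"
  assumes f: "L2 M f" and g: "L2 M g" and fn: "\<And>n. L2 M (F n)" and gn: "\<And>n. L2 M (G n)"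
    and cf: "(\<lambda>n. \<integral>x. (norm (f x - F n x))\<^sup>2 \<partial>M) \<longlonglongrightarrow> 0"
    and cg: "(\<lambda>n. \<integral>x. (norm (g x - G n x))\<^sup>2 \<partial>M) \<longlonglongrightarrow> 0"
  shows "(\<lambda>n. \<integral>x. F n x \<bullet> G n x \<partial>M) \<longlonglongrightarrow> (\<integral>x. f x \<bullet> g x \<partial>M)"
proof -
  let ?d = "\<lambda>n. sqrt (\<integral>x. (norm (f x - F n x))\<^sup>2 \<partial>M)"
  let ?e = "\<lambda>n. sqrt (\<integral>x. (norm (g x - G n x))\<^sup>2 \<partial>M)"
  let ?b = "\<lambda>n. ?d n * ?e n + ?d n * sqrt (\<integral>x. (norm (g x))\<^sup>2 \<partial>M) + sqrt (\<integral>x. (norm (f x))\<^sup>2 \<partial>M) * ?e n"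
  have d0: "?d \<longlonglongrightarrow> 0" and e0: "?e \<longlonglongrightarrow> 0"
    using tendsto_real_sqrt[OF cf] tendsto_real_sqrt[OF cg] by simp_all
  have "?b \<longlonglongrightarrow> 0 * 0 + 0 * sqrt (\<integral>x. (norm (g x))\<^sup>2 \<partial>M) + sqrt (\<integral>x. (norm (f x))\<^sup>2 \<partial>M) * 0"
    by (intro tendsto_add tendsto_mult d0 e0 tendsto_const)
  then have "?b \<longlonglongrightarrow> 0" by simp
  moreover have "norm ((\<integral>x. F n x \<bullet> G n x \<partial>M) - (\<integral>x. f x \<bullet> g x \<partial>M)) \<le> ?b n" for n
  proof -
    note d = L2_diff[OF f fn[of n]] and e = L2_diff[OF g gn[of n]]
    have "(\<integral>x. F n x \<bullet> G n x \<partial>M) =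
        (\<integral>x. (f x - F n x) \<bullet> (g x - G n x) - (f x - F n x) \<bullet> g x - f x \<bullet> (g x - G n x) + f x \<bullet> g x \<partial>M)"
      by (intro Bochner_Integration.integral_cong refl) (simp add: inner_diff_left inner_diff_right)
    also have "\<dots> = (\<integral>x. (f x - F n x) \<bullet> (g x - G n x) \<partial>M) - (\<integral>x. (f x - F n x) \<bullet> g x \<partial>M)
        - (\<integral>x. f x \<bullet> (g x - G n x) \<partial>M) + (\<integral>x. f x \<bullet> g x \<partial>M)"
      using L2_inner_integrable[OF d e] L2_inner_integrable[OF d g] L2_inner_integrable[OF f e] L2_inner_integrable[OF f g]
      by simp
    finally show ?thesis
      using L2_inner_CS[OF d e] L2_inner_CS[OF d g] L2_inner_CS[OF f e] by simp
  qed
  ultimately have "(\<lambda>n. (\<integral>x. F n x \<bullet> G n x \<partial>M) - (\<integral>x. f x \<bullet> g x \<partial>M)) \<longlonglongrightarrow> 0"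
    by (auto intro: Lim_null_comparison[where g="?b"])
  then show ?thesis by (simp add: LIM_zero_iff)
qed

text \<open>The bridge between two measures: Sobolev data live on
  \<open>lebesgue_on \<Omega>\<close>, while translation, scaling and Fubini are carried out on
  \<open>lborel\<close>.\<close>

lemma lebesgue_on_test:
  fixes h :: "'a::euclidean_space \<Rightarrow> 'b::euclidean_space"
  assumes "open \<Omega>" and h: "h \<in> borel_measurable borel" and z: "\<And>x. x \<notin> \<Omega> \<Longrightarrow> h x = 0"
  shows "integrable (lebesgue_on \<Omega>) h \<longleftrightarrow> integrable lborel h"
    and "(LINT x|lebesgue_on \<Omega>. h x) = (LINT x|lborel. h x)"
proof -
  have e: "(\<lambda>x. indicator \<Omega> x *\<^sub>R h x) = h" using z by (auto simp: fun_eq_iff indicator_def)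
  have m: "\<Omega> \<inter> space lebesgue \<in> sets lebesgue" using assms(1) by simp
  have l: "h \<in> lborel \<rightarrow>\<^sub>M borel" using h by simp
  show "integrable (lebesgue_on \<Omega>) h \<longleftrightarrow> integrable lborel h"
    using integrable_restrict_space[OF m, of h] integrable_completion[OF l] e by simp
  show "(LINT x|lebesgue_on \<Omega>. h x) = (LINT x|lborel. h x)"
    using integral_restrict_space[OF m, of h] integral_completion[OF l] e by simp
qed

lemma borel_imp_lebesgue_on: "h \<in> borel_measurable borel \<Longrightarrow> h \<in> borel_measurable (lebesgue_on S)"
  by (intro measurable_restrict_space1 measurable_completion) simp

lemma compact_support_integrable_on:
  fixes h :: "'a::euclidean_space \<Rightarrow> 'b::euclidean_space"
  assumes "open \<Omega>" "continuous_on UNIV h" "compact K" "K \<subseteq> \<Omega>" "\<And>x. x \<notin> K \<Longrightarrow> h x = 0"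
  shows "integrable (lebesgue_on \<Omega>) h"
  using lebesgue_on_test(1)[OF assms(1), of h] compact_support_integrable[OF assms(2,3)] assms
  by (auto intro: borel_measurable_continuous_onI)

lemma test_L2:
  assumes "open \<Omega>" "\<phi> \<in> test_functions \<Omega>"
  shows "L2 (lebesgue_on \<Omega>) \<phi>" "L2 (lebesgue_on \<Omega>) (gradient \<phi>)"
proof -
  obtain K where K: "compact K" "K \<subseteq> \<Omega>" "\<And>x. x \<notin> K \<Longrightarrow> \<phi> x = 0"
    using test_functionsE[OF assms(2)] by blast
  show "L2 (lebesgue_on \<Omega>) \<phi>"
    unfolding L2_def
    using K assms by (auto intro!: borel_imp_lebesgue_on test_borel compact_support_integrable_on[where K=K]
        continuous_intros test_continuous[OF assms(2)] simp del: real_norm_def)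
  have "\<And>i. \<exists>K. compact K \<and> K \<subseteq> \<Omega> \<and> (\<forall>x. x \<notin> K \<longrightarrow> partial_deriv i \<phi> x = 0)"
    using test_functionsE[OF test_partial_deriv[OF assms(2)]] by metis
  then obtain L where L: "\<And>i. compact (L i)" "\<And>i. L i \<subseteq> \<Omega>" "\<And>i x. x \<notin> L i \<Longrightarrow> partial_deriv i \<phi> x = 0"
    by metis
  have L': "compact (\<Union>i. L i)" "(\<Union>i. L i) \<subseteq> \<Omega>" "\<And>x. x \<notin> (\<Union>i. L i) \<Longrightarrow> gradient \<phi> x = 0"
    using L by (auto simp: vec_eq_iff)
  show "L2 (lebesgue_on \<Omega>) (gradient \<phi>)"
    unfolding L2_def
    using L' assms by (auto intro!: borel_imp_lebesgue_on gradient_test_borel compact_support_integrable_on[where K="\<Union>i. L i"]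
        continuous_intros gradient_test_continuous[OF assms(2)] simp del: real_norm_def)
qed

text \<open>On a compact set \<open>norm (f x)\<close> is dominated by
  \<open>1 + (norm (f x))\<^sup>2\<close>, which is integrable there.\<close>

lemma L2_locally_integrable:
  fixes f :: "real^'n::finite \<Rightarrow> 'b::euclidean_space"
  assumes o: "open \<Omega>" and f: "L2 (lebesgue_on \<Omega>) f"
  shows "locally_integrable \<Omega> f"
  unfolding locally_integrable_def
proof (intro allI impI)
  fix K assume K: "compact K \<and> K \<subseteq> \<Omega>"
  note [measurable] = L2_measurable[OF f]
  have KS: "K \<in> sets lebesgue" "\<Omega> \<in> sets lebesgue" using K o by (auto intro: lmeasurable_compact fmeasurableD)
  have KO: "K \<in> sets (lebesgue_on \<Omega>)" using KS K by (auto simp: sets_restrict_space_iff)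
  have fin: "emeasure (lebesgue_on \<Omega>) K < \<infinity>"
    using K KS emeasure_compact_finite[of K] borel_compact[of K]
    by (simp add: emeasure_restrict_space main_part_sets)
  have "integrable (lebesgue_on \<Omega>) (\<lambda>x. indicator K x *\<^sub>R f x)"
  proof (rule Bochner_Integration.integrable_bound)
    show "integrable (lebesgue_on \<Omega>) (\<lambda>x. indicator K x + (norm (f x))\<^sup>2)"
      using L2_integrable[OF f] KO fin by auto
    show "(\<lambda>x. indicator K x *\<^sub>R f x) \<in> borel_measurable (lebesgue_on \<Omega>)"
      using KO by measurable
    show "AE x in lebesgue_on \<Omega>. norm (indicat_real K x *\<^sub>R f x) \<le> norm (indicator K x + (norm (f x))\<^sup>2)"
    proof (rule AE_I2)
      fix x
      have "2 * norm (f x) \<le> (norm (f x))\<^sup>2 + 1"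
        using sum_squares_bound[of "norm (f x)" 1] by simp
      then have "norm (f x) \<le> 1 + (norm (f x))\<^sup>2"
        using norm_ge_zero[of "f x"] by linarith
      then show "norm (indicat_real K x *\<^sub>R f x) \<le> norm (indicator K x + (norm (f x))\<^sup>2)"
        by (auto simp: indicator_def)
    qed
  qed
  then have "integrable lebesgue (\<lambda>x. indicator \<Omega> x *\<^sub>R (indicator K x *\<^sub>R f x))"
    using KS by (subst (asm) integrable_restrict_space) auto
  moreover have "(\<lambda>x. indicator \<Omega> x *\<^sub>R (indicator K x *\<^sub>R f x)) = (\<lambda>x. indicator K x *\<^sub>R f x)"
    using K by (auto simp: indicator_def fun_eq_iff)
  ultimately show "f absolutely_integrable_on K"
    by (simp add: set_integrable_def)
qed

section \<open>The fundamental lemma of the calculus of variations\<close>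

lemma smooth_prod [intro]:
  "(\<And>i. i \<in> A \<Longrightarrow> smooth_on UNIV (f i)) \<Longrightarrow> smooth_on UNIV (\<lambda>x. \<Prod>i\<in>A. f i x)"
  by (induction A rule: infinite_finite_induct) auto

lemma flat_le_1: "flat 0 s \<le> 1"
  by (simp add: flat_def)

lemma flat_scaled_tendsto:
  assumes "s \<ge> 0"
  shows "(\<lambda>n. flat 0 (real n * s)) \<longlonglongrightarrow> (if s > 0 then 1 else 0)"
proof (cases "s > 0")
  case True
  have "((\<lambda>n. exp (- (1 / s) * inverse (real n))) \<longlonglongrightarrow> exp (- (1 / s) * 0))"
    by (intro tendsto_intros lim_inverse_n)
  moreover have "\<forall>\<^sub>F n in sequentially. exp (- (1 / s) * inverse (real n)) = flat 0 (real n * s)"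
    using eventually_gt_at_top[of 0] by eventually_elim (use True in \<open>simp add: flat_def field_simps\<close>)
  ultimately show ?thesis
    using True Lim_transform_eventually by fastforce
qed (use assms in auto)

text \<open>The smooth function \<open>p\<close> is positive exactly on the open box, so
  \<open>flat 0 (n * p x)\<close> tends to the indicator of the box through test functions supported
  in the closed box and bounded by 1.\<close>

lemma integral_box_zero:
  fixes g :: "real^'n::finite \<Rightarrow> real"
  assumes o: "open \<Omega>" and g: "locally_integrable \<Omega> g"
    and z: "\<And>\<phi>. \<phi> \<in> test_functions \<Omega> \<Longrightarrow> (LINT x|lebesgue_on \<Omega>. g x * \<phi> x) = 0"
    and ab: "cbox a b \<subseteq> \<Omega>"
  shows "(LINT x|lebesgue. indicator (box a b) x * g x) = 0"
proof -
  define p where "p x = (\<Prod>i\<in>UNIV. flat 0 (x $ i - a $ i) * flat 0 (b $ i - x $ i))" for x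
  have p_smooth: "smooth_on UNIV p"
    unfolding p_def by (intro smooth_prod smooth_mult smooth_flat smooth_diff) auto
  have p_nonneg: "p x \<ge> 0" for x
    unfolding p_def by (intro prod_nonneg mult_nonneg_nonneg flat_nonneg ballI)
  have p_pos: "p x > 0 \<longleftrightarrow> x \<in> box a b" for x
  proof
    assume "x \<in> box a b"
    then show "p x > 0" unfolding p_def mem_box_cart
      by (intro prod_pos mult_pos_pos flat_pos ballI) auto
  next
    assume p: "p x > 0"
    have "a $ i < x $ i \<and> x $ i < b $ i" for i
    proof (rule ccontr)
      assume "\<not> ?thesis"
      then have "flat 0 (x $ i - a $ i) * flat 0 (b $ i - x $ i) = 0" by auto
      then have "p x = 0" unfolding p_def by (intro prod_zero) auto
      then show False using p by simp
    qed
    then show "x \<in> box a b" by (simp add: mem_box_cart)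
  qed
  define \<phi> where "\<phi> n x = flat 0 (real n * p x)" for n x
  have \<phi>0: "\<phi> n x = 0" if "x \<notin> box a b" for n x
    using that p_pos[of x] p_nonneg[of x] by (auto simp: \<phi>_def)
  have \<phi>_test: "\<phi> n \<in> test_functions \<Omega>" for n
  proof (rule test_functionsI[where K="cbox a b"])
    show "smooth_on UNIV (\<phi> n)" unfolding \<phi>_def by (intro smooth_flat smooth_mult p_smooth) auto
    show "\<phi> n x = 0" if "x \<notin> cbox a b" for x using that \<phi>0 box_subset_cbox by blast
  qed (use ab in auto)
  define h where "h x = indicator (cbox a b) x *\<^sub>R g x" for x
  have h: "integrable lebesgue h"
    using g ab compact_cbox[of a b] by (simp add: locally_integrable_def set_integrable_def h_def[abs_def])
  note [measurable] = borel_measurable_integrable[OF h]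
  have [measurable]: "\<phi> n \<in> borel_measurable lebesgue" for n
    by (intro measurable_completion) (simp add: test_borel[OF \<phi>_test])
  have "(\<lambda>n. LINT x|lebesgue. h x * \<phi> n x) \<longlonglongrightarrow> (LINT x|lebesgue. indicator (box a b) x * h x)"
  proof (rule integral_dominated_convergence[where w="\<lambda>x. norm (h x)"])
    show "integrable lebesgue (\<lambda>x. norm (h x))" using h by (rule integrable_norm)
    have "integrable lebesgue (\<lambda>x. indicator (box a b) x *\<^sub>R h x)"
      by (rule integrable_mult_indicator[OF _ h]) simp
    then show "(\<lambda>x. indicator (box a b) x * h x) \<in> borel_measurable lebesgue"
      by (simp add: borel_measurable_integrable)
    show "(\<lambda>x. h x * \<phi> n x) \<in> borel_measurable lebesgue" for n by measurable
    show "AE x in lebesgue. (\<lambda>n. h x * \<phi> n x) \<longlonglongrightarrow> indicator (box a b) x * h x"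
    proof (rule AE_I2)
      fix x
      have "(\<lambda>n. \<phi> n x) \<longlonglongrightarrow> indicator (box a b) x"
        using flat_scaled_tendsto[OF p_nonneg[of x]] p_pos[of x] unfolding \<phi>_def
        by (auto simp: indicator_def)
      then show "(\<lambda>n. h x * \<phi> n x) \<longlonglongrightarrow> indicator (box a b) x * h x"
        by (subst mult.commute) (rule tendsto_mult[OF _ tendsto_const])
    qed
    show "AE x in lebesgue. norm (h x * \<phi> n x) \<le> norm (h x)" for n
      by (rule AE_I2) (auto simp: \<phi>_def abs_mult flat_nonneg flat_le_1 intro: mult_left_le)
  qed
  moreover have "(LINT x|lebesgue. h x * \<phi> n x) = 0" for n
  proof -
    have "(LINT x|lebesgue_on \<Omega>. g x * \<phi> n x) = (LINT x|lebesgue. indicator \<Omega> x *\<^sub>R (g x * \<phi> n x))"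
      using o by (subst integral_restrict_space) auto
    also have "\<dots> = (LINT x|lebesgue. h x * \<phi> n x)"
      using \<phi>0 ab box_subset_cbox[of a b]
      by (intro Bochner_Integration.integral_cong refl) (auto simp: h_def indicator_def)
    finally show ?thesis using z[OF \<phi>_test] by simp
  qed
  ultimately have "(LINT x|lebesgue. indicator (box a b) x * h x) = 0"
    by (simp only: LIMSEQ_const_iff)
  also have "(LINT x|lebesgue. indicator (box a b) x * h x) = (LINT x|lebesgue. indicator (box a b) x * g x)"
    using box_subset_cbox[of a b]
    by (intro Bochner_Integration.integral_cong refl) (auto simp: h_def indicator_def)
  finally show ?thesis .
qed

text \<open>Boxes are an intersection-stable generator of the Borel sets, and sets with vanishing
  integral are closed under complements and countable disjoint unions. The whole space is not a
  bounded box; its integral enters the complement step and is a hypothesis of its own.\<close>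

lemma integral_boxes_zero_imp_AE_zero:
  fixes h :: "real^'n::finite \<Rightarrow> real"
  assumes h: "integrable lebesgue h"
    and z: "\<And>a b. (LINT x|lebesgue. indicator (box a b) x * h x) = 0"
    and t: "(LINT x|lebesgue. h x) = 0"
  shows "AE x in lebesgue. h x = 0"
proof -
  note [measurable] = borel_measurable_integrable[OF h]
  have int: "integrable lebesgue (\<lambda>x. indicator A x * h x)" if "A \<in> sets lebesgue" for A
    using integrable_mult_indicator[OF that h] by simp
  let ?B = "range (\<lambda>(a, b). box a b) :: (real^'n) set set"
  have "(LINT x|lebesgue. indicator A x * h x) = 0" if "A \<in> sigma_sets UNIV ?B" for A
  proof (rule sigma_sets_induct_disjoint[of ?B UNIV _ "\<lambda>A. (LINT x|lebesgue. indicator A x * h x) = 0"])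
    have sl: "A \<in> sets lebesgue" if "A \<in> sigma_sets UNIV ?B" for A
      using that unfolding borel_eq_box[THEN arg_cong[where f=sets], symmetric]
      by (metis (no_types, lifting) borel_eq_box sets_completionI_sets sets_lborel sets_measure_of subset_UNIV Pow_UNIV)
    show "Int_stable ?B"
      by (auto simp: Int_stable_def box_Int_box)
    show "?B \<subseteq> Pow UNIV" by auto
    show "A \<in> sigma_sets UNIV ?B" by fact
    show "(LINT x|lebesgue. indicator A x * h x) = 0" if "A \<in> ?B" for A
      using that z by auto
    show "(LINT x|lebesgue. indicator {} x * h x) = 0" by simp
    show "(LINT x|lebesgue. indicator (UNIV - A) x * h x) = 0"
      if "A \<in> sigma_sets UNIV ?B" "(LINT x|lebesgue. indicator A x * h x) = 0" for A
    proof -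
      have "(LINT x|lebesgue. indicator (UNIV - A) x * h x) = (LINT x|lebesgue. h x - indicator A x * h x)"
        by (intro Bochner_Integration.integral_cong refl) (auto simp: indicator_def)
      also have "\<dots> = 0"
        using int[OF sl[OF that(1)]] h t that(2) by simp
      finally show ?thesis .
    qed
    show "(LINT x|lebesgue. indicator (\<Union>i. A i) x * h x) = 0"
      if A: "disjoint_family A" "range A \<subseteq> sigma_sets UNIV ?B" "\<And>i. (LINT x|lebesgue. indicator (A i) x * h x) = 0" for A :: "nat \<Rightarrow> _"
    proof -
      have Al: "A i \<in> sets lebesgue" for i using A(2) sl by auto
      have "(LINT x:(\<Union>i. A i)|lebesgue. h x) = (\<Sum>i. LINT x:(A i)|lebesgue. h x)"
        by (rule lebesgue_integral_countable_add)
           (use A Al int in \<open>auto simp: disjoint_family_on_def set_integrable_def\<close>)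
      then show ?thesis using A(3) by (simp add: set_lebesgue_integral_def)
    qed
  qed
  then have borel: "(LINT x|lebesgue. indicator A x * h x) = 0" if "A \<in> sets borel" for A
    using that by (metis (no_types, lifting) borel_eq_box sets_measure_of subset_UNIV Pow_UNIV)
  show ?thesis
  proof (rule density_unique_real[OF h])
    show "integrable lebesgue (\<lambda>x::real^'n. 0::real)" by simp
    fix A :: "(real^'n) set" assume "A \<in> sets lebesgue"
    \<comment> \<open>A Lebesgue set differs from a Borel set by a null set, so the Borel case
      decides.\<close>
    then obtain S N N' where A: "A = S \<union> N" "N \<subseteq> N'" "N' \<in> null_sets lborel" "S \<in> sets lborel"
      by (rule sets_completionE)
    have "N' \<in> null_sets lebesgue" using A by (simp add: null_sets_completionI)
    then have "AE x in lebesgue. x \<notin> N'" by (rule AE_not_in)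
    then have "AE x in lebesgue. indicator A x * h x = indicator S x * h x"
      by eventually_elim (use A in \<open>auto simp: indicator_def\<close>)
    then have "(LINT x|lebesgue. indicator A x * h x) = (LINT x|lebesgue. indicator S x * h x)"
      using A \<open>A \<in> sets lebesgue\<close>
        borel_measurable_integrable[OF int[of A]] borel_measurable_integrable[OF int[of S]]
      by (intro integral_cong_AE) auto
    then show "set_lebesgue_integral lebesgue A h = set_lebesgue_integral lebesgue A (\<lambda>x. 0)"
      using borel A by (simp add: set_lebesgue_integral_def)
  qed
qed

text \<open>The restriction of \<open>g\<close> to a box has zero integral over all boxes, since two
  boxes meet in a box. Countably many closed boxes exhaust \<open>\<Omega>\<close>, and their
  boundaries are null sets.\<close>

lemma fundamental_lemma:
  fixes g :: "real^'n::finite \<Rightarrow> real"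
  assumes o: "open \<Omega>" and g: "locally_integrable \<Omega> g"
    and z: "\<And>\<phi>. \<phi> \<in> test_functions \<Omega> \<Longrightarrow> (LINT x|lebesgue_on \<Omega>. g x * \<phi> x) = 0"
  shows "AE x in lebesgue_on \<Omega>. g x = 0"
proof -
  have box: "AE x in lebesgue. x \<in> cbox a b \<longrightarrow> g x = 0" if ab: "cbox a b \<subseteq> \<Omega>" for a b
  proof -
    define h where "h x = indicator (box a b) x * g x" for x
    have "integrable lebesgue (\<lambda>x. indicator (cbox a b) x *\<^sub>R g x)"
      using g ab compact_cbox[of a b] by (simp only: locally_integrable_def set_integrable_def)
    then have "integrable lebesgue (\<lambda>x. indicator (box a b) x *\<^sub>R (indicator (cbox a b) x *\<^sub>R g x))"
      by (rule integrable_mult_indicator[rotated]) simp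
    moreover have "(\<lambda>x. indicator (box a b) x *\<^sub>R (indicator (cbox a b) x *\<^sub>R g x)) = h"
      using box_subset_cbox[of a b] by (auto simp: h_def indicator_def fun_eq_iff)
    ultimately have h: "integrable lebesgue h" by simp
    have "AE x in lebesgue. h x = 0"
    proof (rule integral_boxes_zero_imp_AE_zero[OF h])
      show "(LINT x|lebesgue. h x) = 0"
        unfolding h_def using integral_box_zero[OF o g z ab] by blast
      fix c d :: "real^'n"
      obtain a' b' where *: "box a b \<inter> box c d = box a' b'" "cbox a b \<inter> cbox c d = cbox a' b'"
        unfolding box_Int_box Int_interval by blast
      have "(LINT x|lebesgue. indicator (box c d) x * h x) = (LINT x|lebesgue. indicator (box a' b') x * g x)"
        unfolding *(1)[symmetric] by (intro Bochner_Integration.integral_cong refl) (auto simp: h_def indicator_def)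
      also have "\<dots> = 0"
        using * ab by (intro integral_box_zero[OF o g z]) auto
      finally show "(LINT x|lebesgue. indicator (box c d) x * h x) = 0" .
    qed
    moreover have "AE x in lebesgue. x \<notin> cbox a b - box a b"
      using negligible_frontier_interval[of a b] by (intro AE_not_in) (simp add: negligible_iff_null_sets)
    ultimately show ?thesis
      by eventually_elim (auto simp: h_def indicator_def split: if_splits)
  qed
  obtain \<D> where D: "countable \<D>" "\<D> \<subseteq> Pow \<Omega>" "\<And>X. X \<in> \<D> \<Longrightarrow> \<exists>a b. X = cbox a b" "\<Union>\<D> = \<Omega>"
    using open_countable_Union_open_cbox[OF o] by metis
  have "AE x in lebesgue. \<forall>X\<in>\<D>. x \<in> X \<longrightarrow> g x = 0"
  proof (subst AE_ball_countable[OF D(1)], rule ballI)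
    fix X assume X: "X \<in> \<D>"
    then obtain a b where "X = cbox a b" using D(3) by blast
    then show "AE x in lebesgue. x \<in> X \<longrightarrow> g x = 0" using box[of a b] X D(2) by blast
  qed
  then have "AE x in lebesgue. x \<in> \<Omega> \<longrightarrow> g x = 0"
    by eventually_elim (use D(4) in blast)
  then show ?thesis
    using o by (subst AE_restrict_space_iff) auto
qed

section \<open>Sobolev functions\<close>

text \<open>The space \<open>H10\<close> with the gradient as explicit data, which avoids the choice made in \<open>weak_gradient\<close>.\<close>

definition sob :: "(real^'n::finite) set \<Rightarrow> (real^'n \<Rightarrow> real) \<Rightarrow> (real^'n \<Rightarrow> real^'n) \<Rightarrow> bool" where
  "sob \<Omega> f G \<longleftrightarrow> L2 (lebesgue_on \<Omega>) f \<and> L2 (lebesgue_on \<Omega>) G \<and>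
    (\<exists>\<phi>. (\<forall>m. \<phi> m \<in> test_functions \<Omega>) \<and>
      (\<lambda>m. LINT x|lebesgue_on \<Omega>. (norm (f x - \<phi> m x))\<^sup>2) \<longlonglongrightarrow> 0 \<and>
      (\<lambda>m. LINT x|lebesgue_on \<Omega>. (norm (G x - gradient (\<phi> m) x))\<^sup>2) \<longlonglongrightarrow> 0)"

lemma sobD: "sob \<Omega> f G \<Longrightarrow> L2 (lebesgue_on \<Omega>) f" "sob \<Omega> f G \<Longrightarrow> L2 (lebesgue_on \<Omega>) G"
  by (simp_all add: sob_def)

lemma sobE:
  assumes "sob \<Omega> f G"
  obtains \<phi> where "\<And>m. \<phi> m \<in> test_functions \<Omega>"
    "(\<lambda>m. LINT x|lebesgue_on \<Omega>. (norm (f x - \<phi> m x))\<^sup>2) \<longlonglongrightarrow> 0"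
    "(\<lambda>m. LINT x|lebesgue_on \<Omega>. (norm (G x - gradient (\<phi> m) x))\<^sup>2) \<longlonglongrightarrow> 0"
  using assms unfolding sob_def by blast

lemma sobI:
  assumes "L2 (lebesgue_on \<Omega>) f" "L2 (lebesgue_on \<Omega>) G" "\<And>m. \<phi> m \<in> test_functions \<Omega>"
    "(\<lambda>m. LINT x|lebesgue_on \<Omega>. (norm (f x - \<phi> m x))\<^sup>2) \<longlonglongrightarrow> 0"
    "(\<lambda>m. LINT x|lebesgue_on \<Omega>. (norm (G x - gradient (\<phi> m) x))\<^sup>2) \<longlonglongrightarrow> 0"
  shows "sob \<Omega> f G"
  using assms unfolding sob_def by blast

lemma test_by_parts:
  assumes o: "open \<Omega>" and \<phi>: "\<phi> \<in> test_functions \<Omega>" and \<psi>: "\<psi> \<in> test_functions \<Omega>"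
  shows "(LINT x|lebesgue_on \<Omega>. \<phi> x * partial_deriv i \<psi> x) = - (LINT x|lebesgue_on \<Omega>. partial_deriv i \<phi> x * \<psi> x)"
proof -
  note L = test_L2(1)[OF o \<phi>] test_L2(1)[OF o \<psi>] test_L2(1)[OF o test_partial_deriv[OF \<phi>]] test_L2(1)[OF o test_partial_deriv[OF \<psi>]]
  have p: "partial_deriv i (\<lambda>x. \<phi> x * \<psi> x) = (\<lambda>x. \<phi> x * partial_deriv i \<psi> x + partial_deriv i \<phi> x * \<psi> x)"
    by (intro ext partial_deriv_mult test_differentiable[OF \<phi>] test_differentiable[OF \<psi>])
  have t: "(\<lambda>x. \<phi> x * \<psi> x) \<in> test_functions \<Omega>"
    using \<phi> \<psi> by (intro test_mult_left test_smooth)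
  have "(LINT x|lebesgue_on \<Omega>. partial_deriv i (\<lambda>x. \<phi> x * \<psi> x) x) = (LINT x|lborel. partial_deriv i (\<lambda>x. \<phi> x * \<psi> x) x)"
    using test_partial_deriv[OF t] by (intro lebesgue_on_test(2) o test_borel test_outside)
  also have "\<dots> = 0" by (rule integral_partial_deriv_test[OF t])
  finally have "(LINT x|lebesgue_on \<Omega>. \<phi> x * partial_deriv i \<psi> x + partial_deriv i \<phi> x * \<psi> x) = 0"
    unfolding p .
  then show ?thesis
    using L2_mult_integrable[OF L(1,4)] L2_mult_integrable[OF L(3,2)] by simp
qed

lemma L2_nth:
  fixes G :: "'a \<Rightarrow> real^'n::finite"
  assumes "L2 M G" shows "L2 M (\<lambda>x. G x $ i :: real)"
proof (rule L2_bound[OF assms, where c=1])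
  note [measurable] = L2_measurable[OF assms]
  have "(\<lambda>x. G x \<bullet> axis i 1) \<in> borel_measurable M" by measurable
  then show "(\<lambda>x. G x $ i) \<in> borel_measurable M" by (simp add: inner_axis)
  show "AE x in M. norm (G x $ i) \<le> 1 * norm (G x)"
    by (rule AE_I2) (simp add: component_le_norm_cart)
qed

lemma L2_nth_tendsto:
  fixes G :: "'a \<Rightarrow> real^'n::finite"
  assumes "L2 M G" "\<And>m. L2 M (F m)" "(\<lambda>m. LINT x|M. (norm (G x - F m x))\<^sup>2) \<longlonglongrightarrow> 0"
  shows "(\<lambda>m. LINT x|M. (norm (G x $ i - F m x $ i))\<^sup>2) \<longlonglongrightarrow> 0"
proof (rule tendsto_sandwich[OF _ _ tendsto_const assms(3)])
  show "\<forall>\<^sub>F m in sequentially. 0 \<le> (LINT x|M. (norm (G x $ i - F m x $ i))\<^sup>2)"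
    by (auto intro: Bochner_Integration.integral_nonneg)
  have "(LINT x|M. (norm (G x $ i - F m x $ i))\<^sup>2) \<le> (LINT x|M. (norm (G x - F m x))\<^sup>2)" for m
  proof (rule integral_mono)
    show "integrable M (\<lambda>x. (norm (G x $ i - F m x $ i))\<^sup>2)"
      using L2_nth[OF L2_diff[OF assms(1) assms(2)[of m]]] by (intro L2_integrable) simp
    show "integrable M (\<lambda>x. (norm (G x - F m x))\<^sup>2)"
      by (intro L2_integrable L2_diff assms)
    show "(norm (G x $ i - F m x $ i))\<^sup>2 \<le> (norm (G x - F m x))\<^sup>2" for x
      using component_le_norm_cart[of "G x - F m x" i] by (intro power_mono) auto
  qed
  then show "\<forall>\<^sub>F m in sequentially. (LINT x|M. (norm (G x $ i - F m x $ i))\<^sup>2) \<le> (LINT x|M. (norm (G x - F m x))\<^sup>2)"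
    by simp
qed

text \<open>The identity holds for test functions and both sides are continuous under L2 convergence
  of functions and gradients. Both factors are limits of test functions, hence there is no boundary
  term.\<close>

lemma sob_by_parts:
  assumes o: "open \<Omega>" and f: "sob \<Omega> f G" and g: "sob \<Omega> g H"
  shows "(LINT x|lebesgue_on \<Omega>. f x * H x $ i) = - (LINT x|lebesgue_on \<Omega>. G x $ i * g x)"
proof -
  let ?M = "lebesgue_on \<Omega>"
  obtain \<phi> where \<phi>: "\<And>m. \<phi> m \<in> test_functions \<Omega>"
    "(\<lambda>m. LINT x|?M. (norm (f x - \<phi> m x))\<^sup>2) \<longlonglongrightarrow> 0"
    "(\<lambda>m. LINT x|?M. (norm (G x - gradient (\<phi> m) x))\<^sup>2) \<longlonglongrightarrow> 0"
    using sobE[OF f] by blast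
  obtain \<psi> where \<psi>: "\<And>m. \<psi> m \<in> test_functions \<Omega>"
    "(\<lambda>m. LINT x|?M. (norm (g x - \<psi> m x))\<^sup>2) \<longlonglongrightarrow> 0"
    "(\<lambda>m. LINT x|?M. (norm (H x - gradient (\<psi> m) x))\<^sup>2) \<longlonglongrightarrow> 0"
    using sobE[OF g] by blast
  note L = sobD[OF f] sobD[OF g] test_L2[OF o \<phi>(1)] test_L2[OF o \<psi>(1)]
  have "(\<lambda>m. LINT x|?M. \<phi> m x \<bullet> (gradient (\<psi> m) x $ i)) \<longlonglongrightarrow> (LINT x|?M. f x \<bullet> (H x $ i))"
    using \<phi>(2) L2_nth_tendsto[OF L(4) L(8) \<psi>(3)] L by (intro L2_tendsto_inner L2_nth) auto
  moreover have "(\<lambda>m. LINT x|?M. (gradient (\<phi> m) x $ i) \<bullet> \<psi> m x) \<longlonglongrightarrow> (LINT x|?M. (G x $ i) \<bullet> g x)"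
    using \<psi>(2) L2_nth_tendsto[OF L(2) L(6) \<phi>(3)] L by (intro L2_tendsto_inner L2_nth) auto
  then have "(\<lambda>m. - (LINT x|?M. (gradient (\<phi> m) x $ i) \<bullet> \<psi> m x)) \<longlonglongrightarrow> - (LINT x|?M. (G x $ i) \<bullet> g x)"
    by (rule tendsto_minus)
  moreover have "(LINT x|?M. \<phi> m x \<bullet> (gradient (\<psi> m) x $ i)) = - (LINT x|?M. (gradient (\<phi> m) x $ i) \<bullet> \<psi> m x)" for m
    using test_by_parts[OF o \<phi>(1) \<psi>(1), of m i m] by simp
  ultimately have "(LINT x|?M. f x \<bullet> (H x $ i)) = - (LINT x|?M. (G x $ i) \<bullet> g x)"
    using LIMSEQ_unique by simp
  then show ?thesis by simp
qed

lemma sob_test: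
  assumes "open \<Omega>" "\<phi> \<in> test_functions \<Omega>"
  shows "sob \<Omega> \<phi> (gradient \<phi>)"
  unfolding sob_def using test_L2[OF assms] assms(2) by (auto intro!: exI[of _ "\<lambda>m. \<phi>"])

lemma sob_weak:
  assumes o: "open \<Omega>" and f: "sob \<Omega> f G"
  shows "has_weak_gradient \<Omega> f G"
  unfolding has_weak_gradient_def
  using sob_by_parts[OF o f sob_test[OF o]] L2_locally_integrable[OF o sobD(1)[OF f]]
    L2_locally_integrable[OF o sobD(2)[OF f]] by simp

lemma locally_integrable_nth:
  fixes G :: "real^'n::finite \<Rightarrow> real^'m::finite"
  assumes "locally_integrable \<Omega> G"
  shows "locally_integrable \<Omega> (\<lambda>x. G x $ i)"
  unfolding locally_integrable_def
proof (intro allI impI)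
  fix K assume "compact K \<and> K \<subseteq> \<Omega>"
  then have "G absolutely_integrable_on K"
    using assms unfolding locally_integrable_def by simp
  from absolutely_integrable_linear[OF this bounded_linear_vec_nth[of i]]
  show "(\<lambda>x. G x $ i) absolutely_integrable_on K"
    by (simp add: o_def)
qed

text \<open>An open set is a countable union of closed boxes, and on each of them integrability
  includes measurability. This serves \<open>weak_gradient\<close>, a choice of which only the
  defining property is known.\<close>

lemma locally_integrable_measurable:
  fixes g :: "real^'n::finite \<Rightarrow> 'b::euclidean_space"
  assumes o: "open \<Omega>" and g: "locally_integrable \<Omega> g"
  shows "g \<in> borel_measurable (lebesgue_on \<Omega>)"
proof -
  obtain \<D> where D: "countable \<D>" "\<D> \<subseteq> Pow \<Omega>" "\<And>X. X \<in> \<D> \<Longrightarrow> \<exists>a b. X = cbox a b" "\<Union>\<D> = \<Omega>"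
    using open_countable_Union_open_cbox[OF o] by metis
  show ?thesis
  proof (rule measurable_piecewise_restrict[OF D(1)])
    show "space (lebesgue_on \<Omega>) \<subseteq> \<Union>\<D>" using D(4) by simp
    fix X assume X: "X \<in> \<D>"
    then obtain a b where ab: "X = cbox a b" using D(3) by blast
    have sub: "X \<subseteq> \<Omega>" using X D(2) by blast
    have X_leb: "X \<in> sets lebesgue" by (simp add: ab)
    then show "X \<inter> space (lebesgue_on \<Omega>) \<in> sets (lebesgue_on \<Omega>)"
      using sub o by (auto simp: sets_restrict_space_iff Int_absorb2)
    have "g absolutely_integrable_on X"
      using g sub ab compact_cbox[of a b] unfolding locally_integrable_def by simp
    then have "g \<in> borel_measurable (lebesgue_on X)"
      using absolutely_integrable_measurable[OF X_leb] by blast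
    moreover have "restrict_space (lebesgue_on \<Omega>) X = lebesgue_on X"
      using sub o X_leb by (subst restrict_restrict_space) (auto simp: Int_absorb1)
    ultimately show "g \<in> borel_measurable (restrict_space (lebesgue_on \<Omega>) X)" by simp
  qed
qed

lemma weak_gradient_unique:
  assumes o: "open \<Omega>" and G: "has_weak_gradient \<Omega> f G" and H: "has_weak_gradient \<Omega> f H"
  shows "AE x in lebesgue_on \<Omega>. G x = H x"
proof -
  have "AE x in lebesgue_on \<Omega>. G x $ i - H x $ i = 0" for i
  proof (rule fundamental_lemma[OF o])
    have l: "locally_integrable \<Omega> (\<lambda>x. G x $ i)" "locally_integrable \<Omega> (\<lambda>x. H x $ i)"
      using G H unfolding has_weak_gradient_def by (auto intro: locally_integrable_nth)
    then show "locally_integrable \<Omega> (\<lambda>x. G x $ i - H x $ i)"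
      unfolding locally_integrable_def by (auto intro: set_integral_diff(1))
    fix \<phi> assume \<phi>: "\<phi> \<in> test_functions \<Omega>"
    obtain K where K: "compact K" "K \<subseteq> \<Omega>" "\<And>x. x \<notin> K \<Longrightarrow> \<phi> x = 0"
      using test_functionsE[OF \<phi>] by blast
    obtain B where B: "B \<ge> 0" "\<And>x. \<bar>\<phi> x\<bar> \<le> B"
      using test_bounded[OF \<phi>] by blast
    have int: "integrable (lebesgue_on \<Omega>) (\<lambda>x. F x * \<phi> x)" if "locally_integrable \<Omega> F" for F
    proof -
      have i: "integrable lebesgue (\<lambda>x. indicator K x *\<^sub>R F x)"
        using that K unfolding locally_integrable_def set_integrable_def by simp
      have "integrable lebesgue (\<lambda>x. (indicator K x *\<^sub>R F x) * \<phi> x)"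
      proof (rule Bochner_Integration.integrable_bound)
        show "integrable lebesgue (\<lambda>x. B * (indicator K x *\<^sub>R F x))" using i by simp
        show "(\<lambda>x. (indicator K x *\<^sub>R F x) * \<phi> x) \<in> borel_measurable lebesgue"
          by (intro borel_measurable_times borel_measurable_integrable[OF i] measurable_completion)
             (simp add: test_borel[OF \<phi>])
        show "AE x in lebesgue. norm ((indicator K x *\<^sub>R F x) * \<phi> x) \<le> norm (B * (indicator K x *\<^sub>R F x))"
          using B by (intro AE_I2) (auto simp: abs_mult indicator_def mult.commute[of B] mult_left_mono)
      qed
      moreover have "(\<lambda>x. indicator \<Omega> x *\<^sub>R (F x * \<phi> x)) = (\<lambda>x. (indicator K x *\<^sub>R F x) * \<phi> x)"
        using K by (auto simp: indicator_def fun_eq_iff)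
      ultimately show ?thesis
        using o by (subst integrable_restrict_space) auto
    qed
    have "(LINT x|lebesgue_on \<Omega>. G x $ i * \<phi> x) = (LINT x|lebesgue_on \<Omega>. H x $ i * \<phi> x)"
      using G H \<phi> unfolding has_weak_gradient_def by (auto dest!: bspec[OF _ \<phi>])
    then show "(LINT x|lebesgue_on \<Omega>. (G x $ i - H x $ i) * \<phi> x) = 0"
      using int l by (simp add: left_diff_distrib)
  qed
  then have "AE x in lebesgue_on \<Omega>. \<forall>i. G x $ i = H x $ i"
    by (simp add: AE_all_countable)
  then show ?thesis by (simp add: vec_eq_iff)
qed

lemma weak_gradient_AE:
  assumes "open \<Omega>" "has_weak_gradient \<Omega> f G"
  shows "AE x in lebesgue_on \<Omega>. weak_gradient \<Omega> f x = G x"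
  unfolding weak_gradient_def
  by (rule weak_gradient_unique[OF assms(1) someI[of "has_weak_gradient \<Omega> f"] assms(2)]) fact

lemma has_weak_gradient_diff:
  assumes o: "open \<Omega>" and "has_weak_gradient \<Omega> f G" "L2 (lebesgue_on \<Omega>) f" "L2 (lebesgue_on \<Omega>) G"
    and "has_weak_gradient \<Omega> g H" "L2 (lebesgue_on \<Omega>) g" "L2 (lebesgue_on \<Omega>) H"
  shows "has_weak_gradient \<Omega> (\<lambda>x. f x - g x) (\<lambda>x. G x - H x)"
proof -
  have "(LINT x|lebesgue_on \<Omega>. (f x - g x) * partial_deriv i \<phi> x) = - (LINT x|lebesgue_on \<Omega>. (G x - H x) $ i * \<phi> x)"
    if \<phi>: "\<phi> \<in> test_functions \<Omega>" for \<phi> i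
  proof -
    note t = test_L2(1)[OF o \<phi>] test_L2(1)[OF o test_partial_deriv[OF \<phi>, of i]]
    have "(LINT x|lebesgue_on \<Omega>. f x * partial_deriv i \<phi> x) = - (LINT x|lebesgue_on \<Omega>. G x $ i * \<phi> x)"
      "(LINT x|lebesgue_on \<Omega>. g x * partial_deriv i \<phi> x) = - (LINT x|lebesgue_on \<Omega>. H x $ i * \<phi> x)"
      using assms \<phi> unfolding has_weak_gradient_def by blast+
    then show ?thesis
      using L2_mult_integrable[OF assms(3) t(2)] L2_mult_integrable[OF assms(6) t(2)]
        L2_mult_integrable[OF L2_nth[OF assms(4)] t(1)] L2_mult_integrable[OF L2_nth[OF assms(7)] t(1)]
      by (simp add: left_diff_distrib)
  qed
  then show ?thesis
    unfolding has_weak_gradient_def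
    using L2_locally_integrable[OF o L2_diff[OF assms(3,6)]] L2_locally_integrable[OF o L2_diff[OF assms(4,7)]] by simp
qed

lemma weak_gradient_borel:
  assumes "open \<Omega>" "has_weak_gradient \<Omega> f G"
  shows "weak_gradient \<Omega> f \<in> borel_measurable (lebesgue_on \<Omega>)"
  using locally_integrable_measurable[OF assms(1)] someI[of "has_weak_gradient \<Omega> f", OF assms(2)]
  unfolding weak_gradient_def[symmetric] has_weak_gradient_def by blast

text \<open>The gradient chosen for \<open>f - \<phi> m\<close> agrees almost everywhere with
  \<open>G - gradient (\<phi> m)\<close> for one fixed \<open>G\<close>; the squared
  \<open>H1_norm\<close> therefore splits into the two distances of \<open>sob\<close>, and both
  tend to 0.\<close>

lemma H10_imp_sob:
  assumes o: "open \<Omega>" and f: "f \<in> H10 \<Omega>"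
  obtains G where "sob \<Omega> f G"
proof -
  let ?M = "lebesgue_on \<Omega>"
  obtain G where G: "has_weak_gradient \<Omega> f G" "L2 ?M f" "L2 ?M G"
    using f unfolding H10_def H1_def square_integrable_L2 by blast
  obtain \<phi> where \<phi>: "\<And>m. \<phi> m \<in> test_functions \<Omega>" "(\<lambda>m. H1_norm \<Omega> (\<lambda>x. f x - \<phi> m x)) \<longlonglongrightarrow> 0"
    using f unfolding H10_def by blast
  define A where "A m = (LINT x|?M. (norm (f x - \<phi> m x))\<^sup>2)" for m
  define B where "B m = (LINT x|?M. (norm (G x - gradient (\<phi> m) x))\<^sup>2)" for m
  have nn: "0 \<le> A m" "0 \<le> B m" for m
    unfolding A_def B_def by (auto intro: Bochner_Integration.integral_nonneg)
  have N: "(H1_norm \<Omega> (\<lambda>x. f x - \<phi> m x))\<^sup>2 = A m + B m" for m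
  proof -
    let ?d = "\<lambda>x. f x - \<phi> m x"
    have w: "has_weak_gradient \<Omega> ?d (\<lambda>x. G x - gradient (\<phi> m) x)"
      by (rule has_weak_gradient_diff[OF o G sob_weak[OF o sob_test[OF o \<phi>(1)]] test_L2[OF o \<phi>(1)]])
    note w' = weak_gradient_AE[OF o w]
    note [measurable] = weak_gradient_borel[OF o w]
    have [measurable]: "(\<lambda>x. G x - gradient (\<phi> m) x) \<in> borel_measurable (lebesgue_on \<Omega>)"
      using L2_measurable[OF L2_diff[OF G(3) test_L2(2)[OF o \<phi>(1)]]] .
    have "(LINT x|?M. (norm (weak_gradient \<Omega> ?d x))\<^sup>2) = B m"
      unfolding B_def using w' by (intro integral_cong_AE) (measurable, auto elim: eventually_mono)
    then show ?thesis
      using nn[of m] by (simp add: H1_norm_def A_def real_norm_def)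
  qed
  have AB: "(\<lambda>m. A m + B m) \<longlonglongrightarrow> 0"
    using tendsto_power[OF \<phi>(2), of 2] N by simp
  have "A \<longlonglongrightarrow> 0" "B \<longlonglongrightarrow> 0"
    by (rule tendsto_sandwich[OF _ _ tendsto_const AB]; use nn in simp)+
  then have "sob \<Omega> f G"
    unfolding A_def[abs_def] B_def[abs_def] by (rule sobI[where \<phi>=\<phi>, OF G(2,3) \<phi>(1)])
  then show ?thesis by (rule that)
qed

text \<open>The same identification of the chosen gradient, read backwards; it makes competitors
  constructed through \<open>sob\<close> eligible for the minimization.\<close>

lemma sob_imp_H10:
  assumes o: "open \<Omega>" and f: "sob \<Omega> f G"
  shows "f \<in> H10 \<Omega>"
proof -
  let ?M = "lebesgue_on \<Omega>"
  obtain \<phi> where \<phi>: "\<And>m. \<phi> m \<in> test_functions \<Omega>"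
    "(\<lambda>m. LINT x|?M. (norm (f x - \<phi> m x))\<^sup>2) \<longlonglongrightarrow> 0"
    "(\<lambda>m. LINT x|?M. (norm (G x - gradient (\<phi> m) x))\<^sup>2) \<longlonglongrightarrow> 0"
    using sobE[OF f] by blast
  have N: "H1_norm \<Omega> (\<lambda>x. f x - \<phi> m x) =
      sqrt ((LINT x|?M. (norm (f x - \<phi> m x))\<^sup>2) + (LINT x|?M. (norm (G x - gradient (\<phi> m) x))\<^sup>2))" for m
  proof -
    let ?d = "\<lambda>x. f x - \<phi> m x"
    have w: "has_weak_gradient \<Omega> ?d (\<lambda>x. G x - gradient (\<phi> m) x)"
      by (rule has_weak_gradient_diff[OF o sob_weak[OF o f] sobD[OF f] sob_weak[OF o sob_test[OF o \<phi>(1)]] test_L2[OF o \<phi>(1)]])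
    note w' = weak_gradient_AE[OF o w]
    note [measurable] = weak_gradient_borel[OF o w]
    have [measurable]: "(\<lambda>x. G x - gradient (\<phi> m) x) \<in> borel_measurable (lebesgue_on \<Omega>)"
      using L2_measurable[OF L2_diff[OF sobD(2)[OF f] test_L2(2)[OF o \<phi>(1)]]] .
    have "(LINT x|?M. (norm (weak_gradient \<Omega> ?d x))\<^sup>2) = (LINT x|?M. (norm (G x - gradient (\<phi> m) x))\<^sup>2)"
      using w' by (intro integral_cong_AE) (measurable, auto elim: eventually_mono)
    then show ?thesis by (simp add: H1_norm_def)
  qed
  have "(\<lambda>m. H1_norm \<Omega> (\<lambda>x. f x - \<phi> m x)) \<longlonglongrightarrow> sqrt (0 + 0)"
    unfolding N by (intro tendsto_real_sqrt tendsto_add \<phi>(2,3))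
  then have "(\<lambda>m. H1_norm \<Omega> (\<lambda>x. f x - \<phi> m x)) \<longlonglongrightarrow> 0" by simp
  then show ?thesis
    unfolding H10_def H1_def square_integrable_L2
    using \<phi>(1) sob_weak[OF o f] sobD[OF f] by blast
qed

section \<open>Closure properties of \<open>sob\<close>\<close>

lemma AE_eq_integral_norm_sq:
  fixes F G :: "'a \<Rightarrow> 'b::euclidean_space"
  assumes "AE x in M. F x = G x" "F \<in> borel_measurable M" "G \<in> borel_measurable M"
  shows "(LINT x|M. (norm (F x))\<^sup>2) = (LINT x|M. (norm (G x))\<^sup>2)"
  using assms by (intro integral_cong_AE) (auto elim: eventually_mono)

lemma L2_cong_AE:
  assumes "L2 M G" "AE x in M. G x = H x" "H \<in> borel_measurable M"
  shows "L2 M H"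
  using assms(1,3) by (rule L2_bound[where c=1]) (use assms(2) in \<open>auto elim: eventually_mono\<close>)

lemma L2_tendsto_add:
  fixes f g :: "'a \<Rightarrow> 'b::euclidean_space"
  assumes f: "L2 M f" and g: "L2 M g" and F: "\<And>n. L2 M (F n)" and G: "\<And>n. L2 M (G n)"
    and cf: "(\<lambda>n. \<integral>x. (norm (f x - F n x))\<^sup>2 \<partial>M) \<longlonglongrightarrow> 0"
    and cg: "(\<lambda>n. \<integral>x. (norm (g x - G n x))\<^sup>2 \<partial>M) \<longlonglongrightarrow> 0"
  shows "(\<lambda>n. \<integral>x. (norm ((f x + g x) - (F n x + G n x)))\<^sup>2 \<partial>M) \<longlonglongrightarrow> 0"
proof (rule tendsto_sandwich[OF _ _ tendsto_const])
  let ?u = "\<lambda>n. 2 * (\<integral>x. (norm (f x - F n x))\<^sup>2 \<partial>M) + 2 * (\<integral>x. (norm (g x - G n x))\<^sup>2 \<partial>M)"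
  have "?u \<longlonglongrightarrow> 2 * 0 + 2 * 0" by (intro tendsto_intros cf cg)
  then show "?u \<longlonglongrightarrow> 0" by simp
  show "\<forall>\<^sub>F n in sequentially. 0 \<le> (\<integral>x. (norm ((f x + g x) - (F n x + G n x)))\<^sup>2 \<partial>M)"
    by (auto intro: Bochner_Integration.integral_nonneg)
  have "(\<integral>x. (norm ((f x + g x) - (F n x + G n x)))\<^sup>2 \<partial>M) \<le> ?u n" for n
    using L2_dist_triangle[OF L2_diff[OF f F[of n]] L2_zero L2_diff[OF G[of n] g]]
    by (simp add: algebra_simps norm_minus_commute)
  then show "\<forall>\<^sub>F n in sequentially. (\<integral>x. (norm ((f x + g x) - (F n x + G n x)))\<^sup>2 \<partial>M) \<le> ?u n"
    by simp
qed

lemma sob_add: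
  assumes o: "open \<Omega>" and f: "sob \<Omega> f G" and g: "sob \<Omega> g H"
  shows "sob \<Omega> (\<lambda>x. f x + g x) (\<lambda>x. G x + H x)"
proof -
  let ?M = "lebesgue_on \<Omega>"
  obtain \<phi> where \<phi>: "\<And>m. \<phi> m \<in> test_functions \<Omega>"
    "(\<lambda>m. LINT x|?M. (norm (f x - \<phi> m x))\<^sup>2) \<longlonglongrightarrow> 0"
    "(\<lambda>m. LINT x|?M. (norm (G x - gradient (\<phi> m) x))\<^sup>2) \<longlonglongrightarrow> 0"
    using sobE[OF f] by blast
  obtain \<psi> where \<psi>: "\<And>m. \<psi> m \<in> test_functions \<Omega>"
    "(\<lambda>m. LINT x|?M. (norm (g x - \<psi> m x))\<^sup>2) \<longlonglongrightarrow> 0"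
    "(\<lambda>m. LINT x|?M. (norm (H x - gradient (\<psi> m) x))\<^sup>2) \<longlonglongrightarrow> 0"
    using sobE[OF g] by blast
  show ?thesis
  proof (rule sobI)
    show "(\<lambda>x. \<phi> m x + \<psi> m x) \<in> test_functions \<Omega>" for m by (rule test_add[OF \<phi>(1) \<psi>(1)])
    have e: "gradient (\<lambda>x. \<phi> m x + \<psi> m x) x = gradient (\<phi> m) x + gradient (\<psi> m) x" for m x
      by (intro gradient_add test_differentiable[OF \<phi>(1)] test_differentiable[OF \<psi>(1)])
    show "(\<lambda>m. LINT x|?M. (norm ((G x + H x) - gradient (\<lambda>x. \<phi> m x + \<psi> m x) x))\<^sup>2) \<longlonglongrightarrow> 0"
      unfolding e by (intro L2_tendsto_add sobD[OF f] sobD[OF g] test_L2[OF o \<phi>(1)] test_L2[OF o \<psi>(1)] \<phi> \<psi>)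
    show "(\<lambda>m. LINT x|?M. (norm ((f x + g x) - (\<phi> m x + \<psi> m x)))\<^sup>2) \<longlonglongrightarrow> 0"
      by (intro L2_tendsto_add sobD[OF f] sobD[OF g] test_L2[OF o \<phi>(1)] test_L2[OF o \<psi>(1)] \<phi> \<psi>)
  qed (intro L2_add sobD[OF f] sobD[OF g])+
qed

lemma L2_tendsto_bounded:
  fixes F :: "nat \<Rightarrow> 'a \<Rightarrow> 'b::euclidean_space" and H :: "nat \<Rightarrow> 'a \<Rightarrow> 'c::euclidean_space"
  assumes f: "\<And>n. L2 M (F n)" and g: "\<And>n. H n \<in> borel_measurable M"
    and le: "\<And>n x. norm (H n x) \<le> c * norm (F n x)"
    and cf: "(\<lambda>n. \<integral>x. (norm (F n x))\<^sup>2 \<partial>M) \<longlonglongrightarrow> 0"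
  shows "(\<lambda>n. \<integral>x. (norm (H n x))\<^sup>2 \<partial>M) \<longlonglongrightarrow> 0"
proof (rule tendsto_sandwich[OF _ _ tendsto_const])
  let ?u = "\<lambda>n. c\<^sup>2 * (\<integral>x. (norm (F n x))\<^sup>2 \<partial>M)"
  have "?u \<longlonglongrightarrow> c\<^sup>2 * 0" by (intro tendsto_intros cf)
  then show "?u \<longlonglongrightarrow> 0" by simp
  show "\<forall>\<^sub>F n in sequentially. 0 \<le> (\<integral>x. (norm (H n x))\<^sup>2 \<partial>M)"
    by (auto intro: Bochner_Integration.integral_nonneg)
  have "(\<integral>x. (norm (H n x))\<^sup>2 \<partial>M) \<le> (\<integral>x. c\<^sup>2 * (norm (F n x))\<^sup>2 \<partial>M)" for n
  proof (rule integral_mono)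
    show "integrable M (\<lambda>x. (norm (H n x))\<^sup>2)"
      by (rule L2_integrable[OF L2_bound[OF f[of n] g[of n], where c=c]]) (use le in auto)
    show "integrable M (\<lambda>x. c\<^sup>2 * (norm (F n x))\<^sup>2)"
      using L2_integrable[OF f[of n]] by simp
    show "(norm (H n x))\<^sup>2 \<le> c\<^sup>2 * (norm (F n x))\<^sup>2" for x
      using power_mono[OF le[of n x], of 2] by (simp add: power_mult_distrib)
  qed
  then show "\<forall>\<^sub>F n in sequentially. (\<integral>x. (norm (H n x))\<^sup>2 \<partial>M) \<le> ?u n"
    by simp
qed

text \<open>The product rule for the approximating test functions survives the limit because
  \<open>\<eta>\<close> and its gradient are bounded.\<close>

lemma sob_mult_test:
  assumes o: "open \<Omega>" and f: "sob \<Omega> f G" and \<eta>: "\<eta> \<in> test_functions \<Omega>"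
  shows "sob \<Omega> (\<lambda>x. \<eta> x * f x) (\<lambda>x. \<eta> x *\<^sub>R G x + f x *\<^sub>R gradient \<eta> x)"
proof -
  let ?M = "lebesgue_on \<Omega>"
  obtain \<phi> where \<phi>: "\<And>m. \<phi> m \<in> test_functions \<Omega>"
    "(\<lambda>m. LINT x|?M. (norm (f x - \<phi> m x))\<^sup>2) \<longlonglongrightarrow> 0"
    "(\<lambda>m. LINT x|?M. (norm (G x - gradient (\<phi> m) x))\<^sup>2) \<longlonglongrightarrow> 0"
    using sobE[OF f] by blast
  obtain B where B: "B \<ge> 0" "\<And>x. \<bar>\<eta> x\<bar> \<le> B" using test_bounded[OF \<eta>] by blast
  obtain C where C: "C \<ge> 0" "\<And>x. norm (gradient \<eta> x) \<le> C" using gradient_test_bounded[OF \<eta>] by blast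
  note [measurable] = borel_imp_lebesgue_on[OF test_borel[OF \<eta>]] borel_imp_lebesgue_on[OF gradient_test_borel[OF \<eta>]]
  have L_\<eta>: "L2 ?M (\<lambda>x. \<eta> x *\<^sub>R F x)" if "L2 ?M F" for F :: "real^'a \<Rightarrow> 'b::euclidean_space"
    using that L2_measurable[OF that]
    by (intro L2_bound[OF that, where c=B]) (auto intro!: mult_right_mono B)
  have L_grad: "L2 ?M (\<lambda>x. F x *\<^sub>R gradient \<eta> x)" if "L2 ?M F" for F :: "real^'a \<Rightarrow> real"
    using that L2_measurable[OF that]
    by (intro L2_bound[OF that, where c=C]) (auto simp: mult.commute[of C] intro!: mult_left_mono C)
  show ?thesis
  proof (rule sobI)
    show "L2 ?M (\<lambda>x. \<eta> x * f x)" using L_\<eta>[OF sobD(1)[OF f]] by simp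
    show "L2 ?M (\<lambda>x. \<eta> x *\<^sub>R G x + f x *\<^sub>R gradient \<eta> x)"
      by (intro L2_add L_\<eta> L_grad sobD[OF f])
    show "(\<lambda>x. \<eta> x * \<phi> m x) \<in> test_functions \<Omega>" for m
      by (intro test_mult_left test_smooth[OF \<eta>] \<phi>(1))
    have e: "gradient (\<lambda>x. \<eta> x * \<phi> m x) x = \<eta> x *\<^sub>R gradient (\<phi> m) x + \<phi> m x *\<^sub>R gradient \<eta> x" for m x
      by (intro gradient_mult test_differentiable[OF \<phi>(1)] test_differentiable[OF \<eta>])
    note d = L2_diff[OF sobD(1)[OF f] test_L2(1)[OF o \<phi>(1)]] L2_diff[OF sobD(2)[OF f] test_L2(2)[OF o \<phi>(1)]]
    note [measurable] = L2_measurable[OF d(1)] L2_measurable[OF d(2)]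
    have "(\<lambda>m. LINT x|?M. (norm (\<eta> x * (f x - \<phi> m x)))\<^sup>2) \<longlonglongrightarrow> 0"
      by (rule L2_tendsto_bounded[where c=B and F="\<lambda>m x. f x - \<phi> m x", OF d(1)])
         (auto simp: abs_mult intro!: mult_right_mono B \<phi>(2)[simplified])
    then show "(\<lambda>m. LINT x|?M. (norm (\<eta> x * f x - \<eta> x * \<phi> m x))\<^sup>2) \<longlonglongrightarrow> 0"
      by (simp add: right_diff_distrib)
    have "(\<lambda>m. LINT x|?M. (norm (\<eta> x *\<^sub>R (G x - gradient (\<phi> m) x)))\<^sup>2) \<longlonglongrightarrow> 0"
      by (rule L2_tendsto_bounded[where c=B and F="\<lambda>m x. G x - gradient (\<phi> m) x", OF d(2)])
         (auto intro!: mult_right_mono B \<phi>)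
    moreover have "(\<lambda>m. LINT x|?M. (norm ((f x - \<phi> m x) *\<^sub>R gradient \<eta> x))\<^sup>2) \<longlonglongrightarrow> 0"
      by (rule L2_tendsto_bounded[where c=C and F="\<lambda>m x. f x - \<phi> m x", OF d(1)])
         (auto simp: mult.commute[of C] intro!: mult_left_mono C \<phi>(2)[simplified])
    ultimately show "(\<lambda>m. LINT x|?M. (norm (\<eta> x *\<^sub>R G x + f x *\<^sub>R gradient \<eta> x - gradient (\<lambda>x. \<eta> x * \<phi> m x) x))\<^sup>2) \<longlonglongrightarrow> 0"
      unfolding e
      using L2_tendsto_add[of ?M "\<lambda>x. \<eta> x *\<^sub>R G x" "\<lambda>x. f x *\<^sub>R gradient \<eta> x" "\<lambda>m x. \<eta> x *\<^sub>R gradient (\<phi> m) x" "\<lambda>m x. \<phi> m x *\<^sub>R gradient \<eta> x"]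
        L_\<eta>[OF sobD(2)[OF f]] L_grad[OF sobD(1)[OF f]] L_\<eta>[OF test_L2(2)[OF o \<phi>(1)]] L_grad[OF test_L2(1)[OF o \<phi>(1)]]
      by (simp add: scaleR_diff_right scaleR_diff_left)
  qed
qed

lemma sob_cmult:
  assumes o: "open \<Omega>" and f: "sob \<Omega> f G"
  shows "sob \<Omega> (\<lambda>x. c * f x) (\<lambda>x. c *\<^sub>R G x)"
proof -
  let ?M = "lebesgue_on \<Omega>"
  obtain \<phi> where \<phi>: "\<And>m. \<phi> m \<in> test_functions \<Omega>"
    "(\<lambda>m. LINT x|?M. (norm (f x - \<phi> m x))\<^sup>2) \<longlonglongrightarrow> 0"
    "(\<lambda>m. LINT x|?M. (norm (G x - gradient (\<phi> m) x))\<^sup>2) \<longlonglongrightarrow> 0"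
    using sobE[OF f] by blast
  show ?thesis
  proof (rule sobI)
    show "L2 ?M (\<lambda>x. c * f x)" "L2 ?M (\<lambda>x. c *\<^sub>R G x)"
      by (intro L2_cmult L2_scaleR sobD[OF f])+
    show "(\<lambda>x. c * \<phi> m x) \<in> test_functions \<Omega>" for m by (rule test_cmult[OF \<phi>(1)])
    have "(norm (c * f x - c * \<phi> m x))\<^sup>2 = c\<^sup>2 * (norm (f x - \<phi> m x))\<^sup>2" for m x
      by (simp add: power_mult_distrib right_diff_distrib[symmetric])
    then show "(\<lambda>m. LINT x|?M. (norm (c * f x - c * \<phi> m x))\<^sup>2) \<longlonglongrightarrow> 0"
      using tendsto_mult_left[OF \<phi>(2), of "c\<^sup>2"] by simp
    have "gradient (\<lambda>x. c * \<phi> m x) x = c *\<^sub>R gradient (\<phi> m) x" for m x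
      by (rule gradient_cmult[OF test_differentiable[OF \<phi>(1)]])
    then have "(norm (c *\<^sub>R G x - gradient (\<lambda>x. c * \<phi> m x) x))\<^sup>2 = c\<^sup>2 * (norm (G x - gradient (\<phi> m) x))\<^sup>2" for m x
      by (simp add: power_mult_distrib scaleR_diff_right[symmetric])
    then show "(\<lambda>m. LINT x|?M. (norm (c *\<^sub>R G x - gradient (\<lambda>x. c * \<phi> m x) x))\<^sup>2) \<longlonglongrightarrow> 0"
      using tendsto_mult_left[OF \<phi>(3), of "c\<^sup>2"] by simp
  qed
qed

lemma sob_minus: "open \<Omega> \<Longrightarrow> sob \<Omega> f G \<Longrightarrow> sob \<Omega> (\<lambda>x. - f x) (\<lambda>x. - G x)"
  using sob_cmult[of \<Omega> f G "-1"] by simp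

lemma sob_diff:
  "open \<Omega> \<Longrightarrow> sob \<Omega> f G \<Longrightarrow> sob \<Omega> g H \<Longrightarrow> sob \<Omega> (\<lambda>x. f x - g x) (\<lambda>x. G x - H x)"
  using sob_add[OF _ _ sob_minus] by fastforce

lemma gradient_const [simp]: "gradient (\<lambda>x. c) x = 0"
  by (simp add: vec_eq_iff)

lemma sob_zero: "open \<Omega> \<Longrightarrow> sob \<Omega> (\<lambda>x. 0) (\<lambda>x. 0)"
  using sob_test[OF _ test_zero, of \<Omega>] by (simp add: gradient_const[abs_def])

lemma sob_sum:
  assumes "open \<Omega>" "\<And>i. i \<in> A \<Longrightarrow> sob \<Omega> (f i) (G i)"
  shows "sob \<Omega> (\<lambda>x. \<Sum>i\<in>A. f i x) (\<lambda>x. \<Sum>i\<in>A. G i x)"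
  using assms(2) by (induction A rule: infinite_finite_induct) (auto intro: sob_zero[OF assms(1)] sob_add[OF assms(1)])

text \<open>A diagonal choice: for each \<open>n\<close> a test function whose squared L2 distances
  to \<open>F n\<close> and \<open>D n\<close> are both below \<open>1 / (n + 1)\<close>.\<close>

lemma sob_limit:
  assumes o: "open \<Omega>" and fn: "\<And>n. sob \<Omega> (F n) (D n)" and f: "L2 (lebesgue_on \<Omega>) f" and G: "L2 (lebesgue_on \<Omega>) G"
    and cf: "(\<lambda>n. LINT x|lebesgue_on \<Omega>. (norm (f x - F n x))\<^sup>2) \<longlonglongrightarrow> 0"
    and cG: "(\<lambda>n. LINT x|lebesgue_on \<Omega>. (norm (G x - D n x))\<^sup>2) \<longlonglongrightarrow> 0"
  shows "sob \<Omega> f G"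
proof -
  let ?M = "lebesgue_on \<Omega>"
  have ex: "\<forall>n. \<exists>\<phi>. \<phi> \<in> test_functions \<Omega> \<and> (LINT x|?M. (norm (F n x - \<phi> x))\<^sup>2) < inverse (real (Suc n))
      \<and> (LINT x|?M. (norm (D n x - gradient \<phi> x))\<^sup>2) < inverse (real (Suc n))"
  proof
    fix n
    obtain \<phi> where \<phi>: "\<And>m. \<phi> m \<in> test_functions \<Omega>"
      "(\<lambda>m. LINT x|?M. (norm (F n x - \<phi> m x))\<^sup>2) \<longlonglongrightarrow> 0"
      "(\<lambda>m. LINT x|?M. (norm (D n x - gradient (\<phi> m) x))\<^sup>2) \<longlonglongrightarrow> 0"
      using sobE[OF fn[of n]] by blast
    have p: "0 < inverse (real (Suc n))" by simp
    have "\<forall>\<^sub>F m in sequentially. (LINT x|?M. (norm (F n x - \<phi> m x))\<^sup>2) < inverse (real (Suc n))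
      \<and> (LINT x|?M. (norm (D n x - gradient (\<phi> m) x))\<^sup>2) < inverse (real (Suc n))"
      using order_tendstoD(2)[OF \<phi>(2) p] order_tendstoD(2)[OF \<phi>(3) p] by eventually_elim simp
    then obtain m where "(LINT x|?M. (norm (F n x - \<phi> m x))\<^sup>2) < inverse (real (Suc n))
      \<and> (LINT x|?M. (norm (D n x - gradient (\<phi> m) x))\<^sup>2) < inverse (real (Suc n))"
      using eventually_happens'[OF sequentially_bot] by blast
    with \<phi>(1)[of m] show "\<exists>\<phi>. \<phi> \<in> test_functions \<Omega> \<and> (LINT x|?M. (norm (F n x - \<phi> x))\<^sup>2) < inverse (real (Suc n))
      \<and> (LINT x|?M. (norm (D n x - gradient \<phi> x))\<^sup>2) < inverse (real (Suc n))" by blast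
  qed
  obtain \<phi> where \<phi>: "\<And>n. \<phi> n \<in> test_functions \<Omega>"
    "\<And>n. (LINT x|?M. (norm (F n x - \<phi> n x))\<^sup>2) < inverse (real (Suc n))"
    "\<And>n. (LINT x|?M. (norm (D n x - gradient (\<phi> n) x))\<^sup>2) < inverse (real (Suc n))"
    using choice[OF ex] by blast
  have lim: "(\<lambda>n. LINT x|?M. (norm (g x - P n x))\<^sup>2) \<longlonglongrightarrow> 0"
    if g: "L2 ?M g" and Q: "\<And>n. L2 ?M (Q n)" and P: "\<And>n. L2 ?M (P n)"
      and c: "(\<lambda>n. LINT x|?M. (norm (g x - Q n x))\<^sup>2) \<longlonglongrightarrow> 0"
      and b: "\<And>n. (LINT x|?M. (norm (Q n x - P n x))\<^sup>2) < inverse (real (Suc n))"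
    for g :: "real^'a \<Rightarrow> 'b::euclidean_space" and Q P
  proof (rule tendsto_sandwich[OF _ _ tendsto_const])
    let ?u = "\<lambda>n. 2 * (LINT x|?M. (norm (g x - Q n x))\<^sup>2) + 2 * inverse (real (Suc n))"
    have "?u \<longlonglongrightarrow> 2 * 0 + 2 * 0" by (intro tendsto_intros c LIMSEQ_inverse_real_of_nat)
    then show "?u \<longlonglongrightarrow> 0" by simp
    show "\<forall>\<^sub>F n in sequentially. 0 \<le> (LINT x|?M. (norm (g x - P n x))\<^sup>2)"
      by (auto intro: Bochner_Integration.integral_nonneg)
    have "(LINT x|?M. (norm (g x - P n x))\<^sup>2) \<le> ?u n" for n
      using L2_dist_triangle[OF g Q[of n] P[of n]] b[of n] by simp
    then show "\<forall>\<^sub>F n in sequentially. (LINT x|?M. (norm (g x - P n x))\<^sup>2) \<le> ?u n" by simp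
  qed
  show ?thesis
  proof (rule sobI[where \<phi>=\<phi>, OF f G \<phi>(1)])
    show "(\<lambda>m. LINT x|?M. (norm (f x - \<phi> m x))\<^sup>2) \<longlonglongrightarrow> 0"
      by (rule lim[OF f sobD(1)[OF fn] test_L2(1)[OF o \<phi>(1)] cf \<phi>(2)])
    show "(\<lambda>m. LINT x|?M. (norm (G x - gradient (\<phi> m) x))\<^sup>2) \<longlonglongrightarrow> 0"
      by (rule lim[OF G sobD(2)[OF fn] test_L2(2)[OF o \<phi>(1)] cG \<phi>(3)])
  qed
qed

text \<open>A smooth approximation of the positive part, exact in the limit \<open>c \<rightarrow> \<infinity>\<close>, that vanishes at the
  origin, so that it maps test functions to test functions.\<close>

definition spos :: "real \<Rightarrow> real \<Rightarrow> real" where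
  "spos c s = s * flat 0 (c * s)"

definition dspos :: "real \<Rightarrow> real \<Rightarrow> real" where
  "dspos c s = flat 0 (c * s) + c * s * flat 2 (c * s)"

lemma spos_deriv: "(spos c has_real_derivative dspos c s) (at s)"
proof -
  have "((\<lambda>s. flat 0 (c * s)) has_real_derivative (flat 2 (c * s) * c)) (at s)"
    using DERIV_chain2[OF has_real_derivative_flat[of 0 "c * s"] DERIV_cmult_Id[of c s]]
    by (simp add: numeral_2_eq_2)
  from DERIV_mult[OF DERIV_ident this] show ?thesis
    by (simp add: spos_def[abs_def] dspos_def algebra_simps)
qed

text \<open>With \<open>y = 1 / (c * s)\<close> the derivative is
  \<open>exp (- y) * (1 + y)\<close>, which is at most 1 because \<open>1 + y\<close> is at most
  \<open>exp y\<close>. These bounds are uniform in \<open>c\<close>, as the limit to the positive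
  part requires.\<close>

lemma dspos_bounds:
  assumes "c \<ge> 0" shows "0 \<le> dspos c s" "dspos c s \<le> 1"
proof -
  show "0 \<le> dspos c s"
  proof (cases "s \<ge> 0")
    case True then show ?thesis using assms by (simp add: dspos_def flat_nonneg)
  next
    case False
    then have "c * s \<le> 0" using assms by (simp add: mult_nonneg_nonpos)
    then show ?thesis by (simp add: dspos_def)
  qed
  show "dspos c s \<le> 1"
  proof (cases "c * s > 0")
    case True
    have "dspos c s = exp (- (1 / (c * s))) * (1 + 1 / (c * s))"
      using True by (simp add: dspos_def flat_def power2_eq_square field_simps)
    also have "\<dots> \<le> exp (- (1 / (c * s))) * exp (1 / (c * s))"
      by (intro mult_left_mono exp_ge_add_one_self) auto
    also have "\<dots> = 1" by (simp flip: exp_add)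
    finally show ?thesis .
  qed (simp add: dspos_def)
qed

lemma spos_contraction:
  assumes "c \<ge> 0" shows "\<bar>spos c a - spos c b\<bar> \<le> \<bar>a - b\<bar>"
proof -
  have "norm (spos c a - spos c b) \<le> 1 * norm (a - b)"
  proof (rule field_differentiable_bound[where S=UNIV])
    show "(spos c has_field_derivative dspos c z) (at z within UNIV)" for z
      by (simp add: spos_deriv)
    show "norm (dspos c z) \<le> 1" for z using dspos_bounds[OF assms, of z] by simp
  qed auto
  then show ?thesis by simp
qed

lemma spos_le: "c \<ge> 0 \<Longrightarrow> \<bar>spos c s\<bar> \<le> \<bar>s\<bar>"
  using spos_contraction[of c s 0] by (simp add: spos_def)

lemma isCont_flat: "isCont (flat n) s"
  using has_real_derivative_flat DERIV_isCont by blast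

lemma isCont_dspos: "isCont (dspos c) s"
  unfolding dspos_def[abs_def]
  by (intro continuous_intros isCont_o2[OF _ isCont_flat])

lemma borel_spos [measurable]: "spos c \<in> borel_measurable borel"
  by (intro borel_measurable_continuous_onI continuous_at_imp_continuous_on ballI DERIV_isCont[OF spos_deriv])

lemma borel_dspos [measurable]: "dspos c \<in> borel_measurable borel"
  by (intro borel_measurable_continuous_onI continuous_at_imp_continuous_on ballI isCont_dspos)

text \<open>The gradient error has two parts. In
  \<open>dspos c (\<phi>) * (G - gradient \<phi>)\<close> the factor \<open>dspos\<close> is bounded
  by 1. In \<open>(dspos c f - dspos c \<phi>) * G\<close> only pointwise convergence is available,
  which is why an almost everywhere convergent subsequence is extracted and dominated convergence is
  used.\<close>

lemma sob_spos:
  assumes o: "open \<Omega>" and f: "sob \<Omega> f G" and c: "c \<ge> 0"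
  shows "sob \<Omega> (\<lambda>x. spos c (f x)) (\<lambda>x. dspos c (f x) *\<^sub>R G x)"
proof -
  let ?M = "lebesgue_on \<Omega>"
  obtain \<phi> where \<phi>: "\<And>m. \<phi> m \<in> test_functions \<Omega>"
    "(\<lambda>m. LINT x|?M. (norm (f x - \<phi> m x))\<^sup>2) \<longlonglongrightarrow> 0"
    "(\<lambda>m. LINT x|?M. (norm (G x - gradient (\<phi> m) x))\<^sup>2) \<longlonglongrightarrow> 0"
    using sobE[OF f] by blast
  note L = sobD[OF f] test_L2[OF o \<phi>(1)]
  note [measurable] = L2_measurable[OF L(1)] L2_measurable[OF L(2)] L2_measurable[OF L(3)] L2_measurable[OF L(4)]
  obtain r where r: "strict_mono r" "AE x in ?M. (\<lambda>n. (norm (f x - \<phi> (r n) x))\<^sup>2) \<longlonglongrightarrow> 0"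
    using tendsto_L1_AE_subseq[of ?M "\<lambda>n x. (norm (f x - \<phi> n x))\<^sup>2"] L2_integrable[OF L2_diff[OF L(1,3)]] \<phi>(2)
    by auto
  have S: "spos c \<circ> \<phi> n \<in> test_functions \<Omega>" for n
  proof -
    have "(\<lambda>x. flat 0 (c * \<phi> n x) * \<phi> n x) \<in> test_functions \<Omega>"
      by (intro test_mult_left smooth_flat smooth_mult smooth_const test_smooth[OF \<phi>(1)] \<phi>(1))
    then show ?thesis by (simp add: spos_def o_def mult.commute)
  qed
  have gr: "gradient (spos c \<circ> \<phi> n) x = dspos c (\<phi> n x) *\<^sub>R gradient (\<phi> n) x" for n x
    using partial_deriv_compose[OF test_differentiable[OF \<phi>(1)[of n]] spos_deriv]
    by (simp add: vec_eq_iff o_def)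
  have L1: "L2 ?M (\<lambda>x. spos c (f x))"
    using spos_le[OF c] by (intro L2_bound[OF L(1), where c=1]) auto
  have L2: "L2 ?M (\<lambda>x. dspos c (h x) *\<^sub>R H x)"
    if [measurable]: "h \<in> borel_measurable ?M" and H: "L2 ?M H" for h and H :: "real^'a \<Rightarrow> real^'a"
  proof (rule L2_bound[OF H, where c=1])
    note [measurable] = L2_measurable[OF H]
    show "(\<lambda>x. dspos c (h x) *\<^sub>R H x) \<in> borel_measurable ?M" by measurable
    show "AE x in ?M. norm (dspos c (h x) *\<^sub>R H x) \<le> 1 * norm (H x)"
      using dspos_bounds[OF c] by (intro AE_I2) (auto intro!: mult_left_le_one_le)
  qed
  have sub: "(\<lambda>n. LINT x|?M. (norm (f x - \<phi> (r n) x))\<^sup>2) \<longlonglongrightarrow> 0"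
    "(\<lambda>n. LINT x|?M. (norm (G x - gradient (\<phi> (r n)) x))\<^sup>2) \<longlonglongrightarrow> 0"
    using LIMSEQ_subseq_LIMSEQ[OF \<phi>(2) r(1)] LIMSEQ_subseq_LIMSEQ[OF \<phi>(3) r(1)] by (simp_all add: o_def)
  show ?thesis
  proof (rule sobI[where \<phi>="\<lambda>n. spos c \<circ> \<phi> (r n)", OF L1 L2 S])
    show "L2 ?M G" by fact
    show "(\<lambda>m. LINT x|?M. (norm (spos c (f x) - (spos c \<circ> \<phi> (r m)) x))\<^sup>2) \<longlonglongrightarrow> 0"
      by (rule L2_tendsto_bounded[where c=1 and F="\<lambda>m x. f x - \<phi> (r m) x", OF L2_diff[OF L(1,3)]])
         (use spos_contraction[OF c] sub in \<open>auto simp: o_def\<close>)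
    have 1: "(\<lambda>m. LINT x|?M. (norm (dspos c (\<phi> (r m) x) *\<^sub>R (G x - gradient (\<phi> (r m)) x)))\<^sup>2) \<longlonglongrightarrow> 0"
      by (rule L2_tendsto_bounded[where c=1 and F="\<lambda>m x. G x - gradient (\<phi> (r m)) x", OF L2_diff[OF L(2,4)]])
         (use dspos_bounds[OF c] sub in \<open>auto intro!: mult_left_le_one_le\<close>)
    have 2: "(\<lambda>m. LINT x|?M. (norm (dspos c (f x) *\<^sub>R G x - dspos c (\<phi> (r m) x) *\<^sub>R G x))\<^sup>2) \<longlonglongrightarrow> (LINT x|?M. 0)"
    proof (rule integral_dominated_convergence[where w="\<lambda>x. (norm (G x))\<^sup>2"])
      show "AE x in ?M. (\<lambda>m. (norm (dspos c (f x) *\<^sub>R G x - dspos c (\<phi> (r m) x) *\<^sub>R G x))\<^sup>2) \<longlonglongrightarrow> 0"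
        using r(2)
      proof eventually_elim
        case (elim x)
        have "(\<lambda>n. \<bar>f x - \<phi> (r n) x\<bar>) \<longlonglongrightarrow> 0"
          using tendsto_real_sqrt[OF elim] by simp
        then have "(\<lambda>n. f x - \<phi> (r n) x) \<longlonglongrightarrow> 0" by (simp add: tendsto_rabs_zero_iff)
        then have "(\<lambda>n. f x - (f x - \<phi> (r n) x)) \<longlonglongrightarrow> f x - 0" by (intro tendsto_intros)
        then have "(\<lambda>n. \<phi> (r n) x) \<longlonglongrightarrow> f x" by simp
        then have "(\<lambda>n. dspos c (\<phi> (r n) x)) \<longlonglongrightarrow> dspos c (f x)"
          by (rule isCont_tendsto_compose[OF isCont_dspos])
        then have "(\<lambda>m. (norm (dspos c (f x) *\<^sub>R G x - dspos c (\<phi> (r m) x) *\<^sub>R G x))\<^sup>2) \<longlonglongrightarrow>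
            (norm (dspos c (f x) *\<^sub>R G x - dspos c (f x) *\<^sub>R G x))\<^sup>2"
          by (intro tendsto_intros)
        then show ?case by simp
      qed
      show "integrable ?M (\<lambda>x. (norm (G x))\<^sup>2)" by (rule L2_integrable[OF L(2)])
      show "AE x in ?M. norm ((norm (dspos c (f x) *\<^sub>R G x - dspos c (\<phi> (r m) x) *\<^sub>R G x))\<^sup>2) \<le> (norm (G x))\<^sup>2" for m
      proof (rule AE_I2)
        fix x
        have "\<bar>dspos c (f x) - dspos c (\<phi> (r m) x)\<bar> \<le> 1"
          using dspos_bounds[OF c, of "f x"] dspos_bounds[OF c, of "\<phi> (r m) x"] by linarith
        then have "norm (dspos c (f x) *\<^sub>R G x - dspos c (\<phi> (r m) x) *\<^sub>R G x) \<le> norm (G x)"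
          by (simp add: scaleR_diff_left[symmetric] mult_left_le_one_le)
        then show "norm ((norm (dspos c (f x) *\<^sub>R G x - dspos c (\<phi> (r m) x) *\<^sub>R G x))\<^sup>2) \<le> (norm (G x))\<^sup>2"
          by (simp add: power_mono)
      qed
    qed measurable
    show "(\<lambda>m. LINT x|?M. (norm (dspos c (f x) *\<^sub>R G x - gradient (spos c \<circ> \<phi> (r m)) x))\<^sup>2) \<longlonglongrightarrow> 0"
    proof (rule tendsto_sandwich[OF _ _ tendsto_const])
      let ?u = "\<lambda>m. 2 * (LINT x|?M. (norm (dspos c (f x) *\<^sub>R G x - dspos c (\<phi> (r m) x) *\<^sub>R G x))\<^sup>2)
         + 2 * (LINT x|?M. (norm (dspos c (\<phi> (r m) x) *\<^sub>R (G x - gradient (\<phi> (r m)) x)))\<^sup>2)"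
      have "?u \<longlonglongrightarrow> 2 * (LINT x|?M. 0) + 2 * 0" by (intro tendsto_intros 1 2)
      then show "?u \<longlonglongrightarrow> 0" by simp
      show "\<forall>\<^sub>F m in sequentially. 0 \<le> (LINT x|?M. (norm (dspos c (f x) *\<^sub>R G x - gradient (spos c \<circ> \<phi> (r m)) x))\<^sup>2)"
        by (auto intro: Bochner_Integration.integral_nonneg)
      have "(LINT x|?M. (norm (dspos c (f x) *\<^sub>R G x - gradient (spos c \<circ> \<phi> (r m)) x))\<^sup>2) \<le> ?u m" for m
        unfolding gr scaleR_diff_right
        by (rule L2_dist_triangle) (use L in \<open>auto intro!: L2\<close>)
      then show "\<forall>\<^sub>F m in sequentially. (LINT x|?M. (norm (dspos c (f x) *\<^sub>R G x - gradient (spos c \<circ> \<phi> (r m)) x))\<^sup>2) \<le> ?u m"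
        by simp
    qed
  qed measurable
qed

lemma spos_tendsto: "(\<lambda>n. spos (real n) s) \<longlonglongrightarrow> max s 0"
proof (cases "s > 0")
  case True
  have "(\<lambda>n. s * flat 0 (real n * s)) \<longlonglongrightarrow> s * 1"
    using flat_scaled_tendsto[of s] True by (intro tendsto_intros) auto
  then show ?thesis using True by (simp add: spos_def)
next
  case False
  then have "real n * s \<le> 0" for n by (simp add: mult_nonneg_nonpos)
  then show ?thesis using False by (simp add: spos_def)
qed

lemma dspos_tendsto: "(\<lambda>n. dspos (real n) s) \<longlonglongrightarrow> (if s > 0 then 1 else 0)"
proof (cases "s > 0")
  case True
  have "(\<lambda>n. exp (- (1 / s) * inverse (real n)) * (1 + (1 / s) * inverse (real n))) \<longlonglongrightarrow> exp (- (1 / s) * 0) * (1 + (1 / s) * 0)"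
    by (intro tendsto_intros lim_inverse_n)
  moreover have "\<forall>\<^sub>F n in sequentially. exp (- (1 / s) * inverse (real n)) * (1 + (1 / s) * inverse (real n)) = dspos (real n) s"
    using eventually_gt_at_top[of 0]
    by eventually_elim (use True in \<open>simp add: dspos_def flat_def field_simps power2_eq_square\<close>)
  ultimately show ?thesis
    using True Lim_transform_eventually by fastforce
next
  case False
  then have "real n * s \<le> 0" for n by (simp add: mult_nonneg_nonpos)
  then show ?thesis using False by (simp add: dspos_def)
qed

text \<open>Dominated convergence along \<open>c = n\<close>. The limit of \<open>dspos\<close> at 0
  is 0, which decides that the gradient of the positive part is 0 where \<open>f\<close>
  vanishes.\<close>

lemma sob_pos_part:
  assumes o: "open \<Omega>" and f: "sob \<Omega> f G"
  shows "sob \<Omega> (\<lambda>x. max (f x) 0) (\<lambda>x. if f x > 0 then G x else 0)"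
proof -
  let ?M = "lebesgue_on \<Omega>"
  note L = sobD[OF f]
  note [measurable] = L2_measurable[OF L(1)] L2_measurable[OF L(2)]
  show ?thesis
  proof (rule sob_limit[OF o sob_spos[OF o f]])
    show "L2 ?M (\<lambda>x. max (f x) 0)" by (rule L2_bound[OF L(1), where c=1]) auto
    show "L2 ?M (\<lambda>x. if f x > 0 then G x else 0)" by (rule L2_bound[OF L(2), where c=1]) auto
    have "(\<lambda>n. LINT x|?M. (norm (max (f x) 0 - spos (real n) (f x)))\<^sup>2) \<longlonglongrightarrow> (LINT x|?M. 0)"
    proof (rule integral_dominated_convergence[where w="\<lambda>x. 4 * (norm (f x))\<^sup>2"])
      show "integrable ?M (\<lambda>x. 4 * (norm (f x))\<^sup>2)" using L2_integrable[OF L(1)] by simp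
      have "(\<lambda>n. (norm (max (f x) 0 - spos (real n) (f x)))\<^sup>2) \<longlonglongrightarrow> (norm (max (f x) 0 - max (f x) 0))\<^sup>2" for x
        by (intro tendsto_intros spos_tendsto)
      then show "AE x in ?M. (\<lambda>n. (norm (max (f x) 0 - spos (real n) (f x)))\<^sup>2) \<longlonglongrightarrow> 0" by simp
      show "AE x in ?M. norm ((norm (max (f x) 0 - spos (real n) (f x)))\<^sup>2) \<le> 4 * (norm (f x))\<^sup>2" for n
      proof (rule AE_I2)
        fix x
        have "norm (max (f x) 0 - spos (real n) (f x)) \<le> 2 * norm (f x)"
          using spos_le[of "real n" "f x"] by (auto simp: max_def)
        then have "(norm (max (f x) 0 - spos (real n) (f x)))\<^sup>2 \<le> (2 * norm (f x))\<^sup>2" by (rule power_mono) auto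
        then show "norm ((norm (max (f x) 0 - spos (real n) (f x)))\<^sup>2) \<le> 4 * (norm (f x))\<^sup>2"
          by (simp add: power_mult_distrib)
      qed
    qed measurable
    then show "(\<lambda>n. LINT x|?M. (norm (max (f x) 0 - spos (real n) (f x)))\<^sup>2) \<longlonglongrightarrow> 0" by simp
    have "(\<lambda>n. LINT x|?M. (norm ((if f x > 0 then G x else 0) - dspos (real n) (f x) *\<^sub>R G x))\<^sup>2) \<longlonglongrightarrow> (LINT x|?M. 0)"
    proof (rule integral_dominated_convergence[where w="\<lambda>x. (norm (G x))\<^sup>2"])
      show "integrable ?M (\<lambda>x. (norm (G x))\<^sup>2)" using L2_integrable[OF L(2)] by simp
      have "(\<lambda>n. (norm ((if f x > 0 then G x else 0) - dspos (real n) (f x) *\<^sub>R G x))\<^sup>2) \<longlonglongrightarrow>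
         (norm ((if f x > 0 then G x else 0) - (if f x > 0 then 1 else 0) *\<^sub>R G x))\<^sup>2" for x
        by (intro tendsto_intros dspos_tendsto)
      moreover have "(norm ((if f x > 0 then G x else 0) - (if f x > 0 then 1 else 0) *\<^sub>R G x))\<^sup>2 = 0" for x
        by simp
      ultimately have "(\<lambda>n. (norm ((if f x > 0 then G x else 0) - dspos (real n) (f x) *\<^sub>R G x))\<^sup>2) \<longlonglongrightarrow> 0" for x
        by (simp only:)
      then show "AE x in ?M. (\<lambda>n. (norm ((if f x > 0 then G x else 0) - dspos (real n) (f x) *\<^sub>R G x))\<^sup>2) \<longlonglongrightarrow> 0"
        by (intro AE_I2)
      show "AE x in ?M. norm ((norm ((if f x > 0 then G x else 0) - dspos (real n) (f x) *\<^sub>R G x))\<^sup>2) \<le> (norm (G x))\<^sup>2" for n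
      proof (rule AE_I2)
        fix x
        have "(if f x > 0 then G x else 0) - dspos (real n) (f x) *\<^sub>R G x = ((if f x > 0 then 1 else 0) - dspos (real n) (f x)) *\<^sub>R G x"
          by (simp add: scaleR_diff_left)
        moreover have "\<bar>(if f x > 0 then 1 else 0) - dspos (real n) (f x)\<bar> \<le> 1"
          using dspos_bounds[of "real n" "f x"] by auto
        ultimately have "norm ((if f x > 0 then G x else 0) - dspos (real n) (f x) *\<^sub>R G x) \<le> norm (G x)"
          by (simp add: mult_left_le_one_le del: scaleR_diff_left)
        then show "norm ((norm ((if f x > 0 then G x else 0) - dspos (real n) (f x) *\<^sub>R G x))\<^sup>2) \<le> (norm (G x))\<^sup>2"
          by (simp add: power_mono)
      qed
    qed measurable
    then show "(\<lambda>n. LINT x|?M. (norm ((if f x > 0 then G x else 0) - dspos (real n) (f x) *\<^sub>R G x))\<^sup>2) \<longlonglongrightarrow> 0" by simp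
  qed auto
qed

lemma sob_gradient_unique:
  assumes o: "open \<Omega>" and "sob \<Omega> f G" "sob \<Omega> f H"
  shows "AE x in lebesgue_on \<Omega>. G x = H x"
  using weak_gradient_unique[OF o sob_weak sob_weak] assms by blast

text \<open>Write \<open>f\<close> as the difference of its positive and negative parts; the
  resulting gradient is 0 where \<open>f = 0\<close>, and gradients are unique almost
  everywhere.\<close>

lemma sob_gradient_zero:
  assumes o: "open \<Omega>" and f: "sob \<Omega> f G"
  shows "AE x in lebesgue_on \<Omega>. f x = 0 \<longrightarrow> G x = 0"
proof -
  have "sob \<Omega> (\<lambda>x. max (f x) 0 - max (- f x) 0) (\<lambda>x. (if f x > 0 then G x else 0) - (if - f x > 0 then - G x else 0))"
    by (intro sob_diff[OF o] sob_pos_part[OF o] sob_minus[OF o] f)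
  moreover have "(\<lambda>x. max (f x) 0 - max (- f x) 0) = f" by (auto simp: max_def)
  ultimately have "sob \<Omega> f (\<lambda>x. (if f x > 0 then G x else 0) - (if - f x > 0 then - G x else 0))" by simp
  from sob_gradient_unique[OF o f this] show ?thesis
    by eventually_elim auto
qed

section \<open>Competitors\<close>

text \<open>A nonempty open set is not negligible. With the continuity of \<open>u\<close> this
  upgrades the almost everywhere constraints to every point of \<open>\<Omega>\<close>.\<close>

lemma AE_imp_all_open:
  fixes \<Omega> :: "(real^'n::finite) set"
  assumes "open \<Omega>" "open S" "S \<subseteq> \<Omega>" "AE x in lebesgue_on \<Omega>. x \<notin> S"
  shows "S = {}"
proof -
  have "AE x in lebesgue. x \<in> \<Omega> \<longrightarrow> x \<notin> S"
    using assms(1,4) by (subst (asm) AE_restrict_space_iff) auto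
  then have "AE x in lebesgue. x \<notin> S" by eventually_elim (use assms in blast)
  then have "negligible S"
    using assms(2) AE_iff_null_sets[of S lebesgue] by (simp add: negligible_iff_null_sets)
  then show ?thesis using assms(2) open_not_negligible by blast
qed

lemma Sigma_k_iff: "\<xi> \<in> Sigma_k \<longleftrightarrow> (\<forall>i j. i \<noteq> j \<longrightarrow> \<xi> $ i * \<xi> $ j = 0)"
proof -
  have "(\<Sum>(i,j)\<in>{(i,j). i \<noteq> j}. (\<xi> $ i)\<^sup>2 * (\<xi> $ j)\<^sup>2) = 0 \<longleftrightarrow>
      (\<forall>p\<in>{(i,j). i \<noteq> j}. (case p of (i, j) \<Rightarrow> (\<xi> $ i)\<^sup>2 * (\<xi> $ j)\<^sup>2) = 0)"
    by (rule sum_nonneg_eq_0_iff) auto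
  then show ?thesis by (auto simp: Sigma_k_def)
qed

lemma energy_sob:
  fixes w :: "real^'n::finite \<Rightarrow> real^'k::finite"
  assumes o: "open \<Omega>" and s: "\<And>i. sob \<Omega> (\<lambda>x. w x $ i) (H i)"
  shows "energy \<Omega> w = (\<Sum>i\<in>UNIV. LINT x|lebesgue_on \<Omega>. (norm (H i x))\<^sup>2)"
proof -
  let ?W = "\<lambda>i. weak_gradient \<Omega> (\<lambda>y. w y $ i)"
  have ae: "AE x in lebesgue_on \<Omega>. ?W i x = H i x" for i
    by (rule weak_gradient_AE[OF o sob_weak[OF o s]])
  have m: "?W i \<in> borel_measurable (lebesgue_on \<Omega>)" for i
    by (rule weak_gradient_borel[OF o sob_weak[OF o s]])
  have L: "L2 (lebesgue_on \<Omega>) (?W i)" for i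
    by (rule L2_cong_AE[OF sobD(2)[OF s] _ m]) (use ae[of i] in \<open>auto elim: eventually_mono\<close>)
  have "energy \<Omega> w = (\<Sum>i\<in>UNIV. LINT x|lebesgue_on \<Omega>. (norm (?W i x))\<^sup>2)"
    unfolding energy_def using L2_integrable[OF L] by (intro Bochner_Integration.integral_sum)
  also have "\<dots> = (\<Sum>i\<in>UNIV. LINT x|lebesgue_on \<Omega>. (norm (H i x))\<^sup>2)"
    by (intro sum.cong refl AE_eq_integral_norm_sq ae m L2_measurable[OF sobD(2)[OF s]])
  finally show ?thesis .
qed

text \<open>The number 6 is the slope of the chord of the convex function
  \<open>1 / (1 - e)^2\<close> over the interval from 0 to 1/2.\<close>

lemma inverse_square_bound:
  fixes m e :: real
  assumes "1 - e \<le> m" "0 \<le> e" "e \<le> 1 / 2"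
  shows "1 / m\<^sup>2 \<le> 1 + 6 * e"
proof -
  \<comment> \<open>The product is \<open>(1 + 6 e) (1 - e)^2 - 1\<close> in factored form.\<close>
  have "0 \<le> e * ((1 - 2 * e) * (4 - 3 * e))" using assms by (intro mult_nonneg_nonneg) auto
  then have "1 \<le> (1 + 6 * e) * (1 - e)\<^sup>2" by (simp add: power2_eq_square algebra_simps)
  also have "\<dots> \<le> (1 + 6 * e) * m\<^sup>2" using assms by (intro mult_left_mono power_mono) auto
  finally have *: "1 \<le> (1 + 6 * e) * m\<^sup>2" .
  have "m > 0" using assms by linarith
  then show ?thesis using * by (simp add: pos_divide_le_eq)
qed

locale segregated_minimizer =
  fixes \<Omega> :: "(real^'n::finite) set" and u :: "real^'n \<Rightarrow> real^'k::finite" and G :: "'k \<Rightarrow> real^'n \<Rightarrow> real^'n"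
  assumes open_dom: "open \<Omega>" and min: "minimizer \<Omega> u" and cont: "continuous_on \<Omega> u"
    and sob_u: "\<And>i. sob \<Omega> (\<lambda>x. u x $ i) (G i)"
begin

abbreviation "M \<equiv> lebesgue_on \<Omega>"

definition "E = (\<Sum>i\<in>UNIV. LINT x|M. (norm (G i x))\<^sup>2)"

lemma energy_u: "energy \<Omega> u = E"
  unfolding E_def by (rule energy_sob[OF open_dom sob_u])

lemma E_nonneg: "E \<ge> 0"
  unfolding E_def by (intro sum_nonneg Bochner_Integration.integral_nonneg) auto

lemma cont_nth: "continuous_on \<Omega> (\<lambda>x. u x $ i)"
  using cont by (intro continuous_intros)

lemma u_nonneg: "x \<in> \<Omega> \<Longrightarrow> 0 \<le> u x $ i"
proof -
  have "{x \<in> \<Omega>. u x $ i < 0} = {}"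
  proof (rule AE_imp_all_open[OF open_dom])
    have "open (\<Omega> \<inter> (\<lambda>x. u x $ i) -` {..<0})"
      using cont_nth open_dom by (auto intro: continuous_open_preimage)
    then show "open {x \<in> \<Omega>. u x $ i < 0}" by (simp add: Int_def vimage_def)
    have "AE x in M. \<forall>i. 0 \<le> u x $ i"
      using min unfolding minimizer_def admissible_def by blast
    then show "AE x in M. x \<notin> {x \<in> \<Omega>. u x $ i < 0}"
      by eventually_elim (auto simp: not_less)
  qed auto
  then show "x \<in> \<Omega> \<Longrightarrow> 0 \<le> u x $ i" by (auto simp: not_less[symmetric])
qed

lemma u_disjoint: "x \<in> \<Omega> \<Longrightarrow> i \<noteq> j \<Longrightarrow> u x $ i * u x $ j = 0"
proof -
  assume ij: "i \<noteq> j"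
  have "{x \<in> \<Omega>. u x $ i * u x $ j \<noteq> 0} = {}"
  proof (rule AE_imp_all_open[OF open_dom])
    have "open (\<Omega> \<inter> (\<lambda>x. u x $ i * u x $ j) -` (- {0}))"
      using open_dom by (intro continuous_open_preimage continuous_intros cont) auto
    moreover have "{x \<in> \<Omega>. u x $ i * u x $ j \<noteq> 0} = \<Omega> \<inter> (\<lambda>x. u x $ i * u x $ j) -` (- {0})" by auto
    ultimately show "open {x \<in> \<Omega>. u x $ i * u x $ j \<noteq> 0}" by (simp only:)
    have "AE x in M. u x \<in> Sigma_k"
      using min unfolding minimizer_def admissible_def H10_Sigma_def by blast
    then show "AE x in M. x \<notin> {x \<in> \<Omega>. u x $ i * u x $ j \<noteq> 0}"
      by eventually_elim (use ij in \<open>auto simp: Sigma_k_iff\<close>)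
  qed auto
  then show "x \<in> \<Omega> \<Longrightarrow> u x $ i * u x $ j = 0" by blast
qed

lemma u_other: "x \<in> \<Omega> \<Longrightarrow> u x $ i > 0 \<Longrightarrow> j \<noteq> i \<Longrightarrow> u x $ j = 0"
  using u_disjoint[of x i j] by auto

lemma u_integrable: "integrable M (\<lambda>x. u x $ i)" and u_mass: "(LINT x|M. u x $ i) = 1"
proof -
  have 1: "(LINT x|M. \<bar>u x $ i\<bar>) = 1"
    using min unfolding minimizer_def admissible_def by blast
  have e: "(LINT x|M. \<bar>u x $ i\<bar>) = (LINT x|M. u x $ i)"
    by (intro Bochner_Integration.integral_cong) (auto simp: u_nonneg)
  show "(LINT x|M. u x $ i) = 1" using 1 e by simp
  \<comment> \<open>A function that is not integrable has integral 0 by convention, so the value 1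
    forces integrability.\<close>
  then show "integrable M (\<lambda>x. u x $ i)" using not_integrable_integral_eq by fastforce
qed

text \<open>Dividing each component by its mass restores the constraint, preserves sign and
  disjointness, and divides the energy of the component by the square of its mass.\<close>

lemma competitor:
  fixes v :: "'k \<Rightarrow> real^'n \<Rightarrow> real"
  assumes s: "\<And>i. sob \<Omega> (v i) (H i)" and nn: "\<And>i x. x \<in> \<Omega> \<Longrightarrow> 0 \<le> v i x"
    and disj: "\<And>i j x. x \<in> \<Omega> \<Longrightarrow> i \<noteq> j \<Longrightarrow> v i x * v j x = 0"
    and m: "\<And>i. (LINT x|M. v i x) > 0"
  shows "E \<le> (\<Sum>i\<in>UNIV. (LINT x|M. (norm (H i x))\<^sup>2) / (LINT x|M. v i x)\<^sup>2)"
proof -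
  define w where "w x = (\<chi> i. (1 / (LINT y|M. v i y)) * v i x)" for x
  have sw: "sob \<Omega> (\<lambda>x. w x $ i) (\<lambda>x. (1 / (LINT x|M. v i x)) *\<^sub>R H i x)" for i
    unfolding w_def by (simp only: vec_lambda_beta) (rule sob_cmult[OF open_dom s])
  have wn: "0 \<le> w x $ i" if "x \<in> \<Omega>" for x i
    using nn[OF that, of i] m[of i] by (simp add: w_def)
  have adm: "w \<in> admissible \<Omega>"
    unfolding admissible_def H10_Sigma_def
  proof (intro CollectI conjI allI)
    show "(\<lambda>x. w x $ i) \<in> H10 \<Omega>" for i by (rule sob_imp_H10[OF open_dom sw])
    show "AE x in M. w x \<in> Sigma_k"
      by (rule AE_I2) (use disj in \<open>auto simp: Sigma_k_iff w_def\<close>)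
    show "AE x in M. \<forall>i. 0 \<le> w x $ i" by (rule AE_I2) (use wn in auto)
    fix i
    have "(LINT x|M. \<bar>w x $ i\<bar>) = (LINT x|M. w x $ i)"
      using wn by (intro Bochner_Integration.integral_cong) auto
    also have "\<dots> = (LINT x|M. (1 / (LINT y|M. v i y)) * v i x)"
      by (simp add: w_def)
    also have "\<dots> = 1" using m[of i] by simp
    finally show "(LINT x|M. \<bar>w x $ i\<bar>) = 1" .
  qed
  have "E \<le> energy \<Omega> w"
    using min adm energy_u unfolding minimizer_def by metis
  also have "\<dots> = (\<Sum>i\<in>UNIV. LINT x|M. (norm ((1 / (LINT x|M. v i x)) *\<^sub>R H i x))\<^sup>2)"
    by (rule energy_sob[OF open_dom sw])
  also have "\<dots> = (\<Sum>i\<in>UNIV. (LINT x|M. (norm (H i x))\<^sup>2) / (LINT x|M. v i x)\<^sup>2)"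
    by (intro sum.cong refl) (simp add: power_mult_distrib power_divide)
  finally show ?thesis .
qed

text \<open>All masses deviate from 1 by at most the same \<open>e\<close>, so one factor
  \<open>1 + 6 * e\<close> serves every component. This suffices for first variations;
  \<open>push_balance\<close> needs the component that gains mass to be treated separately.\<close>

lemma competitor_crude:
  fixes v :: "'k \<Rightarrow> real^'n \<Rightarrow> real"
  assumes s: "\<And>i. sob \<Omega> (v i) (H i)" and nn: "\<And>i x. x \<in> \<Omega> \<Longrightarrow> 0 \<le> v i x"
    and disj: "\<And>i j x. x \<in> \<Omega> \<Longrightarrow> i \<noteq> j \<Longrightarrow> v i x * v j x = 0"
    and m: "\<And>i. \<bar>(LINT x|M. v i x) - 1\<bar> \<le> e" and e: "e \<le> 1 / 2"
    and X: "(\<Sum>i\<in>UNIV. LINT x|M. (norm (H i x))\<^sup>2) \<le> E + X"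
  shows "0 \<le> X + 6 * e * (E + X)"
proof -
  have e0: "e \<ge> 0" using m[of undefined] by linarith
  have "E \<le> (\<Sum>i\<in>UNIV. (LINT x|M. (norm (H i x))\<^sup>2) / (LINT x|M. v i x)\<^sup>2)"
  proof (rule competitor[OF s nn disj])
    show "(LINT x|M. v i x) > 0" for i using m[of i] e by linarith
  qed
  also have "\<dots> \<le> (\<Sum>i\<in>UNIV. (LINT x|M. (norm (H i x))\<^sup>2) * (1 + 6 * e))"
  proof (rule sum_mono)
    fix i
    have "1 / (LINT x|M. v i x)\<^sup>2 \<le> 1 + 6 * e"
      by (rule inverse_square_bound) (use m[of i] e e0 in auto)
    then have "(LINT x|M. (norm (H i x))\<^sup>2) * (1 / (LINT x|M. v i x)\<^sup>2) \<le> (LINT x|M. (norm (H i x))\<^sup>2) * (1 + 6 * e)"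
      by (intro mult_left_mono Bochner_Integration.integral_nonneg) auto
    then show "(LINT x|M. (norm (H i x))\<^sup>2) / (LINT x|M. v i x)\<^sup>2 \<le> (LINT x|M. (norm (H i x))\<^sup>2) * (1 + 6 * e)"
      by simp
  qed
  also have "\<dots> = (1 + 6 * e) * (\<Sum>i\<in>UNIV. LINT x|M. (norm (H i x))\<^sup>2)"
    by (simp add: sum_distrib_left mult.commute)
  also have "\<dots> \<le> (1 + 6 * e) * (E + X)" using X e0 by (intro mult_left_mono) auto
  finally show ?thesis by (simp add: algebra_simps)
qed

text \<open>Apply the crude comparison with \<open>e = t * I\<close>, divide by \<open>t\<close> and
  let \<open>t\<close> tend to 0: what remains is \<open>0 <= 2 * Y + 6 * I * E\<close>.\<close>

lemma first_variation:
  fixes v :: "real \<Rightarrow> 'k \<Rightarrow> real^'n \<Rightarrow> real"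
  assumes s: "\<And>t i. 0 < t \<Longrightarrow> t < 1 \<Longrightarrow> sob \<Omega> (v t i) (H t i)"
    and nn: "\<And>t i x. 0 < t \<Longrightarrow> t < 1 \<Longrightarrow> x \<in> \<Omega> \<Longrightarrow> 0 \<le> v t i x"
    and disj: "\<And>t i j x. 0 < t \<Longrightarrow> t < 1 \<Longrightarrow> x \<in> \<Omega> \<Longrightarrow> i \<noteq> j \<Longrightarrow> v t i x * v t j x = 0"
    and m: "\<And>t i. 0 < t \<Longrightarrow> t < 1 \<Longrightarrow> \<bar>(LINT x|M. v t i x) - 1\<bar> \<le> t * I"
    and X: "\<And>t. 0 < t \<Longrightarrow> t < 1 \<Longrightarrow> (\<Sum>i\<in>UNIV. LINT x|M. (norm (H t i x))\<^sup>2) \<le> E + (2 * t * Y + t\<^sup>2 * Z)"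
    and I: "I \<ge> 0"
  shows "- 3 * E * I \<le> Y"
proof -
  \<comment> \<open>The threshold for \<open>t\<close> keeps \<open>t * I\<close> below 1/2 and
    \<open>t\<close> below 1.\<close>
  have "0 \<le> 2 * Y + t * Z + 6 * I * (E + (2 * t * Y + t\<^sup>2 * Z))" if t: "0 < t" "t < 1 / (2 * I + 2)" for t
  proof -
    have 2: "t * (2 * I + 2) < 1" using t I by (simp add: field_simps)
    have 3: "t * (2 * I + 2) = 2 * (t * I) + 2 * t" by (simp add: algebra_simps)
    have "0 \<le> t * I" using t I by simp
    then have "t * I \<le> 1 / 2" "t < 1"
      using 2 t(1) unfolding 3 by linarith+
    then have "0 \<le> (2 * t * Y + t\<^sup>2 * Z) + 6 * (t * I) * (E + (2 * t * Y + t\<^sup>2 * Z))"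
      using t by (intro competitor_crude[where v="v t" and H="H t"] s nn disj m X)
    also have "\<dots> = t * (2 * Y + t * Z + 6 * I * (E + (2 * t * Y + t\<^sup>2 * Z)))"
      by (simp add: algebra_simps power2_eq_square)
    finally show ?thesis using t by (simp add: zero_le_mult_iff)
  qed
  moreover have "1 / (2 * I + 2) > 0" using I by simp
  ultimately have "\<forall>\<^sub>F t in at_right 0. 0 \<le> 2 * Y + t * Z + 6 * I * (E + (2 * t * Y + t\<^sup>2 * Z))"
    unfolding eventually_at_right_field by blast
  moreover have "((\<lambda>t. 2 * Y + t * Z + 6 * I * (E + (2 * t * Y + t\<^sup>2 * Z))) \<longlongrightarrow> 2 * Y + 0 * Z + 6 * I * (E + (2 * 0 * Y + 0\<^sup>2 * Z))) (at_right 0)"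
    by (intro tendsto_intros)
  ultimately have "0 \<le> 2 * Y + 0 * Z + 6 * I * (E + (2 * 0 * Y + 0\<^sup>2 * Z))"
    by (intro tendsto_lowerbound[where F="at_right (0::real)"]) auto
  then show ?thesis by (simp add: algebra_simps)
qed

lemma gradient_support: "AE x in M. \<forall>i. u x $ i = 0 \<longrightarrow> G i x = 0"
  using sob_gradient_zero[OF open_dom sob_u] by (simp add: AE_all_countable)

lemma L2_u: "L2 M (\<lambda>x. u x $ i)" and L2_G: "L2 M (G i)"
  using sobD[OF sob_u] by auto

text \<open>A signed coordinate on the tree: branch \<open>i\<close> is the positive half-line and
  all other branches are folded onto the negative one. A motion towards the end of branch
  \<open>i\<close> increases it at unit speed.\<close>

definition "hat i x = u x $ i - (\<Sum>j\<in>UNIV - {i}. u x $ j)"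
definition "Ghat i x = G i x - (\<Sum>j\<in>UNIV - {i}. G j x)"

lemma sob_hat: "sob \<Omega> (hat i) (Ghat i)"
  unfolding hat_def[abs_def] Ghat_def[abs_def]
  by (intro sob_diff[OF open_dom] sob_sum[OF open_dom] sob_u)

lemma hat_pos: "x \<in> \<Omega> \<Longrightarrow> u x $ i > 0 \<Longrightarrow> hat i x = u x $ i"
  unfolding hat_def using u_other[of x i] by (simp add: sum.neutral)

lemma hat_neg: "x \<in> \<Omega> \<Longrightarrow> u x $ j > 0 \<Longrightarrow> j \<noteq> i \<Longrightarrow> hat i x = - (u x $ j)"
proof -
  assume x: "x \<in> \<Omega>" "u x $ j > 0" "j \<noteq> i"
  have "(\<Sum>l\<in>UNIV - {i}. u x $ l) = (\<Sum>l\<in>{j}. u x $ l)"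
    using x u_other[of x j] by (intro sum.mono_neutral_right) auto
  then show "hat i x = - (u x $ j)"
    unfolding hat_def using x u_other[of x j i] by simp
qed

lemma hat_zero: "(\<And>j. u x $ j = 0) \<Longrightarrow> hat i x = 0"
  by (simp add: hat_def)

lemma u_cases:
  assumes "x \<in> \<Omega>"
  obtains (zero) "\<And>j. u x $ j = 0" | (branch) a where "u x $ a > 0" "\<And>j. j \<noteq> a \<Longrightarrow> u x $ j = 0"
proof (cases "\<exists>a. u x $ a > 0")
  case True
  then show ?thesis using branch u_other[OF assms] by blast
next
  case False
  then have "\<And>j. u x $ j = 0" using u_nonneg[OF assms] by (meson antisym not_less)
  then show ?thesis by (rule zero)
qed

lemma Ghat_branch:
  assumes "\<And>j. j \<noteq> a \<Longrightarrow> G j x = 0"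
  shows "Ghat i x = (if i = a then G a x else - G a x)"
proof (cases "i = a")
  case True
  then show ?thesis using assms by (simp add: Ghat_def sum.neutral)
next
  case False
  have "(\<Sum>l\<in>UNIV - {i}. G l x) = (\<Sum>l\<in>{a}. G l x)"
    using False assms by (intro sum.mono_neutral_right) auto
  then show ?thesis using False assms by (simp add: Ghat_def)
qed

text \<open>Folding is an isometry on each branch, and almost everywhere at most one
  \<open>G j\<close> is nonzero, so the folded coordinate carries the whole energy.\<close>

lemma integral_Ghat: "(LINT x|M. (norm (Ghat i x))\<^sup>2) = E"
proof -
  have "AE x in M. (norm (Ghat i x))\<^sup>2 = (\<Sum>j\<in>UNIV. (norm (G j x))\<^sup>2)"
    using gradient_support AE_space
  proof eventually_elim
    case (elim x)
    then have "x \<in> \<Omega>" by simp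
    then show ?case
    proof (cases rule: u_cases)
      case zero
      then show ?thesis using elim by (simp add: Ghat_def)
    next
      case (branch a)
      have G0: "\<And>j. j \<noteq> a \<Longrightarrow> G j x = 0" using elim branch by blast
      have "(\<Sum>j\<in>UNIV. (norm (G j x))\<^sup>2) = (\<Sum>j\<in>{a}. (norm (G j x))\<^sup>2)"
        using G0 by (intro sum.mono_neutral_right) auto
      then show ?thesis using Ghat_branch[OF G0] by simp
    qed
  qed
  moreover have "Ghat i \<in> borel_measurable M" using sobD(2)[OF sob_hat] by (rule L2_measurable)
  moreover have "integrable M (\<lambda>x. \<Sum>j\<in>UNIV. (norm (G j x))\<^sup>2)"
    using L2_integrable[OF L2_G] by (intro Bochner_Integration.integrable_sum)
  ultimately have "(LINT x|M. (norm (Ghat i x))\<^sup>2) = (LINT x|M. (\<Sum>j\<in>UNIV. (norm (G j x))\<^sup>2))"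
    by (intro integral_cong_AE) auto
  also have "\<dots> = E"
    unfolding E_def using L2_integrable[OF L2_G] by (intro Bochner_Integration.integral_sum)
  finally show ?thesis .
qed

end

section \<open>First variations\<close>

lemma L2_norm_sq_expand:
  fixes a b :: "'a \<Rightarrow> 'b::euclidean_space"
  assumes a: "L2 M a" and b: "L2 M b"
  shows "(LINT x|M. (norm (a x + t *\<^sub>R b x))\<^sup>2) =
    (LINT x|M. (norm (a x))\<^sup>2) + 2 * t * (LINT x|M. a x \<bullet> b x) + t\<^sup>2 * (LINT x|M. (norm (b x))\<^sup>2)"
proof -
  have "(norm (a x + t *\<^sub>R b x))\<^sup>2 = (norm (a x))\<^sup>2 + 2 * t * (a x \<bullet> b x) + t\<^sup>2 * (norm (b x))\<^sup>2" for x
    unfolding power2_norm_eq_inner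
    by (simp add: inner_add_left inner_add_right inner_commute algebra_simps power2_eq_square)
  then show ?thesis
    using L2_integrable[OF a] L2_integrable[OF b] L2_inner_integrable[OF a b] by simp
qed

lemma sob_laplacian:
  assumes o: "open \<Omega>" and f: "sob \<Omega> f G" and \<phi>: "\<phi> \<in> test_functions \<Omega>"
  shows "(LINT x|lebesgue_on \<Omega>. G x \<bullet> gradient \<phi> x) = - (LINT x|lebesgue_on \<Omega>. f x * laplacian \<phi> x)"
proof -
  let ?M = "lebesgue_on \<Omega>"
  note t = test_partial_deriv[OF \<phi>]
  note L = sobD[OF f] test_L2(1)[OF o t] test_L2(1)[OF o test_partial_deriv[OF t]]
  have "(LINT x|?M. G x \<bullet> gradient \<phi> x) = (LINT x|?M. (\<Sum>i\<in>UNIV. G x $ i * partial_deriv i \<phi> x))"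
    by (simp add: inner_vec_def)
  also have "\<dots> = (\<Sum>i\<in>UNIV. LINT x|?M. G x $ i * partial_deriv i \<phi> x)"
    by (intro Bochner_Integration.integral_sum L2_mult_integrable L2_nth L)
  also have "\<dots> = (\<Sum>i\<in>UNIV. - (LINT x|?M. f x * partial_deriv i (partial_deriv i \<phi>) x))"
    using sob_by_parts[OF o f sob_test[OF o t]] by simp
  also have "\<dots> = - (LINT x|?M. (\<Sum>i\<in>UNIV. f x * partial_deriv i (partial_deriv i \<phi>) x))"
    by (subst Bochner_Integration.integral_sum) (intro L2_mult_integrable L, simp add: sum_negf)
  finally show ?thesis by (simp add: laplacian_def sum_distrib_left)
qed

text \<open>Formally the left side pairs half the gradient of \<open>f^2\<close> with that of
  \<open>\<eta>\<close>. As \<open>f^2\<close> itself need not be a Sobolev function in the sense of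
  \<open>sob\<close>, the integration by parts is done with the two factors \<open>f\<close> and
  \<open>partial_deriv i \<eta> * f\<close>.\<close>

lemma sob_laplacian_square:
  assumes o: "open \<Omega>" and f: "sob \<Omega> f G" and \<eta>: "\<eta> \<in> test_functions \<Omega>"
  shows "(LINT x|lebesgue_on \<Omega>. G x \<bullet> (f x *\<^sub>R gradient \<eta> x)) = - (1/2) * (LINT x|lebesgue_on \<Omega>. (f x)\<^sup>2 * laplacian \<eta> x)"
proof -
  let ?M = "lebesgue_on \<Omega>"
  note t = test_partial_deriv[OF \<eta>]
  note tt = test_partial_deriv[OF t]
  have m: "L2 ?M (\<lambda>x. \<psi> x * h x)" if \<psi>: "\<psi> \<in> test_functions \<Omega>" and h: "L2 ?M h" for \<psi> and h :: "real^'a \<Rightarrow> real"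
  proof -
    obtain B where B: "B \<ge> 0" "\<And>x. \<bar>\<psi> x\<bar> \<le> B" using test_bounded[OF \<psi>] by blast
    show ?thesis
      using B L2_measurable[OF h] borel_imp_lebesgue_on[OF test_borel[OF \<psi>]]
      by (intro L2_bound[OF h, where c=B]) (auto simp: abs_mult intro!: mult_right_mono)
  qed
  have i1: "integrable ?M (\<lambda>x. f x * (partial_deriv i \<eta> x * G x $ i))" for i
    by (intro L2_mult_integrable m[OF t] L2_nth sobD[OF f])
  have i2: "integrable ?M (\<lambda>x. f x * (partial_deriv i (partial_deriv i \<eta>) x * f x))" for i
    by (intro L2_mult_integrable m[OF tt] L2_nth sobD[OF f])
  have key: "(LINT x|?M. f x * (partial_deriv i \<eta> x * G x $ i)) = - (1/2) * (LINT x|?M. f x * (partial_deriv i (partial_deriv i \<eta>) x * f x))" for i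
  proof -
    have "(LINT x|?M. f x * (partial_deriv i \<eta> x *\<^sub>R G x + f x *\<^sub>R gradient (partial_deriv i \<eta>) x) $ i)
        = - (LINT x|?M. G x $ i * (partial_deriv i \<eta> x * f x))"
      by (rule sob_by_parts[OF o f sob_mult_test[OF o f t]])
    moreover have "(LINT x|?M. f x * (partial_deriv i \<eta> x *\<^sub>R G x + f x *\<^sub>R gradient (partial_deriv i \<eta>) x) $ i)
      = (LINT x|?M. f x * (partial_deriv i \<eta> x * G x $ i)) + (LINT x|?M. f x * (partial_deriv i (partial_deriv i \<eta>) x * f x))"
      by (subst Bochner_Integration.integral_add[OF i1 i2, symmetric]) (simp add: algebra_simps)
    moreover have "(LINT x|?M. G x $ i * (partial_deriv i \<eta> x * f x)) = (LINT x|?M. f x * (partial_deriv i \<eta> x * G x $ i))"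
      by (intro Bochner_Integration.integral_cong) auto
    ultimately show ?thesis by simp
  qed
  have "(LINT x|?M. G x \<bullet> (f x *\<^sub>R gradient \<eta> x)) = (LINT x|?M. (\<Sum>i\<in>UNIV. f x * (partial_deriv i \<eta> x * G x $ i)))"
    by (intro Bochner_Integration.integral_cong refl) (simp add: inner_vec_def sum_distrib_left mult_ac)
  also have "\<dots> = (\<Sum>i\<in>UNIV. LINT x|?M. f x * (partial_deriv i \<eta> x * G x $ i))"
    by (rule Bochner_Integration.integral_sum[OF i1])
  also have "\<dots> = - (1/2) * (\<Sum>i\<in>UNIV. LINT x|?M. f x * (partial_deriv i (partial_deriv i \<eta>) x * f x))"
    unfolding key sum_distrib_left[symmetric] ..
  also have "(\<Sum>i\<in>UNIV. LINT x|?M. f x * (partial_deriv i (partial_deriv i \<eta>) x * f x))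
      = (LINT x|?M. (\<Sum>i\<in>UNIV. f x * (partial_deriv i (partial_deriv i \<eta>) x * f x)))"
    by (rule Bochner_Integration.integral_sum[OF i2, symmetric])
  also have "\<dots> = (LINT x|?M. (f x)\<^sup>2 * laplacian \<eta> x)"
    by (intro Bochner_Integration.integral_cong refl)
       (simp add: laplacian_def sum_distrib_left power2_eq_square mult_ac)
  finally show ?thesis .
qed

lemma test_integrable_on: "open \<Omega> \<Longrightarrow> \<phi> \<in> test_functions \<Omega> \<Longrightarrow> integrable (lebesgue_on \<Omega>) \<phi>"
  using lebesgue_on_test(1)[of \<Omega> \<phi>] test_integrable test_borel test_outside by blast

context segregated_minimizer
begin

text \<open>An inequality for \<open>W\<close> rather than an equation admits competitors cut off at
  0, whose gradient is \<open>G i + t D\<close> in one place and 0 in another.\<close>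

lemma replace_one_energy:
  assumes w: "L2 M W" and le: "AE x in M. norm (W x) \<le> norm (G i x + t *\<^sub>R D x)" and D: "L2 M D"
  shows "(\<Sum>j\<in>UNIV. LINT x|M. (norm (if j = i then W x else G j x))\<^sup>2)
    \<le> E + (2 * t * (LINT x|M. G i x \<bullet> D x) + t\<^sup>2 * (LINT x|M. (norm (D x))\<^sup>2))"
proof -
  have "(\<Sum>j\<in>UNIV. LINT x|M. (norm (if j = i then W x else G j x))\<^sup>2)
      = (LINT x|M. (norm (W x))\<^sup>2) + (\<Sum>j\<in>UNIV - {i}. LINT x|M. (norm (G j x))\<^sup>2)"
    by (subst sum.remove[of UNIV i]) (auto intro!: sum.cong)
  moreover have "E = (LINT x|M. (norm (G i x))\<^sup>2) + (\<Sum>j\<in>UNIV - {i}. LINT x|M. (norm (G j x))\<^sup>2)"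
    unfolding E_def by (subst sum.remove[of UNIV i]) auto
  moreover have "(LINT x|M. (norm (W x))\<^sup>2) \<le> (LINT x|M. (norm (G i x + t *\<^sub>R D x))\<^sup>2)"
    using le by (intro integral_mono_AE L2_integrable w L2_add L2_G L2_scaleR D)
       (auto elim!: eventually_mono intro: power_mono)
  ultimately show ?thesis using L2_norm_sq_expand[OF L2_G D, of i t] by simp
qed

lemma mass_change:
  assumes v: "L2 M w" and i: "integrable M d" and le: "\<And>x. x \<in> \<Omega> \<Longrightarrow> \<bar>w x - u x $ j\<bar> \<le> d x"
  shows "integrable M w" "(LINT x|M. w x) - 1 = (LINT x|M. w x - u x $ j)" "\<bar>(LINT x|M. w x) - 1\<bar> \<le> (LINT x|M. d x)"
    "integrable M (\<lambda>x. w x - u x $ j)"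
proof -
  show id: "integrable M (\<lambda>x. w x - u x $ j)"
  proof (rule Bochner_Integration.integrable_bound[OF i])
    show "(\<lambda>x. w x - u x $ j) \<in> borel_measurable M"
      by (intro borel_measurable_diff L2_measurable v L2_u)
    show "AE x in M. norm (w x - u x $ j) \<le> norm (d x)"
      using le by (intro AE_I2) fastforce
  qed
  have "integrable M (\<lambda>x. (w x - u x $ j) + u x $ j)"
    by (rule Bochner_Integration.integrable_add[OF id u_integrable])
  then show w: "integrable M w" by simp
  then show e: "(LINT x|M. w x) - 1 = (LINT x|M. w x - u x $ j)"
    using u_integrable[of j] u_mass[of j] by simp
  have "\<bar>LINT x|M. w x - u x $ j\<bar> \<le> (LINT x|M. \<bar>w x - u x $ j\<bar>)" by (rule integral_abs_bound)
  also have "\<dots> \<le> (LINT x|M. d x)"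
    by (rule integral_mono[OF integrable_abs[OF id] i]) (use le in auto)
  finally show "\<bar>(LINT x|M. w x) - 1\<bar> \<le> (LINT x|M. d x)" using e by simp
qed

text \<open>Retracting the component \<open>i\<close> towards the origin of the tree: it is a subsolution.\<close>

lemma subsolution_gradient:
  assumes \<phi>: "\<phi> \<in> test_functions \<Omega>" and pos: "\<And>x. \<phi> x \<ge> 0"
  shows "(LINT x|M. G i x \<bullet> gradient \<phi> x) \<le> 3 * E * (LINT x|M. \<phi> x)"
proof -
  have L\<phi>: "L2 M (gradient \<phi>)" by (rule test_L2(2)[OF open_dom \<phi>])
  define D where "D x = - gradient \<phi> x" for x
  have D: "L2 M D" unfolding D_def by (rule L2_minus[OF L\<phi>])
  define v where "v t j x = (if j = i then max (u x $ i - t * \<phi> x) 0 else u x $ j)" for t j x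
  define W where "W t x = (if u x $ i - t * \<phi> x > 0 then G i x - t *\<^sub>R gradient \<phi> x else 0)" for t x
  have sW: "sob \<Omega> (\<lambda>x. max (u x $ i - t * \<phi> x) 0) (W t)" for t
    unfolding W_def[abs_def]
    by (intro sob_pos_part[OF open_dom] sob_diff[OF open_dom] sob_u sob_cmult[OF open_dom] sob_test[OF open_dom \<phi>])
  have sv: "sob \<Omega> (v t j) (\<lambda>x. if j = i then W t x else G j x)" for t j
    unfolding v_def[abs_def] using sW sob_u by (cases "j = i") auto
  have "- 3 * E * (LINT x|M. \<phi> x) \<le> (LINT x|M. G i x \<bullet> D x)"
  proof (rule first_variation[where v=v and H="\<lambda>t j x. if j = i then W t x else G j x" and Z="LINT x|M. (norm (D x))\<^sup>2"])
    show "sob \<Omega> (v t j) (\<lambda>x. if j = i then W t x else G j x)" for t j by (rule sv)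
    fix t :: real assume t: "0 < t" "t < 1"
    show "0 \<le> v t j x" if "x \<in> \<Omega>" for j x using u_nonneg[OF that] by (simp add: v_def)
    show "v t j x * v t l x = 0" if "x \<in> \<Omega>" "j \<noteq> l" for j l x
    proof -
      \<comment> \<open>A component of the competitor can be positive only where the same component
        of \<open>u\<close> is, so disjointness is inherited.\<close>
      have "v t j x = 0 \<or> u x $ j > 0" for j
        using u_nonneg[OF that(1), of j] u_nonneg[OF that(1), of i] pos[of x] t mult_nonneg_nonneg[of t "\<phi> x"]
        by (auto simp: v_def max_def less_le)
      then show ?thesis using u_disjoint[OF that] by (metis less_irrefl mult_eq_0_iff)
    qed
    show "\<bar>(LINT x|M. v t j x) - 1\<bar> \<le> t * (LINT x|M. \<phi> x)" for j
    proof -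
      have i: "integrable M (\<lambda>x. t * \<phi> x)" using test_integrable_on[OF open_dom \<phi>] by simp
      have le: "\<bar>v t j x - u x $ j\<bar> \<le> t * \<phi> x" if "x \<in> \<Omega>" for x
        using u_nonneg[OF that, of i] pos[of x] t mult_nonneg_nonneg[of t "\<phi> x"] by (auto simp: v_def max_def)
      show ?thesis
        using mass_change(3)[OF sobD(1)[OF sv] i le] by simp
    qed
    show "(\<Sum>j\<in>UNIV. LINT x|M. (norm (if j = i then W t x else G j x))\<^sup>2)
      \<le> E + (2 * t * (LINT x|M. G i x \<bullet> D x) + t\<^sup>2 * (LINT x|M. (norm (D x))\<^sup>2))"
      by (rule replace_one_energy[OF sobD(2)[OF sW] _ D]) (auto simp: W_def D_def)
  qed (use pos in \<open>auto intro: Bochner_Integration.integral_nonneg\<close>)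
  then show ?thesis by (simp add: D_def)
qed

lemma subsolution:
  assumes \<phi>: "\<phi> \<in> test_functions \<Omega>" and pos: "\<And>x. \<phi> x \<ge> 0"
  shows "(LINT x|M. u x $ i * laplacian \<phi> x) \<ge> - 3 * E * (LINT x|M. \<phi> x)"
  using subsolution_gradient[OF assms, of i] sob_laplacian[OF open_dom sob_u \<phi>, of i] by simp

text \<open>Testing minimality with \<open>(1 - t \<eta>) u\<^sub>i\<close>.\<close>

lemma caccioppoli:
  assumes \<eta>: "\<eta> \<in> test_functions \<Omega>" and pos: "\<And>x. \<eta> x \<ge> 0" "\<And>x. \<eta> x \<le> 1"
  shows "(LINT x|M. \<eta> x * (norm (G i x))\<^sup>2) \<le> 1/2 * (LINT x|M. (u x $ i)\<^sup>2 * laplacian \<eta> x) + 3 * E * (LINT x|M. \<eta> x * u x $ i)"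
proof -
  define D where "D x = - (\<eta> x *\<^sub>R G i x + u x $ i *\<^sub>R gradient \<eta> x)" for x
  have s\<eta>: "sob \<Omega> (\<lambda>x. \<eta> x * u x $ i) (\<lambda>x. \<eta> x *\<^sub>R G i x + u x $ i *\<^sub>R gradient \<eta> x)"
    by (rule sob_mult_test[OF open_dom sob_u \<eta>])
  have D: "L2 M D" unfolding D_def by (rule L2_minus[OF sobD(2)[OF s\<eta>]])
  define v where "v t j x = (if j = i then u x $ i - t * (\<eta> x * u x $ i) else u x $ j)" for t j x
  define W where "W t x = G i x - t *\<^sub>R (\<eta> x *\<^sub>R G i x + u x $ i *\<^sub>R gradient \<eta> x)" for t x
  have sW: "sob \<Omega> (\<lambda>x. u x $ i - t * (\<eta> x * u x $ i)) (W t)" for t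
    unfolding W_def[abs_def]
    by (intro sob_diff[OF open_dom] sob_u sob_cmult[OF open_dom] s\<eta>)
  have i: "integrable M (\<lambda>x. \<eta> x * u x $ i)"
    by (intro L2_mult_integrable test_L2(1)[OF open_dom \<eta>] L2_u)
  have nn: "0 \<le> \<eta> x * u x $ i" "\<eta> x * u x $ i \<le> u x $ i" if "x \<in> \<Omega>" for x
    using u_nonneg[OF that, of i] pos[of x] by (auto intro: mult_left_le_one_le)
  have "- 3 * E * (LINT x|M. \<eta> x * u x $ i) \<le> (LINT x|M. G i x \<bullet> D x)"
  proof (rule first_variation[where v=v and H="\<lambda>t j x. if j = i then W t x else G j x" and Z="LINT x|M. (norm (D x))\<^sup>2"])
    show "0 \<le> (LINT x|M. \<eta> x * u x $ i)"
      using nn by (intro Bochner_Integration.integral_nonneg) auto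
    fix t :: real assume t: "0 < t" "t < 1"
    have sv: "sob \<Omega> (v t j) (\<lambda>x. if j = i then W t x else G j x)" for j
      unfolding v_def[abs_def] using sW sob_u by (cases "j = i") auto
    then show "sob \<Omega> (v t j) (\<lambda>x. if j = i then W t x else G j x)" for j .
    show "0 \<le> v t j x" if "x \<in> \<Omega>" for j x
      using u_nonneg[OF that, of j] nn[OF that] t mult_left_le_one_le[of "\<eta> x * u x $ i" t]
      by (auto simp: v_def)
    show "v t j x * v t l x = 0" if "x \<in> \<Omega>" "j \<noteq> l" for j l x
      using u_disjoint[OF that] by (auto simp: v_def)
    show "\<bar>(LINT x|M. v t j x) - 1\<bar> \<le> t * (LINT x|M. \<eta> x * u x $ i)" for j
    proof -
      have "\<bar>(LINT x|M. v t j x) - 1\<bar> \<le> (LINT x|M. t * (\<eta> x * u x $ i))"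
        using i nn t by (intro mass_change(3)[OF sobD(1)[OF sv], where j=j]) (auto simp: v_def)
      then show ?thesis by simp
    qed
    show "(\<Sum>j\<in>UNIV. LINT x|M. (norm (if j = i then W t x else G j x))\<^sup>2)
      \<le> E + (2 * t * (LINT x|M. G i x \<bullet> D x) + t\<^sup>2 * (LINT x|M. (norm (D x))\<^sup>2))"
    proof (rule replace_one_energy[OF sobD(2)[OF sW] _ D])
      have "W t x = G i x + t *\<^sub>R D x" for x by (simp add: W_def D_def algebra_simps)
      then show "AE x in M. norm (W t x) \<le> norm (G i x + t *\<^sub>R D x)" by simp
    qed
  qed
  \<comment> \<open>The mixed term is integrated by parts once more, so that the right side of the
    estimate contains \<open>u\<close> and the Laplacian of the cutoff but no gradient of
    \<open>u\<close>.\<close>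
  moreover have "(LINT x|M. G i x \<bullet> D x) = - (LINT x|M. \<eta> x * (norm (G i x))\<^sup>2) + 1/2 * (LINT x|M. (u x $ i)\<^sup>2 * laplacian \<eta> x)"
  proof -
    obtain B where B: "B \<ge> 0" "\<And>x. norm (gradient \<eta> x) \<le> B" using gradient_test_bounded[OF \<eta>] by blast
    note [measurable] = borel_imp_lebesgue_on[OF test_borel[OF \<eta>], of \<Omega>] borel_imp_lebesgue_on[OF gradient_test_borel[OF \<eta>], of \<Omega>]
      L2_measurable[OF L2_u[of i]] L2_measurable[OF L2_G[of i]]
    have 1: "L2 M (\<lambda>x. u x $ i *\<^sub>R gradient \<eta> x)"
      using B by (intro L2_bound[OF L2_u[of i], where c=B]) (auto simp: mult.commute[of B] intro!: mult_left_mono)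
    have 2: "L2 M (\<lambda>x. \<eta> x *\<^sub>R G i x)"
      using pos by (intro L2_bound[OF L2_G[of i], where c=1]) (auto intro!: mult_left_le_one_le)
    have "(LINT x|M. G i x \<bullet> D x) = (LINT x|M. - (G i x \<bullet> (\<eta> x *\<^sub>R G i x)) - G i x \<bullet> (u x $ i *\<^sub>R gradient \<eta> x))"
      by (simp add: D_def inner_diff_right inner_add_right)
    also have "\<dots> = - (LINT x|M. G i x \<bullet> (\<eta> x *\<^sub>R G i x)) - (LINT x|M. G i x \<bullet> (u x $ i *\<^sub>R gradient \<eta> x))"
      using L2_inner_integrable[OF L2_G 2, of i] L2_inner_integrable[OF L2_G 1, of i] by simp
    also have "\<dots> = - (LINT x|M. \<eta> x * (norm (G i x))\<^sup>2) + 1/2 * (LINT x|M. (u x $ i)\<^sup>2 * laplacian \<eta> x)"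
      unfolding sob_laplacian_square[OF open_dom sob_u \<eta>] by (simp add: power2_norm_eq_inner)
    finally show ?thesis .
  qed
  ultimately show ?thesis by simp
qed


lemma Ghat_norm_sq: "AE x in M. (norm (Ghat i x))\<^sup>2 = (\<Sum>j\<in>UNIV. (norm (G j x))\<^sup>2)"
  using gradient_support AE_space
proof eventually_elim
  case (elim x)
  then have "x \<in> \<Omega>" by simp
  then show ?case
  proof (cases rule: u_cases)
    case zero
    then show ?thesis using elim by (simp add: Ghat_def)
  next
    case (branch a)
    have G0: "\<And>j. j \<noteq> a \<Longrightarrow> G j x = 0" using elim branch by blast
    have "(\<Sum>j\<in>UNIV. (norm (G j x))\<^sup>2) = (\<Sum>j\<in>{a}. (norm (G j x))\<^sup>2)"
      using G0 by (intro sum.mono_neutral_right) auto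
    then show ?thesis using Ghat_branch[OF G0] by simp
  qed
qed

text \<open>The competitor that moves every point of the tree by \<open>\<phi>\<close> towards the end of the branch \<open>i\<close>.\<close>

definition push :: "'k \<Rightarrow> (real^'n \<Rightarrow> real) \<Rightarrow> 'k \<Rightarrow> real^'n \<Rightarrow> real" where
  "push i \<phi> j x = (if j = i then max (hat i x + \<phi> x) 0 else max (u x $ j - \<phi> x) 0)"

definition dpush :: "'k \<Rightarrow> (real^'n \<Rightarrow> real) \<Rightarrow> 'k \<Rightarrow> real^'n \<Rightarrow> real^'n" where
  "dpush i \<phi> j x = (if j = i then if hat i x + \<phi> x > 0 then Ghat i x + gradient \<phi> x else 0
     else if u x $ j - \<phi> x > 0 then G j x - gradient \<phi> x else 0)"

lemma sob_push:
  assumes "\<phi> \<in> test_functions \<Omega>"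
  shows "sob \<Omega> (push i \<phi> j) (dpush i \<phi> j)"
proof (cases "j = i")
  case True
  have "sob \<Omega> (\<lambda>x. max (hat i x + \<phi> x) 0) (\<lambda>x. if hat i x + \<phi> x > 0 then Ghat i x + gradient \<phi> x else 0)"
    by (intro sob_pos_part[OF open_dom] sob_add[OF open_dom] sob_hat sob_test[OF open_dom] assms)
  then show ?thesis using True by (simp add: push_def[abs_def] dpush_def[abs_def])
next
  case False
  have "sob \<Omega> (\<lambda>x. max (u x $ j - \<phi> x) 0) (\<lambda>x. if u x $ j - \<phi> x > 0 then G j x - gradient \<phi> x else 0)"
    by (intro sob_pos_part[OF open_dom] sob_diff[OF open_dom] sob_u sob_test[OF open_dom] assms)
  then show ?thesis using False by (simp add: push_def[abs_def] dpush_def[abs_def])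
qed

lemma push_nonneg: "0 \<le> push i \<phi> j x"
  by (simp add: push_def)

lemma hat_pos_part: "x \<in> \<Omega> \<Longrightarrow> max (hat i x) 0 = u x $ i"
proof -
  assume x: "x \<in> \<Omega>"
  then show ?thesis
  proof (cases rule: u_cases)
    case zero
    then show ?thesis by (simp add: hat_zero)
  next
    case (branch a)
    then show ?thesis using hat_pos[OF x, of i] hat_neg[OF x branch(1), of i] by (cases "i = a") auto
  qed
qed

lemma push_diff:
  assumes x: "x \<in> \<Omega>" and "\<phi> x \<ge> 0"
  shows "\<bar>push i \<phi> j x - u x $ j\<bar> \<le> \<phi> x"
  using assms(2) hat_pos_part[OF x, of i] u_nonneg[OF x, of j] by (auto simp: push_def max_def split: if_splits)

text \<open>On another branch, at distance \<open>s\<close> from the origin, the first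
  \<open>s\<close> units of the shift are spent on reaching the origin and only the rest is added to
  component \<open>i\<close>.\<close>

lemma push_lower:
  assumes x: "x \<in> \<Omega>"
  shows "push i \<phi> i x - u x $ i \<ge> \<phi> x - (\<Sum>j\<in>UNIV. u x $ j)"
proof -
  have "(\<Sum>j\<in>UNIV. u x $ j) = u x $ i + (\<Sum>j\<in>UNIV - {i}. u x $ j)" by (rule sum.remove) auto
  then show ?thesis using u_nonneg[OF x, of i] by (simp add: push_def hat_def)
qed

text \<open>If a branch \<open>m\<close> other than \<open>i\<close> survives the shift, then
  \<open>hat i x + \<phi> x\<close> equals \<open>\<phi> x - u x $ m\<close>, which is negative, so
  component \<open>i\<close> is 0 there.\<close>

lemma push_disjoint:
  assumes x: "x \<in> \<Omega>" and p: "\<phi> x \<ge> 0" and jl: "j \<noteq> l"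
  shows "push i \<phi> j x * push i \<phi> l x = 0"
proof -
  have i: "push i \<phi> i x * push i \<phi> m x = 0" if m: "m \<noteq> i" for m
  proof (cases "u x $ m > \<phi> x")
    case True
    then have "hat i x = - (u x $ m)" using hat_neg[OF x, of m i] p m by auto
    then show ?thesis using True by (simp add: push_def)
  next
    case False
    then show ?thesis using m by (simp add: push_def)
  qed
  show ?thesis
  proof (cases "j = i \<or> l = i")
    case True
    then show ?thesis using i[of l] i[of j] jl by (auto simp: mult.commute)
  next
    case False
    have "push i \<phi> m x = 0" if "m \<noteq> i" "u x $ m = 0" for m using that p by (simp add: push_def)
    then show ?thesis using u_disjoint[OF x jl] False by auto
  qed
qed

text \<open>At almost every point at most one component of the competitor has a nonzero gradient:
  that of the branch \<open>m\<close> with \<open>u x $ m > \<phi> x\<close>, or else that of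
  \<open>i\<close>. Its norm is at most that of \<open>Ghat i + gradient \<phi>\<close>, so a single
  quadratic expansion in the folded coordinate covers all components.\<close>

lemma push_energy:
  assumes \<phi>: "\<phi> \<in> test_functions \<Omega>" and pos: "\<And>x. \<phi> x \<ge> 0"
  shows "(\<Sum>j\<in>UNIV. LINT x|M. (norm (dpush i \<phi> j x))\<^sup>2)
    \<le> E + (2 * (LINT x|M. Ghat i x \<bullet> gradient \<phi> x) + (LINT x|M. (norm (gradient \<phi> x))\<^sup>2))"
proof -
  have L: "L2 M (dpush i \<phi> j)" for j by (rule sobD(2)[OF sob_push[OF \<phi>]])
  have Lh: "L2 M (Ghat i)" by (rule sobD(2)[OF sob_hat])
  have L\<phi>: "L2 M (gradient \<phi>)" by (rule test_L2(2)[OF open_dom \<phi>])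
  have "(\<Sum>j\<in>UNIV. LINT x|M. (norm (dpush i \<phi> j x))\<^sup>2) = (LINT x|M. (\<Sum>j\<in>UNIV. (norm (dpush i \<phi> j x))\<^sup>2))"
    using L2_integrable[OF L] by (intro Bochner_Integration.integral_sum[symmetric])
  also have "\<dots> \<le> (LINT x|M. (norm (Ghat i x + 1 *\<^sub>R gradient \<phi> x))\<^sup>2)"
  proof (rule integral_mono_AE)
    show "integrable M (\<lambda>x. \<Sum>j\<in>UNIV. (norm (dpush i \<phi> j x))\<^sup>2)"
      using L2_integrable[OF L] by (intro Bochner_Integration.integrable_sum)
    show "integrable M (\<lambda>x. (norm (Ghat i x + 1 *\<^sub>R gradient \<phi> x))\<^sup>2)"
      by (intro L2_integrable L2_add L2_scaleR Lh L\<phi>)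
    show "AE x in M. (\<Sum>j\<in>UNIV. (norm (dpush i \<phi> j x))\<^sup>2) \<le> (norm (Ghat i x + 1 *\<^sub>R gradient \<phi> x))\<^sup>2"
      using gradient_support AE_space
    proof eventually_elim
      case (elim x)
      then have x: "x \<in> \<Omega>" by simp
      have single: ?case if "\<And>j. j \<noteq> m \<Longrightarrow> dpush i \<phi> j x = 0" "norm (dpush i \<phi> m x) \<le> norm (Ghat i x + gradient \<phi> x)" for m
      proof -
        have "(\<Sum>j\<in>UNIV. (norm (dpush i \<phi> j x))\<^sup>2) = (\<Sum>j\<in>{m}. (norm (dpush i \<phi> j x))\<^sup>2)"
          using that(1) by (intro sum.mono_neutral_right) auto
        then show ?thesis using that(2) by (simp add: power_mono)
      qed
      show ?case
      proof (cases "\<exists>m. m \<noteq> i \<and> u x $ m > \<phi> x")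
        case True
        then obtain m where m: "m \<noteq> i" "u x $ m > \<phi> x" by blast
        then have um: "u x $ m > 0" using pos[of x] by simp
        have h: "hat i x = - (u x $ m)" using hat_neg[OF x um] m by auto
        have oth: "u x $ j = 0" if "j \<noteq> m" for j using u_other[OF x um that] .
        have "G j x = 0" if "j \<noteq> m" for j using elim oth[OF that] by blast
        then have "Ghat i x = - G m x" using Ghat_branch[of m x i] m by simp
        then have "norm (G m x - gradient \<phi> x) = norm (Ghat i x + gradient \<phi> x)"
          by (metis minus_diff_eq norm_minus_cancel uminus_add_conv_diff)
        then show ?thesis
          using m h oth pos[of x] by (intro single[of m]) (auto simp: dpush_def)
      next
        case False
        then show ?thesis by (intro single[of i]) (auto simp: dpush_def)
      qed
    qed
  qed
  also have "\<dots> = E + (2 * (LINT x|M. Ghat i x \<bullet> gradient \<phi> x) + (LINT x|M. (norm (gradient \<phi> x))\<^sup>2))"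
    unfolding L2_norm_sq_expand[OF Lh L\<phi>] integral_Ghat by simp
  finally show ?thesis .
qed

lemma hat_supersolution:
  assumes \<phi>: "\<phi> \<in> test_functions \<Omega>" and pos: "\<And>x. \<phi> x \<ge> 0"
  shows "(LINT x|M. hat i x * laplacian \<phi> x) \<le> 3 * E * (LINT x|M. \<phi> x)"
proof -
  have "- 3 * E * (LINT x|M. \<phi> x) \<le> (LINT x|M. Ghat i x \<bullet> gradient \<phi> x)"
  proof (rule first_variation[where v="\<lambda>t. push i (\<lambda>x. t * \<phi> x)" and H="\<lambda>t. dpush i (\<lambda>x. t * \<phi> x)" and Z="LINT x|M. (norm (gradient \<phi> x))\<^sup>2"])
    show "0 \<le> (LINT x|M. \<phi> x)" using pos by (auto intro: Bochner_Integration.integral_nonneg)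
    fix t :: real assume t: "0 < t" "t < 1"
    have t\<phi>: "(\<lambda>x. t * \<phi> x) \<in> test_functions \<Omega>" by (rule test_cmult[OF \<phi>])
    have p: "0 \<le> t * \<phi> x" for x using pos t by simp
    show "sob \<Omega> (push i (\<lambda>x. t * \<phi> x) j) (dpush i (\<lambda>x. t * \<phi> x) j)" for j by (rule sob_push[OF t\<phi>])
    show "0 \<le> push i (\<lambda>x. t * \<phi> x) j x" if "x \<in> \<Omega>" for j x by (rule push_nonneg)
    show "push i (\<lambda>x. t * \<phi> x) j x * push i (\<lambda>x. t * \<phi> x) l x = 0" if "x \<in> \<Omega>" "j \<noteq> l" for j l x
      by (rule push_disjoint) (use that p in auto)
    show "\<bar>(LINT x|M. push i (\<lambda>x. t * \<phi> x) j x) - 1\<bar> \<le> t * (LINT x|M. \<phi> x)" for j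
      using mass_change(3)[OF sobD(1)[OF sob_push[OF t\<phi>]] test_integrable_on[OF open_dom t\<phi>] push_diff[OF _ p]] by simp
    have g: "gradient (\<lambda>x. t * \<phi> x) x = t *\<^sub>R gradient \<phi> x" for x
      by (rule gradient_cmult[OF test_differentiable[OF \<phi>]])
    show "(\<Sum>j\<in>UNIV. LINT x|M. (norm (dpush i (\<lambda>x. t * \<phi> x) j x))\<^sup>2)
      \<le> E + (2 * t * (LINT x|M. Ghat i x \<bullet> gradient \<phi> x) + t\<^sup>2 * (LINT x|M. (norm (gradient \<phi> x))\<^sup>2))"
      using push_energy[OF t\<phi> p, of i] unfolding g by (simp add: power_mult_distrib)
  qed
  then show ?thesis using sob_laplacian[OF open_dom sob_hat \<phi>, of i] by simp
qed

text \<open>The mass gained by the component \<open>i\<close> has to be paid for by the energy of the competitor.\<close>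

lemma push_balance:
  assumes \<phi>: "\<phi> \<in> test_functions \<Omega>" and pos: "\<And>x. \<phi> x \<ge> 0"
    and B: "B \<in> sets M" "\<And>x. x \<notin> B \<Longrightarrow> \<phi> x = 0"
    and s: "s = (LINT x|M. indicator B x * (\<Sum>j\<in>UNIV. u x $ j))" and I: "I = (LINT x|M. \<phi> x)"
    and g: "g = (LINT x|M. indicator B x * (\<Sum>j\<in>UNIV. (norm (G j x))\<^sup>2))"
    and Z: "Z = (LINT x|M. (norm (gradient \<phi> x))\<^sup>2)"
    and sI: "s \<le> I / 2" "I \<le> 1"
  shows "((LINT x|M. (norm (G i x))\<^sup>2) - g) * (I / 2) \<le> 2 * sqrt g * sqrt Z + Z + 6 * s * (E + 2 * sqrt g * sqrt Z + Z)"
proof -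
  let ?F = "\<lambda>j. LINT x|M. (norm (dpush i \<phi> j x))\<^sup>2"
  let ?m = "\<lambda>j. LINT x|M. push i \<phi> j x"
  let ?X = "2 * sqrt g * sqrt Z + Z"
  have Lp: "L2 M (push i \<phi> j)" for j by (rule sobD(1)[OF sob_push[OF \<phi>]])
  have mc: "(LINT x|M. push i \<phi> j x) - 1 = (LINT x|M. push i \<phi> j x - u x $ j)"
    "integrable M (\<lambda>x. push i \<phi> j x - u x $ j)" for j
    using mass_change(2,4)[OF Lp test_integrable_on[OF open_dom \<phi>] push_diff[OF _ pos]] by blast+
  have intB: "integrable M (\<lambda>x. indicator B x * f x)" if "integrable M f" for f :: "_ \<Rightarrow> real"
    using integrable_mult_indicator[OF B(1) that] by simp
  have int_su: "integrable M (\<lambda>x. \<Sum>j\<in>UNIV. u x $ j)"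
    by (intro Bochner_Integration.integrable_sum u_integrable)
  have s0: "s \<ge> 0" unfolding s
    by (intro Bochner_Integration.integral_nonneg mult_nonneg_nonneg sum_nonneg) (auto simp: u_nonneg)
  have out: "push i \<phi> j x = u x $ j" if "x \<in> \<Omega>" "x \<notin> B" for j x
    using push_diff[where \<phi>=\<phi> and i=i and j=j, OF that(1)] B(2)[OF that(2)] by simp
  \<comment> \<open>By \<open>push_lower\<close> component \<open>i\<close> gains the mass of the
    bump up to the mass \<open>s\<close> of \<open>u\<close> in \<open>B\<close>. Each other
    component loses at most what it has in \<open>B\<close>, hence at most \<open>s\<close>.\<close>
  have mi: "?m i - 1 \<ge> I - s"
  proof -
    have "I - s = (LINT x|M. \<phi> x - indicator B x * (\<Sum>j\<in>UNIV. u x $ j))"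
      unfolding I s using test_integrable_on[OF open_dom \<phi>] intB[OF int_su] by simp
    also have "\<dots> \<le> (LINT x|M. push i \<phi> i x - u x $ i)"
    proof (rule integral_mono)
      show "integrable M (\<lambda>x. \<phi> x - indicator B x * (\<Sum>j\<in>UNIV. u x $ j))"
        using test_integrable_on[OF open_dom \<phi>] intB[OF int_su] by simp
      show "integrable M (\<lambda>x. push i \<phi> i x - u x $ i)" by (rule mc(2))
      fix x assume x: "x \<in> space M"
      show "\<phi> x - indicator B x * (\<Sum>j\<in>UNIV. u x $ j) \<le> push i \<phi> i x - u x $ i"
        using push_lower[where \<phi>=\<phi> and i=i and x=x] out[of x i] B(2)[of x] x by (cases "x \<in> B") auto
    qed
    also have "\<dots> = ?m i - 1" using mc(1)[of i] by simp
    finally show ?thesis .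
  qed
  have mj: "?m j - 1 \<ge> - s" for j
  proof -
    have "- s = (LINT x|M. - (indicator B x * (\<Sum>j\<in>UNIV. u x $ j)))"
      unfolding s by simp
    also have "\<dots> \<le> (LINT x|M. push i \<phi> j x - u x $ j)"
    proof (rule integral_mono)
      show "integrable M (\<lambda>x. - (indicator B x * (\<Sum>j\<in>UNIV. u x $ j)))"
        using intB[OF int_su] by simp
      show "integrable M (\<lambda>x. push i \<phi> j x - u x $ j)" by (rule mc(2))
      fix x assume x: "x \<in> space M"
      have "u x $ j \<le> (\<Sum>j\<in>UNIV. u x $ j)"
        using x by (intro member_le_sum) (auto simp: u_nonneg)
      then show "- (indicator B x * (\<Sum>j\<in>UNIV. u x $ j)) \<le> push i \<phi> j x - u x $ j"
        using push_nonneg[of i \<phi> j x] out[of x j] x by (cases "x \<in> B") auto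
    qed
    also have "\<dots> = ?m j - 1" using mc(1)[of j] by simp
    finally show ?thesis .
  qed
  have F0: "?F j \<ge> 0" for j by (rule Bochner_Integration.integral_nonneg) auto
  have "E \<le> (\<Sum>j\<in>UNIV. ?F j / (?m j)\<^sup>2)"
    using sI s0 mj by (intro competitor sob_push \<phi> push_nonneg push_disjoint pos) (auto simp: field_simps intro: less_le_trans[of 0 "1 - s"])
  also have "\<dots> = ?F i / (?m i)\<^sup>2 + (\<Sum>j\<in>UNIV - {i}. ?F j / (?m j)\<^sup>2)"
    by (rule sum.remove) auto
  also have "\<dots> \<le> ?F i * (1 + 6 * s - I / 2) + (\<Sum>j\<in>UNIV - {i}. ?F j * (1 + 6 * s))"
  proof (rule add_mono)
    \<comment> \<open>Since \<open>s <= I / 2\<close>, the mass of component \<open>i\<close> is at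
      least \<open>1 + I / 2\<close>. With \<open>y = I / 2\<close> its renormalization multiplies
      the energy by at most \<open>1 - I / 2\<close>: this is the gain that the lemma
      measures.\<close>
    have "1 \<le> (1 - y) * (1 + y)\<^sup>2" if "0 \<le> y" "y \<le> 1 / 2" for y :: real
    proof -
      have "0 \<le> y * (1 - y - y\<^sup>2)"
        using that power_mono[of y "1 / 2" 2] by (intro mult_nonneg_nonneg) (auto simp: power2_eq_square)
      then show ?thesis by (simp add: power2_eq_square algebra_simps)
    qed
    from this[of "I / 2"] have "1 \<le> (1 - I / 2) * (1 + I / 2)\<^sup>2" using sI s0 by simp
    also have "\<dots> \<le> (1 - I / 2) * (?m i)\<^sup>2"
      using sI s0 mi by (intro mult_left_mono power_mono) auto
    finally have "1 / (?m i)\<^sup>2 \<le> 1 - I / 2"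
      using mi sI s0 by (subst pos_divide_le_eq) auto
    then have "1 / (?m i)\<^sup>2 \<le> 1 + 6 * s - I / 2" using s0 by simp
    then have "?F i * (1 / (?m i)\<^sup>2) \<le> ?F i * (1 + 6 * s - I / 2)" using F0 by (rule mult_left_mono)
    then show "?F i / (?m i)\<^sup>2 \<le> ?F i * (1 + 6 * s - I / 2)" by simp
    show "(\<Sum>j\<in>UNIV - {i}. ?F j / (?m j)\<^sup>2) \<le> (\<Sum>j\<in>UNIV - {i}. ?F j * (1 + 6 * s))"
    proof (rule sum_mono)
      fix j
      have "1 / (?m j)\<^sup>2 \<le> 1 + 6 * s"
        using mj[of j] s0 sI by (intro inverse_square_bound) auto
      then have "?F j * (1 / (?m j)\<^sup>2) \<le> ?F j * (1 + 6 * s)" using F0 by (rule mult_left_mono)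
      then show "?F j / (?m j)\<^sup>2 \<le> ?F j * (1 + 6 * s)" by simp
    qed
  qed
  also have "\<dots> = (1 + 6 * s) * (\<Sum>j\<in>UNIV. ?F j) - ?F i * (I / 2)"
    by (subst sum.remove[of UNIV i ?F]) (auto simp: sum_distrib_left algebra_simps)
  finally have 1: "E + ?F i * (I / 2) \<le> (1 + 6 * s) * (\<Sum>j\<in>UNIV. ?F j)" by simp
  note Lh = sobD(2)[OF sob_hat[of i]]
  note L\<phi> = test_L2(2)[OF open_dom \<phi>]
  have gB: "g = (LINT x|M. (norm (indicator B x *\<^sub>R Ghat i x))\<^sup>2)"
    and LB: "L2 M (\<lambda>x. indicator B x *\<^sub>R Ghat i x)"
  proof -
    have m: "(\<lambda>x. indicator B x *\<^sub>R Ghat i x) \<in> borel_measurable M"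
      using B(1) L2_measurable[OF Lh] by measurable
    show LB: "L2 M (\<lambda>x. indicator B x *\<^sub>R Ghat i x)"
      by (rule L2_bound[OF Lh m, where c=1]) (auto simp: indicator_def)
    have "integrable M (\<lambda>x. indicator B x * (\<Sum>j\<in>UNIV. (norm (G j x))\<^sup>2))"
      using L2_integrable[OF L2_G] by (intro intB Bochner_Integration.integrable_sum)
    moreover have "AE x in M. indicator B x * (\<Sum>j\<in>UNIV. (norm (G j x))\<^sup>2) = (norm (indicator B x *\<^sub>R Ghat i x))\<^sup>2"
      using Ghat_norm_sq[of i] by eventually_elim (auto simp: indicator_def)
    ultimately show "g = (LINT x|M. (norm (indicator B x *\<^sub>R Ghat i x))\<^sup>2)"
      unfolding g using L2_integrable[OF LB]
      by (intro integral_cong_AE borel_measurable_integrable)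
  qed
  \<comment> \<open>Off \<open>B\<close> the bump vanishes and so, almost everywhere, does its
    gradient; the first-order term therefore sees only the gradient energy \<open>g\<close> inside
    \<open>B\<close>.\<close>
  have grad_out: "AE x in M. x \<notin> B \<longrightarrow> gradient \<phi> x = 0"
    using sob_gradient_zero[OF open_dom sob_test[OF open_dom \<phi>]] by eventually_elim (use B(2) in auto)
  have Y: "(LINT x|M. Ghat i x \<bullet> gradient \<phi> x) \<le> sqrt g * sqrt Z"
  proof -
    have "AE x in M. Ghat i x \<bullet> gradient \<phi> x = (indicator B x *\<^sub>R Ghat i x) \<bullet> gradient \<phi> x"
      using grad_out by eventually_elim (auto simp: indicator_def)
    then have "(LINT x|M. Ghat i x \<bullet> gradient \<phi> x) = (LINT x|M. (indicator B x *\<^sub>R Ghat i x) \<bullet> gradient \<phi> x)"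
      using L2_inner_integrable[OF Lh L\<phi>] L2_inner_integrable[OF LB L\<phi>] by (intro integral_cong_AE) auto
    also have "\<dots> \<le> sqrt g * sqrt Z"
      using L2_inner_CS[OF LB L\<phi>] unfolding gB Z by simp
    finally show ?thesis .
  qed
  have 2: "(\<Sum>j\<in>UNIV. ?F j) \<le> E + ?X"
    using push_energy[OF \<phi> pos, of i] Y unfolding Z by simp
  \<comment> \<open>Outside \<open>B\<close> component \<open>i\<close> keeps its gradient, so at
    most \<open>g\<close> of its energy can be lost.\<close>
  have 3: "(LINT x|M. (norm (G i x))\<^sup>2) - g \<le> ?F i"
  proof -
    have i1: "integrable M (\<lambda>x. (norm (G i x))\<^sup>2)" by (rule L2_integrable[OF L2_G])
    have i2: "integrable M (\<lambda>x. indicator B x * (\<Sum>j\<in>UNIV. (norm (G j x))\<^sup>2))"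
      using L2_integrable[OF L2_G] by (intro intB Bochner_Integration.integrable_sum)
    have "(LINT x|M. (norm (G i x))\<^sup>2) - g = (LINT x|M. (norm (G i x))\<^sup>2 - indicator B x * (\<Sum>j\<in>UNIV. (norm (G j x))\<^sup>2))"
      unfolding g using i1 i2 by simp
    also have "\<dots> \<le> ?F i"
    proof (rule integral_mono_AE)
      show "integrable M (\<lambda>x. (norm (G i x))\<^sup>2 - indicator B x * (\<Sum>j\<in>UNIV. (norm (G j x))\<^sup>2))"
        using i1 i2 by simp
      show "integrable M (\<lambda>x. (norm (dpush i \<phi> i x))\<^sup>2)" by (rule L2_integrable[OF sobD(2)[OF sob_push[OF \<phi>]]])
      show "AE x in M. (norm (G i x))\<^sup>2 - indicator B x * (\<Sum>j\<in>UNIV. (norm (G j x))\<^sup>2) \<le> (norm (dpush i \<phi> i x))\<^sup>2"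
        using grad_out gradient_support AE_space
      proof eventually_elim
        case (elim x)
        then have x: "x \<in> \<Omega>" by simp
        show ?case
        proof (cases "x \<in> B")
          case True
          have "(norm (G i x))\<^sup>2 \<le> (\<Sum>j\<in>UNIV. (norm (G j x))\<^sup>2)" by (intro member_le_sum) auto
          then show ?thesis using True zero_le_power2[of "norm (dpush i \<phi> i x)"]
            by (simp add: order_trans[OF _ zero_le_power2])
        next
          case False
          then have "\<phi> x = 0" "gradient \<phi> x = 0" using elim B by auto
          moreover have "norm (G i x) \<le> norm (if hat i x > 0 then Ghat i x else 0)"
          proof (cases "u x $ i > 0")
            case True
            then have "\<And>j. j \<noteq> i \<Longrightarrow> G j x = 0" using elim u_other[OF x] by blast
            then show ?thesis using True hat_pos[OF x True] Ghat_branch[of i x i] by simp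
          next
            case False
            then have "u x $ i = 0" using u_nonneg[OF x, of i] by simp
            then show ?thesis using elim by simp
          qed
          ultimately show ?thesis using False by (auto simp: dpush_def power_mono split: if_splits)
        qed
      qed
    qed
    finally show ?thesis .
  qed
  have I0: "I \<ge> 0" using sI s0 by simp
  have "E + ((LINT x|M. (norm (G i x))\<^sup>2) - g) * (I / 2) \<le> E + ?F i * (I / 2)"
    using 3 I0 by (intro add_left_mono mult_right_mono) auto
  also have "\<dots> \<le> (1 + 6 * s) * (\<Sum>j\<in>UNIV. ?F j)" by (rule 1)
  also have "\<dots> \<le> (1 + 6 * s) * (E + ?X)" using 2 s0 by (intro mult_left_mono) auto
  finally show ?thesis by (simp add: algebra_simps)
qed

end

section \<open>Displacement estimates and traces\<close>

lemma nn_integral_lborel_affine: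
  fixes f :: "'a::euclidean_space \<Rightarrow> ennreal"
  assumes [measurable]: "f \<in> borel_measurable borel" and c: "c > 0"
  shows "(\<integral>\<^sup>+x. f x \<partial>lborel) = ennreal (c ^ DIM('a)) * (\<integral>\<^sup>+x. f (t + c *\<^sub>R x) \<partial>lborel)"
  by (subst lborel_affine[of c t]) (use c in \<open>auto simp: nn_integral_density nn_integral_distr nn_integral_cmult\<close>)

lemma integral_lborel_affine:
  fixes f :: "'a::euclidean_space \<Rightarrow> real"
  assumes [measurable]: "f \<in> borel_measurable borel" and c: "c > 0"
  shows "(LINT x|lborel. f x) = c ^ DIM('a) * (LINT x|lborel. f (t + c *\<^sub>R x))"
    "integrable lborel (\<lambda>x. f (t + c *\<^sub>R x)) \<longleftrightarrow> integrable lborel f"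
proof -
  show "(LINT x|lborel. f x) = c ^ DIM('a) * (LINT x|lborel. f (t + c *\<^sub>R x))"
    by (subst lborel_affine[of c t]) (use c in \<open>auto simp: integral_density integral_distr\<close>)
  have "integrable lborel f \<longleftrightarrow> integrable (density (distr lborel borel (\<lambda>x. t + c *\<^sub>R x)) (\<lambda>_. ennreal (\<bar>c\<bar> ^ DIM('a)))) f"
    using lborel_affine[of c t] c by (metis less_irrefl)
  also have "\<dots> \<longleftrightarrow> integrable lborel (\<lambda>x. f (t + c *\<^sub>R x))"
    using c by (subst integrable_density) (auto simp: integrable_distr_eq)
  finally show "integrable lborel (\<lambda>x. f (t + c *\<^sub>R x)) \<longleftrightarrow> integrable lborel f" by simp
qed

text \<open>The fundamental theorem of calculus along a segment. The bound is a nonnegative extended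
  integral over \<open>lborel\<close>, the form in which the order of integration is exchanged
  afterwards.\<close>

lemma test_increment_le:
  fixes a b :: "real \<Rightarrow> real^'n::finite"
  assumes \<phi>: "\<phi> \<in> test_functions \<Omega>"
    and A: "\<And>s. A s = p + s *\<^sub>R w" and w: "norm w \<le> L"
  shows "ennreal \<bar>\<phi> (p + w) - \<phi> p\<bar> \<le> (\<integral>\<^sup>+s. ennreal (indicator {0..1} s * (L * norm (gradient \<phi> (A s)))) \<partial>lborel)"
proof -
  have cA: "continuous_on UNIV A" unfolding A by (intro continuous_intros)
  have cg: "continuous_on UNIV (\<lambda>s. gradient \<phi> (A s))"
    using continuous_on_compose2[OF gradient_test_continuous[OF \<phi>, of UNIV] cA] by simp
  have L0: "L \<ge> 0" using w norm_ge_zero order_trans by blast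
  have "((\<lambda>s. \<phi> (A s)) has_real_derivative gradient \<phi> (A s) \<bullet> w) (at s)" for s
  proof -
    have l: "(A has_derivative (\<lambda>h. h *\<^sub>R w)) (at s)" unfolding A by (auto intro!: derivative_eq_intros)
    from has_derivative_compose[OF l has_derivative_gradient[OF test_differentiable[OF \<phi>]]]
    have "((\<lambda>s. \<phi> (A s)) has_derivative (\<lambda>h. h * (gradient \<phi> (A s) \<bullet> w))) (at s)" by simp
    then show ?thesis by (simp add: has_field_derivative_def mult_commute_abs)
  qed
  then have "((\<lambda>s. gradient \<phi> (A s) \<bullet> w) has_integral (\<phi> (A 1) - \<phi> (A 0))) {0..1}"
    by (intro fundamental_theorem_of_calculus)
       (auto simp: has_real_derivative_iff_has_vector_derivative[symmetric] intro: has_field_derivative_at_within)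
  then have e: "\<phi> (p + w) - \<phi> p = integral {0..1} (\<lambda>s. gradient \<phi> (A s) \<bullet> w)"
    by (simp add: A integral_unique)
  define J where "J = integral {0..1} (\<lambda>s. L * norm (gradient \<phi> (A s)))"
  have ci: "(\<lambda>s. L * norm (gradient \<phi> (A s))) integrable_on {0..1}"
    by (intro integrable_continuous_interval continuous_intros continuous_on_subset[OF cg]) auto
  have "\<bar>\<phi> (p + w) - \<phi> p\<bar> \<le> J"
    unfolding e J_def real_norm_def[symmetric]
  proof (rule integral_norm_bound_integral)
    show "(\<lambda>s. gradient \<phi> (A s) \<bullet> w) integrable_on {0..1}"
      by (intro integrable_continuous_interval continuous_intros continuous_on_subset[OF cg]) auto
    show "(\<lambda>s. L * norm (gradient \<phi> (A s))) integrable_on {0..1}" by (rule ci)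
    fix s
    have "norm (gradient \<phi> (A s) \<bullet> w) \<le> norm (gradient \<phi> (A s)) * norm w"
      by (simp add: Cauchy_Schwarz_ineq2)
    also have "\<dots> \<le> L * norm (gradient \<phi> (A s))" using w by (simp add: mult.commute mult_right_mono)
    finally show "norm (gradient \<phi> (A s) \<bullet> w) \<le> L * norm (gradient \<phi> (A s))" .
  qed
  moreover have "(\<integral>\<^sup>+s. ennreal (indicator {0..1} s * (L * norm (gradient \<phi> (A s)))) \<partial>lborel) = ennreal J"
  proof (rule nn_integral_has_integral_lborel)
    show "(\<lambda>s. indicator {0..1} s * (L * norm (gradient \<phi> (A s)))) \<in> borel_measurable borel"
      by (intro borel_measurable_times borel_measurable_indicator borel_measurable_continuous_onI continuous_intros cg) auto
    have "((\<lambda>s. if s \<in> {0..1} then L * norm (gradient \<phi> (A s)) else 0) has_integral J) UNIV"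
      unfolding J_def has_integral_restrict_UNIV using ci by (rule integrable_integral)
    moreover have "(\<lambda>s. if s \<in> {0..1} then L * norm (gradient \<phi> (A s)) else 0) = (\<lambda>s. indicator {0..1} s * (L * norm (gradient \<phi> (A s))))"
      by (auto simp: indicator_def)
    ultimately show "((\<lambda>s. indicator {0..1} s * (L * norm (gradient \<phi> (A s)))) has_integral J) UNIV"
      by (simp only:)
  qed (use L0 in auto)
  ultimately show ?thesis by (simp add: ennreal_leI)
qed

text \<open>Integrated increments along the segments from \<open>x\<close> to the image of \<open>x\<close> under a contraction about \<open>x0\<close>
  followed by a translation.\<close>

lemma test_displacement:
  fixes h x0 :: "real^'n::finite"
  assumes \<phi>: "\<phi> \<in> test_functions \<Omega>" and r: "r > 0" and \<tau>: "0 \<le> \<tau>" "\<tau> < 1"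
  defines "T \<equiv> (\<lambda>x. x0 + (1 - \<tau>) *\<^sub>R (x - x0) + h)"
  shows "(\<integral>\<^sup>+x. ennreal (indicator (ball x0 r) x * \<bar>\<phi> (T x) - \<phi> x\<bar>) \<partial>lborel)
    \<le> ennreal ((norm h + \<tau> * r) / (1 - \<tau>) ^ CARD('n)) * (\<integral>\<^sup>+x. ennreal (indicator (ball x0 (r + norm h)) x * norm (gradient \<phi> x)) \<partial>lborel)"
proof -
  define w where "w x = h - \<tau> *\<^sub>R (x - x0)" for x
  define L where "L = norm h + \<tau> * r"
  define A where "A x s = x + s *\<^sub>R w x" for x s
  let ?B = "ball x0 r" and ?B' = "ball x0 (r + norm h)"
  define g where "g x = ennreal (indicator ?B' x * norm (gradient \<phi> x))" for x
  have L0: "L \<ge> 0" using r \<tau> by (simp add: L_def)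
  have w_le: "norm (w x) \<le> L" if "x \<in> ?B" for x
  proof -
    have "norm (w x) \<le> norm h + norm (\<tau> *\<^sub>R (x - x0))" unfolding w_def by (rule norm_triangle_ineq4)
    also have "norm (\<tau> *\<^sub>R (x - x0)) \<le> \<tau> * r"
      using that \<tau> by (auto simp: dist_norm norm_minus_commute intro!: mult_left_mono)
    finally show ?thesis by (simp add: L_def)
  qed
  have T: "T x = x + w x" for x by (simp add: T_def w_def algebra_simps)
  have [measurable]: "gradient \<phi> \<in> borel_measurable borel" by (rule gradient_test_borel[OF \<phi>])
  have [measurable]: "g \<in> borel_measurable borel"
    unfolding g_def
    by (intro measurable_compose[OF _ measurable_ennreal] borel_measurable_times borel_measurable_indicator
        borel_measurable_norm[THEN measurable_compose[rotated]] gradient_test_borel[OF \<phi>]) simp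
  have [measurable]: "(\<lambda>(x, s). A x s) \<in> borel_measurable (lborel \<Otimes>\<^sub>M lborel)"
    unfolding A_def w_def by measurable
  have A_in: "A x s \<in> ?B'" if "x \<in> ?B" "0 \<le> s" "s \<le> 1" for x s
  proof -
    \<comment> \<open>The point at time \<open>s\<close> is again a contraction about
      \<open>x0\<close>, with ratio \<open>1 - s * \<tau>\<close>, followed by a translation by
      \<open>s h\<close>; hence the segment stays in the enlarged ball.\<close>
    have e: "A x s - x0 = (1 - s * \<tau>) *\<^sub>R (x - x0) + s *\<^sub>R h"
      by (simp add: A_def w_def algebra_simps)
    have st: "0 \<le> s * \<tau>" "s * \<tau> \<le> 1" using that \<tau> mult_le_one[of s \<tau>] by auto
    have "norm (A x s - x0) \<le> (1 - s * \<tau>) * norm (x - x0) + s * norm h"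
      unfolding e using norm_triangle_ineq[of "(1 - s * \<tau>) *\<^sub>R (x - x0)" "s *\<^sub>R h"] st that by simp
    also have "\<dots> \<le> norm (x - x0) + norm h"
      using st that by (intro add_mono mult_left_le_one_le) auto
    also have "\<dots> < r + norm h" using that by (simp add: dist_norm norm_minus_commute)
    finally show ?thesis by (simp add: dist_norm norm_minus_commute)
  qed
  have 1: "ennreal (indicator ?B x * \<bar>\<phi> (T x) - \<phi> x\<bar>) \<le> (\<integral>\<^sup>+s. ennreal (indicator {0..1} s * L) * g (A x s) \<partial>lborel)" for x
  proof (cases "x \<in> ?B")
    case True
    have "ennreal \<bar>\<phi> (x + w x) - \<phi> x\<bar> \<le> (\<integral>\<^sup>+s. ennreal (indicator {0..1} s * (L * norm (gradient \<phi> (A x s)))) \<partial>lborel)"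
      using w_le[OF True] by (intro test_increment_le[OF \<phi>]) (auto simp: A_def)
    also have "\<dots> \<le> (\<integral>\<^sup>+s. ennreal (indicator {0..1} s * L) * g (A x s) \<partial>lborel)"
      using A_in[OF True] L0 by (intro nn_integral_mono) (auto simp: g_def indicator_def ennreal_mult'[symmetric])
    finally show ?thesis using True by (simp add: T)
  qed simp
  \<comment> \<open>For fixed \<open>s\<close> the map is affine with ratio at least
    \<open>1 - \<tau>\<close>, so the change of variables costs at most the factor
    \<open>1 / (1 - \<tau>) ^ CARD('n)\<close>.\<close>
  have 2: "(\<integral>\<^sup>+x. g (A x s) \<partial>lborel) \<le> ennreal (1 / (1 - \<tau>) ^ CARD('n)) * (\<integral>\<^sup>+x. g x \<partial>lborel)" if s: "0 \<le> s" "s \<le> 1" for s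
  proof -
    define c where "c = 1 - s * \<tau>"
    have "s * \<tau> \<le> \<tau>" using s \<tau> by (intro mult_left_le_one_le) auto
    then have c: "c > 0" "1 - \<tau> \<le> c" using \<tau> by (auto simp: c_def)
    have e: "A x s = (s *\<^sub>R (h + \<tau> *\<^sub>R x0)) + c *\<^sub>R x" for x
      by (simp add: A_def w_def c_def algebra_simps)
    have "(\<integral>\<^sup>+x. g x \<partial>lborel) = ennreal (c ^ CARD('n)) * (\<integral>\<^sup>+x. g (A x s) \<partial>lborel)"
      unfolding e using nn_integral_lborel_affine[of g c "s *\<^sub>R (h + \<tau> *\<^sub>R x0)"] c by simp
    then have "ennreal (1 / c ^ CARD('n)) * (\<integral>\<^sup>+x. g x \<partial>lborel) = (ennreal (1 / c ^ CARD('n)) * ennreal (c ^ CARD('n))) * (\<integral>\<^sup>+x. g (A x s) \<partial>lborel)"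
      by (simp only: mult.assoc)
    also have "ennreal (1 / c ^ CARD('n)) * ennreal (c ^ CARD('n)) = 1"
      using c by (simp add: ennreal_mult'[symmetric])
    finally have "(\<integral>\<^sup>+x. g (A x s) \<partial>lborel) = ennreal (1 / c ^ CARD('n)) * (\<integral>\<^sup>+x. g x \<partial>lborel)"
      by simp
    also have "\<dots> \<le> ennreal (1 / (1 - \<tau>) ^ CARD('n)) * (\<integral>\<^sup>+x. g x \<partial>lborel)"
      using c \<tau> by (intro mult_right_mono ennreal_leI divide_left_mono power_mono mult_pos_pos zero_less_power) auto
    finally show ?thesis .
  qed
  have "(\<integral>\<^sup>+x. ennreal (indicator ?B x * \<bar>\<phi> (T x) - \<phi> x\<bar>) \<partial>lborel)
      \<le> (\<integral>\<^sup>+x. (\<integral>\<^sup>+s. ennreal (indicator {0..1} s * L) * g (A x s) \<partial>lborel) \<partial>lborel)"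
    by (intro nn_integral_mono 1)
  also have "\<dots> = (\<integral>\<^sup>+s. (\<integral>\<^sup>+x. ennreal (indicator {0..1} s * L) * g (A x s) \<partial>lborel) \<partial>lborel)"
    by (rule lborel_pair.Fubini'[symmetric]) measurable
  also have "\<dots> = (\<integral>\<^sup>+s. ennreal (indicator {0..1} s * L) * (\<integral>\<^sup>+x. g (A x s) \<partial>lborel) \<partial>lborel)"
    by (intro nn_integral_cong nn_integral_cmult) (auto simp: A_def w_def)
  also have "\<dots> \<le> (\<integral>\<^sup>+s. ennreal (indicator {0..1::real} s * L) * (ennreal (1 / (1 - \<tau>) ^ CARD('n)) * (\<integral>\<^sup>+x. g x \<partial>lborel)) \<partial>lborel)"
    by (rule nn_integral_mono) (use 2 in \<open>auto simp: indicator_def intro: mult_left_mono\<close>)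
  also have "\<dots> = (\<integral>\<^sup>+s. ennreal (indicator {0..1::real} s * L) \<partial>lborel) * (ennreal (1 / (1 - \<tau>) ^ CARD('n)) * (\<integral>\<^sup>+x. g x \<partial>lborel))"
    by (rule nn_integral_multc) measurable
  also have "(\<integral>\<^sup>+s. ennreal (indicator {0..1::real} s * L) \<partial>lborel) = ennreal L"
  proof -
    have "(\<integral>\<^sup>+s. ennreal (indicator {0..1::real} s * L) \<partial>lborel) = (\<integral>\<^sup>+s. ennreal L * indicator {0..1::real} s \<partial>lborel)"
      by (intro nn_integral_cong) (auto simp: indicator_def)
    then show ?thesis by (simp add: nn_integral_cmult_indicator)
  qed
  also have "ennreal L * (ennreal (1 / (1 - \<tau>) ^ CARD('n)) * (\<integral>\<^sup>+x. g x \<partial>lborel))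
      = ennreal (L / (1 - \<tau>) ^ CARD('n)) * (\<integral>\<^sup>+x. g x \<partial>lborel)"
    using L0 \<tau> by (simp add: mult.assoc[symmetric] ennreal_mult'[symmetric])
  finally show ?thesis by (simp add: L_def g_def)
qed

section \<open>Integrals over balls and passage from test functions to Sobolev functions\<close>

lemma integrable_indicator_continuous:
  fixes k :: "'a::euclidean_space \<Rightarrow> real"
  assumes k: "continuous_on UNIV k" and S: "bounded S" "S \<in> sets borel"
  shows "integrable lborel (\<lambda>x. indicator S x * k x)"
proof -
  have "integrable lborel (\<lambda>x. indicator (closure S) x *\<^sub>R k x)"
    using S k by (intro borel_integrable_compact) (auto intro: continuous_on_subset)
  then have "integrable lborel (\<lambda>x. indicator S x *\<^sub>R (indicator (closure S) x *\<^sub>R k x))"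
    by (rule integrable_mult_indicator[rotated]) (simp add: S)
  moreover have "(\<lambda>x. indicator S x *\<^sub>R (indicator (closure S) x *\<^sub>R k x)) = (\<lambda>x. indicator S x * k x)"
    using closure_subset[of S] by (auto simp: indicator_def fun_eq_iff)
  ultimately show ?thesis by simp
qed

lemma L2_indicator:
  assumes "B \<in> sets M" "emeasure M B < \<infinity>"
  shows "L2 M (indicator B :: _ \<Rightarrow> real)"
proof -
  have "(\<lambda>x. (norm (indicator B x :: real))\<^sup>2) = (indicator B :: _ \<Rightarrow> real)" by (auto simp: indicator_def fun_eq_iff)
  then show ?thesis using assms unfolding L2_def by auto
qed

lemma L2_imp_L1_on:
  fixes F :: "'a \<Rightarrow> 'b::euclidean_space"
  assumes B: "B \<in> sets M" "emeasure M B < \<infinity>" and F: "L2 M F"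
  shows "integrable M (\<lambda>x. indicator B x * norm (F x))"
    "(LINT x|M. indicator B x * norm (F x)) \<le> sqrt (measure M B) * sqrt (LINT x|M. (norm (F x))\<^sup>2)"
proof -
  note I = L2_indicator[OF B]
  show "integrable M (\<lambda>x. indicator B x * norm (F x))"
    using L2_norm_mult_integrable[OF I F] by simp
  have "(LINT x|M. (norm (indicator B x :: real))\<^sup>2) = (LINT x|M. indicator B x)"
    by (intro Bochner_Integration.integral_cong) (auto simp: indicator_def)
  also have "\<dots> = measure M B" using B(1) sets.sets_into_space[OF B(1)] by (simp add: Int_absorb2)
  finally show "(LINT x|M. indicator B x * norm (F x)) \<le> sqrt (measure M B) * sqrt (LINT x|M. (norm (F x))\<^sup>2)"
    using L2_norm_CS[OF I F] by simp
qed

lemma L2_tendsto_L1_on: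
  fixes F :: "nat \<Rightarrow> 'a \<Rightarrow> 'b::euclidean_space"
  assumes B: "B \<in> sets M" "emeasure M B < \<infinity>" and F: "\<And>m. L2 M (F m)"
    and lim: "(\<lambda>m. LINT x|M. (norm (F m x))\<^sup>2) \<longlonglongrightarrow> 0"
  shows "(\<lambda>m. LINT x|M. indicator B x * norm (F m x)) \<longlonglongrightarrow> 0"
proof (rule tendsto_sandwich[OF _ _ tendsto_const])
  let ?u = "\<lambda>m. sqrt (measure M B) * sqrt (LINT x|M. (norm (F m x))\<^sup>2)"
  have "?u \<longlonglongrightarrow> sqrt (measure M B) * sqrt 0" by (intro tendsto_intros lim)
  then show "?u \<longlonglongrightarrow> 0" by simp
  show "\<forall>\<^sub>F m in sequentially. 0 \<le> (LINT x|M. indicator B x * norm (F m x))"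
    by (auto intro: Bochner_Integration.integral_nonneg)
  show "\<forall>\<^sub>F m in sequentially. (LINT x|M. indicator B x * norm (F m x)) \<le> ?u m"
    using L2_imp_L1_on(2)[OF B F] by simp
qed

lemma ball_lebesgue_on:
  fixes \<Omega> :: "'a::euclidean_space set"
  assumes "open \<Omega>" "ball x r \<subseteq> \<Omega>"
  shows "ball x r \<in> sets (lebesgue_on \<Omega>)" "emeasure (lebesgue_on \<Omega>) (ball x r) < \<infinity>"
    "measure (lebesgue_on \<Omega>) (ball x r) = measure lborel (ball x r)"
proof -
  show "ball x r \<in> sets (lebesgue_on \<Omega>)" using assms by (auto simp: sets_restrict_space_iff)
  have e: "emeasure (lebesgue_on \<Omega>) (ball x r) = emeasure lborel (ball x r)"
    using assms by (subst emeasure_restrict_space) auto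
  then show "emeasure (lebesgue_on \<Omega>) (ball x r) < \<infinity>"
    using emeasure_bounded_finite[of "ball x r"] by simp
  show "measure (lebesgue_on \<Omega>) (ball x r) = measure lborel (ball x r)"
    using e by (simp add: measure_def)
qed

lemma test_displacement_real:
  fixes h x0 :: "real^'n::finite"
  assumes \<phi>: "\<phi> \<in> test_functions \<Omega>" and r: "r > 0" and \<tau>: "0 \<le> \<tau>" "\<tau> < 1"
  shows "(LINT x|lborel. indicator (ball x0 r) x * \<bar>\<phi> (x0 + (1 - \<tau>) *\<^sub>R (x - x0) + h) - \<phi> x\<bar>)
    \<le> (norm h + \<tau> * r) / (1 - \<tau>) ^ CARD('n) * (LINT x|lborel. indicator (ball x0 (r + norm h)) x * norm (gradient \<phi> x))"
proof -
  let ?T = "\<lambda>x. x0 + (1 - \<tau>) *\<^sub>R (x - x0) + h"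
  let ?K = "(norm h + \<tau> * r) / (1 - \<tau>) ^ CARD('n)"
  have K: "?K \<ge> 0" using r \<tau> by simp
  have i1: "integrable lborel (\<lambda>x. indicator (ball x0 r) x * \<bar>\<phi> (?T x) - \<phi> x\<bar>)"
    by (intro integrable_indicator_continuous continuous_intros continuous_on_compose2[OF test_continuous[OF \<phi>, of UNIV]] test_continuous[OF \<phi>]) auto
  have i2: "integrable lborel (\<lambda>x. indicator (ball x0 (r + norm h)) x * norm (gradient \<phi> x))"
    by (intro integrable_indicator_continuous continuous_intros gradient_test_continuous[OF \<phi>]) auto
  have "ennreal (LINT x|lborel. indicator (ball x0 r) x * \<bar>\<phi> (?T x) - \<phi> x\<bar>) = (\<integral>\<^sup>+x. ennreal (indicator (ball x0 r) x * \<bar>\<phi> (?T x) - \<phi> x\<bar>) \<partial>lborel)"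
    using i1 by (intro nn_integral_eq_integral[symmetric]) auto
  also have "\<dots> \<le> ennreal ?K * (\<integral>\<^sup>+x. ennreal (indicator (ball x0 (r + norm h)) x * norm (gradient \<phi> x)) \<partial>lborel)"
    by (rule test_displacement[OF \<phi> r \<tau>])
  also have "(\<integral>\<^sup>+x. ennreal (indicator (ball x0 (r + norm h)) x * norm (gradient \<phi> x)) \<partial>lborel)
     = ennreal (LINT x|lborel. indicator (ball x0 (r + norm h)) x * norm (gradient \<phi> x))"
    using i2 by (intro nn_integral_eq_integral) auto
  also have "ennreal ?K * \<dots> = ennreal (?K * (LINT x|lborel. indicator (ball x0 (r + norm h)) x * norm (gradient \<phi> x)))"
    by (rule ennreal_mult'[OF K, symmetric])
  finally show ?thesis
    by (subst (asm) ennreal_le_iff) (intro mult_nonneg_nonneg K Bochner_Integration.integral_nonneg, simp_all)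
qed

text \<open>The test function estimate plus the L1 error of the approximation, taken at
  \<open>x\<close> and at its image; the latter is reduced to the former by an affine change of
  variables. The continuous function \<open>f\<close> is defined everywhere and agrees with the
  Sobolev function \<open>f0\<close> on the ball in question, which makes point values and Borel
  measurability available.\<close>

lemma sob_displacement:
  fixes h x0 :: "real^'n::finite"
  assumes o: "open \<Omega>" and s: "sob \<Omega> f0 G" and f: "continuous_on UNIV f"
    and r: "r > 0" and \<tau>: "0 \<le> \<tau>" "\<tau> < 1"
    and sub: "ball x0 (r + norm h) \<subseteq> \<Omega>" and eq: "\<And>x. x \<in> ball x0 (r + norm h) \<Longrightarrow> f x = f0 x"
  shows "(LINT x|lborel. indicator (ball x0 r) x * \<bar>f (x0 + (1 - \<tau>) *\<^sub>R (x - x0) + h) - f x\<bar>)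
    \<le> (norm h + \<tau> * r) / (1 - \<tau>) ^ CARD('n) * (LINT x|lebesgue_on \<Omega>. indicator (ball x0 (r + norm h)) x * norm (G x))"
proof -
  let ?M = "lebesgue_on \<Omega>"
  let ?T = "\<lambda>x. x0 + (1 - \<tau>) *\<^sub>R (x - x0) + h"
  let ?K = "(norm h + \<tau> * r) / (1 - \<tau>) ^ CARD('n)"
  let ?B = "ball x0 r" and ?B' = "ball x0 (r + norm h)"
  have K: "?K \<ge> 0" using r \<tau> by simp
  obtain \<phi> where \<phi>: "\<And>m. \<phi> m \<in> test_functions \<Omega>"
    "(\<lambda>m. LINT x|?M. (norm (f0 x - \<phi> m x))\<^sup>2) \<longlonglongrightarrow> 0"
    "(\<lambda>m. LINT x|?M. (norm (G x - gradient (\<phi> m) x))\<^sup>2) \<longlonglongrightarrow> 0"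
    using sobE[OF s] by blast
  note B' = ball_lebesgue_on[OF o sub]
  define d where "d m = (LINT x|?M. indicator ?B' x * norm (f0 x - \<phi> m x))" for m
  define e where "e m = (LINT x|?M. indicator ?B' x * norm (G x - gradient (\<phi> m) x))" for m
  define A where "A = (LINT x|?M. indicator ?B' x * norm (G x))"
  note L0 = L2_diff[OF sobD(1)[OF s] test_L2(1)[OF o \<phi>(1)]] L2_diff[OF sobD(2)[OF s] test_L2(2)[OF o \<phi>(1)]]
  have d0: "d \<longlonglongrightarrow> 0" and e0: "e \<longlonglongrightarrow> 0"
    unfolding d_def[abs_def] e_def[abs_def] by (intro L2_tendsto_L1_on B' L0 \<phi>)+
  have conv: "(LINT x|lborel. indicator ?B' x * k x) = (LINT x|?M. indicator ?B' x * k x)"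
    if "k \<in> borel_measurable borel" for k :: "real^'n \<Rightarrow> real"
  proof (rule lebesgue_on_test(2)[OF o, symmetric])
    show "(\<lambda>x. indicator ?B' x * k x) \<in> borel_measurable borel"
      using that by (intro borel_measurable_times borel_measurable_indicator) auto
    show "indicator ?B' x * k x = 0" if "x \<notin> \<Omega>" for x
    proof -
      have "x \<notin> ?B'" using that sub by blast
      then show ?thesis by simp
    qed
  qed
  have T_in: "?T x \<in> ?B'" if "x \<in> ?B" for x
  proof -
    have "norm (?T x - x0) \<le> norm ((1 - \<tau>) *\<^sub>R (x - x0)) + norm h"
      using norm_triangle_ineq[of "(1 - \<tau>) *\<^sub>R (x - x0)" h] by simp
    also have "norm ((1 - \<tau>) *\<^sub>R (x - x0)) \<le> norm (x - x0)" using \<tau> by (simp add: mult_left_le_one_le)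
    also have "norm (x - x0) < r" using that by (simp add: dist_norm norm_minus_commute)
    finally have "dist (?T x) x0 < r + norm h" by (simp add: dist_norm)
    then show ?thesis by (simp only: mem_ball dist_commute)
  qed
  have main: "(LINT x|lborel. indicator ?B x * \<bar>f (?T x) - f x\<bar>) \<le> (1 / (1 - \<tau>) ^ CARD('n) + 1) * d m + ?K * (A + e m)" for m
  proof -
    note c\<phi> = test_continuous[OF \<phi>(1)[of m]]
    have cd: "continuous_on UNIV (\<lambda>x. \<bar>f x - \<phi> m x\<bar>)" by (intro continuous_intros f c\<phi>)
    define k where "k x = indicator ?B' x * \<bar>f x - \<phi> m x\<bar>" for x
    have k_borel: "k \<in> borel_measurable borel"
      unfolding k_def[abs_def] by (intro borel_measurable_times borel_measurable_indicator borel_measurable_continuous_onI cd) auto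
    have k_int: "integrable lborel k"
      unfolding k_def[abs_def] by (intro integrable_indicator_continuous cd) auto
    have kd: "(LINT x|lborel. k x) = d m"
    proof -
      have "(LINT x|lborel. k x) = (LINT x|?M. k x)"
        unfolding k_def[abs_def] by (intro conv borel_measurable_continuous_onI cd)
      also have "\<dots> = d m"
        unfolding d_def k_def by (intro Bochner_Integration.integral_cong refl) (auto simp: indicator_def eq)
      finally show ?thesis .
    qed
    have "(1 - \<tau>) > 0" using \<tau> by simp
    note aff = integral_lborel_affine[OF k_borel this, of "\<tau> *\<^sub>R x0 + h"]
    have Taff: "(\<tau> *\<^sub>R x0 + h) + (1 - \<tau>) *\<^sub>R x = ?T x" for x by (simp add: algebra_simps)
    have kT: "(LINT x|lborel. k (?T x)) = 1 / (1 - \<tau>) ^ CARD('n) * d m" "integrable lborel (\<lambda>x. k (?T x))"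
      using aff k_int kd \<tau> unfolding Taff by auto
    let ?b = "\<lambda>x. indicator ?B x * \<bar>\<phi> m (?T x) - \<phi> m x\<bar>"
    have b_int: "integrable lborel ?b"
      by (intro integrable_indicator_continuous continuous_intros continuous_on_compose2[OF test_continuous[OF \<phi>(1), of UNIV]] c\<phi>) auto
    have "(LINT x|lborel. indicator ?B x * \<bar>f (?T x) - f x\<bar>) \<le> (LINT x|lborel. k (?T x) + ?b x + k x)"
    proof (rule integral_mono)
      show "integrable lborel (\<lambda>x. indicator ?B x * \<bar>f (?T x) - f x\<bar>)"
        by (intro integrable_indicator_continuous continuous_intros continuous_on_compose2[OF f] f) auto
      show "integrable lborel (\<lambda>x. k (?T x) + ?b x + k x)" using k_int kT b_int by simp
      fix x
      show "indicator ?B x * \<bar>f (?T x) - f x\<bar> \<le> k (?T x) + ?b x + k x"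
      proof (cases "x \<in> ?B")
        case True
        then have "x \<in> ?B'" using norm_ge_zero[of h] unfolding mem_ball by linarith
        then show ?thesis using True T_in[OF True] by (simp add: k_def)
      qed (simp add: k_def)
    qed
    also have "\<dots> = (1 / (1 - \<tau>) ^ CARD('n) + 1) * d m + (LINT x|lborel. ?b x)"
      using k_int kT b_int kd by (simp add: algebra_simps)
    also have "(LINT x|lborel. ?b x) \<le> ?K * (LINT x|lborel. indicator ?B' x * norm (gradient (\<phi> m) x))"
      by (rule test_displacement_real[OF \<phi>(1) r \<tau>])
    also have "(LINT x|lborel. indicator ?B' x * norm (gradient (\<phi> m) x)) = (LINT x|?M. indicator ?B' x * norm (gradient (\<phi> m) x))"
      by (intro conv borel_measurable_continuous_onI continuous_intros gradient_test_continuous[OF \<phi>(1)])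
    also have "\<dots> \<le> (LINT x|?M. indicator ?B' x * norm (G x) + indicator ?B' x * norm (G x - gradient (\<phi> m) x))"
    proof (rule integral_mono)
      show "integrable ?M (\<lambda>x. indicator ?B' x * norm (gradient (\<phi> m) x))"
        by (rule L2_imp_L1_on(1)[OF B'(1,2) test_L2(2)[OF o \<phi>(1)]])
      show "integrable ?M (\<lambda>x. indicator ?B' x * norm (G x) + indicator ?B' x * norm (G x - gradient (\<phi> m) x))"
        by (intro Bochner_Integration.integrable_add L2_imp_L1_on(1)[OF B'(1,2)] L0 sobD(2)[OF s])
      fix x
      have "norm (gradient (\<phi> m) x) \<le> norm (G x) + norm (G x - gradient (\<phi> m) x)"
        using norm_triangle_ineq4[of "G x" "G x - gradient (\<phi> m) x"] by simp
      then show "indicator ?B' x * norm (gradient (\<phi> m) x) \<le> indicator ?B' x * norm (G x) + indicator ?B' x * norm (G x - gradient (\<phi> m) x)"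
        by (auto simp: indicator_def)
    qed
    also have "\<dots> = A + e m"
      unfolding A_def e_def by (intro Bochner_Integration.integral_add L2_imp_L1_on(1)[OF B'(1,2)] L0 sobD(2)[OF s])
    finally show ?thesis using K by (simp only: mult_left_mono add_left_mono)
  qed
  have "(\<lambda>m. (1 / (1 - \<tau>) ^ CARD('n) + 1) * d m + ?K * (A + e m)) \<longlonglongrightarrow> (1 / (1 - \<tau>) ^ CARD('n) + 1) * 0 + ?K * (A + 0)"
    by (intro tendsto_intros d0 e0)
  then have "(LINT x|lborel. indicator ?B x * \<bar>f (?T x) - f x\<bar>) \<le> (1 / (1 - \<tau>) ^ CARD('n) + 1) * 0 + ?K * (A + 0)"
    by (rule LIMSEQ_le_const) (use main in blast)
  then show ?thesis by (simp add: A_def)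
qed

text \<open>Comparing the shell between radii \<open>t r\<close> and \<open>r\<close> with the trace on the sphere and letting \<open>t\<close> tend to 1.
  The trace enters as the 0-homogeneous function with the same boundary values.\<close>

lemma trace_inequality:
  fixes x0 :: "real^'n::finite"
  assumes o: "open \<Omega>" and s: "sob \<Omega> f0 G" and f: "continuous_on UNIV f"
    and r: "r > 0" and sub: "ball x0 r \<subseteq> \<Omega>" and eq: "\<And>x. x \<in> ball x0 r \<Longrightarrow> f x = f0 x"
  shows "(LINT x|lborel. indicator (ball x0 r) x * f x)
    \<le> (LINT x|lborel. indicator (ball x0 r) x * f (x0 + r *\<^sub>R sgn (x - x0))) + r * (LINT x|lebesgue_on \<Omega>. indicator (ball x0 r) x * norm (G x))"
proof -
  let ?B = "ball x0 r"
  let ?g = "\<lambda>x. f (x0 + r *\<^sub>R sgn (x - x0))"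
  define A where "A = (LINT x|lebesgue_on \<Omega>. indicator ?B x * norm (G x))"
  define b where "b = measure lborel ?B"
  define Ig where "Ig = (LINT x|lborel. indicator ?B x * ?g x)"
  define F where "F = (LINT x|lborel. indicator ?B x * f x)"
  have A0: "A \<ge> 0" unfolding A_def by (rule Bochner_Integration.integral_nonneg) auto
  obtain C where C: "\<And>x. x \<in> cball x0 r \<Longrightarrow> \<bar>f x\<bar> \<le> C"
  proof -
    have "bounded (f ` cball x0 r)"
      by (intro compact_imp_bounded compact_continuous_image continuous_on_subset[OF f]) auto
    then obtain C where "\<forall>x\<in>cball x0 r. \<bar>f x\<bar> \<le> C" unfolding bounded_iff by auto
    then show ?thesis using that by blast
  qed
  have on_sphere: "x0 + r *\<^sub>R sgn (x - x0) \<in> cball x0 r" for x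
    using r by (simp add: dist_norm norm_sgn)
  have [measurable]: "f \<in> borel_measurable borel" by (rule borel_measurable_continuous_onI[OF f])
  have g_borel [measurable]: "?g \<in> borel_measurable borel" by measurable
  have ind1: "integrable lborel (\<lambda>x. indicator (ball x0 \<rho>) x :: real)" for \<rho>
    using emeasure_bounded_finite[of "ball x0 \<rho>"] by (intro integrable_real_indicator) auto
  have gi: "integrable lborel (\<lambda>x. indicator (ball x0 \<rho>) x * ?g x)" for \<rho>
  proof (rule Bochner_Integration.integrable_bound)
    show "integrable lborel (\<lambda>x. indicator (ball x0 \<rho>) x * C)" using ind1 by simp
    show "(\<lambda>x. indicator (ball x0 \<rho>) x * ?g x) \<in> borel_measurable lborel"
      using g_borel by (intro borel_measurable_times borel_measurable_indicator) auto
    show "AE x in lborel. norm (indicator (ball x0 \<rho>) x * ?g x) \<le> norm (indicator (ball x0 \<rho>) x * C)"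
      using order_trans[OF C[OF on_sphere] abs_ge_self] by (intro AE_I2) (auto simp: indicator_def)
  qed
  have fi: "integrable lborel (\<lambda>x. indicator (ball x0 \<rho>) x * f x)" for \<rho>
    by (intro integrable_indicator_continuous f) auto
  have scale: "(LINT x|lborel. indicator (ball x0 (t * r)) x * k x) = t ^ CARD('n) * (LINT x|lborel. indicator ?B x * k (x0 + t *\<^sub>R (x - x0)))"
    if t: "0 < t" and k: "k \<in> borel_measurable borel" for t and k :: "real^'n \<Rightarrow> real"
  proof -
    have "(\<lambda>x. indicator (ball x0 (t * r)) x * k x) \<in> borel_measurable borel"
      using k by (intro borel_measurable_times borel_measurable_indicator) auto
    from integral_lborel_affine(1)[OF this t, of "(1 - t) *\<^sub>R x0"]
    have "(LINT x|lborel. indicator (ball x0 (t * r)) x * k x) =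
        t ^ CARD('n) * (LINT x|lborel. indicator (ball x0 (t * r)) ((1 - t) *\<^sub>R x0 + t *\<^sub>R x) * k ((1 - t) *\<^sub>R x0 + t *\<^sub>R x))"
      by simp
    also have "(1 - t) *\<^sub>R x0 + t *\<^sub>R x = x0 + t *\<^sub>R (x - x0)" for x by (simp add: algebra_simps)
    moreover have "indicator (ball x0 (t * r)) (x0 + t *\<^sub>R (x - x0)) = (indicator ?B x :: real)" for x
      using t by (auto simp: indicator_def dist_norm norm_minus_commute)
    ultimately show ?thesis by simp
  qed
  \<comment> \<open>The integral over the shell is \<open>F - q * Ft\<close>, and there
    \<open>f\<close> exceeds its boundary values by at most \<open>\<epsilon>\<close>. The
    difference between \<open>F\<close> and \<open>Ft\<close> comes from contracting the ball and is
    paid for by the gradient.\<close>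
  have key: "F \<le> Ig + \<epsilon> * b + r * A / t ^ CARD('n) + (1 - t) * r * A / t ^ CARD('n)"
    if \<epsilon>: "\<epsilon> > 0" and t: "0 < t" "t < 1"
      and near: "\<And>x. x \<in> ?B \<Longrightarrow> x \<notin> ball x0 (t * r) \<Longrightarrow> f x \<le> ?g x + \<epsilon>" for \<epsilon> t
  proof -
    let ?S = "ball x0 (t * r)"
    have SB: "?S \<subseteq> ?B" using t r by (intro subset_ball) (simp add: mult_left_le_one_le)
    define Ft where "Ft = (LINT x|lborel. indicator ?B x * f (x0 + t *\<^sub>R (x - x0)))"
    define q where "q = t ^ CARD('n)"
    have q: "0 < q" "q < 1" "q \<le> t"
      using t power_decreasing[of 1 "CARD('n)" t] by (auto simp: q_def power_less_one_iff)
    have S_f: "(LINT x|lborel. indicator ?S x * f x) = q * Ft"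
      unfolding Ft_def q_def by (rule scale) (use t in auto)
    \<comment> \<open>The radial projection to the sphere does not see a dilation about
      \<open>x0\<close>, so the 0-homogeneous function scales by the volume factor alone.\<close>
    have S_g: "(LINT x|lborel. indicator ?S x * ?g x) = q * Ig"
    proof -
      have "sgn (t *\<^sub>R (x - x0)) = sgn (x - x0)" for x using t by (simp add: sgn_scaleR)
      then show ?thesis
        unfolding Ig_def q_def using scale[of t ?g] t by simp
    qed
    have S_1: "(LINT x|lborel. indicator ?S x) = q * b"
      unfolding b_def q_def using scale[of t "\<lambda>x. 1"] t by simp
    have "F - q * Ft = (LINT x|lborel. indicator ?B x * f x - indicator ?S x * f x)"
      unfolding F_def S_f[symmetric] using fi[of r] fi[of "t * r"] by simp
    also have "\<dots> \<le> (LINT x|lborel. (indicator ?B x * ?g x - indicator ?S x * ?g x) + \<epsilon> * (indicator ?B x - indicator ?S x))"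
    proof (rule integral_mono)
      show "integrable lborel (\<lambda>x. indicator ?B x * f x - indicator ?S x * f x)" using fi by simp
      show "integrable lborel (\<lambda>x. (indicator ?B x * ?g x - indicator ?S x * ?g x) + \<epsilon> * (indicator ?B x - indicator ?S x))"
        using gi[of r] gi[of "t * r"] ind1 by simp
      show "indicator ?B x * f x - indicator ?S x * f x \<le> (indicator ?B x * ?g x - indicator ?S x * ?g x) + \<epsilon> * (indicator ?B x - indicator ?S x)" for x
        using near[of x] SB by (cases "x \<in> ?S"; cases "x \<in> ?B") auto
    qed
    also have "\<dots> = (1 - q) * (Ig + \<epsilon> * b)"
      using gi[of r] gi[of "t * r"] ind1 S_g S_1 by (simp add: Ig_def[symmetric] b_def[symmetric] algebra_simps)
    finally have 1: "F - q * Ft \<le> (1 - q) * (Ig + \<epsilon> * b)" .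
    have 2: "\<bar>F - Ft\<bar> \<le> (1 - t) * r / q * A"
    proof -
      have cT: "continuous_on UNIV (\<lambda>x. f (x0 + t *\<^sub>R (x - x0)))"
        by (intro continuous_on_compose2[OF f] continuous_intros) auto
      have iT: "integrable lborel (\<lambda>x. indicator ?B x * f (x0 + t *\<^sub>R (x - x0)))"
        by (intro integrable_indicator_continuous cT) auto
      have "\<bar>F - Ft\<bar> = \<bar>LINT x|lborel. indicator ?B x * f x - indicator ?B x * f (x0 + t *\<^sub>R (x - x0))\<bar>"
        unfolding F_def Ft_def using iT fi[of r] by simp
      also have "\<dots> \<le> (LINT x|lborel. \<bar>indicator ?B x * f x - indicator ?B x * f (x0 + t *\<^sub>R (x - x0))\<bar>)"
        by (rule integral_abs_bound)
      also have "\<dots> = (LINT x|lborel. indicator ?B x * \<bar>f (x0 + (1 - (1 - t)) *\<^sub>R (x - x0) + 0) - f x\<bar>)"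
        by (intro Bochner_Integration.integral_cong refl) (auto simp: indicator_def)
      also have "\<dots> \<le> (norm (0::real^'n) + (1 - t) * r) / (1 - (1 - t)) ^ CARD('n) * (LINT x|lebesgue_on \<Omega>. indicator (ball x0 (r + norm (0::real^'n))) x * norm (G x))"
        by (rule sob_displacement[OF o s f r]) (use t sub eq in auto)
      finally show ?thesis by (simp add: A_def q_def)
    qed
    have "(1 - q) * Ft \<le> (1 - q) * (Ig + \<epsilon> * b) + (1 - t) * r / q * A" using 1 2 by (simp add: algebra_simps)
    \<comment> \<open>As \<open>q <= t\<close>, the contraction \<open>1 - t\<close> is at most the
      relative volume \<open>1 - q\<close> of the shell. That common factor can then be cancelled,
      which leaves a bound that does not degenerate as \<open>t\<close> tends to 1.\<close>
    also have "\<dots> \<le> (1 - q) * (Ig + \<epsilon> * b) + (1 - q) * r / q * A"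
      using q r A0 by (intro add_left_mono mult_right_mono divide_right_mono) auto
    also have "\<dots> = (1 - q) * (Ig + \<epsilon> * b + r / q * A)" by (simp add: algebra_simps add_divide_distrib)
    finally have "Ft \<le> Ig + \<epsilon> * b + r / q * A" using q by simp
    then show ?thesis using 2 by (simp add: q_def)
  qed
  have "F \<le> Ig + \<epsilon> * b + r * A" if \<epsilon>: "\<epsilon> > 0" for \<epsilon>
  proof -
    have "uniformly_continuous_on (cball x0 r) f"
      by (intro compact_uniformly_continuous continuous_on_subset[OF f]) auto
    then obtain \<delta> where \<delta>: "\<delta> > 0" "\<And>x y. x \<in> cball x0 r \<Longrightarrow> y \<in> cball x0 r \<Longrightarrow> dist y x < \<delta> \<Longrightarrow> dist (f y) (f x) < \<epsilon>"
      unfolding uniformly_continuous_on_def using \<epsilon> by metis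
    \<comment> \<open>The distance from \<open>x\<close> to its radial projection is
      \<open>r - norm (x - x0)\<close>, which is below the modulus of continuity in a thin
      shell.\<close>
    have near: "f x \<le> ?g x + \<epsilon>" if x: "x \<in> ?B" "x \<notin> ball x0 (t * r)" and t: "0 < t" "(1 - t) * r < \<delta>" for x t
    proof -
      have n: "t * r \<le> norm (x - x0)" "norm (x - x0) < r"
        using x by (auto simp: dist_norm norm_minus_commute)
      have ne: "norm (x - x0) > 0" using n(1) t r by (meson mult_pos_pos less_le_trans)
      have "x - (x0 + r *\<^sub>R sgn (x - x0)) = (1 - r / norm (x - x0)) *\<^sub>R (x - x0)"
        by (simp add: sgn_div_norm scaleR_diff_left divide_inverse algebra_simps)
      then have "dist x (x0 + r *\<^sub>R sgn (x - x0)) = \<bar>1 - r / norm (x - x0)\<bar> * norm (x - x0)"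
        by (simp add: dist_norm)
      also have "\<dots> = r - norm (x - x0)" using n ne by (simp add: abs_if field_simps)
      also have "\<dots> < \<delta>" using n t by (simp add: algebra_simps)
      finally have "dist (f x) (?g x) < \<epsilon>"
        using x by (intro \<delta>(2) on_sphere) auto
      then show ?thesis by (simp add: dist_real_def)
    qed
    let ?R = "\<lambda>t. Ig + \<epsilon> * b + r * A / t ^ CARD('n) + (1 - t) * r * A / t ^ CARD('n)"
    have "(?R \<longlongrightarrow> Ig + \<epsilon> * b + r * A / 1 ^ CARD('n) + (1 - 1) * r * A / 1 ^ CARD('n)) (at_left 1)"
      by (intro tendsto_intros) auto
    moreover have "\<forall>\<^sub>F t in at_left 1. F \<le> ?R t"
      unfolding eventually_at_left_field
    proof (intro exI[of _ "max (1/2) (1 - \<delta> / r)"] conjI allI impI)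
      show "max (1/2) (1 - \<delta> / r) < 1" using \<delta> r by simp
      fix t :: real assume t: "max (1/2) (1 - \<delta> / r) < t" "t < 1"
      then have "(1 - t) < \<delta> / r" "0 < t" by auto
      then have "(1 - t) * r < \<delta>" using r by (simp add: pos_less_divide_eq)
      with \<open>0 < t\<close> t show "F \<le> ?R t" by (intro key \<epsilon> near) auto
    qed
    ultimately have "F \<le> Ig + \<epsilon> * b + r * A / 1 ^ CARD('n) + (1 - 1) * r * A / 1 ^ CARD('n)"
      by (intro tendsto_lowerbound) auto
    then show ?thesis by simp
  qed
  then have ev: "\<forall>\<^sub>F \<epsilon> in at_right 0. F \<le> Ig + \<epsilon> * b + r * A"
    unfolding eventually_at_right_field by (intro exI[of _ 1]) auto
  have "((\<lambda>\<epsilon>. Ig + \<epsilon> * b + r * A) \<longlongrightarrow> Ig + 0 * b + r * A) (at_right 0)" by (intro tendsto_intros)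
  then have "F \<le> Ig + 0 * b + r * A" using ev by (rule tendsto_lowerbound) auto
  then show ?thesis by (simp add: F_def Ig_def A_def)
qed

section \<open>Bump functions\<close>

definition bump :: "real^'n::finite \<Rightarrow> real \<Rightarrow> real^'n \<Rightarrow> real" where
  "bump x0 r x = flat 0 (1 - (norm (x - x0))\<^sup>2 / r\<^sup>2)"

lemma smooth_bump_arg: "smooth_on UNIV (\<lambda>x. 1 - (norm (x - x0))\<^sup>2 / r\<^sup>2)"
proof -
  have "smooth_on UNIV (\<lambda>x. 1 - (1 / r\<^sup>2) * (norm (x - x0))\<^sup>2)"
    by (intro smooth_diff smooth_mult smooth_const smooth_norm_sq)
  then show ?thesis by simp
qed

lemma bump_arg_nonpos: "r > 0 \<Longrightarrow> x \<notin> ball x0 r \<Longrightarrow> 1 - (norm (x - x0))\<^sup>2 / r\<^sup>2 \<le> 0"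
proof -
  assume r: "r > 0" and x: "x \<notin> ball x0 r"
  then have "r\<^sup>2 \<le> (norm (x - x0))\<^sup>2" by (intro power_mono) (auto simp: dist_norm norm_minus_commute)
  then show ?thesis using r by simp
qed

lemma flat_bump_outside: "r > 0 \<Longrightarrow> x \<notin> ball x0 r \<Longrightarrow> flat n (1 - (norm (x - x0))\<^sup>2 / r\<^sup>2) = 0"
  using bump_arg_nonpos by (intro flat_nonpos)

lemma bump_outside: "r > 0 \<Longrightarrow> x \<notin> ball x0 r \<Longrightarrow> bump x0 r x = 0"
  unfolding bump_def by (rule flat_bump_outside)

lemma flat_bump_test:
  assumes "r > 0" "cball x0 r \<subseteq> \<Omega>"
  shows "(\<lambda>x. flat n (1 - (norm (x - x0))\<^sup>2 / r\<^sup>2)) \<in> test_functions \<Omega>"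
proof (rule test_functionsI[where K="cball x0 r"])
  show "smooth_on UNIV (\<lambda>x. flat n (1 - (norm (x - x0))\<^sup>2 / r\<^sup>2))"
    by (intro smooth_flat smooth_bump_arg)
  show "flat n (1 - (norm (x - x0))\<^sup>2 / r\<^sup>2) = 0" if "x \<notin> cball x0 r" for x
    using that assms by (intro flat_bump_outside) auto
qed (use assms in auto)

lemma bump_test: "r > 0 \<Longrightarrow> cball x0 r \<subseteq> \<Omega> \<Longrightarrow> bump x0 r \<in> test_functions \<Omega>"
  unfolding bump_def[abs_def] by (rule flat_bump_test)

lemma bump_nonneg: "0 \<le> bump x0 r x" and bump_le_1: "bump x0 r x \<le> 1"
  by (simp_all add: bump_def flat_nonneg flat_le_1)

lemma partial_deriv_bump_arg:
  "partial_deriv i (\<lambda>x. 1 - (norm (x - x0))\<^sup>2 / r\<^sup>2) x = - (2 / r\<^sup>2) * (x $ i - x0 $ i)"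
proof -
  have d: "(\<lambda>x. (norm (x - x0))\<^sup>2) differentiable (at x)" by (rule smooth_differentiable[OF smooth_norm_sq])
  have d': "(\<lambda>x. (1 / r\<^sup>2) * (norm (x - x0))\<^sup>2) differentiable (at x)"
    by (rule smooth_differentiable) (intro smooth_mult smooth_const smooth_norm_sq)
  have "partial_deriv i (\<lambda>x. 1 - (1 / r\<^sup>2) * (norm (x - x0))\<^sup>2) x = 0 - (1 / r\<^sup>2) * (2 * (x $ i - x0 $ i))"
    unfolding partial_deriv_diff[OF differentiable_const d'] partial_deriv_cmult[OF d] partial_deriv_norm_sq partial_deriv_const ..
  then show ?thesis by simp
qed

lemma partial_deriv_flat_bump:
  "partial_deriv i (\<lambda>x. flat n (1 - (norm (x - x0))\<^sup>2 / r\<^sup>2)) x =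
    (flat (n + 2) (1 - (norm (x - x0))\<^sup>2 / r\<^sup>2) - n * flat (n + 1) (1 - (norm (x - x0))\<^sup>2 / r\<^sup>2)) * (- (2 / r\<^sup>2) * (x $ i - x0 $ i))"
  using partial_deriv_compose[OF smooth_differentiable[OF smooth_bump_arg] has_real_derivative_flat]
  by (simp only: partial_deriv_bump_arg)

lemma partial_deriv_bump:
  "partial_deriv i (bump x0 r) x = flat 2 (1 - (norm (x - x0))\<^sup>2 / r\<^sup>2) * (- (2 / r\<^sup>2) * (x $ i - x0 $ i))"
  unfolding bump_def[abs_def] using partial_deriv_flat_bump[of i 0 x0 r x]
  by (simp only: add_0 of_nat_0 mult_zero_left diff_zero)

lemma gradient_bump: "gradient (bump x0 r) x = (- (2 / r\<^sup>2) * flat 2 (1 - (norm (x - x0))\<^sup>2 / r\<^sup>2)) *\<^sub>R (x - x0)"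
  by (simp add: vec_eq_iff partial_deriv_bump)

text \<open>Expanded in \<open>flat 2\<close>, \<open>flat 3\<close> and \<open>flat 4\<close>, so
  that it can be matched with the radius derivative of the averaging kernel and be bounded term by
  term.\<close>

lemma laplacian_bump:
  fixes x0 :: "real^'n::finite" and r :: real
  defines "\<sigma> \<equiv> (\<lambda>x. 1 - (norm (x - x0))\<^sup>2 / r\<^sup>2)"
  shows "laplacian (bump x0 r) x =
    - (2 / r\<^sup>2) * CARD('n) * flat 2 (\<sigma> x) + 4 / r ^ 4 * (norm (x - x0))\<^sup>2 * (flat 4 (\<sigma> x) - 2 * flat 3 (\<sigma> x))"
proof -
  have p1: "partial_deriv i (bump x0 r) = (\<lambda>x. (- (2 / r\<^sup>2) * (x $ i - x0 $ i)) * flat 2 (\<sigma> x))" for i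
    unfolding \<sigma>_def by (simp add: fun_eq_iff partial_deriv_bump)
  have d1: "(\<lambda>x. - (2 / r\<^sup>2) * (x $ i - x0 $ i)) differentiable (at x)" for i
    by (rule smooth_differentiable) (intro smooth_mult smooth_diff smooth_const smooth_nth)
  have d2: "(\<lambda>x. flat 2 (\<sigma> x)) differentiable (at x)"
    unfolding \<sigma>_def by (rule smooth_differentiable) (intro smooth_flat smooth_bump_arg)
  have p2: "partial_deriv i (\<lambda>x. - (2 / r\<^sup>2) * (x $ i - x0 $ i)) x = - (2 / r\<^sup>2)" for i
  proof -
    have d: "(\<lambda>x. x $ i - x0 $ i) differentiable (at x)"
      by (rule smooth_differentiable) (intro smooth_diff smooth_const smooth_nth)
    have "partial_deriv i (\<lambda>x. x $ i - x0 $ i) x = 1"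
      using partial_deriv_diff[OF smooth_differentiable[OF smooth_nth[of i]] differentiable_const[of "x0 $ i"]]
      by (simp add: partial_deriv_nth)
    then show ?thesis unfolding partial_deriv_cmult[OF d] by simp
  qed
  have p3: "partial_deriv i (partial_deriv i (bump x0 r)) x =
      - (2 / r\<^sup>2) * flat 2 (\<sigma> x) + 4 / r ^ 4 * (flat 4 (\<sigma> x) - 2 * flat 3 (\<sigma> x)) * (x $ i - x0 $ i)\<^sup>2" for i
  proof -
    have "partial_deriv i (partial_deriv i (bump x0 r)) x =
      (- (2 / r\<^sup>2) * (x $ i - x0 $ i)) * ((flat 4 (\<sigma> x) - 2 * flat 3 (\<sigma> x)) * (- (2 / r\<^sup>2) * (x $ i - x0 $ i))) + (- (2 / r\<^sup>2)) * flat 2 (\<sigma> x)"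
      unfolding p1 partial_deriv_mult[OF d1 d2] p2
      using partial_deriv_flat_bump[of i 2 x0 r x] by (simp add: \<sigma>_def)
    also have "\<dots> = - (2 / r\<^sup>2) * flat 2 (\<sigma> x) + 4 / r ^ 4 * (flat 4 (\<sigma> x) - 2 * flat 3 (\<sigma> x)) * (x $ i - x0 $ i)\<^sup>2"
      by (simp add: power2_eq_square power4_eq_xxxx field_simps)
    finally show ?thesis .
  qed
  have "(norm (x - x0))\<^sup>2 = (\<Sum>i\<in>UNIV. (x $ i - x0 $ i)\<^sup>2)"
    unfolding power2_norm_eq_inner inner_vec_def by (simp add: power2_eq_square)
  then show ?thesis
    unfolding laplacian_def p3 sum.distrib sum_distrib_left[symmetric] by (simp add: algebra_simps diff_divide_distrib)
qed

text \<open>A single term of the exponential series, \<open>(1 / s) ^ n / fact n\<close>, is at most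
  \<open>exp (1 / s)\<close>.\<close>

lemma flat_bounded: "flat n s \<le> fact n"
proof (cases "s > 0")
  case True
  have "(1 / s) ^ n / fact n \<le> exp (1 / s)"
  proof -
    have "(1 / s) ^ n / fact n = (\<Sum>k\<in>{n}. (1 / s) ^ k /\<^sub>R fact k)" by (simp add: divide_inverse mult.commute)
    also have "\<dots> \<le> (\<Sum>k. (1 / s) ^ k /\<^sub>R fact k)"
      using True by (intro sum_le_suminf summable_exp_generic) auto
    finally show ?thesis by (simp add: exp_def)
  qed
  then have "(1 / s) ^ n \<le> fact n * exp (1 / s)" by (simp only: pos_divide_le_eq[OF fact_gt_zero] mult.commute)
  then have "(1 / s) ^ n * exp (- 1 / s) \<le> fact n * exp (1 / s) * exp (- 1 / s)"
    by (intro mult_right_mono) auto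
  also have "\<dots> = fact n" by (simp add: mult.assoc exp_add[symmetric])
  finally show ?thesis using True by (simp add: flat_def power_divide)
qed simp

lemma norm_gradient_bump:
  assumes "r > 0" shows "norm (gradient (bump x0 r) x) \<le> 4 / r"
proof (cases "x \<in> ball x0 r")
  case True
  have "norm (gradient (bump x0 r) x) = 2 / r\<^sup>2 * flat 2 (1 - (norm (x - x0))\<^sup>2 / r\<^sup>2) * norm (x - x0)"
    unfolding gradient_bump by (simp add: abs_mult flat_nonneg)
  also have "\<dots> \<le> 2 / r\<^sup>2 * 2 * r"
    using True flat_bounded[of 2] by (intro mult_mono) (auto simp: flat_nonneg dist_norm norm_minus_commute)
  also have "\<dots> = 4 / r" using assms by (simp add: power2_eq_square)
  finally show ?thesis .
next
  case False
  then show ?thesis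
    unfolding gradient_bump using flat_bump_outside[OF assms False] assms by simp
qed

text \<open>The constants come from \<open>flat n <= fact n\<close>: \<open>4 N\<close> is
  \<open>2 * N * 2\<close>, and 144 is 4 times \<open>24 + 2 * 6\<close>.\<close>

lemma abs_laplacian_bump:
  fixes x0 :: "real^'n::finite"
  assumes "r > 0" shows "\<bar>laplacian (bump x0 r) x\<bar> \<le> (4 * CARD('n) + 144) / r\<^sup>2"
proof (cases "x \<in> ball x0 r")
  case True
  let ?\<sigma> = "1 - (norm (x - x0))\<^sup>2 / r\<^sup>2"
  have n: "(norm (x - x0))\<^sup>2 \<le> r\<^sup>2" using True by (intro power_mono) (auto simp: dist_norm norm_minus_commute)
  have f: "0 \<le> flat 2 ?\<sigma>" "flat 2 ?\<sigma> \<le> 2" "\<bar>flat 4 ?\<sigma> - 2 * flat 3 ?\<sigma>\<bar> \<le> 36"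
  proof -
    have "flat 3 ?\<sigma> \<le> 6" "flat 4 ?\<sigma> \<le> 24"
      using flat_bounded[of 3 ?\<sigma>] flat_bounded[of 4 ?\<sigma>] by (simp_all add: fact_numeral)
    then show "\<bar>flat 4 ?\<sigma> - 2 * flat 3 ?\<sigma>\<bar> \<le> 36"
      using flat_nonneg[of 4 ?\<sigma>] flat_nonneg[of 3 ?\<sigma>] by linarith
  qed (use flat_bounded[of 2 ?\<sigma>] in \<open>auto simp: flat_nonneg fact_numeral\<close>)
  have "\<bar>laplacian (bump x0 r) x\<bar> \<le> \<bar>2 / r\<^sup>2 * CARD('n) * flat 2 ?\<sigma>\<bar> + \<bar>4 / r ^ 4 * (norm (x - x0))\<^sup>2 * (flat 4 ?\<sigma> - 2 * flat 3 ?\<sigma>)\<bar>"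
    unfolding laplacian_bump mult_minus_left by (rule order_trans[OF abs_triangle_ineq]) simp
  also have "\<bar>2 / r\<^sup>2 * CARD('n) * flat 2 ?\<sigma>\<bar> \<le> 2 / r\<^sup>2 * CARD('n) * 2"
    using f by (simp add: abs_mult divide_right_mono)
  also have "\<bar>4 / r ^ 4 * (norm (x - x0))\<^sup>2 * (flat 4 ?\<sigma> - 2 * flat 3 ?\<sigma>)\<bar> \<le> 4 / r ^ 4 * r\<^sup>2 * 36"
    unfolding abs_mult using f n by (intro mult_mono) auto
  also have "4 / r ^ 4 * r\<^sup>2 * 36 = 144 / r\<^sup>2"
    using assms by (simp add: power2_eq_square power4_eq_xxxx)
  finally show ?thesis by (simp add: add_divide_distrib)
next
  case False
  then show ?thesis
    unfolding laplacian_bump using flat_bump_outside[OF assms False] by simp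
qed

lemma measure_ball_scale:
  fixes x0 :: "real^'n::finite"
  assumes "r > 0" shows "measure lborel (ball x0 r) = r ^ CARD('n) * measure lborel (ball (0::real^'n) 1)"
proof -
  have "measure lborel (ball x0 r) = (LINT x|lborel. indicator (ball x0 r) x)" by simp
  also have "\<dots> = r ^ CARD('n) * (LINT x|lborel. indicator (ball x0 r) (x0 + r *\<^sub>R x))"
    using integral_lborel_affine(1)[OF borel_measurable_indicator assms, of "ball x0 r" x0] by simp
  also have "(\<lambda>x. indicator (ball x0 r) (x0 + r *\<^sub>R x) :: real) = indicator (ball 0 1)"
    using assms by (auto simp: indicator_def fun_eq_iff dist_norm)
  finally show ?thesis by simp
qed

lemma measure_ball_pos:
  fixes x0 :: "real^'n::finite"
  assumes "r > 0" shows "measure lborel (ball x0 r) > 0"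
  using content_ball_pos[OF assms, of x0] by simp

text \<open>On the concentric ball of half the radius the argument of \<open>flat 0\<close> is at
  least 3/4.\<close>

lemma bump_lower: "r > 0 \<Longrightarrow> x \<in> ball x0 (r / 2) \<Longrightarrow> exp (- 4 / 3) \<le> bump x0 r x"
proof -
  assume r: "r > 0" and x: "x \<in> ball x0 (r / 2)"
  have "(norm (x - x0))\<^sup>2 \<le> (r / 2)\<^sup>2" using x by (intro power_mono) (auto simp: dist_norm norm_minus_commute)
  then have s: "3 / 4 \<le> 1 - (norm (x - x0))\<^sup>2 / r\<^sup>2" using r by (simp add: field_simps power2_eq_square)
  then have "1 / (1 - (norm (x - x0))\<^sup>2 / r\<^sup>2) \<le> 1 / (3 / 4)" by (intro divide_left_mono) auto
  then have "- 4 / 3 \<le> - 1 / (1 - (norm (x - x0))\<^sup>2 / r\<^sup>2)" by simp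
  moreover have "0 < 1 - (norm (x - x0))\<^sup>2 / r\<^sup>2" using s by linarith
  ultimately show ?thesis unfolding bump_def flat_def by simp
qed

section \<open>Local norms\<close>

text \<open>The sphere measure is an image of Lebesgue measure on the unit ball under radial
  projection, so surface integrals are volume integrals of the 0-homogeneous extension. In this form
  they meet \<open>trace_inequality\<close>.\<close>

lemma sphere_measure_integral:
  fixes x0 :: "real^'n::finite" and k :: "real^'n \<Rightarrow> real"
  assumes r: "r > 0" and k: "continuous_on UNIV k"
  shows "(LINT x:sphere x0 r|sphere_measure x0 r. k x) =
    CARD('n) / r * (LINT x|lborel. indicator (ball x0 r) x * k (x0 + r *\<^sub>R sgn (x - x0)))"
proof -
  let ?c = "CARD('n) * r ^ (CARD('n) - 1) :: real"
  let ?h = "\<lambda>x. indicator (sphere x0 r) x *\<^sub>R k x"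
  let ?R = "restrict_space lborel (ball (0::real^'n) 1)"
  let ?S = "\<lambda>y. x0 + r *\<^sub>R sgn y"
  have [measurable]: "k \<in> borel_measurable borel" by (rule borel_measurable_continuous_onI[OF k])
  have h: "?h \<in> borel_measurable borel" by (intro borel_measurable_scaleR borel_measurable_indicator) auto
  have S: "?S \<in> ?R \<rightarrow>\<^sub>M borel" by (intro measurable_restrict_space1) measurable
  have hS: "(\<lambda>y. ?h (?S y)) \<in> borel_measurable ?R" using measurable_compose[OF S h] .
  have sc: "scale_measure (ennreal ?c) ?R = density ?R (\<lambda>_. ennreal ?c)"
    by (rule measure_eqI) (auto simp: emeasure_density nn_integral_cmult_indicator)
  have "(LINT x:sphere x0 r|sphere_measure x0 r. k x) = (LINT y|scale_measure (ennreal ?c) ?R. ?h (?S y))"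
    unfolding set_lebesgue_integral_def sphere_measure_def
    using S h by (intro integral_distr) (auto cong: measurable_cong_sets)
  also have "\<dots> = ?c * (LINT y|?R. ?h (?S y))"
    unfolding sc using hS r by (subst integral_density) auto
  also have "(LINT y|?R. ?h (?S y)) = (LINT y|lborel. indicator (ball 0 1) y *\<^sub>R ?h (?S y))"
    by (rule integral_restrict_space) auto
  also have "\<dots> = (LINT y|lborel. indicator (ball 0 1) y * k (?S y))"
  proof (rule integral_cong_AE)
    \<comment> \<open>As \<open>sgn 0 = 0\<close>, the origin is sent to the centre
      \<open>x0\<close>, which is off the sphere; this single point is a null set.\<close>
    have "AE y in lborel. y \<noteq> (0::real^'n)" using AE_lborel_singleton[of "0::real^'n"] by simp
    then show "AE y in lborel. indicator (ball 0 1) y *\<^sub>R ?h (?S y) = indicator (ball 0 1) y * k (?S y)"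
      by eventually_elim (use r in \<open>auto simp: indicator_def dist_norm norm_sgn\<close>)
    have S': "?S \<in> borel \<rightarrow>\<^sub>M borel" by measurable
    show "(\<lambda>y. indicator (ball 0 1) y *\<^sub>R ?h (?S y)) \<in> borel_measurable lborel"
      "(\<lambda>y. indicator (ball 0 1) y * k (?S y)) \<in> borel_measurable lborel"
      using measurable_compose[OF S' h] measurable_compose[OF S', of k borel]
      by (auto intro!: borel_measurable_scaleR borel_measurable_times borel_measurable_indicator)
  qed
  also have "\<dots> = (LINT x|lborel. indicator (ball x0 r) x * k (x0 + r *\<^sub>R sgn (x - x0))) / r ^ CARD('n)"
  proof -
    have "(\<lambda>x. indicator (ball x0 r) x * k (x0 + r *\<^sub>R sgn (x - x0))) \<in> borel_measurable borel"
    proof (intro borel_measurable_times borel_measurable_indicator)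
      have "(\<lambda>x. x0 + r *\<^sub>R sgn (x - x0)) \<in> borel \<rightarrow>\<^sub>M borel" by measurable
      then show "(\<lambda>x. k (x0 + r *\<^sub>R sgn (x - x0))) \<in> borel_measurable borel"
        by (rule measurable_compose) measurable
    qed auto
    from integral_lborel_affine(1)[OF this r, of x0]
    have "(LINT x|lborel. indicator (ball x0 r) x * k (x0 + r *\<^sub>R sgn (x - x0))) =
      r ^ CARD('n) * (LINT x|lborel. indicator (ball x0 r) (x0 + r *\<^sub>R x) * k (x0 + r *\<^sub>R sgn (r *\<^sub>R x)))" by simp
    also have "(\<lambda>x. indicator (ball x0 r) (x0 + r *\<^sub>R x) :: real) = indicator (ball 0 1)"
      using r by (auto simp: indicator_def fun_eq_iff dist_norm)
    then have "(LINT x|lborel. indicator (ball x0 r) (x0 + r *\<^sub>R x) * k (x0 + r *\<^sub>R sgn (r *\<^sub>R x))) = (LINT y|lborel. indicator (ball 0 1) y * k (?S y))"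
      using r by (simp add: sgn_scaleR fun_eq_iff)
    finally show ?thesis using r by simp
  qed
  also have "?c * ((LINT x|lborel. indicator (ball x0 r) x * k (x0 + r *\<^sub>R sgn (x - x0))) / r ^ CARD('n))
      = CARD('n) / r * (LINT x|lborel. indicator (ball x0 r) x * k (x0 + r *\<^sub>R sgn (x - x0)))"
  proof -
    have "r ^ CARD('n) = r * r ^ (CARD('n) - 1)" using zero_less_card_finite[where 'a='n] by (metis power_eq_if neq0_conv)
    then show ?thesis using r by simp
  qed
  finally show ?thesis .
qed

lemma lebesgue_on_subset_integral:
  fixes f :: "real^'n::finite \<Rightarrow> real"
  assumes "open \<Omega>" "open B" "B \<subseteq> \<Omega>"
  shows "(LINT x|lebesgue_on B. f x) = (LINT x|lebesgue_on \<Omega>. indicator B x * f x)"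
proof -
  have "(LINT x|lebesgue_on B. f x) = (LINT x|lebesgue. indicator B x *\<^sub>R f x)"
    using assms by (intro integral_restrict_space) auto
  also have "\<dots> = (LINT x|lebesgue. indicator \<Omega> x *\<^sub>R (indicator B x * f x))"
    using assms(3) by (intro Bochner_Integration.integral_cong refl) (auto simp: indicator_def)
  also have "\<dots> = (LINT x|lebesgue_on \<Omega>. indicator B x * f x)"
    using assms by (intro integral_restrict_space[symmetric]) auto
  finally show ?thesis .
qed

text \<open>Stated for vanishing gradient only. For a test function, integrating by parts against
  \<open>x $ i * \<phi> x\<close> shows that the integral of \<open>\<phi>^2\<close> is -2 times
  that of \<open>\<phi> * x_i * d_i \<phi>\<close>, hence at most \<open>2 R\<close> times the
  product of the two norms; this inequality passes to the limit.\<close>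

lemma poincare:
  fixes \<Omega> :: "(real^'n::finite) set"
  assumes o: "open \<Omega>" and b: "bounded \<Omega>" and s: "sob \<Omega> f G" and z: "(LINT x|lebesgue_on \<Omega>. (norm (G x))\<^sup>2) = 0"
  shows "(LINT x|lebesgue_on \<Omega>. (f x)\<^sup>2) = 0"
proof -
  let ?M = "lebesgue_on \<Omega>"
  obtain R where R: "\<And>x. x \<in> \<Omega> \<Longrightarrow> norm x \<le> R" using b unfolding bounded_iff by blast
  obtain i :: 'n where True by simp
  obtain \<phi> where \<phi>: "\<And>m. \<phi> m \<in> test_functions \<Omega>"
    "(\<lambda>m. LINT x|?M. (norm (f x - \<phi> m x))\<^sup>2) \<longlonglongrightarrow> 0"
    "(\<lambda>m. LINT x|?M. (norm (G x - gradient (\<phi> m) x))\<^sup>2) \<longlonglongrightarrow> 0"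
    using sobE[OF s] by blast
  note L = test_L2[OF o \<phi>(1)]
  have le: "(LINT x|?M. (norm (\<phi> m x))\<^sup>2) \<le> 2 * \<bar>R\<bar> * (sqrt (LINT x|?M. (norm (\<phi> m x))\<^sup>2) * sqrt (LINT x|?M. (norm (gradient (\<phi> m) x))\<^sup>2))" for m
  proof -
    have t: "(\<lambda>x. x $ i * \<phi> m x) \<in> test_functions \<Omega>" by (rule test_mult_left[OF smooth_nth \<phi>(1)])
    have p: "partial_deriv i (\<lambda>x. x $ i * \<phi> m x) x = x $ i * partial_deriv i (\<phi> m) x + \<phi> m x" for x
      using partial_deriv_mult[OF smooth_differentiable[OF smooth_nth[of i]] test_differentiable[OF \<phi>(1)[of m]]]
      by (simp add: partial_deriv_nth)
    have "(LINT x|?M. \<phi> m x * (x $ i * partial_deriv i (\<phi> m) x + \<phi> m x)) = - (LINT x|?M. partial_deriv i (\<phi> m) x * (x $ i * \<phi> m x))"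
      using test_by_parts[OF o \<phi>(1) t, of m i] unfolding p .
    moreover have i1: "integrable ?M (\<lambda>x. \<phi> m x * (x $ i * partial_deriv i (\<phi> m) x))"
      using L2_mult_integrable[OF L(1)[of m] test_L2(1)[OF o test_mult_left[OF smooth_nth[of i] test_partial_deriv[OF \<phi>(1)[of m], of i]]]] .
    moreover have i2: "integrable ?M (\<lambda>x. (\<phi> m x)\<^sup>2)" using L2_integrable[OF L(1)[of m]] by simp
    moreover have "(LINT x|?M. \<phi> m x * (x $ i * partial_deriv i (\<phi> m) x + \<phi> m x)) = (LINT x|?M. \<phi> m x * (x $ i * partial_deriv i (\<phi> m) x)) + (LINT x|?M. (\<phi> m x)\<^sup>2)"
      by (subst Bochner_Integration.integral_add[OF i1 i2, symmetric]) (simp add: algebra_simps power2_eq_square)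
    moreover have "(LINT x|?M. partial_deriv i (\<phi> m) x * (x $ i * \<phi> m x)) = (LINT x|?M. \<phi> m x * (x $ i * partial_deriv i (\<phi> m) x))"
      by (intro Bochner_Integration.integral_cong) auto
    ultimately have "(LINT x|?M. (\<phi> m x)\<^sup>2) = - 2 * (LINT x|?M. \<phi> m x * (x $ i * partial_deriv i (\<phi> m) x))" by simp
    also have "\<dots> \<le> 2 * (LINT x|?M. \<bar>R\<bar> * (norm (\<phi> m x) * norm (gradient (\<phi> m) x)))"
    proof -
      have "- (LINT x|?M. \<phi> m x * (x $ i * partial_deriv i (\<phi> m) x)) = (LINT x|?M. - (\<phi> m x * (x $ i * partial_deriv i (\<phi> m) x)))" by simp
      also have "\<dots> \<le> (LINT x|?M. \<bar>R\<bar> * (norm (\<phi> m x) * norm (gradient (\<phi> m) x)))"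
      proof (rule integral_mono)
        show "integrable ?M (\<lambda>x. \<bar>R\<bar> * (norm (\<phi> m x) * norm (gradient (\<phi> m) x)))"
          using L2_norm_mult_integrable[OF L(1)[of m] L(2)[of m]] by simp
        fix x assume "x \<in> space ?M"
        then have "\<bar>x $ i\<bar> \<le> \<bar>R\<bar>" using R[of x] component_le_norm_cart[of x i] by simp
        moreover have "\<bar>partial_deriv i (\<phi> m) x\<bar> \<le> norm (gradient (\<phi> m) x)"
          using component_le_norm_cart[of "gradient (\<phi> m) x" i] by simp
        ultimately have "\<bar>x $ i * partial_deriv i (\<phi> m) x\<bar> \<le> \<bar>R\<bar> * norm (gradient (\<phi> m) x)"
          unfolding abs_mult by (intro mult_mono) auto
        then have "\<bar>\<phi> m x\<bar> * \<bar>x $ i * partial_deriv i (\<phi> m) x\<bar> \<le> \<bar>\<phi> m x\<bar> * (\<bar>R\<bar> * norm (gradient (\<phi> m) x))"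
          by (rule mult_left_mono) auto
        then show "- (\<phi> m x * (x $ i * partial_deriv i (\<phi> m) x)) \<le> \<bar>R\<bar> * (norm (\<phi> m x) * norm (gradient (\<phi> m) x))"
          unfolding abs_mult[symmetric] by (simp add: algebra_simps abs_le_iff)
      qed (use i1 in simp)
      finally show ?thesis by simp
    qed
    also have "\<dots> = 2 * \<bar>R\<bar> * (LINT x|?M. norm (\<phi> m x) * norm (gradient (\<phi> m) x))" by simp
    also have "\<dots> \<le> 2 * \<bar>R\<bar> * (sqrt (LINT x|?M. (norm (\<phi> m x))\<^sup>2) * sqrt (LINT x|?M. (norm (gradient (\<phi> m) x))\<^sup>2))"
      by (intro mult_left_mono L2_norm_CS L) auto
    finally show ?thesis by simp
  qed
  have c1: "(\<lambda>m. LINT x|?M. (norm (\<phi> m x))\<^sup>2) \<longlonglongrightarrow> (LINT x|?M. (norm (f x))\<^sup>2)"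
    using L2_tendsto_inner[OF sobD(1)[OF s] sobD(1)[OF s] L(1) L(1) \<phi>(2) \<phi>(2)] by (simp add: power2_eq_square)
  have c2: "(\<lambda>m. LINT x|?M. (norm (gradient (\<phi> m) x))\<^sup>2) \<longlonglongrightarrow> 0"
    using L2_tendsto_inner[OF sobD(2)[OF s] sobD(2)[OF s] L(2) L(2) \<phi>(3) \<phi>(3)] z by (simp add: power2_norm_eq_inner)
  have "(LINT x|?M. (norm (f x))\<^sup>2) \<le> 2 * \<bar>R\<bar> * (sqrt (LINT x|?M. (norm (f x))\<^sup>2) * sqrt 0)"
  proof (rule LIMSEQ_le[OF c1])
    show "(\<lambda>m. 2 * \<bar>R\<bar> * (sqrt (LINT x|?M. (norm (\<phi> m x))\<^sup>2) * sqrt (LINT x|?M. (norm (gradient (\<phi> m) x))\<^sup>2)))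
        \<longlonglongrightarrow> 2 * \<bar>R\<bar> * (sqrt (LINT x|?M. (norm (f x))\<^sup>2) * sqrt 0)"
      by (intro tendsto_intros c1 c2)
  qed (use le in blast)
  then have "(LINT x|?M. (f x)\<^sup>2) \<le> 0" by simp
  moreover have "0 \<le> (LINT x|?M. (f x)\<^sup>2)" by (rule Bochner_Integration.integral_nonneg) auto
  ultimately show ?thesis by (rule order_antisym)
qed

text \<open>First \<open>c\<close> is chosen so that the term quadratic in \<open>c\<close> takes at
  most half of the gain \<open>l c \<kappa> / 4\<close>. All other terms then carry a factor
  \<open>\<delta>\<close> and, with total coefficient \<open>Q\<close>, take less than the other
  half.\<close>

lemma smallness_arith:
  fixes l \<kappa> \<omega> :: real
  assumes "l > 0" "\<kappa> > 0" "\<omega> > 0" "E \<ge> 0" "k > 0"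
  obtains c \<delta> where "0 < c" "c \<le> 1" "0 < \<delta>" "\<delta> \<le> 1" "\<delta>\<^sup>2 \<le> l / 2" "2 * k * sqrt \<omega> * \<delta> \<le> c * \<kappa> / 2"
    "8 * \<delta> * c * sqrt \<omega> + 16 * c\<^sup>2 * \<omega> + 12 * k * sqrt \<omega> * \<delta> * (E + 8 * c * sqrt \<omega> + 16 * c\<^sup>2 * \<omega>) < l * c * \<kappa> / 4"
proof -
  \<comment> \<open>The number 128 turns \<open>c <= l \<kappa> / (128 \<omega>)\<close> into
    \<open>16 c^2 \<omega> <= l c \<kappa> / 8\<close>.\<close>
  define c where "c = min 1 (l * \<kappa> / (128 * \<omega>))"
  have c: "0 < c" "c \<le> 1" using assms by (auto simp: c_def)
  have "c \<le> l * \<kappa> / (128 * \<omega>)" by (simp add: c_def)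
  then have "128 * \<omega> * c \<le> l * \<kappa>" using assms by (simp add: pos_le_divide_eq mult.commute)
  then have "c * (128 * \<omega> * c) \<le> c * (l * \<kappa>)" using c by (intro mult_left_mono) auto
  then have c16: "16 * c\<^sup>2 * \<omega> \<le> l * c * \<kappa> / 8" by (simp add: power2_eq_square algebra_simps)
  define Q where "Q = 8 * c * sqrt \<omega> + 12 * k * sqrt \<omega> * (E + 8 * c * sqrt \<omega> + 16 * c\<^sup>2 * \<omega>)"
  have Q: "Q > 0" unfolding Q_def using assms c by (intro add_pos_nonneg mult_nonneg_nonneg) auto
  define \<delta> where "\<delta> = Min {1, l / 2, c * \<kappa> / (4 * k * sqrt \<omega>), l * c * \<kappa> / (16 * Q)}"
  have pos: "0 < \<delta>" unfolding \<delta>_def using assms c Q by (subst Min_gr_iff) auto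
  have le: "\<delta> \<le> 1" "\<delta> \<le> l / 2" "\<delta> \<le> c * \<kappa> / (4 * k * sqrt \<omega>)" "\<delta> \<le> l * c * \<kappa> / (16 * Q)"
    unfolding \<delta>_def by (auto intro!: Min_le)
  have "\<delta>\<^sup>2 \<le> \<delta>" using pos le(1) by (simp add: power2_eq_square mult_left_le)
  moreover have "2 * k * sqrt \<omega> * \<delta> \<le> c * \<kappa> / 2"
    using le(3) assms by (simp add: pos_le_divide_eq algebra_simps)
  moreover have "\<delta> * Q < l * c * \<kappa> / 8"
  proof -
    have "\<delta> * (16 * Q) \<le> l * c * \<kappa>" using le(4) Q by (simp add: pos_le_divide_eq)
    then have "16 * (\<delta> * Q) \<le> l * c * \<kappa>" by simp
    moreover have "0 < l * c * \<kappa>" using assms c by simp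
    ultimately show ?thesis by linarith
  qed
  then have "8 * \<delta> * c * sqrt \<omega> + 16 * c\<^sup>2 * \<omega> + 12 * k * sqrt \<omega> * \<delta> * (E + 8 * c * sqrt \<omega> + 16 * c\<^sup>2 * \<omega>) < l * c * \<kappa> / 4"
    using c16 by (simp add: Q_def algebra_simps)
  ultimately show ?thesis using that c pos le by simp
qed

text \<open>Values of \<open>u\<close> outside \<open>\<Omega>\<close> are arbitrary, whereas
  displacement and averages ask for functions continuous on the whole space; Tietze extension
  supplies them without change on the ball.\<close>

lemma continuous_extension_cball:
  fixes f :: "real^'n::finite \<Rightarrow> real"
  assumes "continuous_on \<Omega> f" "cball x0 r \<subseteq> \<Omega>"
  obtains g where "continuous_on UNIV g" "\<And>x. x \<in> cball x0 r \<Longrightarrow> g x = f x"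
  using Tietze_unbounded[of "cball x0 r" f UNIV] continuous_on_subset[OF assms] by auto

context segregated_minimizer
begin

definition gnorm :: "real^'n \<Rightarrow> real \<Rightarrow> 'k \<Rightarrow> real" where
  "gnorm x0 r i = (LINT x|M. indicator (ball x0 r) x * (norm (G i x))\<^sup>2)"

text \<open>The surface integral of the squared component over the sphere, times
  \<open>r / N\<close>, written as a volume integral of the 0-homogeneous extension.\<close>

definition tnorm :: "real^'n \<Rightarrow> real \<Rightarrow> 'k \<Rightarrow> real" where
  "tnorm x0 r i = (LINT x|lborel. indicator (ball x0 r) x * (u (x0 + r *\<^sub>R sgn (x - x0)) $ i)\<^sup>2)"

lemma gnorm_nonneg: "0 \<le> gnorm x0 r i" and tnorm_nonneg: "0 \<le> tnorm x0 r i"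
  unfolding gnorm_def tnorm_def by (auto intro: Bochner_Integration.integral_nonneg)

lemma on_sphere_in_cball: "r > 0 \<Longrightarrow> x0 + r *\<^sub>R sgn (x - x0) \<in> cball x0 r" for x0 :: "real^'n"
  by (simp add: dist_norm norm_sgn)

lemma local_norm_sq_eq:
  assumes r: "r > 0" and sub: "cball x0 r \<subseteq> \<Omega>"
  shows "local_norm_sq \<Omega> (\<lambda>x. u x $ i) x0 r =
    1 / r ^ (CARD('n) - 2) * gnorm x0 r i + CARD('n) / r ^ CARD('n) * tnorm x0 r i"
proof -
  obtain f where f: "continuous_on UNIV f" "\<And>x. x \<in> cball x0 r \<Longrightarrow> f x = u x $ i"
    using continuous_extension_cball[OF cont_nth sub] by blast
  have "(LINT x:sphere x0 r|sphere_measure x0 r. (u x $ i)\<^sup>2) = (LINT x:sphere x0 r|sphere_measure x0 r. (f x)\<^sup>2)"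
    unfolding set_lebesgue_integral_def
    by (intro Bochner_Integration.integral_cong refl) (auto simp: indicator_def f(2))
  also have "\<dots> = CARD('n) / r * (LINT x|lborel. indicator (ball x0 r) x * (f (x0 + r *\<^sub>R sgn (x - x0)))\<^sup>2)"
    by (rule sphere_measure_integral[OF r]) (intro continuous_intros f)
  also have "(LINT x|lborel. indicator (ball x0 r) x * (f (x0 + r *\<^sub>R sgn (x - x0)))\<^sup>2) = tnorm x0 r i"
    unfolding tnorm_def using f(2)[OF on_sphere_in_cball[OF r]] by simp
  finally have S: "(LINT x:sphere x0 r|sphere_measure x0 r. (u x $ i)\<^sup>2) = CARD('n) / r * tnorm x0 r i" .
  have sub': "ball x0 r \<subseteq> \<Omega>" using sub ball_subset_cball by blast
  have w: "has_weak_gradient \<Omega> (\<lambda>y. u y $ i) (G i)" by (rule sob_weak[OF open_dom sob_u])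
  have m: "indicator (ball x0 r) \<in> borel_measurable M"
    using ball_lebesgue_on(1)[OF open_dom sub'] by simp
  have mw: "(\<lambda>x. (norm (weak_gradient \<Omega> (\<lambda>y. u y $ i) x))\<^sup>2) \<in> borel_measurable M"
    using measurable_compose[OF weak_gradient_borel[OF open_dom w], of "\<lambda>v. (norm v)\<^sup>2" borel] by simp
  have mG: "(\<lambda>x. (norm (G i x))\<^sup>2) \<in> borel_measurable M"
    using measurable_compose[OF L2_measurable[OF L2_G], of "\<lambda>v. (norm v)\<^sup>2" borel] by simp
  have "(LINT x|lebesgue_on (ball x0 r). (norm (weak_gradient \<Omega> (\<lambda>y. u y $ i) x))\<^sup>2)
      = (LINT x|M. indicator (ball x0 r) x * (norm (weak_gradient \<Omega> (\<lambda>y. u y $ i) x))\<^sup>2)"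
    by (rule lebesgue_on_subset_integral[OF open_dom open_ball sub'])
  also have "\<dots> = gnorm x0 r i"
    unfolding gnorm_def using weak_gradient_AE[OF open_dom w] m mw mG
    by (intro integral_cong_AE borel_measurable_times) (auto elim: eventually_mono)
  finally have D: "(LINT x|lebesgue_on (ball x0 r). (norm (weak_gradient \<Omega> (\<lambda>y. u y $ i) x))\<^sup>2) = gnorm x0 r i" .
  have "r ^ CARD('n) = r * r ^ (CARD('n) - 1)"
    using zero_less_card_finite[where 'a='n] by (metis power_eq_if neq0_conv)
  then show ?thesis unfolding local_norm_sq_def S D using r by simp
qed

lemma local_norm_sq_parts:
  assumes r: "r > 0" and sub: "cball x0 r \<subseteq> \<Omega>"
  shows "(local_norm \<Omega> u x0 r)\<^sup>2 = (\<Sum>i\<in>UNIV. 1 / r ^ (CARD('n) - 2) * gnorm x0 r i + CARD('n) / r ^ CARD('n) * tnorm x0 r i)"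
  unfolding local_norm_def local_norm_sq_eq[OF assms]
  using r gnorm_nonneg tnorm_nonneg by (intro real_sqrt_pow2 sum_nonneg add_nonneg_nonneg mult_nonneg_nonneg) auto

lemma gradient_L1_ball:
  assumes sub: "ball x0 r \<subseteq> \<Omega>"
  shows "(LINT x|M. indicator (ball x0 r) x * norm (G i x)) \<le> sqrt (measure lborel (ball x0 r)) * sqrt (gnorm x0 r i)"
proof -
  let ?B = "ball x0 r"
  note B = ball_lebesgue_on[OF open_dom sub]
  have m: "(\<lambda>x. indicator ?B x *\<^sub>R G i x) \<in> borel_measurable M"
    using B(1) by (intro borel_measurable_scaleR borel_measurable_indicator L2_measurable[OF L2_G])
  have L: "L2 M (\<lambda>x. indicator ?B x *\<^sub>R G i x)"
    by (rule L2_bound[OF L2_G m, where c=1]) (auto simp: indicator_def)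
  have "(LINT x|M. indicator ?B x * norm (G i x)) = (LINT x|M. indicator ?B x * norm (indicator ?B x *\<^sub>R G i x))"
    by (intro Bochner_Integration.integral_cong refl) (auto simp: indicator_def)
  also have "\<dots> \<le> sqrt (measure M ?B) * sqrt (LINT x|M. (norm (indicator ?B x *\<^sub>R G i x))\<^sup>2)"
    by (rule L2_imp_L1_on(2)[OF B(1,2) L])
  also have "(LINT x|M. (norm (indicator ?B x *\<^sub>R G i x))\<^sup>2) = gnorm x0 r i"
    unfolding gnorm_def by (intro Bochner_Integration.integral_cong refl) (auto simp: indicator_def)
  finally show ?thesis using B(3) by simp
qed

text \<open>The trace inequality bounds the mass by a boundary term and \<open>r\<close> times a
  gradient term. By Cauchy-Schwarz each of them is at most \<open>sqrt \<omega> * r ^ N\<close>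
  times the local norm, whence the factor 2.\<close>

lemma mass_in_ball:
  assumes N: "2 \<le> CARD('n)" and r: "r > 0" and sub: "cball x0 r \<subseteq> \<Omega>"
  shows "(LINT x|M. indicator (ball x0 r) x * u x $ i)
    \<le> 2 * sqrt (measure lborel (ball (0::real^'n) 1)) * r ^ CARD('n) * local_norm \<Omega> u x0 r"
proof -
  let ?B = "ball x0 r"
  define \<omega> where "\<omega> = measure lborel (ball (0::real^'n) 1)"
  define ln0 where "ln0 = local_norm \<Omega> u x0 r"
  have ln0_nonneg: "ln0 \<ge> 0" unfolding ln0_def local_norm_def
    by (intro real_sqrt_ge_zero sum_nonneg)
       (use r gnorm_nonneg tnorm_nonneg in \<open>auto simp: local_norm_sq_eq[OF r sub] intro!: add_nonneg_nonneg\<close>)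
  have sub': "?B \<subseteq> \<Omega>" using sub ball_subset_cball by blast
  have mB: "measure lborel ?B = r ^ CARD('n) * \<omega>" unfolding \<omega>_def by (rule measure_ball_scale[OF r])
  have \<omega>0: "\<omega> \<ge> 0" by (simp add: \<omega>_def)
  obtain f where f: "continuous_on UNIV f" "\<And>x. x \<in> cball x0 r \<Longrightarrow> f x = u x $ i"
    using continuous_extension_cball[OF cont_nth sub] by blast
  \<comment> \<open>The exponent \<open>CARD('n) - 2\<close> is a truncated subtraction; here the
    dimension hypothesis enters.\<close>
  have rp: "r ^ CARD('n) = r\<^sup>2 * r ^ (CARD('n) - 2)"
    using N by (metis le_add_diff_inverse power_add)
  have parts: "1 / r ^ (CARD('n) - 2) * gnorm x0 r i + CARD('n) / r ^ CARD('n) * tnorm x0 r i \<le> ln0\<^sup>2"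
    unfolding ln0_def local_norm_sq_parts[OF r sub]
    using r gnorm_nonneg tnorm_nonneg by (intro member_le_sum) (auto intro!: add_nonneg_nonneg)
  have nn1: "0 \<le> CARD('n) / r ^ CARD('n) * tnorm x0 r i" and nn2: "0 \<le> 1 / r ^ (CARD('n) - 2) * gnorm x0 r i"
    using r gnorm_nonneg tnorm_nonneg by (intro mult_nonneg_nonneg; simp)+
  have "1 / r ^ (CARD('n) - 2) * gnorm x0 r i \<le> ln0\<^sup>2" using parts nn1 by linarith
  then have g_le: "gnorm x0 r i \<le> r ^ (CARD('n) - 2) * ln0\<^sup>2" using r by (simp add: field_simps)
  have "1 / r ^ CARD('n) * tnorm x0 r i \<le> CARD('n) / r ^ CARD('n) * tnorm x0 r i"
    using r tnorm_nonneg N by (intro mult_right_mono divide_right_mono) auto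
  then have "1 / r ^ CARD('n) * tnorm x0 r i \<le> ln0\<^sup>2" using parts nn2 by linarith
  then have t_le: "tnorm x0 r i \<le> r ^ CARD('n) * ln0\<^sup>2" using r by (simp add: field_simps)
  have eqM: "(LINT x|lborel. indicator ?B x * f x) = (LINT x|M. indicator ?B x * u x $ i)"
  proof -
    have "(LINT x|M. indicator ?B x * f x) = (LINT x|lborel. indicator ?B x * f x)"
    proof (rule lebesgue_on_test(2)[OF open_dom])
      show "(\<lambda>x. indicator ?B x * f x) \<in> borel_measurable borel"
        using f by (intro borel_measurable_times borel_measurable_indicator borel_measurable_continuous_onI) auto
      show "indicator ?B x * f x = 0" if "x \<notin> \<Omega>" for x
      proof -
        have "x \<notin> ?B" using that sub' by blast
        then show ?thesis by simp
      qed
    qed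
    moreover have "(LINT x|M. indicator ?B x * f x) = (LINT x|M. indicator ?B x * u x $ i)"
      using f(2) by (intro Bochner_Integration.integral_cong refl) (auto simp: indicator_def)
    ultimately show ?thesis by simp
  qed
  have tr: "(LINT x|lborel. indicator ?B x * f x)
    \<le> (LINT x|lborel. indicator ?B x * f (x0 + r *\<^sub>R sgn (x - x0))) + r * (LINT x|M. indicator ?B x * norm (G i x))"
    using f(2) by (intro trace_inequality[OF open_dom sob_u f(1) r sub']) auto
  have 1: "(LINT x|lborel. indicator ?B x * f (x0 + r *\<^sub>R sgn (x - x0))) \<le> sqrt (measure lborel ?B) * sqrt (tnorm x0 r i)"
  proof -
    define F where "F x = indicator ?B x * f (x0 + r *\<^sub>R sgn (x - x0))" for x
    have meas: "F \<in> borel_measurable lborel"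
    proof -
      have "(\<lambda>x. x0 + r *\<^sub>R sgn (x - x0)) \<in> borel \<rightarrow>\<^sub>M borel" by measurable
      then have "(\<lambda>x. f (x0 + r *\<^sub>R sgn (x - x0))) \<in> borel_measurable borel"
        by (rule measurable_compose) (rule borel_measurable_continuous_onI[OF f(1)])
      then show ?thesis unfolding F_def[abs_def] by (intro borel_measurable_times borel_measurable_indicator) auto
    qed
    have "bounded (f ` cball x0 r)"
      by (intro compact_imp_bounded compact_continuous_image continuous_on_subset[OF f(1)]) auto
    then obtain C where C: "\<forall>x\<in>cball x0 r. \<bar>f x\<bar> \<le> C" unfolding bounded_iff by auto
    have fin: "emeasure lborel ?B < \<infinity>" using emeasure_bounded_finite[of ?B] by simp
    have LI: "L2 lborel (indicator ?B :: _ \<Rightarrow> real)" using fin by (intro L2_indicator) auto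
    have LF: "L2 lborel F"
    proof (rule L2_bound[OF LI meas, where c=C])
      show "AE x in lborel. norm (F x) \<le> C * norm (indicator ?B x :: real)"
        using C on_sphere_in_cball[OF r, of x0] by (intro AE_I2) (auto simp: F_def indicator_def)
    qed
    have "(LINT x|lborel. F x) \<le> (LINT x|lborel. indicator ?B x * norm (F x))"
    proof (rule integral_mono_AE)
      show "integrable lborel (\<lambda>x. indicator ?B x * norm (F x))" using fin LF by (intro L2_imp_L1_on) auto
      have "integrable lborel (\<lambda>x. (indicator ?B x :: real) * F x)" by (rule L2_mult_integrable[OF LI LF])
      moreover have "(\<lambda>x. (indicator ?B x :: real) * F x) = F" by (auto simp: F_def indicator_def)
      ultimately show "integrable lborel F" by simp
      show "AE x in lborel. F x \<le> indicator ?B x * norm (F x)"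
        by (rule AE_I2) (auto simp: F_def indicator_def)
    qed
    also have "\<dots> \<le> sqrt (measure lborel ?B) * sqrt (LINT x|lborel. (norm (F x))\<^sup>2)"
      using fin LF by (intro L2_imp_L1_on) auto
    also have "(LINT x|lborel. (norm (F x))\<^sup>2) = tnorm x0 r i"
      unfolding tnorm_def using f(2)[OF on_sphere_in_cball[OF r]]
      by (intro Bochner_Integration.integral_cong refl) (auto simp: F_def indicator_def)
    finally show ?thesis by (simp add: F_def)
  qed
  note 2 = gradient_L1_ball[OF sub', of i]
  have s1: "sqrt (measure lborel ?B) * sqrt (tnorm x0 r i) \<le> sqrt \<omega> * r ^ CARD('n) * ln0"
  proof -
    have "sqrt (measure lborel ?B) * sqrt (tnorm x0 r i) \<le> sqrt (r ^ CARD('n) * \<omega>) * sqrt (r ^ CARD('n) * ln0\<^sup>2)"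
      unfolding mB using t_le r \<omega>0 by (intro mult_left_mono) auto
    also have "\<dots> = sqrt ((r ^ CARD('n))\<^sup>2 * (\<omega> * ln0\<^sup>2))"
      by (simp add: real_sqrt_mult[symmetric] power2_eq_square mult_ac)
    also have "\<dots> = sqrt \<omega> * r ^ CARD('n) * ln0" using r ln0_nonneg by (simp add: real_sqrt_mult)
    finally show ?thesis .
  qed
  have s2: "r * (sqrt (measure lborel ?B) * sqrt (gnorm x0 r i)) \<le> sqrt \<omega> * r ^ CARD('n) * ln0"
  proof -
    have "sqrt (measure lborel ?B) * sqrt (gnorm x0 r i) \<le> sqrt (r ^ CARD('n) * \<omega>) * sqrt (r ^ (CARD('n) - 2) * ln0\<^sup>2)"
      unfolding mB using g_le r \<omega>0 by (intro mult_left_mono) auto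
    also have "\<dots> = sqrt ((r * r ^ (CARD('n) - 2))\<^sup>2 * (\<omega> * ln0\<^sup>2))"
      unfolding rp by (simp add: real_sqrt_mult[symmetric] power2_eq_square mult_ac)
    also have "\<dots> = sqrt \<omega> * (r * r ^ (CARD('n) - 2)) * ln0" using r ln0_nonneg by (simp add: real_sqrt_mult)
    finally have "r * (sqrt (measure lborel ?B) * sqrt (gnorm x0 r i)) \<le> r * (sqrt \<omega> * (r * r ^ (CARD('n) - 2)) * ln0)"
      using r by (intro mult_left_mono) auto
    then show ?thesis unfolding rp by (simp add: power2_eq_square mult_ac)
  qed
  have "r * (LINT x|M. indicator ?B x * norm (G i x)) \<le> r * (sqrt (measure lborel ?B) * sqrt (gnorm x0 r i))"
    using 2 r by (intro mult_left_mono) auto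
  then show ?thesis using tr 1 s1 s2 unfolding eqM \<omega>_def[symmetric] ln0_def[symmetric] by linarith
qed

text \<open>With zero energy the component would vanish almost everywhere, against its mass 1. This
  energy is what the competitor saves per unit of gained mass, so non-degeneracy rests on
  it.\<close>

lemma component_energy_pos:
  assumes "bounded \<Omega>"
  shows "0 < (LINT x|M. (norm (G i x))\<^sup>2)"
proof (rule ccontr)
  assume "\<not> ?thesis"
  moreover have "0 \<le> (LINT x|M. (norm (G i x))\<^sup>2)" by (rule Bochner_Integration.integral_nonneg) auto
  ultimately have "(LINT x|M. (norm (G i x))\<^sup>2) = 0" by linarith
  then have z: "(LINT x|M. (u x $ i)\<^sup>2) = 0" by (rule poincare[OF open_dom assms sob_u])
  have "integrable M (\<lambda>x. (u x $ i)\<^sup>2)" using L2_integrable[OF L2_u] by simp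
  then have "AE x in M. (u x $ i)\<^sup>2 = 0" using z by (subst (asm) integral_nonneg_eq_0_iff_AE) auto
  then have "AE x in M. u x $ i = 0" by eventually_elim simp
  then have "(LINT x|M. u x $ i) = 0" by (rule integral_eq_zero_AE)
  then show False using u_mass[of i] by simp
qed


lemma nondegenerate:
  assumes N: "2 \<le> CARD('n)" and bdd: "bounded \<Omega>" and x0: "x0 \<in> \<Omega>"
  obtains \<delta> r0 where "\<delta> > 0" "r0 > 0" "\<And>r. 0 < r \<Longrightarrow> r < r0 \<Longrightarrow> \<delta> * r\<^sup>2 \<le> local_norm \<Omega> u x0 r"
proof -
  obtain R where R: "R > 0" "cball x0 R \<subseteq> \<Omega>" using open_dom x0 open_contains_cball by blast
  obtain i :: 'k where True by simp
  define \<omega> where "\<omega> = measure lborel (ball (0::real^'n) 1)"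
  \<comment> \<open>A lower bound for the integral of the bump, relative to \<open>r ^ N\<close>:
    its value is at least \<open>exp (- 4 / 3)\<close> on the ball of half the radius.\<close>
  define \<kappa> where "\<kappa> = exp (- 4 / 3) * (1 / 2) ^ CARD('n) * \<omega>"
  define l where "l = (LINT x|M. (norm (G i x))\<^sup>2)"
  define k where "k = real CARD('k)"
  have \<omega>: "\<omega> > 0" unfolding \<omega>_def by (rule measure_ball_pos) simp
  have \<kappa>: "\<kappa> > 0" using \<omega> by (simp add: \<kappa>_def)
  have l: "l > 0" unfolding l_def by (rule component_energy_pos[OF bdd])
  have k: "k > 0" by (simp add: k_def)
  obtain c \<delta> where c: "0 < c" "c \<le> 1" and \<delta>: "0 < \<delta>" "\<delta> \<le> 1" "\<delta>\<^sup>2 \<le> l / 2"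
    and sm: "2 * k * sqrt \<omega> * \<delta> \<le> c * \<kappa> / 2"
    "8 * \<delta> * c * sqrt \<omega> + 16 * c\<^sup>2 * \<omega> + 12 * k * sqrt \<omega> * \<delta> * (E + 8 * c * sqrt \<omega> + 16 * c\<^sup>2 * \<omega>) < l * c * \<kappa> / 4"
    by (rule smallness_arith[OF l \<kappa> \<omega> E_nonneg k])
  \<comment> \<open>Below 1 and \<open>1 / (\<omega> + 1)\<close> the scale \<open>\<rho>\<close> is
    at most \<open>r\<close> and the mass \<open>I\<close> of the bump at most 1, as
    \<open>push_balance\<close> demands.\<close>
  define r0 where "r0 = min R (min 1 (1 / (\<omega> + 1)))"
  have "\<delta> * r\<^sup>2 \<le> local_norm \<Omega> u x0 r" if r: "0 < r" "r < r0" for r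
  proof (rule ccontr)
    assume "\<not> ?thesis"
    then have small: "local_norm \<Omega> u x0 r \<le> \<delta> * r\<^sup>2" by simp
    let ?B = "ball x0 r"
    \<comment> \<open>The common scale \<open>r ^ (N + 2)\<close>: the mass of the bump is
      comparable to it, and \<open>s\<close>, \<open>g\<close> and \<open>Z\<close> are at most
      constants times it.\<close>
    define \<rho> where "\<rho> = r\<^sup>2 * r ^ CARD('n)"
    define \<phi> where "\<phi> x = c * r\<^sup>2 * bump x0 r x" for x
    define I where "I = (LINT x|M. \<phi> x)"
    define s where "s = (LINT x|M. indicator ?B x * (\<Sum>j\<in>UNIV. u x $ j))"
    define g where "g = (LINT x|M. indicator ?B x * (\<Sum>j\<in>UNIV. (norm (G j x))\<^sup>2))"
    define Z where "Z = (LINT x|M. (norm (gradient \<phi> x))\<^sup>2)"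
    have r1: "r < R" "r < 1" "r * (\<omega> + 1) < 1"
    proof -
      have "r < 1 / (\<omega> + 1)" and *: "r < R" "r < 1" using r by (auto simp: r0_def)
      then show "r * (\<omega> + 1) < 1" using \<omega> by (subst (asm) pos_less_divide_eq) auto
    qed (use r in \<open>simp_all add: r0_def\<close>)
    have sub: "cball x0 r \<subseteq> \<Omega>" using R r1 by (meson less_imp_le order_trans subset_cball)
    have sub': "?B \<subseteq> \<Omega>" using sub ball_subset_cball by blast
    have \<rho>: "0 < \<rho>" "\<rho> \<le> r" "\<rho> \<le> 1"
    proof -
      show "0 < \<rho>" using r by (simp add: \<rho>_def)
      have "r\<^sup>2 * r ^ CARD('n) = r ^ (2 + CARD('n))" by (rule power_add[symmetric])
      also have "\<dots> \<le> r ^ 1" using r r1 by (intro power_decreasing) auto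
      finally show "\<rho> \<le> r" by (simp add: \<rho>_def)
      then show "\<rho> \<le> 1" using r1 by simp
    qed
    note B = ball_lebesgue_on[OF open_dom sub']
    have mB: "measure lborel ?B = r ^ CARD('n) * \<omega>" unfolding \<omega>_def by (rule measure_ball_scale[OF r(1)])
    have \<phi>t: "\<phi> \<in> test_functions \<Omega>"
      unfolding \<phi>_def[abs_def] by (intro test_cmult bump_test r sub)
    have pos: "0 \<le> \<phi> x" for x unfolding \<phi>_def using c bump_nonneg by (intro mult_nonneg_nonneg) auto
    have out: "\<phi> x = 0" if "x \<notin> ?B" for x using bump_outside[OF r(1) that] by (simp add: \<phi>_def)
    have Iint: "I = (LINT x|lborel. \<phi> x)"
      unfolding I_def using out sub' by (intro lebesgue_on_test(2)[OF open_dom test_borel[OF \<phi>t]]) blast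
    have ind: "integrable lborel (\<lambda>x. a * indicator (ball x0 t) x :: real)" for a t
      using emeasure_bounded_finite[of "ball x0 t"] by (intro integrable_mult_right integrable_real_indicator) auto
    have I_low: "c * \<kappa> * \<rho> \<le> I"
    proof -
      have "c * \<kappa> * \<rho> = (LINT x|lborel. c * r\<^sup>2 * exp (- 4 / 3) * indicator (ball x0 (r / 2)) x)"
        using measure_ball_scale[of "r / 2" x0] r by (simp add: \<kappa>_def \<rho>_def \<omega>_def power_divide mult_ac)
      also have "\<dots> \<le> I"
        unfolding Iint
      proof (rule integral_mono[OF ind test_integrable[OF \<phi>t]])
        fix x
        show "c * r\<^sup>2 * exp (- 4 / 3) * indicator (ball x0 (r / 2)) x \<le> \<phi> x"
        proof (cases "x \<in> ball x0 (r / 2)")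
          case True
          have "c * r\<^sup>2 * exp (- 4 / 3) \<le> c * r\<^sup>2 * bump x0 r x"
            using bump_lower[OF r(1) True] c by (intro mult_left_mono) auto
          then show ?thesis using True by (simp add: \<phi>_def)
        qed (use pos in simp)
      qed
      finally show ?thesis .
    qed
    have I_up: "I \<le> c * \<omega> * \<rho>"
    proof -
      have "I \<le> (LINT x|lborel. c * r\<^sup>2 * indicator ?B x)"
        unfolding Iint
      proof (rule integral_mono[OF test_integrable[OF \<phi>t] ind])
        fix x
        show "\<phi> x \<le> c * r\<^sup>2 * indicator ?B x"
          using out[of x] bump_le_1[of x0 r x] c by (cases "x \<in> ?B") (auto simp: \<phi>_def mult_left_le)
      qed
      also have "\<dots> = c * \<omega> * \<rho>" using mB by (simp add: \<rho>_def mult_ac)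
      finally show ?thesis .
    qed
    have I1: "I \<le> 1"
    proof -
      have "c * \<omega> * \<rho> \<le> 1 * \<omega> * r" using c \<omega> \<rho> by (intro mult_mono) auto
      also have "\<dots> \<le> 1" using r1 r by (simp add: algebra_simps)
      finally show ?thesis using I_up by linarith
    qed
    have s_le: "s \<le> 2 * k * sqrt \<omega> * \<delta> * \<rho>"
    proof -
      have i: "integrable M (\<lambda>x. indicator ?B x * u x $ j)" for j
        using integrable_mult_indicator[OF B(1) u_integrable[of j]] by simp
      have "s = (LINT x|M. (\<Sum>j\<in>UNIV. indicator ?B x * u x $ j))" by (simp add: s_def sum_distrib_left)
      also have "\<dots> = (\<Sum>j\<in>UNIV. LINT x|M. indicator ?B x * u x $ j)"
        by (rule Bochner_Integration.integral_sum[OF i])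
      also have "\<dots> \<le> (\<Sum>j\<in>(UNIV::'k set). 2 * sqrt \<omega> * r ^ CARD('n) * (\<delta> * r\<^sup>2))"
      proof (rule sum_mono)
        fix j
        have "(LINT x|M. indicator ?B x * u x $ j) \<le> 2 * sqrt \<omega> * r ^ CARD('n) * local_norm \<Omega> u x0 r"
          unfolding \<omega>_def by (rule mass_in_ball[OF N r(1) sub])
        also have "\<dots> \<le> 2 * sqrt \<omega> * r ^ CARD('n) * (\<delta> * r\<^sup>2)"
          using small r \<omega> by (intro mult_left_mono) auto
        finally show "(LINT x|M. indicator ?B x * u x $ j) \<le> 2 * sqrt \<omega> * r ^ CARD('n) * (\<delta> * r\<^sup>2)" .
      qed
      also have "\<dots> = 2 * k * sqrt \<omega> * \<delta> * \<rho>" by (simp add: k_def \<rho>_def mult_ac)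
      finally show ?thesis .
    qed
    have g_le: "g \<le> \<delta>\<^sup>2 * \<rho>"
    proof -
      have i: "integrable M (\<lambda>x. indicator ?B x * (norm (G j x))\<^sup>2)" for j
        using integrable_mult_indicator[OF B(1) L2_integrable[OF L2_G[of j]]] by simp
      have "g = (LINT x|M. (\<Sum>j\<in>UNIV. indicator ?B x * (norm (G j x))\<^sup>2))" by (simp add: g_def sum_distrib_left)
      also have "\<dots> = (\<Sum>j\<in>UNIV. gnorm x0 r j)"
        unfolding gnorm_def by (rule Bochner_Integration.integral_sum[OF i])
      finally have g: "g = (\<Sum>j\<in>UNIV. gnorm x0 r j)" .
      have "1 / r ^ (CARD('n) - 2) * g \<le> (local_norm \<Omega> u x0 r)\<^sup>2"
        unfolding local_norm_sq_parts[OF r(1) sub] g sum_distrib_left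
        using r tnorm_nonneg by (intro sum_mono) auto
      also have "\<dots> \<le> (\<delta> * r\<^sup>2)\<^sup>2"
      proof (rule power_mono[OF small])
        show "0 \<le> local_norm \<Omega> u x0 r" unfolding local_norm_def
          by (intro real_sqrt_ge_zero sum_nonneg)
             (use r gnorm_nonneg tnorm_nonneg in \<open>auto simp: local_norm_sq_eq[OF r(1) sub] intro!: add_nonneg_nonneg\<close>)
      qed
      finally have "g \<le> (\<delta> * r\<^sup>2)\<^sup>2 * r ^ (CARD('n) - 2)" using r by (simp add: pos_divide_le_eq)
      also have "\<dots> = \<delta>\<^sup>2 * \<rho>"
      proof -
        have "r ^ CARD('n) = r\<^sup>2 * r ^ (CARD('n) - 2)" using N by (metis le_add_diff_inverse power_add)
        then show ?thesis by (simp add: \<rho>_def power2_eq_square mult_ac)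
      qed
      finally show ?thesis .
    qed
    have g0: "0 \<le> g" unfolding g_def by (rule Bochner_Integration.integral_nonneg) (simp add: sum_nonneg)
    have s0: "0 \<le> s" unfolding s_def
      by (rule Bochner_Integration.integral_nonneg) (auto intro!: mult_nonneg_nonneg sum_nonneg u_nonneg)
    have Z0: "0 \<le> Z" unfolding Z_def by (rule Bochner_Integration.integral_nonneg) simp
    have Z_le: "Z \<le> 16 * c\<^sup>2 * \<omega> * \<rho>"
    proof -
      have gr: "gradient \<phi> x = (c * r\<^sup>2) *\<^sub>R gradient (bump x0 r) x" for x
        unfolding \<phi>_def[abs_def] by (rule gradient_cmult[OF test_differentiable[OF bump_test[OF r(1) sub]]])
      have "(norm (gradient \<phi> x))\<^sup>2 \<le> (4 * c * r)\<^sup>2 * indicator ?B x" for x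
      proof (cases "x \<in> ?B")
        case True
        have "norm (gradient \<phi> x) = c * r\<^sup>2 * norm (gradient (bump x0 r) x)" using c by (simp add: gr abs_mult)
        also have "\<dots> \<le> c * r\<^sup>2 * (4 / r)" using c norm_gradient_bump[OF r(1), of x0 x] by (intro mult_left_mono) auto
        also have "\<dots> = 4 * c * r" using r by (simp add: power2_eq_square)
        finally show ?thesis using True by (simp add: power_mono del: power_mult_distrib)
      next
        case False
        then show ?thesis unfolding gr gradient_bump using flat_bump_outside[OF r(1) False] by simp
      qed
      then have "Z \<le> (LINT x|M. (4 * c * r)\<^sup>2 * indicator ?B x)"
        unfolding Z_def using B(1,2)
        by (intro integral_mono L2_integrable test_L2(2)[OF open_dom \<phi>t] integrable_mult_right integrable_real_indicator) auto
      also have "\<dots> = (4 * c * r)\<^sup>2 * (r ^ CARD('n) * \<omega>)"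
        using B mB sub' by (simp add: Int_absorb2)
      also have "\<dots> = 16 * c\<^sup>2 * \<omega> * \<rho>" by (simp add: \<rho>_def power_mult_distrib mult_ac)
      finally show ?thesis .
    qed
    have gZ: "sqrt g * sqrt Z \<le> 4 * \<delta> * c * sqrt \<omega> * \<rho>"
    proof -
      have "sqrt g * sqrt Z = sqrt (g * Z)" by (simp add: real_sqrt_mult)
      also have "\<dots> \<le> sqrt ((\<delta>\<^sup>2 * \<rho>) * (16 * c\<^sup>2 * \<omega> * \<rho>))"
        using g_le Z_le g0 Z0 by (intro real_sqrt_le_mono mult_mono) auto
      also have "(\<delta>\<^sup>2 * \<rho>) * (16 * c\<^sup>2 * \<omega> * \<rho>) = (4 * \<delta> * c * \<rho>)\<^sup>2 * \<omega>" by (simp add: power2_eq_square)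
      also have "sqrt ((4 * \<delta> * c * \<rho>)\<^sup>2 * \<omega>) = 4 * \<delta> * c * \<rho> * sqrt \<omega>"
        using \<delta> c \<rho> by (simp add: real_sqrt_mult)
      finally show ?thesis by (simp add: mult_ac)
    qed
    have sI: "s \<le> I / 2"
    proof -
      have "2 * k * sqrt \<omega> * \<delta> * \<rho> \<le> c * \<kappa> / 2 * \<rho>" using sm(1) \<rho> by (intro mult_right_mono) auto
      then show ?thesis using s_le I_low by simp
    qed
    have bal: "(l - g) * (I / 2) \<le> 2 * sqrt g * sqrt Z + Z + 6 * s * (E + 2 * sqrt g * sqrt Z + Z)"
      unfolding l_def
      by (rule push_balance[OF \<phi>t pos B(1) out s_def I_def g_def Z_def sI I1])
    \<comment> \<open>The gain, from below: since \<open>g\<close> is at most \<open>l / 2\<close>,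
      half of the energy of component \<open>i\<close> remains, multiplied by half of the least
      possible mass of the bump.\<close>
    have "l / 2 * (c * \<kappa> * \<rho> / 2) \<le> (l - g) * (I / 2)"
    proof (rule mult_mono)
      have "\<delta>\<^sup>2 * \<rho> \<le> l / 2 * 1" using \<delta> \<rho> l by (intro mult_mono) auto
      then show "l / 2 \<le> l - g" using g_le by simp
      then show "0 \<le> l - g" using l by simp
    qed (use I_low c \<kappa> \<rho> in auto)
    also note bal
    also have "2 * sqrt g * sqrt Z + Z + 6 * s * (E + 2 * sqrt g * sqrt Z + Z)
      \<le> 8 * \<delta> * c * sqrt \<omega> * \<rho> + 16 * c\<^sup>2 * \<omega> * \<rho> + 6 * (2 * k * sqrt \<omega> * \<delta> * \<rho>) * (E + 8 * c * sqrt \<omega> + 16 * c\<^sup>2 * \<omega>)"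
    proof -
      have 1: "2 * sqrt g * sqrt Z \<le> 8 * \<delta> * c * sqrt \<omega> * \<rho>" using gZ by linarith
      \<comment> \<open>Inside the bracket the factors \<open>\<delta>\<close> and
        \<open>\<rho>\<close> are bounded by 1 and dropped, because \<open>s\<close> in front of it
        already carries both; this makes the total proportional to \<open>\<rho>\<close>.\<close>
      have "\<delta> * \<rho> * (8 * c * sqrt \<omega>) \<le> 1 * (8 * c * sqrt \<omega>)"
        using \<delta> \<rho> c \<omega> by (intro mult_right_mono mult_le_one) auto
      then have 2: "2 * sqrt g * sqrt Z \<le> 8 * c * sqrt \<omega>" using 1 by (simp add: mult_ac)
      have "(16 * c\<^sup>2 * \<omega>) * \<rho> \<le> (16 * c\<^sup>2 * \<omega>) * 1" using c \<omega> \<rho> by (intro mult_left_mono) auto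
      then have 3: "Z \<le> 16 * c\<^sup>2 * \<omega>" using Z_le by simp
      have 4: "6 * s * (E + 2 * sqrt g * sqrt Z + Z) \<le> 6 * (2 * k * sqrt \<omega> * \<delta> * \<rho>) * (E + 8 * c * sqrt \<omega> + 16 * c\<^sup>2 * \<omega>)"
      proof (rule mult_mono)
        have "0 \<le> 2 * sqrt g * sqrt Z" using g0 Z0 by (intro mult_nonneg_nonneg) auto
        then show "0 \<le> E + 2 * sqrt g * sqrt Z + Z" using E_nonneg Z0 by linarith
        show "E + 2 * sqrt g * sqrt Z + Z \<le> E + 8 * c * sqrt \<omega> + 16 * c\<^sup>2 * \<omega>" using 2 3 by linarith
        show "6 * s \<le> 6 * (2 * k * sqrt \<omega> * \<delta> * \<rho>)" using s_le by linarith
        then show "0 \<le> 6 * (2 * k * sqrt \<omega> * \<delta> * \<rho>)" using s0 by linarith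
      qed
      show ?thesis using 1 Z_le 4 by linarith
    qed
    also have "\<dots> = \<rho> * (8 * \<delta> * c * sqrt \<omega> + 16 * c\<^sup>2 * \<omega> + 12 * k * sqrt \<omega> * \<delta> * (E + 8 * c * sqrt \<omega> + 16 * c\<^sup>2 * \<omega>))"
      by (simp add: algebra_simps)
    also have "\<dots> < \<rho> * (l * c * \<kappa> / 4)" using sm(2) \<rho> by (intro mult_strict_left_mono) auto
    finally show False by (simp add: mult_ac)
  qed
  moreover have "r0 > 0" using R \<omega> by (simp add: r0_def)
  ultimately show ?thesis using that \<delta>(1) by blast
qed

end

section \<open>The mean value inequality\<close>

text \<open>Up to the factor \<open>- s^N / s^2\<close>, this is the coefficient of
  \<open>z - x\<close> in \<open>gradient (bump x s) z\<close>; that origin makes its derivative in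
  \<open>s\<close> a Laplacian of the bump. It is not normalized to mass 1, but by scaling its mass
  \<open>ker_mass\<close> depends on the dimension only.\<close>

definition ker :: "real \<Rightarrow> real^'n::finite \<Rightarrow> real^'n \<Rightarrow> real" where
  "ker s x z = 2 / s ^ CARD('n) * flat 2 (1 - (norm (z - x))\<^sup>2 / s\<^sup>2)"

definition avg :: "(real^'n::finite \<Rightarrow> real) \<Rightarrow> real \<Rightarrow> real^'n \<Rightarrow> real" where
  "avg f s x = (LINT z|lborel. f z * ker s x z)"

definition ker_mass :: "'n::finite itself \<Rightarrow> real" where
  "ker_mass _ = (LINT z|lborel. ker 1 (0::real^'n) z)"

definition bump_mass :: "'n::finite itself \<Rightarrow> real" where
  "bump_mass _ = (LINT z|lborel. bump (0::real^'n) 1 z)"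

lemma ker_sym: "ker s x z = ker s z x"
  by (simp add: ker_def norm_minus_commute)

lemma ker_nonneg: "s > 0 \<Longrightarrow> 0 \<le> ker s x z"
  by (simp add: ker_def flat_nonneg)

lemma ker_outside: "s > 0 \<Longrightarrow> z \<notin> ball x s \<Longrightarrow> ker s x z = 0"
  unfolding ker_def using flat_bump_outside by simp

lemma continuous_on_flat [continuous_intros]: "continuous_on A f \<Longrightarrow> continuous_on A (\<lambda>x. flat n (f x))"
  by (rule continuous_on_compose2[OF continuous_at_imp_continuous_on[of UNIV "flat n"]]) (auto simp: isCont_flat)

lemma ker_continuous: "continuous_on UNIV (ker s x)"
  unfolding ker_def[abs_def] by (cases "s = 0") (auto intro!: continuous_intros)

lemma ker_continuous_pair: "continuous_on UNIV (\<lambda>(x, z). ker s x z)"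
  unfolding ker_def[abs_def] case_prod_beta by (cases "s = 0") (auto intro!: continuous_intros)

lemma ker_scale: "s > 0 \<Longrightarrow> ker s x (x + s *\<^sub>R y) = ker 1 0 y / s ^ CARD('n)" for x :: "real^'n::finite"
  by (simp add: ker_def power_mult_distrib)

lemma f_ker_integrable:
  assumes "s > 0" "continuous_on UNIV f"
  shows "integrable lborel (\<lambda>z. f z * ker s x z)"
proof (rule compact_support_integrable[where K="cball x s"])
  show "continuous_on UNIV (\<lambda>z. f z * ker s x z)" by (intro continuous_intros assms(2) ker_continuous)
  show "f z * ker s x z = 0" if "z \<notin> cball x s" for z
    using ker_outside[OF assms(1), of z x] that ball_subset_cball[of x s] by auto
qed auto

lemma avg_scale:
  fixes x :: "real^'n::finite"
  assumes s: "s > 0" and f: "continuous_on UNIV f"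
  shows "avg f s x = (LINT y|lborel. f (x + s *\<^sub>R y) * ker 1 0 y)"
proof -
  have "(\<lambda>z. f z * ker s x z) \<in> borel_measurable borel"
    by (intro borel_measurable_continuous_onI continuous_intros f ker_continuous)
  from integral_lborel_affine(1)[OF this s, of x] show ?thesis
    using s by (simp add: avg_def ker_scale)
qed

lemma ker_integral: "s > 0 \<Longrightarrow> (LINT z|lborel. ker s (x::real^'n::finite) z) = ker_mass TYPE('n)"
  using avg_scale[of s "\<lambda>z. 1" x] by (simp add: avg_def ker_mass_def)

lemma ker_integrable: "s > 0 \<Longrightarrow> integrable lborel (ker s x)"
  using f_ker_integrable[of s "\<lambda>z. 1" x] by simp

lemma bump_integral:
  fixes x :: "real^'n::finite"
  assumes s: "s > 0" shows "(LINT z|lborel. bump x s z) = s ^ CARD('n) * bump_mass TYPE('n)"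
proof -
  have "bump x s \<in> borel_measurable borel" using test_borel[OF bump_test[OF s, of x UNIV]] by simp
  from integral_lborel_affine(1)[OF this s, of x] show ?thesis
    using s by (simp add: bump_mass_def bump_def power_mult_distrib)
qed

lemma integral_pos_of_ball:
  fixes f :: "real^'n::finite \<Rightarrow> real"
  assumes f: "integrable lborel f" "\<And>x. 0 \<le> f x" and c: "c > 0" "\<And>x. x \<in> ball 0 (1/2) \<Longrightarrow> c \<le> f x"
  shows "0 < (LINT x|lborel. f x)"
proof -
  have "0 < (LINT x|lborel. c * indicator (ball (0::real^'n) (1/2)) x)"
    using c measure_ball_pos[of "1/2" "0::real^'n"] by simp
  also have "\<dots> \<le> (LINT x|lborel. f x)"
  proof (rule integral_mono[OF _ f(1)])
    show "integrable lborel (\<lambda>x. c * indicator (ball (0::real^'n) (1/2)) x)"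
      using emeasure_bounded_finite[of "ball (0::real^'n) (1/2)"]
      by (intro integrable_mult_right integrable_real_indicator) auto
    show "c * indicator (ball 0 (1/2)) x \<le> f x" for x using f(2)[of x] c(2)[of x] by (auto simp: indicator_def)
  qed
  finally show ?thesis .
qed

lemma bump_mass_pos: "bump_mass TYPE('n::finite) > 0"
  unfolding bump_mass_def
  by (rule integral_pos_of_ball[where c="exp (- 4 / 3)"])
     (use bump_lower[of 1 _ "0::real^'n"] test_integrable[OF bump_test[of 1 "0::real^'n" UNIV]] in \<open>auto simp: bump_nonneg\<close>)

lemma ker_mass_pos: "ker_mass TYPE('n::finite) > 0"
  unfolding ker_mass_def
proof (rule integral_pos_of_ball[where c="2 * exp (- 4 / 3)"])
  show "integrable lborel (ker 1 (0::real^'n))" by (rule ker_integrable) simp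
  fix x :: "real^'n"
  show "0 \<le> ker 1 0 x" by (rule ker_nonneg) simp
  assume x: "x \<in> ball 0 (1/2)"
  define \<sigma> where "\<sigma> = 1 - (norm x)\<^sup>2"
  have "(norm x)\<^sup>2 \<le> (1/2)\<^sup>2" using x by (intro power_mono) auto
  then have \<sigma>: "3/4 \<le> \<sigma>" "\<sigma> \<le> 1" by (auto simp: \<sigma>_def power2_eq_square)
  have "exp (- 4 / 3) \<le> flat 0 \<sigma>" using bump_lower[of 1 x "0::real^'n"] x by (simp add: bump_def \<sigma>_def)
  also have "\<dots> \<le> flat 2 \<sigma>" using \<sigma> by (simp add: flat_def pos_le_divide_eq mult_left_le power_le_one)
  finally show "2 * exp (- 4 / 3) \<le> ker 1 0 x" by (simp add: ker_def \<sigma>_def)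
qed simp

lemma lborel_integral_cbox:
  fixes k :: "real^'n::finite \<Rightarrow> real"
  assumes "continuous_on UNIV k" "\<And>z. z \<notin> cbox a b \<Longrightarrow> k z = 0"
  shows "(LINT z|lborel. k z) = integral (cbox a b) k"
proof -
  have i: "integrable lborel k" by (rule compact_support_integrable[where K="cbox a b"]) (use assms in auto)
  have "(LINT z|lborel. k z) = integral UNIV k" by (rule integral_lborel[OF i, symmetric])
  also have "\<dots> = integral UNIV (\<lambda>z. if z \<in> cbox a b then k z else 0)"
    by (intro Henstock_Kurzweil_Integration.integral_cong) (use assms(2) in auto)
  also have "\<dots> = integral (cbox a b) k" by (rule integral_restrict_UNIV)
  finally show ?thesis .
qed

text \<open>The identity behind the mean value property: the radial derivative of the kernel is the Laplacian
  of a multiple of the bump function.\<close>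

lemma ker_deriv:
  fixes x z :: "real^'n::finite"
  assumes s: "s > 0"
  shows "((\<lambda>s. ker s x z) has_real_derivative (s / s ^ CARD('n) * laplacian (bump x s) z)) (at s)"
proof -
  define q where "q = (norm (z - x))\<^sup>2"
  let ?\<sigma> = "1 - q / s\<^sup>2"
  have 1: "((\<lambda>s. 1 - q / s\<^sup>2) has_real_derivative (2 * q / s ^ 3)) (at s)"
    using s by (auto intro!: derivative_eq_intros simp: power2_eq_square power3_eq_cube field_simps)
  have 2: "((\<lambda>s. flat 2 (1 - q / s\<^sup>2)) has_real_derivative ((flat 4 ?\<sigma> - 2 * flat 3 ?\<sigma>) * (2 * q / s ^ 3))) (at s)"
    using DERIV_chain2[OF has_real_derivative_flat[of 2 ?\<sigma>] 1] by simp
  have 3: "((\<lambda>s. 2 / s ^ CARD('n)) has_real_derivative (- 2 * CARD('n) / (s * s ^ CARD('n)))) (at s)"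
  proof -
    have "s ^ CARD('n) = s * s ^ (CARD('n) - 1)"
      using zero_less_card_finite[where 'a='n] by (metis power_eq_if neq0_conv)
    then show ?thesis using s
      by (auto intro!: derivative_eq_intros simp: field_simps)
  qed
  have e: "2 / s ^ CARD('n) * ((flat 4 ?\<sigma> - 2 * flat 3 ?\<sigma>) * (2 * q / s ^ 3)) + - 2 * CARD('n) / (s * s ^ CARD('n)) * flat 2 ?\<sigma>
     = s / s ^ CARD('n) * laplacian (bump x s) z"
    unfolding laplacian_bump q_def[symmetric] using s
    by (simp add: field_simps power2_eq_square power3_eq_cube power4_eq_xxxx)
  from DERIV_mult[OF 3 2] show ?thesis
    unfolding ker_def q_def[symmetric] e[symmetric] by (simp add: mult.commute)
qed

text \<open>For parameters between \<open>s / 2\<close> and \<open>2 * s\<close> all kernels are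
  supported in one box, over which differentiation under the integral sign is legitimate.\<close>

lemma avg_deriv:
  fixes x :: "real^'n::finite"
  assumes s: "s > 0" and f: "continuous_on UNIV f"
  shows "((\<lambda>s. avg f s x) has_real_derivative (s / s ^ CARD('n) * (LINT z|lborel. f z * laplacian (bump x s) z))) (at s)"
proof -
  obtain a where a: "ball x (2 * s) \<subseteq> cbox (- a) a"
    using bounded_subset_cbox_symmetric[of "ball x (2 * s)"] by auto
  let ?U = "{s / 2<..<2 * s}"
  define k' where "k' t z = f z * (t / t ^ CARD('n) * laplacian (bump x t) z)" for t z
  have ball_sub: "ball x t \<subseteq> cbox (- a) a" if "t \<in> ?U" for t
    using a that subset_ball[of t "2 * s" x] by auto
  have av: "avg f t x = integral (cbox (- a) a) (\<lambda>z. f z * ker t x z)" if t: "t \<in> ?U" for t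
    unfolding avg_def
  proof (rule lborel_integral_cbox)
    show "continuous_on UNIV (\<lambda>z. f z * ker t x z)" by (intro continuous_intros f ker_continuous)
    show "f z * ker t x z = 0" if "z \<notin> cbox (- a) a" for z
    proof -
      have "z \<notin> ball x t" "t > 0" using that ball_sub[OF t] t s by auto
      then show ?thesis using ker_outside[of t z x] by simp
    qed
  qed
  have "((\<lambda>t. integral (cbox (- a) a) (\<lambda>z. f z * ker t x z)) has_field_derivative integral (cbox (- a) a) (k' s)) (at s within ?U)"
  proof (rule leibniz_rule_field_derivative)
    show "((\<lambda>t. f z * ker t x z) has_field_derivative k' t z) (at t within ?U)" if "t \<in> ?U" for t z
      unfolding k'_def using that s
      by (intro has_field_derivative_at_within[OF DERIV_cmult[OF ker_deriv]]) auto
    show "(\<lambda>z. f z * ker t x z) integrable_on cbox (- a) a" for t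
      by (intro integrable_continuous continuous_intros continuous_on_subset[OF f] continuous_on_subset[OF ker_continuous]) auto
    have f2: "continuous_on (?U \<times> cbox (- a) a) (\<lambda>p. f (snd p))"
      by (rule continuous_on_compose2[OF f continuous_on_snd[OF continuous_on_id]]) auto
    show "continuous_on (?U \<times> cbox (- a) a) (\<lambda>(t, z). k' t z)"
      unfolding k'_def laplacian_bump case_prod_beta using s by (intro continuous_intros f2) auto
  qed (use s in auto)
  then have "((\<lambda>t. avg f t x) has_field_derivative integral (cbox (- a) a) (k' s)) (at s within ?U)"
    by (rule has_field_derivative_transform_within[where d=s]) (use s av in auto)
  then have "((\<lambda>t. avg f t x) has_field_derivative integral (cbox (- a) a) (k' s)) (at s)"
    using s by (subst (asm) at_within_open) auto
  moreover have "integral (cbox (- a) a) (k' s) = s / s ^ CARD('n) * (LINT z|lborel. f z * laplacian (bump x s) z)"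
  proof -
    have t: "bump x s \<in> test_functions UNIV" by (rule bump_test[OF s]) simp
    have "(LINT z|lborel. f z * laplacian (bump x s) z) = integral (cbox (- a) a) (\<lambda>z. f z * laplacian (bump x s) z)"
    proof (rule lborel_integral_cbox)
      show "continuous_on UNIV (\<lambda>z. f z * laplacian (bump x s) z)"
        by (intro continuous_intros f test_continuous[OF test_laplacian[OF t]])
      show "f z * laplacian (bump x s) z = 0" if "z \<notin> cbox (- a) a" for z
      proof -
        have "z \<notin> ball x s" using that ball_sub[of s] s by auto
        then show ?thesis by (simp add: laplacian_bump flat_bump_outside[OF s] del: mem_ball)
      qed
    qed
    then show ?thesis unfolding k'_def by (simp add: mult.left_commute[of "f _"] )
  qed
  ultimately show ?thesis by simp
qed

text \<open>The kernel concentrates at \<open>x\<close> with constant mass, so only the oscillation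
  of \<open>f\<close> on the ball of radius \<open>s\<close> matters.\<close>

lemma avg_tendsto:
  fixes x :: "real^'n::finite"
  assumes f: "continuous_on UNIV f"
  shows "((\<lambda>s. avg f s x) \<longlongrightarrow> f x * ker_mass TYPE('n)) (at_right 0)"
proof (rule tendstoI)
  fix e :: real assume e: "e > 0"
  let ?K = "ker_mass TYPE('n)"
  define \<epsilon> where "\<epsilon> = e / (2 * ?K)"
  have \<epsilon>: "\<epsilon> > 0" using e ker_mass_pos[where 'n='n] by (simp add: \<epsilon>_def)
  have "isCont f x" using f by (simp add: continuous_on_eq_continuous_at)
  then obtain d where d: "d > 0" "\<And>y. dist y x < d \<Longrightarrow> dist (f y) (f x) < \<epsilon>"
    using \<epsilon> unfolding continuous_at_eps_delta by blast
  have "dist (avg f s x) (f x * ?K) < e" if s: "0 < s" "s < d" for s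
  proof -
    have i: "integrable lborel (\<lambda>z. f z * ker s x z)" "integrable lborel (\<lambda>z. f x * ker s x z)" "integrable lborel (\<lambda>z. \<epsilon> * ker s x z)"
      using f_ker_integrable[OF s(1) f, of x] integrable_mult_right[OF ker_integrable[OF s(1), of x]] by simp_all
    have "avg f s x - f x * ?K = (LINT z|lborel. f z * ker s x z - f x * ker s x z)"
      using i ker_integral[OF s(1), of x] by (simp add: avg_def)
    also have "\<bar>\<dots>\<bar> \<le> (LINT z|lborel. \<bar>f z * ker s x z - f x * ker s x z\<bar>)" by (rule integral_abs_bound)
    also have "\<dots> \<le> (LINT z|lborel. \<epsilon> * ker s x z)"
    proof (rule integral_mono)
      show "integrable lborel (\<lambda>z. \<bar>f z * ker s x z - f x * ker s x z\<bar>)"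
        by (intro integrable_abs Bochner_Integration.integrable_diff i)
      fix z
      show "\<bar>f z * ker s x z - f x * ker s x z\<bar> \<le> \<epsilon> * ker s x z"
      proof (cases "z \<in> ball x s")
        case True
        then have "\<bar>f z - f x\<bar> \<le> \<epsilon>" using d(2)[of z] s by (simp add: dist_commute dist_real_def)
        then show ?thesis using ker_nonneg[OF s(1), of x z]
          by (simp add: left_diff_distrib[symmetric] abs_mult mult_right_mono)
      qed (simp add: ker_outside[OF s(1)])
    qed (use i in simp)
    also have "\<dots> = \<epsilon> * ?K" using ker_integral[OF s(1), of x] by simp
    also have "\<dots> < e" using e ker_mass_pos[where 'n='n] by (simp add: \<epsilon>_def)
    finally show ?thesis by (simp add: dist_real_def)
  qed
  then show "\<forall>\<^sub>F s in at_right 0. dist (avg f s x) (f x * ?K) < e"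
    unfolding eventually_at_right_field using d(1) by blast
qed

text \<open>The distributional inequality \<open>laplacian f >= - C\<close> on \<open>U\<close>. The
  function is global and the integrals are over \<open>lborel\<close>, so that translates and
  averages can be formed without leaving a domain.\<close>

definition wsub :: "(real^'n::finite) set \<Rightarrow> (real^'n \<Rightarrow> real) \<Rightarrow> real \<Rightarrow> bool" where
  "wsub U f C \<longleftrightarrow> (\<forall>\<phi>\<in>test_functions U. (\<forall>x. 0 \<le> \<phi> x) \<longrightarrow>
     - C * (LINT x|lborel. \<phi> x) \<le> (LINT x|lborel. f x * laplacian \<phi> x))"

text \<open>Adding \<open>C * k / 2 * s^2\<close>, with \<open>k\<close> the mass of the unit bump,
  makes the average nondecreasing in \<open>s\<close>: its derivative is the weak inequality tested
  with \<open>bump x s\<close>, whose mass is \<open>s^N * k\<close>. The left side is the limit for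
  \<open>s\<close> tending to 0.\<close>

lemma wsub_mean_value:
  fixes x :: "real^'n::finite"
  assumes w: "wsub U f C" and f: "continuous_on UNIV f" and \<rho>: "\<rho> > 0" and sub: "cball x \<rho> \<subseteq> U"
  shows "f x * ker_mass TYPE('n) \<le> avg f \<rho> x + C * bump_mass TYPE('n) / 2 * \<rho>\<^sup>2"
proof -
  let ?H = "\<lambda>s. avg f s x + C * bump_mass TYPE('n) / 2 * s\<^sup>2"
  have mono: "?H s \<le> ?H \<rho>" if s: "0 < s" "s \<le> \<rho>" for s
  proof (rule DERIV_nonneg_imp_nondecreasing[OF s(2)])
    fix t assume t: "s \<le> t" "t \<le> \<rho>"
    then have t0: "t > 0" using s by simp
    let ?D = "t / t ^ CARD('n) * (LINT z|lborel. f z * laplacian (bump x t) z) + C * bump_mass TYPE('n) / 2 * (2 * t)"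
    have sq: "((\<lambda>s. c * s\<^sup>2) has_real_derivative c * (2 * t)) (at t)" for c
      by (auto intro!: derivative_eq_intros)
    have "(?H has_real_derivative ?D) (at t)"
      by (rule DERIV_add[OF avg_deriv[OF t0 f] sq])
    moreover have "0 \<le> ?D"
    proof -
      have "cball x t \<subseteq> U" using sub t by (meson order_trans subset_cball)
      then have bt: "bump x t \<in> test_functions U" by (rule bump_test[OF t0])
      have "- C * (t ^ CARD('n) * bump_mass TYPE('n)) \<le> (LINT z|lborel. f z * laplacian (bump x t) z)"
        using w[unfolded wsub_def, rule_format, OF bt bump_nonneg] unfolding bump_integral[OF t0] .
      then have "t / t ^ CARD('n) * (- C * (t ^ CARD('n) * bump_mass TYPE('n))) \<le> t / t ^ CARD('n) * (LINT z|lborel. f z * laplacian (bump x t) z)"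
        using t0 by (intro mult_left_mono) auto
      moreover have "t / t ^ CARD('n) * (- C * (t ^ CARD('n) * bump_mass TYPE('n))) = - (C * bump_mass TYPE('n) / 2 * (2 * t))"
        using t0 by simp
      ultimately show ?thesis by linarith
    qed
    ultimately show "\<exists>y. (?H has_real_derivative y) (at t) \<and> 0 \<le> y" by blast
  qed
  have "(?H \<longlongrightarrow> f x * ker_mass TYPE('n) + C * bump_mass TYPE('n) / 2 * 0\<^sup>2) (at_right 0)"
    by (intro tendsto_intros avg_tendsto f)
  moreover have "\<forall>\<^sub>F s in at_right 0. ?H s \<le> ?H \<rho>"
    unfolding eventually_at_right_field using mono \<rho> by (intro exI[of _ \<rho>]) auto
  ultimately have "f x * ker_mass TYPE('n) + C * bump_mass TYPE('n) / 2 * 0\<^sup>2 \<le> ?H \<rho>"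
    by (rule tendsto_upperbound) simp
  then show ?thesis by simp
qed

lemma green_test:
  assumes \<phi>: "\<phi> \<in> test_functions (UNIV :: (real^'n::finite) set)" and \<psi>: "\<psi> \<in> test_functions UNIV"
  shows "(LINT x|lborel. \<phi> x * laplacian \<psi> x) = (LINT x|lborel. laplacian \<phi> x * \<psi> x)"
proof -
  have o: "open (UNIV :: (real^'n) set)" by simp
  have conv: "(LINT x|lebesgue_on UNIV. k x) = (LINT x|lborel. k x)" if "continuous_on UNIV k" for k :: "real^'n \<Rightarrow> real"
    by (rule lebesgue_on_test(2)[OF o borel_measurable_continuous_onI[OF that]]) simp
  note c = test_continuous[OF \<phi>] test_continuous[OF \<psi>] test_continuous[OF test_laplacian[OF \<phi>]] test_continuous[OF test_laplacian[OF \<psi>]]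
  have 1: "(LINT x|lebesgue_on UNIV. gradient \<phi> x \<bullet> gradient \<psi> x) = - (LINT x|lebesgue_on UNIV. \<phi> x * laplacian \<psi> x)"
    by (rule sob_laplacian[OF o sob_test[OF o \<phi>] \<psi>])
  have 2: "(LINT x|lebesgue_on UNIV. gradient \<psi> x \<bullet> gradient \<phi> x) = - (LINT x|lebesgue_on UNIV. \<psi> x * laplacian \<phi> x)"
    by (rule sob_laplacian[OF o sob_test[OF o \<psi>] \<phi>])
  have "(LINT x|lborel. \<phi> x * laplacian \<psi> x) = (LINT x|lebesgue_on UNIV. \<phi> x * laplacian \<psi> x)"
    by (rule conv[symmetric]) (intro continuous_intros c)
  also have "\<dots> = (LINT x|lebesgue_on UNIV. \<psi> x * laplacian \<phi> x)"
    using 1 2 by (simp add: inner_commute)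
  also have "\<dots> = (LINT x|lborel. \<psi> x * laplacian \<phi> x)"
    by (rule conv) (intro continuous_intros c)
  finally show ?thesis by (simp add: mult.commute)
qed

lemma wsub_test:
  fixes \<phi> :: "real^'n::finite \<Rightarrow> real"
  assumes \<phi>: "\<phi> \<in> test_functions UNIV" and le: "\<And>x. x \<in> U \<Longrightarrow> - C \<le> laplacian \<phi> x"
  shows "wsub U \<phi> C"
  unfolding wsub_def
proof (intro ballI impI)
  fix \<psi> :: "real^'n \<Rightarrow> real" assume \<psi>: "\<psi> \<in> test_functions U" and p: "\<forall>x. 0 \<le> \<psi> x"
  have \<psi>': "\<psi> \<in> test_functions UNIV" using test_mono[OF \<psi>] by simp
  obtain K where K: "compact K" "K \<subseteq> U" "\<And>x. x \<notin> K \<Longrightarrow> \<psi> x = 0"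
    using test_functionsE[OF \<psi>] by blast
  have "(LINT x|lborel. - C * \<psi> x) \<le> (LINT x|lborel. laplacian \<phi> x * \<psi> x)"
  proof (rule integral_mono)
    show "integrable lborel (\<lambda>x. - C * \<psi> x)" using test_integrable[OF \<psi>] by simp
    show "integrable lborel (\<lambda>x. laplacian \<phi> x * \<psi> x)"
      by (rule test_integrable[OF test_mult_left[OF test_smooth[OF test_laplacian[OF \<phi>]] \<psi>]])
    show "- C * \<psi> x \<le> laplacian \<phi> x * \<psi> x" for x
    proof (cases "x \<in> K")
      case True then show ?thesis using le[of x] K(2) p by (intro mult_right_mono) auto
    qed (use K(3) in simp)
  qed
  then show "- C * (LINT x|lborel. \<psi> x) \<le> (LINT x|lborel. \<phi> x * laplacian \<psi> x)"
    unfolding green_test[OF \<phi> \<psi>'] by simp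
qed

text \<open>The mean value inequality for \<open>\<phi>\<close> and for \<open>- \<phi>\<close>,
  with the Laplacian frozen at \<open>x\<close>, gives the second-order expansion of the average
  from both sides. The ball of radius \<open>2 * \<rho>\<close> is an open set around the closed
  ball of radius \<open>\<rho>\<close>, on which the Laplacian varies by at most
  \<open>2 * B * \<rho>\<close>.\<close>

lemma test_avg_expansion:
  fixes \<phi> :: "real^'n::finite \<Rightarrow> real"
  assumes \<phi>: "\<phi> \<in> test_functions UNIV" and B: "\<And>x y. \<bar>laplacian \<phi> x - laplacian \<phi> y\<bar> \<le> B * norm (x - y)" "B \<ge> 0" and \<rho>: "\<rho> > 0"
  shows "\<bar>avg \<phi> \<rho> x - \<phi> x * ker_mass TYPE('n) - bump_mass TYPE('n) / 2 * \<rho>\<^sup>2 * laplacian \<phi> x\<bar> \<le> bump_mass TYPE('n) / 2 * \<rho>\<^sup>2 * (2 * B * \<rho>)"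
proof -
  let ?K = "ker_mass TYPE('n)" and ?k = "bump_mass TYPE('n)"
  let ?U = "ball x (2 * \<rho>)"
  have near: "\<bar>laplacian \<phi> y - laplacian \<phi> x\<bar> \<le> 2 * B * \<rho>" if "y \<in> ?U" for y
  proof -
    have "B * norm (y - x) \<le> B * (2 * \<rho>)"
      using that B(2) by (intro mult_left_mono) (auto simp: dist_norm norm_minus_commute)
    then show ?thesis using B(1)[of y x] by linarith
  qed
  have sub: "cball x \<rho> \<subseteq> ?U" using \<rho> by auto
  have n: "(\<lambda>x. - \<phi> x) \<in> test_functions UNIV" using test_cmult[OF \<phi>, of "-1"] by simp
  have ln: "laplacian (\<lambda>x. - \<phi> x) y = - laplacian \<phi> y" for y
  proof -
    have *: "partial_deriv i (\<lambda>x. - \<psi> x) = (\<lambda>x. - partial_deriv i \<psi> x)" if "\<psi> \<in> test_functions UNIV" for \<psi> :: "real^'n \<Rightarrow> real" and i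
      using partial_deriv_cmult[OF test_differentiable[OF that], of i "-1"] by (simp add: fun_eq_iff)
    show ?thesis unfolding laplacian_def
      by (simp add: *[OF \<phi>] *[OF test_partial_deriv[OF \<phi>]] sum_negf)
  qed
  have "wsub ?U \<phi> (- (laplacian \<phi> x - 2 * B * \<rho>))"
    using near by (intro wsub_test \<phi>) fastforce
  from wsub_mean_value[OF this test_continuous[OF \<phi>] \<rho> sub]
  have 1: "\<phi> x * ?K \<le> avg \<phi> \<rho> x + - (laplacian \<phi> x - 2 * B * \<rho>) * ?k / 2 * \<rho>\<^sup>2" .
  have "wsub ?U (\<lambda>x. - \<phi> x) (laplacian \<phi> x + 2 * B * \<rho>)"
    using near by (intro wsub_test n) (fastforce simp: ln)
  from wsub_mean_value[OF this test_continuous[OF n] \<rho> sub]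
  have 2: "- \<phi> x * ?K \<le> avg (\<lambda>x. - \<phi> x) \<rho> x + (laplacian \<phi> x + 2 * B * \<rho>) * ?k / 2 * \<rho>\<^sup>2" .
  have 3: "avg (\<lambda>x. - \<phi> x) \<rho> x = - avg \<phi> \<rho> x" by (simp add: avg_def)
  show ?thesis
    using 1 2 unfolding 3 abs_le_iff by (simp add: algebra_simps diff_divide_distrib add_divide_distrib)
qed

text \<open>Integrate the mean value inequality against \<open>\<phi>\<close>, move the average onto
  \<open>\<phi>\<close> by the symmetry of the kernel, expand it to second order, divide by
  \<open>\<rho>^2\<close> and let \<open>\<rho>\<close> tend to 0. Integration over \<open>x\<close>
  needs the same \<open>\<rho>\<close> at all points, hence the uniform
  \<open>\<rho>0\<close>.\<close>

lemma wsub_of_uniform_mean_value: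
  fixes f :: "real^'n::finite \<Rightarrow> real"
  assumes f: "continuous_on UNIV f" and \<rho>0: "\<rho>0 > 0"
    and mv: "\<And>x \<rho>. x \<in> U \<Longrightarrow> 0 < \<rho> \<Longrightarrow> \<rho> < \<rho>0 \<Longrightarrow> f x * ker_mass TYPE('n) \<le> avg f \<rho> x + C * bump_mass TYPE('n) / 2 * \<rho>\<^sup>2"
  shows "wsub U f C"
  unfolding wsub_def
proof (intro ballI impI)
  fix \<phi> :: "real^'n \<Rightarrow> real" assume \<phi>U: "\<phi> \<in> test_functions U" and p: "\<forall>x. 0 \<le> \<phi> x"
  let ?K = "ker_mass TYPE('n)" and ?k = "bump_mass TYPE('n)"
  have \<phi>: "\<phi> \<in> test_functions UNIV" using test_mono[OF \<phi>U] by simp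
  obtain K where K: "compact K" "K \<subseteq> U" "\<And>x. x \<notin> K \<Longrightarrow> \<phi> x = 0"
    using test_functionsE[OF \<phi>U] by blast
  obtain R where R: "\<And>x. x \<in> K \<Longrightarrow> norm x \<le> R" using compact_imp_bounded[OF K(1)] unfolding bounded_iff by blast
  obtain B where B: "B \<ge> 0" "\<And>x y. \<bar>laplacian \<phi> x - laplacian \<phi> y\<bar> \<le> B * norm (x - y)"
    using test_lipschitz[OF test_laplacian[OF \<phi>]] by blast
  \<comment> \<open>For radii below \<open>\<rho>0\<close> both \<open>\<phi>\<close> and its
    averages vanish outside this ball, so the error of the expansion is controlled by the integral
    \<open>A\<close> of \<open>\<bar>f\<bar>\<close> over it.\<close>
  let ?C = "cball (0::real^'n) (R + \<rho>0)"
  define A where "A = (LINT z|lborel. indicator ?C z * \<bar>f z\<bar>)"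
  note c\<phi> = test_continuous[OF \<phi>, of UNIV]
  have f_test_int: "integrable lborel (\<lambda>z. f z * \<psi> z)" if \<psi>: "\<psi> \<in> test_functions UNIV" for \<psi>
  proof -
    obtain L where L: "compact L" "L \<subseteq> UNIV" "\<And>x. x \<notin> L \<Longrightarrow> \<psi> x = 0" using test_functionsE[OF \<psi>] by blast
    show ?thesis
      by (rule compact_support_integrable[OF _ L(1)]) (auto intro!: continuous_intros f test_continuous[OF \<psi>] simp: L(3))
  qed
  have Lout: "laplacian \<phi> z = 0" if "z \<notin> ?C" for z
  proof -
    have t: "\<phi> \<in> test_functions (ball 0 (R + \<rho>0))"
    proof (rule test_functionsI[OF test_smooth[OF \<phi>] K(1)])
      show "K \<subseteq> ball 0 (R + \<rho>0)" using R \<rho>0 by fastforce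
    qed (use K in auto)
    show ?thesis by (rule test_outside[OF test_laplacian[OF t]]) (use that in auto)
  qed
  have key: "- C * (LINT x|lborel. \<phi> x) \<le> (LINT x|lborel. f x * laplacian \<phi> x) + 2 * B * \<rho> * A" if \<rho>: "0 < \<rho>" "\<rho> < \<rho>0" for \<rho>
  proof -
    have pair_int: "integrable (lborel \<Otimes>\<^sub>M lborel) (\<lambda>(x, z). \<phi> x * (f z * ker \<rho> x z))"
      unfolding lborel_prod
    proof (rule compact_support_integrable[where K="K \<times> ?C"])
      have c1: "continuous_on UNIV (\<lambda>p::(real^'n) \<times> (real^'n). \<phi> (fst p))"
        by (rule continuous_on_compose2[OF c\<phi> continuous_on_fst[OF continuous_on_id]]) auto
      have c2: "continuous_on UNIV (\<lambda>p::(real^'n) \<times> (real^'n). f (snd p))"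
        by (rule continuous_on_compose2[OF f continuous_on_snd[OF continuous_on_id]]) auto
      have c3: "continuous_on UNIV (\<lambda>p::(real^'n) \<times> (real^'n). ker \<rho> (fst p) (snd p))"
        using ker_continuous_pair[of \<rho>] by (simp add: case_prod_beta)
      show "continuous_on UNIV (\<lambda>(x, z). \<phi> x * (f z * ker \<rho> x z))"
        unfolding case_prod_beta by (intro continuous_intros c1 c2 c3)
      show "(case p of (x, z) \<Rightarrow> \<phi> x * (f z * ker \<rho> x z)) = 0" if "p \<notin> K \<times> ?C" for p
      proof (cases p)
        case (Pair x z)
        show ?thesis
        proof (cases "x \<in> K")
          case True
          then have "z \<notin> ?C" using that Pair by simp
          then have "norm z > R + \<rho>" using \<rho> by simp
          moreover have "norm z \<le> norm x + norm (z - x)" using norm_triangle_ineq[of x "z - x"] by simp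
          ultimately have "z \<notin> ball x \<rho>" using R[OF True] by (auto simp: dist_norm norm_minus_commute)
          then show ?thesis using Pair by (simp add: ker_outside[OF \<rho>(1)] del: mem_ball)
        qed (use K(3) Pair in simp)
      qed
    qed (use K in \<open>auto intro: compact_Times\<close>)
    have i1: "integrable lborel (\<lambda>x. \<phi> x * avg f \<rho> x)"
      using lborel_pair.integrable_fst'[OF pair_int] by (simp add: avg_def)
    have i2: "integrable lborel (\<lambda>z. f z * avg \<phi> \<rho> z)"
    proof -
      have "integrable lborel (\<lambda>z. LINT x|lborel. \<phi> x * (f z * ker \<rho> x z))"
        using lborel_pair.integrable_snd[OF pair_int] by simp
      moreover have "(LINT x|lborel. \<phi> x * (f z * ker \<rho> x z)) = f z * avg \<phi> \<rho> z" for z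
        unfolding avg_def integral_mult_right_zero[symmetric]
        by (intro Bochner_Integration.integral_cong refl) (simp add: ker_sym[of \<rho> z])
      ultimately show ?thesis by simp
    qed
    have fub: "(LINT x|lborel. \<phi> x * avg f \<rho> x) = (LINT z|lborel. f z * avg \<phi> \<rho> z)"
    proof -
      have "(LINT z|lborel. (LINT x|lborel. \<phi> x * (f z * ker \<rho> x z))) = (LINT x|lborel. (LINT z|lborel. \<phi> x * (f z * ker \<rho> x z)))"
        by (rule lborel_pair.Fubini_integral[OF pair_int])
      moreover have "(LINT x|lborel. \<phi> x * (f z * ker \<rho> x z)) = f z * avg \<phi> \<rho> z" for z
        unfolding avg_def integral_mult_right_zero[symmetric]
        by (intro Bochner_Integration.integral_cong refl) (simp add: ker_sym[of \<rho> z])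
      ultimately show ?thesis by (simp add: avg_def)
    qed
    have "(LINT x|lborel. \<phi> x * (f x * ?K)) \<le> (LINT x|lborel. \<phi> x * avg f \<rho> x + C * ?k / 2 * \<rho>\<^sup>2 * \<phi> x)"
    proof (rule integral_mono)
      show "integrable lborel (\<lambda>x. \<phi> x * (f x * ?K))" using f_test_int[OF \<phi>] by (simp add: mult.left_commute mult.commute)
      show "integrable lborel (\<lambda>x. \<phi> x * avg f \<rho> x + C * ?k / 2 * \<rho>\<^sup>2 * \<phi> x)"
        using i1 test_integrable[OF \<phi>] by simp
      fix x
      show "\<phi> x * (f x * ?K) \<le> \<phi> x * avg f \<rho> x + C * ?k / 2 * \<rho>\<^sup>2 * \<phi> x"
      proof (cases "x \<in> K")
        case True
        then have "\<phi> x * (f x * ?K) \<le> \<phi> x * (avg f \<rho> x + C * ?k / 2 * \<rho>\<^sup>2)"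
          using mv[of x \<rho>] K(2) \<rho> p by (intro mult_left_mono) auto
        then show ?thesis by (simp add: algebra_simps)
      qed (use K(3) in simp)
    qed
    then have 1: "(LINT x|lborel. f x * \<phi> x) * ?K \<le> (LINT z|lborel. f z * avg \<phi> \<rho> z) + C * ?k / 2 * \<rho>\<^sup>2 * (LINT x|lborel. \<phi> x)"
      using i1 test_integrable[OF \<phi>] unfolding fub[symmetric] by (simp add: mult_ac)
    have err: "f z * avg \<phi> \<rho> z \<le> f z * \<phi> z * ?K + ?k / 2 * \<rho>\<^sup>2 * (f z * laplacian \<phi> z) + ?k / 2 * \<rho>\<^sup>2 * (2 * B * \<rho>) * (indicator ?C z * \<bar>f z\<bar>)" for z
    proof (cases "z \<in> ?C")
      case True
      have "f z * (avg \<phi> \<rho> z - \<phi> z * ?K - ?k / 2 * \<rho>\<^sup>2 * laplacian \<phi> z) \<le> \<bar>f z\<bar> * \<bar>avg \<phi> \<rho> z - \<phi> z * ?K - ?k / 2 * \<rho>\<^sup>2 * laplacian \<phi> z\<bar>"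
        unfolding abs_mult[symmetric] by (rule abs_ge_self)
      also have "\<dots> \<le> \<bar>f z\<bar> * (?k / 2 * \<rho>\<^sup>2 * (2 * B * \<rho>))"
        by (intro mult_left_mono test_avg_expansion[OF \<phi> B(2,1) \<rho>(1)]) auto
      finally show ?thesis using True by (simp add: algebra_simps)
    next
      case False
      then have "norm z > R + \<rho>" using \<rho> by simp
      have "\<phi> x * ker \<rho> z x = 0" for x
      proof (cases "x \<in> K")
        case True
        have "norm z \<le> norm x + norm (z - x)" using norm_triangle_ineq[of x "z - x"] by simp
        then have "x \<notin> ball z \<rho>" using R[OF True] \<open>norm z > R + \<rho>\<close> by (auto simp: dist_norm)
        then show ?thesis by (simp add: ker_outside[OF \<rho>(1)] del: mem_ball)
      qed (use K(3) in simp)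
      then have "avg \<phi> \<rho> z = 0" by (simp only: avg_def Bochner_Integration.integral_zero)
      moreover have "\<phi> z = 0" using K(3) R \<open>norm z > R + \<rho>\<close> \<rho> by force
      ultimately show ?thesis using Lout[OF False] False by simp
    qed
    have iA: "integrable lborel (\<lambda>z. indicator ?C z * \<bar>f z\<bar>)"
      by (intro integrable_indicator_continuous continuous_intros f) auto
    have "(LINT z|lborel. f z * avg \<phi> \<rho> z) \<le> (LINT z|lborel. f z * \<phi> z * ?K + ?k / 2 * \<rho>\<^sup>2 * (f z * laplacian \<phi> z) + ?k / 2 * \<rho>\<^sup>2 * (2 * B * \<rho>) * (indicator ?C z * \<bar>f z\<bar>))"
      using f_test_int[OF \<phi>] f_test_int[OF test_laplacian[OF \<phi>]] iA err
      by (intro integral_mono i2 Bochner_Integration.integrable_add integrable_mult_left integrable_mult_right)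
    also have "\<dots> = (LINT z|lborel. f z * \<phi> z) * ?K + ?k / 2 * \<rho>\<^sup>2 * (LINT z|lborel. f z * laplacian \<phi> z) + ?k / 2 * \<rho>\<^sup>2 * (2 * B * \<rho>) * A"
      using f_test_int[OF \<phi>] f_test_int[OF test_laplacian[OF \<phi>]] iA by (simp add: A_def)
    finally have "?k / 2 * \<rho>\<^sup>2 * (- C * (LINT x|lborel. \<phi> x)) \<le> ?k / 2 * \<rho>\<^sup>2 * ((LINT z|lborel. f z * laplacian \<phi> z) + 2 * B * \<rho> * A)"
      using 1 by (simp add: algebra_simps)
    moreover have "?k / 2 * \<rho>\<^sup>2 > 0" using bump_mass_pos[where 'n='n] \<rho> by simp
    ultimately show ?thesis by (simp only: mult_le_cancel_left_pos)
  qed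
  have "((\<lambda>\<rho>. (LINT x|lborel. f x * laplacian \<phi> x) + 2 * B * \<rho> * A) \<longlongrightarrow> (LINT x|lborel. f x * laplacian \<phi> x) + 2 * B * 0 * A) (at_right 0)"
    by (intro tendsto_intros)
  moreover have "\<forall>\<^sub>F \<rho> in at_right 0. - C * (LINT x|lborel. \<phi> x) \<le> (LINT x|lborel. f x * laplacian \<phi> x) + 2 * B * \<rho> * A"
    unfolding eventually_at_right_field using key \<rho>0 by blast
  ultimately have "- C * (LINT x|lborel. \<phi> x) \<le> (LINT x|lborel. f x * laplacian \<phi> x) + 2 * B * 0 * A"
    by (rule tendsto_lowerbound) simp
  then show "- C * (LINT x|lborel. \<phi> x) \<le> (LINT x|lborel. f x * laplacian \<phi> x)" by simp
qed

section \<open>The distance to a translate\<close>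

text \<open>For two points of the tree the sum is their distance. Let \<open>a\<close> be the branch
  of the point \<open>\<xi>\<close> that is farther from the origin: the path from
  \<open>\<zeta>\<close> to \<open>\<xi>\<close> moves towards the end of \<open>a\<close>
  throughout, so its length is a difference of coordinates folded at \<open>a\<close>. The bound by
  \<open>2 * \<xi> a\<close> keeps \<open>\<xi>\<close> away from the origin when the distance is
  bounded below.\<close>

lemma tree_distance_branch:
  fixes \<xi> \<zeta> :: "'k::finite \<Rightarrow> real"
  assumes nn: "\<And>j. 0 \<le> \<xi> j" "\<And>j. 0 \<le> \<zeta> j" and br: "\<And>i j. i \<noteq> j \<Longrightarrow> \<xi> i * \<xi> j = 0"
    and le: "(\<Sum>j\<in>UNIV. \<zeta> j) \<le> (\<Sum>j\<in>UNIV. \<xi> j)" and D: "(\<Sum>j\<in>UNIV. \<bar>\<xi> j - \<zeta> j\<bar>) > 0"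
  obtains a where "(\<Sum>j\<in>UNIV. \<bar>\<xi> j - \<zeta> j\<bar>) \<le> 2 * \<xi> a"
    "(\<Sum>j\<in>UNIV. \<bar>\<xi> j - \<zeta> j\<bar>) = \<xi> a - (\<zeta> a - (\<Sum>j\<in>UNIV - {a}. \<zeta> j))"
proof -
  let ?D = "\<Sum>j\<in>UNIV. \<bar>\<xi> j - \<zeta> j\<bar>"
  have "?D \<le> (\<Sum>j\<in>UNIV. \<xi> j + \<zeta> j)" using nn by (intro sum_mono) (auto simp: abs_le_iff add_increasing2 add_increasing)
  then have D2: "?D \<le> 2 * (\<Sum>j\<in>UNIV. \<xi> j)" using le by (simp add: sum.distrib)
  then have "(\<Sum>j\<in>UNIV. \<xi> j) \<noteq> 0" using D by auto
  then obtain a where a: "\<xi> a \<noteq> 0" by (metis sum.neutral)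
  have oth: "\<xi> j = 0" if "j \<noteq> a" for j using br[OF that] a by simp
  have S: "(\<Sum>j\<in>UNIV. \<xi> j) = \<xi> a"
    by (subst sum.remove[of UNIV a]) (auto simp: oth)
  have Z: "(\<Sum>j\<in>UNIV. \<zeta> j) = \<zeta> a + (\<Sum>j\<in>UNIV - {a}. \<zeta> j)" by (rule sum.remove) auto
  have Z0: "0 \<le> (\<Sum>j\<in>UNIV - {a}. \<zeta> j)" using nn by (intro sum_nonneg) auto
  have "?D = \<bar>\<xi> a - \<zeta> a\<bar> + (\<Sum>j\<in>UNIV - {a}. \<bar>\<xi> j - \<zeta> j\<bar>)" by (rule sum.remove) auto
  also have "(\<Sum>j\<in>UNIV - {a}. \<bar>\<xi> j - \<zeta> j\<bar>) = (\<Sum>j\<in>UNIV - {a}. \<zeta> j)"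
    using nn oth by (intro sum.cong) auto
  also have "\<bar>\<xi> a - \<zeta> a\<bar> = \<xi> a - \<zeta> a" using le S Z Z0 by simp
  finally have "?D = \<xi> a - (\<zeta> a - (\<Sum>j\<in>UNIV - {a}. \<zeta> j))" by simp
  then show ?thesis using that[of a] D2 S by simp
qed

section \<open>Elementary properties of the averages\<close>

lemma avg_translate:
  fixes x h :: "real^'n::finite"
  assumes "s > 0" "continuous_on UNIV f"
  shows "avg f s (x + h) = avg (\<lambda>y. f (y + h)) s x"
proof -
  have c: "continuous_on UNIV (\<lambda>y. f (y + h))" by (rule continuous_on_compose2[OF assms(2)]) (auto intro!: continuous_intros)
  show ?thesis unfolding avg_scale[OF assms] avg_scale[OF assms(1) c] by (simp add: add_ac)
qed

lemma avg_mono: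
  assumes s: "s > 0" and f: "continuous_on UNIV f" and g: "continuous_on UNIV g"
    and le: "\<And>y. y \<in> ball x s \<Longrightarrow> f y \<le> g y"
  shows "avg f s x \<le> avg g s x"
  unfolding avg_def
proof (rule integral_mono[OF f_ker_integrable[OF s f] f_ker_integrable[OF s g]])
  fix z
  show "f z * ker s x z \<le> g z * ker s x z"
    using le[of z] ker_nonneg[OF s, of x z] ker_outside[OF s, of z x]
    by (cases "z \<in> ball x s") (auto intro: mult_right_mono)
qed

lemma avg_diff:
  assumes s: "s > 0" and f: "continuous_on UNIV f" and g: "continuous_on UNIV g"
  shows "avg (\<lambda>y. f y - g y) s x = avg f s x - avg g s x"
  unfolding avg_def using f_ker_integrable[OF s f, of x] f_ker_integrable[OF s g, of x] by (simp add: left_diff_distrib)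

lemma avg_const: "s > 0 \<Longrightarrow> avg (\<lambda>y. c) s (x::real^'n::finite) = c * ker_mass TYPE('n)"
  unfolding avg_def using ker_integral[of s x] by simp

text \<open>The truncation changes \<open>f\<close> by at most \<open>\<epsilon>\<close>, which is
  harmless after testing with a fixed \<open>\<phi>\<close>. It permits ignoring the set where a
  distance is small and has no local representation on a uniform radius.\<close>

lemma wsub_of_max:
  fixes f :: "real^'n::finite \<Rightarrow> real"
  assumes f: "continuous_on UNIV f" and m: "\<And>\<epsilon>. \<epsilon> > 0 \<Longrightarrow> wsub U (\<lambda>x. max (f x) \<epsilon>) C" and f0: "\<And>x. 0 \<le> f x"
  shows "wsub U f C"
  unfolding wsub_def
proof (intro ballI impI)
  fix \<phi> :: "real^'n \<Rightarrow> real" assume \<phi>: "\<phi> \<in> test_functions U" and p: "\<forall>x. 0 \<le> \<phi> x"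
  have L: "laplacian \<phi> \<in> test_functions U" by (rule test_laplacian[OF \<phi>])
  obtain K where K: "compact K" "K \<subseteq> U" "\<And>x. x \<notin> K \<Longrightarrow> laplacian \<phi> x = 0" using test_functionsE[OF L] by blast
  have int: "integrable lborel (\<lambda>x. g x * laplacian \<phi> x)" if "continuous_on UNIV g" for g
    by (rule compact_support_integrable[OF _ K(1)]) (auto intro!: continuous_intros that test_continuous[OF L] simp: K(3))
  have cm: "continuous_on UNIV (\<lambda>x. max (f x) \<epsilon>)" for \<epsilon> by (intro continuous_intros f)
  define A where "A = (LINT x|lborel. \<bar>laplacian \<phi> x\<bar>)"
  have key: "- C * (LINT x|lborel. \<phi> x) \<le> (LINT x|lborel. f x * laplacian \<phi> x) + \<epsilon> * A" if \<epsilon>: "\<epsilon> > 0" for \<epsilon>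
  proof -
    have "- C * (LINT x|lborel. \<phi> x) \<le> (LINT x|lborel. max (f x) \<epsilon> * laplacian \<phi> x)"
      using m[OF \<epsilon>, unfolded wsub_def] \<phi> p by blast
    also have "\<dots> \<le> (LINT x|lborel. f x * laplacian \<phi> x + \<epsilon> * \<bar>laplacian \<phi> x\<bar>)"
    proof (rule integral_mono[OF int[OF cm]])
      show "integrable lborel (\<lambda>x. f x * laplacian \<phi> x + \<epsilon> * \<bar>laplacian \<phi> x\<bar>)"
        using int[OF f] test_integrable[OF L] by simp
      fix x
      have "(max (f x) \<epsilon> - f x) * laplacian \<phi> x \<le> \<epsilon> * \<bar>laplacian \<phi> x\<bar>"
      proof -
        have "\<bar>max (f x) \<epsilon> - f x\<bar> \<le> \<epsilon>" using f0[of x] \<epsilon> by (simp add: max_def)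
        then have "\<bar>max (f x) \<epsilon> - f x\<bar> * \<bar>laplacian \<phi> x\<bar> \<le> \<epsilon> * \<bar>laplacian \<phi> x\<bar>" by (intro mult_right_mono) auto
        then show ?thesis using abs_ge_self[of "(max (f x) \<epsilon> - f x) * laplacian \<phi> x"] by (simp only: abs_mult)
      qed
      then show "max (f x) \<epsilon> * laplacian \<phi> x \<le> f x * laplacian \<phi> x + \<epsilon> * \<bar>laplacian \<phi> x\<bar>"
        by (simp add: algebra_simps)
    qed
    also have "\<dots> = (LINT x|lborel. f x * laplacian \<phi> x) + \<epsilon> * A"
      using int[OF f] test_integrable[OF L] by (simp add: A_def)
    finally show ?thesis .
  qed
  have "((\<lambda>\<epsilon>. (LINT x|lborel. f x * laplacian \<phi> x) + \<epsilon> * A) \<longlongrightarrow> (LINT x|lborel. f x * laplacian \<phi> x) + 0 * A) (at_right 0)"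
    by (intro tendsto_intros)
  moreover have "\<forall>\<^sub>F \<epsilon> in at_right 0. - C * (LINT x|lborel. \<phi> x) \<le> (LINT x|lborel. f x * laplacian \<phi> x) + \<epsilon> * A"
    unfolding eventually_at_right_field using key by (intro exI[of _ 1]) auto
  ultimately have "- C * (LINT x|lborel. \<phi> x) \<le> (LINT x|lborel. f x * laplacian \<phi> x) + 0 * A"
    by (rule tendsto_lowerbound) simp
  then show "- C * (LINT x|lborel. \<phi> x) \<le> (LINT x|lborel. f x * laplacian \<phi> x)" by simp
qed

context segregated_minimizer
begin

lemma integral_test_product:
  assumes sub: "U \<subseteq> \<Omega>" and \<psi>: "\<psi> \<in> test_functions U" and f: "continuous_on UNIV f" "\<And>x. x \<in> U \<Longrightarrow> f x = g x"
  shows "(LINT x|lborel. f x * \<psi> x) = (LINT x|M. g x * \<psi> x)"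
proof -
  have \<psi>': "\<psi> \<in> test_functions \<Omega>" by (rule test_mono[OF \<psi> sub])
  have "(LINT x|M. f x * \<psi> x) = (LINT x|lborel. f x * \<psi> x)"
    using test_outside[OF \<psi>'] f(1)
    by (intro lebesgue_on_test(2)[OF open_dom] borel_measurable_times borel_measurable_continuous_onI test_continuous[OF \<psi>]) auto
  moreover have "(LINT x|M. f x * \<psi> x) = (LINT x|M. g x * \<psi> x)"
    using test_outside[OF \<psi>] f(2) by (intro Bochner_Integration.integral_cong refl) (metis mult_zero_right)
  ultimately show ?thesis by simp
qed

lemma integral_test_M: "\<phi> \<in> test_functions \<Omega> \<Longrightarrow> (LINT x|M. \<phi> x) = (LINT x|lborel. \<phi> x)"
  by (intro lebesgue_on_test(2)[OF open_dom] test_borel test_outside)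

lemma wsub_component:
  assumes sub: "U \<subseteq> \<Omega>" and f: "continuous_on UNIV f" "\<And>x. x \<in> U \<Longrightarrow> f x = u x $ i"
  shows "wsub U f (3 * E)"
  unfolding wsub_def
proof (intro ballI impI)
  fix \<phi> :: "real^'n \<Rightarrow> real" assume \<phi>: "\<phi> \<in> test_functions U" and p: "\<forall>x. 0 \<le> \<phi> x"
  have \<phi>': "\<phi> \<in> test_functions \<Omega>" by (rule test_mono[OF \<phi> sub])
  show "- (3 * E) * (LINT x|lborel. \<phi> x) \<le> (LINT x|lborel. f x * laplacian \<phi> x)"
    using subsolution[OF \<phi>', of i] p integral_test_product[OF sub test_laplacian[OF \<phi>] f]
    unfolding integral_test_M[OF \<phi>'] by simp
qed

lemma wsub_minus_hat:
  assumes sub: "U \<subseteq> \<Omega>" and f: "continuous_on UNIV f" "\<And>x. x \<in> U \<Longrightarrow> f x = - hat i x"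
  shows "wsub U f (3 * E)"
  unfolding wsub_def
proof (intro ballI impI)
  fix \<phi> :: "real^'n \<Rightarrow> real" assume \<phi>: "\<phi> \<in> test_functions U" and p: "\<forall>x. 0 \<le> \<phi> x"
  have \<phi>': "\<phi> \<in> test_functions \<Omega>" by (rule test_mono[OF \<phi> sub])
  show "- (3 * E) * (LINT x|lborel. \<phi> x) \<le> (LINT x|lborel. f x * laplacian \<phi> x)"
    using hat_supersolution[OF \<phi>', of i] p integral_test_product[OF sub test_laplacian[OF \<phi>] f]
    unfolding integral_test_M[OF \<phi>'] by simp
qed

text \<open>The distance in the tree between \<open>u\<close> and its translate is subharmonic up to a bounded term. Where it is
  positive it is locally the maximum of differences of components and reflected components; the radius of
  these neighbourhoods is uniform wherever the distance is bounded below.\<close>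

lemma wsub_translate_distance:
  assumes R: "R > 0" and sub: "cball x0 (3 * R) \<subseteq> \<Omega>" and h: "norm h \<le> R"
    and f: "\<And>j. continuous_on UNIV (f j)" "\<And>j x. x \<in> cball x0 (3 * R) \<Longrightarrow> f j x = u x $ j"
  shows "wsub (ball x0 R) (\<lambda>x. \<Sum>j\<in>UNIV. \<bar>f j x - f j (x + h)\<bar>) (6 * E)"
proof -
  let ?K = "ker_mass TYPE('n)" and ?k = "bump_mass TYPE('n)"
  let ?U = "ball x0 (3 * R)"
  define D where "D x = (\<Sum>j\<in>UNIV. \<bar>f j x - f j (x + h)\<bar>)" for x
  define fh where "fh a x = f a x - (\<Sum>j\<in>UNIV - {a}. f j x)" for a x
  have cf_h: "continuous_on UNIV (\<lambda>x. f j (x + d))" for j d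
    by (rule continuous_on_compose2[OF f(1)]) (auto intro!: continuous_intros)
  have cD: "continuous_on UNIV D" unfolding D_def[abs_def] by (intro continuous_intros f cf_h)
  have cfh: "continuous_on UNIV (fh a)" for a unfolding fh_def[abs_def] by (intro continuous_intros f)
  have cfh_h: "continuous_on UNIV (\<lambda>x. fh a (x + d))" for a d
    by (rule continuous_on_compose2[OF cfh]) (auto intro!: continuous_intros)
  have U\<Omega>: "?U \<subseteq> \<Omega>" using sub ball_subset_cball by blast
  have w1: "wsub ?U (f a) (3 * E)" for a
    by (rule wsub_component[OF U\<Omega> f(1)]) (use f(2) in auto)
  have w2: "wsub ?U (\<lambda>x. - fh a x) (3 * E)" for a
  proof (rule wsub_minus_hat[OF U\<Omega>])
    show "continuous_on UNIV (\<lambda>x. - fh a x)" by (intro continuous_intros cfh)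
    show "- fh a x = - hat a x" if "x \<in> ?U" for x
      using f(2)[of x] that by (simp add: fh_def hat_def)
  qed
  have f_nn: "0 \<le> f j x" if "x \<in> cball x0 (3 * R)" for j x using f(2)[OF that] u_nonneg[of x j] that sub by auto
  have f_br: "f i x * f j x = 0" if "x \<in> cball x0 (3 * R)" "i \<noteq> j" for i j x
    using f(2)[OF that(1)] u_disjoint[of x i j] that sub by auto
  \<comment> \<open>The folded coordinate does not increase tree distances.\<close>
  have hat_lip: "\<bar>fh a x - fh a y\<bar> \<le> (\<Sum>j\<in>UNIV. \<bar>f j x - f j y\<bar>)" for a x y
  proof -
    have "fh a x - fh a y = (f a x - f a y) - (\<Sum>j\<in>UNIV - {a}. f j x - f j y)" by (simp add: fh_def sum_subtractf)
    then have "\<bar>fh a x - fh a y\<bar> \<le> \<bar>f a x - f a y\<bar> + \<bar>\<Sum>j\<in>UNIV - {a}. f j x - f j y\<bar>" by linarith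
    also have "\<dots> \<le> \<bar>f a x - f a y\<bar> + (\<Sum>j\<in>UNIV - {a}. \<bar>f j x - f j y\<bar>)" by (intro add_left_mono sum_abs)
    also have "\<dots> = (\<Sum>j\<in>UNIV. \<bar>f j x - f j y\<bar>)" by (rule sum.remove[symmetric]) auto
    finally show ?thesis .
  qed
  have inside: "p + d \<in> cball x0 (3 * R)" if "p \<in> ball x0 R" "norm d \<le> 2 * R" for p d
  proof -
    have "norm (p + d - x0) \<le> norm (p - x0) + norm d" using norm_triangle_ineq[of "p - x0" d] by (simp add: algebra_simps)
    moreover have "norm (p - x0) < R" using that by (simp add: dist_norm norm_minus_commute)
    ultimately have "dist (p + d) x0 \<le> 3 * R" using that by (simp add: dist_norm)
    then show ?thesis by (simp only: mem_cball dist_commute)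
  qed
  have "wsub (ball x0 R) (\<lambda>x. max (D x) \<epsilon>) (6 * E)" if \<epsilon>: "\<epsilon> > 0" for \<epsilon>
  proof -
    have cDe: "continuous_on UNIV (\<lambda>x. max (D x) \<epsilon>)" by (intro continuous_intros cD)
    have "\<exists>d>0. \<forall>x\<in>cball x0 (3 * R). \<forall>y\<in>cball x0 (3 * R). dist y x < d \<longrightarrow> dist (f j y) (f j x) < \<epsilon> / 2" for j
    proof -
      have "uniformly_continuous_on (cball x0 (3 * R)) (f j)"
        by (intro compact_uniformly_continuous continuous_on_subset[OF f(1)]) auto
      then show ?thesis unfolding uniformly_continuous_on_def using \<epsilon> by (meson half_gt_zero)
    qed
    then obtain d where d: "\<And>j. d j > 0"
      "\<And>j x y. x \<in> cball x0 (3 * R) \<Longrightarrow> y \<in> cball x0 (3 * R) \<Longrightarrow> dist y x < d j \<Longrightarrow> dist (f j y) (f j x) < \<epsilon> / 2"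
      by metis
    \<comment> \<open>A radius on which no component varies by \<open>\<epsilon> / 2\<close> or
      more, so that a component of size at least \<open>\<epsilon> / 2\<close> stays positive. Being
      at most \<open>R\<close>, it also keeps the balls around \<open>x\<close> and
      \<open>x + h\<close> inside the large ball.\<close>
    define \<rho>0 where "\<rho>0 = Min (insert R (range d))"
    have \<rho>0: "\<rho>0 > 0" "\<rho>0 \<le> R" "\<And>j. \<rho>0 \<le> d j"
    proof -
      show "\<rho>0 > 0" unfolding \<rho>0_def using R d(1) by (subst Min_gr_iff) auto
      show "\<rho>0 \<le> R" unfolding \<rho>0_def by (rule Min_le) auto
      show "\<rho>0 \<le> d j" for j unfolding \<rho>0_def by (rule Min_le) auto
    qed
    show ?thesis
    proof (rule wsub_of_uniform_mean_value[OF cDe \<rho>0(1)])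
      fix x \<rho> assume x: "x \<in> ball x0 R" and \<rho>: "0 < \<rho>" "\<rho> < \<rho>0"
      have pos: "0 \<le> 6 * E * ?k / 2 * \<rho>\<^sup>2" using E_nonneg bump_mass_pos[where 'n='n] by simp
      show "max (D x) \<epsilon> * ?K \<le> avg (\<lambda>x. max (D x) \<epsilon>) \<rho> x + 6 * E * ?k / 2 * \<rho>\<^sup>2"
      proof (cases "D x \<le> \<epsilon>")
        case True
        have "\<epsilon> * ?K = avg (\<lambda>x. \<epsilon>) \<rho> x" by (rule avg_const[OF \<rho>(1), symmetric])
        also have "\<dots> \<le> avg (\<lambda>x. max (D x) \<epsilon>) \<rho> x"
          by (rule avg_mono[OF \<rho>(1) continuous_on_const cDe]) simp
        finally show ?thesis using True pos by (simp add: max_def)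
      next
        case False
        \<comment> \<open>The shifts \<open>dp\<close> and \<open>dq\<close> are 0 and
          \<open>h\<close> in one of the two orders, so that the point farther from the origin is
          always the one at \<open>x + dp\<close>.\<close>
        have core: "D x * ?K \<le> avg (\<lambda>x. max (D x) \<epsilon>) \<rho> x + 6 * E * ?k / 2 * \<rho>\<^sup>2"
          if p: "norm dp \<le> R" and q: "norm dq \<le> R"
            and Dpq: "\<And>y. D y = (\<Sum>j\<in>UNIV. \<bar>f j (y + dp) - f j (y + dq)\<bar>)"
            and le: "(\<Sum>j\<in>UNIV. f j (x + dq)) \<le> (\<Sum>j\<in>UNIV. f j (x + dp))" for dp dq
        proof -
          have xp: "x + dp \<in> cball x0 (3 * R)" and xq: "x + dq \<in> cball x0 (3 * R)"
            using inside[OF x] p q R by auto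
          have D0: "(\<Sum>j\<in>UNIV. \<bar>f j (x + dp) - f j (x + dq)\<bar>) > 0" using False \<epsilon> Dpq[of x] by simp
          obtain a where a: "(\<Sum>j\<in>UNIV. \<bar>f j (x + dp) - f j (x + dq)\<bar>) \<le> 2 * f a (x + dp)"
            "(\<Sum>j\<in>UNIV. \<bar>f j (x + dp) - f j (x + dq)\<bar>) = f a (x + dp) - (f a (x + dq) - (\<Sum>j\<in>UNIV - {a}. f j (x + dq)))"
            by (rule tree_distance_branch[where \<xi>="\<lambda>j. f j (x + dp)" and \<zeta>="\<lambda>j. f j (x + dq)", OF f_nn[OF xp] f_nn[OF xq] f_br[OF xp] le D0])
          have Dx: "D x = f a (x + dp) - fh a (x + dq)" using a(2) Dpq[of x] by (simp add: fh_def)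
          have fa: "\<epsilon> / 2 \<le> f a (x + dp)" using a(1) False Dpq[of x] by simp
          \<comment> \<open>Where \<open>f a (y + dp)\<close> is positive it equals
            \<open>fh a (y + dp)\<close>, so the expression is a difference of two values of the
            folded coordinate and is at most the distance. At \<open>y = x\<close> there is
            equality, by \<open>Dx\<close>.\<close>
          have near: "f a (y + dp) - fh a (y + dq) \<le> max (D y) \<epsilon>" if y: "y \<in> ball x \<rho>" for y
          proof -
            have yd: "norm (y - x) < \<rho>" using y by (simp add: dist_norm norm_minus_commute)
            have "y + dp = x + (y - x + dp)" by simp
            moreover have "norm (y - x + dp) \<le> 2 * R"
              using norm_triangle_ineq[of "y - x" dp] yd p \<rho> \<rho>0 by linarith
            ultimately have yp: "y + dp \<in> cball x0 (3 * R)" using inside[OF x] by metis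
            have "dist (y + dp) (x + dp) < d a" using yd \<rho> \<rho>0(3)[of a] by (simp add: dist_norm)
            then have "dist (f a (y + dp)) (f a (x + dp)) < \<epsilon> / 2" by (rule d(2)[OF xp yp])
            then have "f a (y + dp) > 0" using fa unfolding dist_real_def by linarith
            then have "f j (y + dp) = 0" if "j \<noteq> a" for j using f_br[OF yp that] by simp
            then have "fh a (y + dp) = f a (y + dp)" by (simp add: fh_def)
            then have "f a (y + dp) - fh a (y + dq) \<le> D y"
              using hat_lip[of a "y + dp" "y + dq"] Dpq[of y] by simp
            then show ?thesis by simp
          qed
          have balls: "cball (x + dd) \<rho> \<subseteq> ?U" if "norm dd \<le> R" for dd
          proof
            fix y assume "y \<in> cball (x + dd) \<rho>"
            then have "norm (y - (x + dd)) \<le> \<rho>" by (simp add: dist_norm norm_minus_commute)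
            moreover have "norm (x - x0) < R" using x by (simp add: dist_norm norm_minus_commute)
            moreover have "norm (y - x0) \<le> norm (y - (x + dd)) + norm (x - x0) + norm dd"
              using norm_triangle_ineq[of "y - (x + dd)" "(x - x0) + dd"] norm_triangle_ineq[of "x - x0" dd]
              by (simp add: algebra_simps)
            ultimately have "dist y x0 < 3 * R" using that \<rho> \<rho>0 by (simp add: dist_norm)
            then show "y \<in> ?U" by (simp only: mem_ball dist_commute)
          qed
          have m1: "f a (x + dp) * ?K \<le> avg (f a) \<rho> (x + dp) + 3 * E * ?k / 2 * \<rho>\<^sup>2"
            by (rule wsub_mean_value[OF w1 f(1) \<rho>(1) balls[OF p]])
          have m2: "- fh a (x + dq) * ?K \<le> avg (\<lambda>x. - fh a x) \<rho> (x + dq) + 3 * E * ?k / 2 * \<rho>\<^sup>2"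
            by (rule wsub_mean_value[OF w2 _ \<rho>(1) balls[OF q]]) (intro continuous_intros cfh)
          have neg: "avg (\<lambda>x. - fh a x) \<rho> (x + dq) = - avg (fh a) \<rho> (x + dq)" by (simp add: avg_def)
          have "avg (f a) \<rho> (x + dp) - avg (fh a) \<rho> (x + dq) = avg (\<lambda>y. f a (y + dp) - fh a (y + dq)) \<rho> x"
            unfolding avg_translate[OF \<rho>(1) f(1)] avg_translate[OF \<rho>(1) cfh] by (rule avg_diff[OF \<rho>(1) cf_h cfh_h, symmetric])
          also have "\<dots> \<le> avg (\<lambda>x. max (D x) \<epsilon>) \<rho> x"
            by (rule avg_mono[OF \<rho>(1) _ cDe near]) (intro continuous_intros cf_h cfh_h)
          finally show ?thesis using m1 m2 unfolding Dx neg by (simp add: algebra_simps)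
        qed
        have "D x * ?K \<le> avg (\<lambda>x. max (D x) \<epsilon>) \<rho> x + 6 * E * ?k / 2 * \<rho>\<^sup>2"
        proof (cases "(\<Sum>j\<in>UNIV. f j (x + h)) \<le> (\<Sum>j\<in>UNIV. f j (x + 0))")
          case True
          show ?thesis by (rule core[OF _ h _ True]) (use R in \<open>auto simp: D_def\<close>)
        next
          case False
          then have "(\<Sum>j\<in>UNIV. f j (x + 0)) \<le> (\<Sum>j\<in>UNIV. f j (x + h))" by simp
          moreover have "D y = (\<Sum>j\<in>UNIV. \<bar>f j (y + h) - f j (y + 0)\<bar>)" for y by (simp add: D_def abs_minus_commute)
          ultimately show ?thesis using core[of h 0] h R by simp
        qed
        then show ?thesis using False by (simp add: max_def)
      qed
    qed
  qed
  then have "wsub (ball x0 R) D (6 * E)"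
    by (rule wsub_of_max[OF cD]) (simp_all add: D_def sum_nonneg)
  then show ?thesis by (simp add: D_def[abs_def])
qed

end

section \<open>Growth at zeros\<close>

text \<open>The factor \<open>2 A B\<close> in the passage from the radius \<open>t\<close> to \<open>q t\<close> does not depend on \<open>q\<close>, so that it is absorbed
  by \<open>q powr - \<epsilon>\<close> when \<open>q\<close> is small.\<close>

lemma power_growth:
  fixes S :: "'a::real_normed_vector \<Rightarrow> real" and b :: "real \<Rightarrow> real"
  assumes t0: "0 < t0" "t0 \<le> 1" and AB: "0 \<le> A" "0 \<le> B" and \<epsilon>: "0 < \<epsilon>" "\<epsilon> < 1" and b: "\<And>t. 0 \<le> b t"
    and S: "\<And>t h. 0 < t \<Longrightarrow> t \<le> t0 \<Longrightarrow> norm h \<le> t / 2 \<Longrightarrow> S h \<le> A * (norm h * b t + t\<^sup>2)"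
    and b_le: "\<And>\<rho> s. 0 < \<rho> \<Longrightarrow> \<rho> \<le> t0 / 2 \<Longrightarrow> 0 \<le> s \<Longrightarrow> (\<And>h. norm h \<le> \<rho> \<Longrightarrow> S h \<le> s) \<Longrightarrow>
      b (\<rho> / 2) \<le> B * (s / \<rho> + sqrt s)"
  obtains C where "0 \<le> C" "\<And>r h. 0 < r \<Longrightarrow> r \<le> t0 / 2 \<Longrightarrow> norm h \<le> r \<Longrightarrow> S h \<le> C * r powr (1 - \<epsilon>)"
proof -
  define C0 where "C0 = 2 * A * B"
  have C0: "C0 \<ge> 0" using AB by (simp add: C0_def)
  \<comment> \<open>The second bound makes \<open>2 * C0 <= q powr - \<epsilon>\<close>; the first
    keeps \<open>2 * q * t\<close> below \<open>t / 2\<close>, within the range of the hypothesis on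
    \<open>S\<close>.\<close>
  define q where "q = min (1 / 4) ((1 / (2 * C0 + 1)) powr (1 / \<epsilon>))"
  have q: "0 < q" "q \<le> 1 / 4" using C0 by (auto simp: q_def)
  have q\<epsilon>: "2 * C0 \<le> q powr - \<epsilon>"
  proof -
    have "q powr \<epsilon> \<le> ((1 / (2 * C0 + 1)) powr (1 / \<epsilon>)) powr \<epsilon>"
      using q \<epsilon> by (intro powr_mono2) (auto simp: q_def)
    also have "\<dots> = 1 / (2 * C0 + 1)" using \<epsilon> C0 by (simp add: powr_powr)
    finally have "(2 * C0 + 1) * q powr \<epsilon> \<le> 1" using C0 by (simp add: field_simps)
    then have "2 * C0 * q powr \<epsilon> \<le> 1" using powr_ge_zero[of q \<epsilon>] by (simp only: distrib_right mult_1)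
    then show ?thesis using q by (simp add: powr_minus field_simps)
  qed
  define C1 where "C1 = B * (A / q + 1)"
  have step: "b (q * t) \<le> C0 * b t + C1" if t: "0 < t" "t \<le> t0" for t
  proof -
    define \<rho> where "\<rho> = 2 * q * t"
    define s where "s = A * (\<rho> * b t + t\<^sup>2)"
    have \<rho>: "0 < \<rho>" "\<rho> \<le> t / 2" using q t mult_right_mono[of q "1/4" t] by (auto simp: \<rho>_def)
    have s0: "0 \<le> s" using AB b[of t] \<rho> by (simp add: s_def)
    have "S h \<le> s" if h: "norm h \<le> \<rho>" for h
    proof -
      have "S h \<le> A * (norm h * b t + t\<^sup>2)" using S[OF t, of h] h \<rho> by simp
      also have "\<dots> \<le> s" unfolding s_def using AB b[of t] h by (intro mult_left_mono add_right_mono mult_right_mono) auto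
      finally show ?thesis .
    qed
    then have "b (\<rho> / 2) \<le> B * (s / \<rho> + sqrt s)" using b_le[of \<rho> s] \<rho> s0 t by simp
    also have "\<dots> \<le> B * (2 * A * b t + (A / q + 1))"
    proof (intro mult_left_mono AB)
      define w where "w = s / \<rho>"
      have w: "0 \<le> w" using s0 \<rho> by (simp add: w_def)
      have "sqrt s = sqrt (w * \<rho>)" using \<rho> by (simp add: w_def)
      also have "\<dots> \<le> (w + \<rho>) / 2" using w \<rho> by (intro arith_geo_mean_sqrt) auto
      also have "\<dots> \<le> w + \<rho>" using w \<rho>(1) by simp
      finally have "sqrt s \<le> s / \<rho> + \<rho>" unfolding w_def .
      then have "s / \<rho> + sqrt s \<le> 2 * (s / \<rho>) + \<rho>" by simp
      also have "2 * (s / \<rho>) = 2 * A * b t + A * t / q"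
        unfolding s_def \<rho>_def using q t by (simp add: field_simps power2_eq_square)
      also have "A * t / q \<le> A / q" using AB t t0 q mult_left_mono[of t 1 A] by (intro divide_right_mono) auto
      finally show "s / \<rho> + sqrt s \<le> 2 * A * b t + (A / q + 1)" using \<rho> t t0 by simp
    qed
    finally show ?thesis by (simp add: C0_def C1_def \<rho>_def algebra_simps)
  qed
  define Q where "Q = max (b t0) (2 * C1)"
  have Q: "b t0 \<le> Q" "C1 \<le> Q / 2" "0 \<le> Q" using b[of t0] by (auto simp: Q_def)
  have iter: "b (q ^ n * t0) \<le> Q * (q ^ n) powr - \<epsilon>" for n
  proof (induction n)
    case 0 then show ?case using Q by simp
  next
    case (Suc n)
    let ?X = "(q ^ Suc n) powr - \<epsilon>" and ?Y = "(q ^ n) powr - \<epsilon>"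
    have qn: "0 < q ^ n" "q ^ n \<le> 1" using q by (auto intro: power_le_one)
    have X: "?X = q powr - \<epsilon> * ?Y" using q by (simp add: powr_mult)
    have "0 < q ^ Suc n" "q ^ Suc n \<le> 1" using q by (auto intro!: power_le_one simp del: power_Suc)
    then have X1: "1 \<le> ?X" using powr_mono2'[of "- \<epsilon>" "q ^ Suc n" 1] \<epsilon> by simp
    have "q ^ n * t0 \<le> t0" using qn t0 mult_right_mono[of "q ^ n" 1 t0] by simp
    then have "b (q * (q ^ n * t0)) \<le> C0 * b (q ^ n * t0) + C1" using qn t0 by (intro step) auto
    also have "\<dots> \<le> C0 * (Q * ?Y) + Q / 2" using Suc Q C0 by (intro add_mono mult_left_mono) auto
    also have "\<dots> \<le> Q / 2 * ?X + Q / 2 * ?X"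
    proof (rule add_mono)
      show "C0 * (Q * ?Y) \<le> Q / 2 * ?X"
      proof -
        have "2 * C0 * (Q * ?Y) \<le> q powr - \<epsilon> * (Q * ?Y)" using q\<epsilon> Q by (intro mult_right_mono) auto
        then show ?thesis unfolding X by (simp add: mult_ac)
      qed
      show "Q / 2 \<le> Q / 2 * ?X" using mult_left_mono[OF X1, of "Q / 2"] Q by simp
    qed
    also have "\<dots> = Q * ?X" by simp
    finally show ?case by (simp only: power_Suc mult.assoc)
  qed
  define C where "C = A * (Q + 4 / q\<^sup>2)"
  show ?thesis
  proof (rule that[of C])
    show "0 \<le> C" using AB Q by (simp add: C_def)
    fix r :: real and h :: 'a assume r: "0 < r" "r \<le> t0 / 2" and h: "norm h \<le> r"
    let ?x = "2 * r / t0"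
    have x: "0 < ?x" "?x \<le> 1" using r t0 by auto
    have ex: "\<exists>n. q ^ Suc n < ?x"
    proof -
      obtain m where "q ^ m < ?x" using real_arch_pow_inv[OF x(1), of q] q by auto
      moreover have "q ^ Suc m \<le> q ^ m" using q by (intro power_decreasing) auto
      ultimately show ?thesis by (meson le_less_trans)
    qed
    define n where "n = (LEAST n. q ^ Suc n < ?x)"
    have n1: "q ^ Suc n < ?x" unfolding n_def by (rule LeastI_ex[OF ex])
    have n2: "?x \<le> q ^ n"
    proof (cases n)
      case (Suc m)
      then have "\<not> q ^ Suc m < ?x" using not_less_Least[of m "\<lambda>n. q ^ Suc n < ?x"] by (simp add: n_def)
      then show ?thesis using Suc by simp
    qed (use x in simp)
    let ?t = "q ^ n * t0"
    have t: "0 < ?t" "?t \<le> t0" using q t0 mult_right_mono[of "q ^ n" 1 t0] power_le_one[of q n] by auto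
    have rt: "2 * r \<le> ?t" using n2 t0 by (simp add: pos_divide_le_eq)
    have tr: "?t \<le> 2 * r / q" using n1 t0 q by (simp add: field_simps)
    have r1: "r \<le> 1" using r t0 by simp
    have "S h \<le> A * (norm h * b ?t + ?t\<^sup>2)" using S[OF t, of h] h rt by simp
    also have "\<dots> \<le> A * (Q * r powr (1 - \<epsilon>) + 4 / q\<^sup>2 * r powr (1 - \<epsilon>))"
    proof (intro mult_left_mono add_mono AB)
      have "q ^ n * t0 \<le> q ^ n * 1" using t0 q by (intro mult_left_mono) auto
      then have rq: "r \<le> q ^ n" using rt r by linarith
      have "norm h * b ?t \<le> r * (Q * (q ^ n) powr - \<epsilon>)"
        using h b[of ?t] iter[of n] r by (intro mult_mono) auto
      also have "\<dots> \<le> r * (Q * r powr - \<epsilon>)"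
        using rq r \<epsilon> Q by (intro mult_left_mono powr_mono2') auto
      also have "\<dots> = Q * r powr (1 - \<epsilon>)" using r powr_add[of r 1 "- \<epsilon>"] by simp
      finally show "norm h * b ?t \<le> Q * r powr (1 - \<epsilon>)" .
      have "?t\<^sup>2 \<le> (2 * r / q)\<^sup>2" using tr t by (intro power_mono) auto
      also have "\<dots> = 4 / q\<^sup>2 * r powr 2" using r by (simp add: power_divide power_mult_distrib powr_numeral)
      also have "\<dots> \<le> 4 / q\<^sup>2 * r powr (1 - \<epsilon>)"
        using r r1 \<epsilon> by (intro mult_left_mono powr_mono') auto
      finally show "?t\<^sup>2 \<le> 4 / q\<^sup>2 * r powr (1 - \<epsilon>)" .
    qed
    finally show "S h \<le> C * r powr (1 - \<epsilon>)" by (simp add: C_def algebra_simps)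
  qed
qed

context segregated_minimizer
begin

lemma gnorm_caccioppoli:
  assumes r: "r > 0" and sub: "cball x0 r \<subseteq> \<Omega>" and s: "0 \<le> s" "\<And>x. x \<in> ball x0 r \<Longrightarrow> u x $ i \<le> s"
  shows "gnorm x0 (r / 2) i \<le>
    exp (4 / 3) * measure lborel (ball (0::real^'n) 1) * (2 * CARD('n) + 72 + 3 * E) * ((s / r)\<^sup>2 + s) * r ^ CARD('n)"
proof -
  let ?B = "ball x0 r" and ?b = "bump x0 r" and ?m = "measure lborel (ball x0 r)"
  have sub': "?B \<subseteq> \<Omega>" using sub ball_subset_cball by blast
  have t: "?b \<in> test_functions \<Omega>" by (rule bump_test[OF r sub])
  note B = ball_lebesgue_on[OF open_dom sub']
  have u_bd: "0 \<le> u x $ i" "u x $ i \<le> s" if "x \<in> ?B" for x using u_nonneg s(2) that sub' by auto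
  have B_int: "integrable M (\<lambda>x. c * indicator ?B x)" "(LINT x|M. c * indicator ?B x) = c * ?m" for c :: real
    using B by (simp_all add: Int_absorb2[OF sub'])
  have "exp (- 4 / 3) * gnorm x0 (r / 2) i = (LINT x|M. exp (- 4 / 3) * (indicator (ball x0 (r / 2)) x * (norm (G i x))\<^sup>2))"
    by (simp add: gnorm_def)
  also have "\<dots> \<le> (LINT x|M. ?b x * (norm (G i x))\<^sup>2)"
  proof (rule integral_mono')
    show "integrable M (\<lambda>x. ?b x * (norm (G i x))\<^sup>2)"
    proof (rule Bochner_Integration.integrable_bound[OF L2_integrable[OF L2_G]])
      show "(\<lambda>x. ?b x * (norm (G i x))\<^sup>2) \<in> borel_measurable M"
        by (rule borel_measurable_times[OF borel_imp_lebesgue_on[OF test_borel[OF t]]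
              borel_measurable_integrable[OF L2_integrable[OF L2_G]]])
      show "AE x in M. norm (?b x * (norm (G i x))\<^sup>2) \<le> norm ((norm (G i x))\<^sup>2)"
        using bump_nonneg[of x0 r] bump_le_1[of x0 r] by (intro AE_I2) (simp add: abs_mult mult_left_le_one_le)
    qed
    fix x
    show "0 \<le> ?b x * (norm (G i x))\<^sup>2" using bump_nonneg[of x0 r x] by simp
    show "exp (- 4 / 3) * (indicator (ball x0 (r / 2)) x * (norm (G i x))\<^sup>2) \<le> ?b x * (norm (G i x))\<^sup>2"
      using bump_lower[OF r, of x x0] bump_nonneg[of x0 r x]
      by (cases "x \<in> ball x0 (r / 2)") (auto intro: mult_right_mono)
  qed
  also have "\<dots> \<le> 1/2 * (LINT x|M. (u x $ i)\<^sup>2 * laplacian ?b x) + 3 * E * (LINT x|M. ?b x * u x $ i)"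
    by (rule caccioppoli[OF t]) (rule bump_nonneg bump_le_1)+
  also have "(LINT x|M. (u x $ i)\<^sup>2 * laplacian ?b x) \<le> (LINT x|M. (s\<^sup>2 * ((4 * CARD('n) + 144) / r\<^sup>2)) * indicator ?B x)"
  proof (rule integral_mono'[OF B_int(1)])
    fix x
    show "0 \<le> (s\<^sup>2 * ((4 * CARD('n) + 144) / r\<^sup>2)) * indicator ?B x" by simp
    show "(u x $ i)\<^sup>2 * laplacian ?b x \<le> (s\<^sup>2 * ((4 * CARD('n) + 144) / r\<^sup>2)) * indicator ?B x"
    proof (cases "x \<in> ?B")
      case True
      have "(u x $ i)\<^sup>2 * laplacian ?b x \<le> (u x $ i)\<^sup>2 * ((4 * CARD('n) + 144) / r\<^sup>2)"
        using abs_laplacian_bump[OF r, of x0 x] by (intro mult_left_mono) auto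
      also have "\<dots> \<le> s\<^sup>2 * ((4 * CARD('n) + 144) / r\<^sup>2)"
        using u_bd[OF True] by (intro mult_right_mono power_mono) auto
      finally show ?thesis using True by simp
    next
      case False
      then have "laplacian ?b x = 0" unfolding laplacian_bump using flat_bump_outside[OF r, of x x0] by simp
      then show ?thesis using False by simp
    qed
  qed
  also have "(LINT x|M. ?b x * u x $ i) \<le> (LINT x|M. s * indicator ?B x)"
  proof (rule integral_mono'[OF B_int(1)])
    fix x
    show "0 \<le> s * indicator ?B x" using s by simp
    show "?b x * u x $ i \<le> s * indicator ?B x"
    proof (cases "x \<in> ?B")
      case True
      then show ?thesis using u_bd[OF True] bump_nonneg[of x0 r x] bump_le_1[of x0 r x]
          mult_mono[of "?b x" 1 "u x $ i" s] by simp
    qed (use bump_outside[OF r, of x x0] in simp)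
  qed
  finally have "exp (- 4 / 3) * gnorm x0 (r / 2) i
      \<le> 1/2 * (s\<^sup>2 * ((4 * CARD('n) + 144) / r\<^sup>2) * ?m) + 3 * E * (s * ?m)"
    unfolding B_int(2) using E_nonneg by (simp add: mult_left_mono)
  also have "\<dots> = ((2 * CARD('n) + 72) * (s / r)\<^sup>2 + 3 * E * s) * ?m"
    using r by (simp add: field_simps power2_eq_square)
  also have "\<dots> \<le> (2 * CARD('n) + 72 + 3 * E) * ((s / r)\<^sup>2 + s) * ?m"
    using E_nonneg s by (intro mult_right_mono) (auto simp: algebra_simps intro!: add_nonneg_nonneg)
  finally have "exp (4 / 3) * (exp (- 4 / 3) * gnorm x0 (r / 2) i) \<le> exp (4 / 3) * ((2 * CARD('n) + 72 + 3 * E) * ((s / r)\<^sup>2 + s) * ?m)"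
    by (intro mult_left_mono) auto
  moreover have "exp (4 / 3) * (exp (- 4 / 3) * gnorm x0 (r / 2) i) = gnorm x0 (r / 2) i"
    by (simp add: exp_minus)
  ultimately have "gnorm x0 (r / 2) i \<le> exp (4 / 3) * ((2 * CARD('n) + 72 + 3 * E) * ((s / r)\<^sup>2 + s) * ?m)" by linarith
  then show ?thesis unfolding measure_ball_scale[OF r] by (simp only: mult_ac)
qed

lemma component_sum_bound:
  assumes sub: "cball x0 (3 * R) \<subseteq> \<Omega>" and z: "u x0 = 0" and r: "0 < r" "r < R" and h: "norm h \<le> r"
  shows "(\<Sum>j\<in>UNIV. u (x0 + h) $ j) * ker_mass TYPE('n) \<le>
    4 / r ^ CARD('n) * norm h * (\<Sum>j\<in>UNIV. sqrt (measure lborel (ball x0 (2 * r))) * sqrt (gnorm x0 (2 * r) j))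
    + 3 * E * bump_mass TYPE('n) * r\<^sup>2"
proof -
  let ?B = "ball x0 r" and ?B2 = "ball x0 (2 * r)" and ?B' = "ball x0 (r + norm h)"
  have "\<exists>f. continuous_on UNIV f \<and> (\<forall>x\<in>cball x0 (3 * R). f x = u x $ j)" for j
    using continuous_extension_cball[OF cont_nth sub, of j] by metis
  then obtain f where f: "\<And>j. continuous_on UNIV (f j)" "\<And>j x. x \<in> cball x0 (3 * R) \<Longrightarrow> f j x = u x $ j"
    by metis
  define D where "D x = (\<Sum>j\<in>UNIV. \<bar>f j x - f j (x + h)\<bar>)" for x
  have cf: "continuous_on UNIV (\<lambda>x. \<bar>f j x - f j (x + h)\<bar>)" for j
    by (intro continuous_intros f continuous_on_compose2[OF f(1)]) auto
  have cD: "continuous_on UNIV D" unfolding D_def[abs_def] by (intro continuous_intros cf)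
  have hR: "norm h \<le> R" using h r by simp
  have w: "wsub (ball x0 R) D (6 * E)"
    unfolding D_def[abs_def] by (rule wsub_translate_distance[OF _ sub hR f]) (use r in auto)
  have "cball x0 r \<subseteq> ball x0 R" using r by auto
  from wsub_mean_value[OF w cD r(1) this]
  have mv: "D x0 * ker_mass TYPE('n) \<le> avg D r x0 + 3 * E * bump_mass TYPE('n) * r\<^sup>2"
    by (simp add: mult_ac)
  have D0: "D x0 = (\<Sum>j\<in>UNIV. u (x0 + h) $ j)"
  proof -
    have "x0 + h \<in> cball x0 (3 * R)" using hR r norm_ge_zero[of h] by (simp add: dist_norm)
    moreover from this have "x0 + h \<in> \<Omega>" using sub by blast
    ultimately show ?thesis
      unfolding D_def using f(2)[of x0] f(2)[of "x0 + h"] z r u_nonneg[of "x0 + h"] by (intro sum.cong) auto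
  qed
  have sub2: "?B2 \<subseteq> \<Omega>" using sub r by (intro order.trans[OF _ sub]) auto
  have B'2: "?B' \<subseteq> ?B2" using h by auto
  have sub': "?B' \<subseteq> \<Omega>" using B'2 sub2 by blast
  have B'R: "?B' \<subseteq> cball x0 (3 * R)" using h r by auto
  note B2 = ball_lebesgue_on[OF open_dom sub2]
  have disp: "(LINT x|lborel. indicator ?B x * \<bar>f j x - f j (x + h)\<bar>)
      \<le> norm h * (sqrt (measure lborel ?B2) * sqrt (gnorm x0 (2 * r) j))" for j
  proof -
    have "(LINT x|lborel. indicator ?B x * \<bar>f j x - f j (x + h)\<bar>)
        = (LINT x|lborel. indicator ?B x * \<bar>f j (x0 + (1 - 0) *\<^sub>R (x - x0) + h) - f j x\<bar>)"
      by (simp add: abs_minus_commute)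
    also have "\<dots> \<le> (norm h + 0 * r) / (1 - 0) ^ CARD('n) * (LINT x|M. indicator ?B' x * norm (G j x))"
      by (rule sob_displacement[OF open_dom sob_u f(1) r(1) _ _ sub']) (use f(2) B'R in auto)
    also have "\<dots> = norm h * (LINT x|M. indicator ?B' x * norm (G j x))" by simp
    also have "(LINT x|M. indicator ?B' x * norm (G j x)) \<le> (LINT x|M. indicator ?B2 x * norm (G j x))"
    proof (rule integral_mono')
      show "integrable M (\<lambda>x. indicator ?B2 x * norm (G j x))" by (rule L2_imp_L1_on(1)[OF B2(1,2) L2_G])
      show "indicator ?B' x * norm (G j x) \<le> indicator ?B2 x * norm (G j x)" for x
        using B'2 by (intro mult_right_mono) (auto simp: indicator_def)
    qed simp
    also have "(LINT x|M. indicator ?B2 x * norm (G j x)) \<le> sqrt (measure lborel ?B2) * sqrt (gnorm x0 (2 * r) j)"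
      by (rule gradient_L1_ball[OF sub2])
    finally show ?thesis by (simp add: mult_left_mono)
  qed
  have iD: "integrable lborel (\<lambda>x. indicator ?B x * \<bar>f j x - f j (x + h)\<bar>)" for j
    by (rule integrable_indicator_continuous[OF cf]) auto
  have Dsum: "indicator ?B x * D x = (\<Sum>j\<in>UNIV. indicator ?B x * \<bar>f j x - f j (x + h)\<bar>)" for x
    by (simp add: D_def sum_distrib_left)
  have "avg D r x0 \<le> (LINT x|lborel. 4 / r ^ CARD('n) * (indicator ?B x * D x))"
    unfolding avg_def
  proof (rule integral_mono')
    show "integrable lborel (\<lambda>x. 4 / r ^ CARD('n) * (indicator ?B x * D x))"
      unfolding Dsum by (intro integrable_mult_right Bochner_Integration.integrable_sum iD)
    fix x
    have D_nn: "0 \<le> D x" by (simp add: D_def sum_nonneg)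
    show "0 \<le> 4 / r ^ CARD('n) * (indicator ?B x * D x)" using D_nn r by simp
    show "D x * ker r x0 x \<le> 4 / r ^ CARD('n) * (indicator ?B x * D x)"
    proof (cases "x \<in> ?B")
      case True
      have "ker r x0 x \<le> 2 / r ^ CARD('n) * 2"
        unfolding ker_def using flat_bounded[of 2] r by (intro mult_left_mono) (auto simp: fact_numeral)
      then show ?thesis using True D_nn mult_left_mono[of "ker r x0 x" "4 / r ^ CARD('n)" "D x"] by (simp add: mult.commute)
    qed (use ker_outside[OF r(1), of x x0] in simp)
  qed
  also have "\<dots> = 4 / r ^ CARD('n) * (\<Sum>j\<in>UNIV. LINT x|lborel. indicator ?B x * \<bar>f j x - f j (x + h)\<bar>)"
    unfolding Dsum integral_mult_right_zero by (subst Bochner_Integration.integral_sum) (rule iD, rule refl)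
  also have "\<dots> \<le> 4 / r ^ CARD('n) * (\<Sum>j\<in>UNIV. norm h * (sqrt (measure lborel ?B2) * sqrt (gnorm x0 (2 * r) j)))"
    using r by (intro mult_left_mono sum_mono disp) auto
  finally show ?thesis using mv unfolding D0 by (simp add: sum_distrib_left mult.assoc)
qed

lemma growth:
  assumes x0: "x0 \<in> \<Omega>" and z: "u x0 = 0" and \<epsilon>: "0 < \<epsilon>" "\<epsilon> < 1"
  obtains C r1 where "0 \<le> C" "0 < r1" "r1 \<le> 1" "cball x0 r1 \<subseteq> \<Omega>"
    "\<And>r x i. 0 < r \<Longrightarrow> r \<le> r1 \<Longrightarrow> x \<in> cball x0 r \<Longrightarrow> u x $ i \<le> C * r powr (1 - \<epsilon>)"
proof -
  obtain R0 where R0: "R0 > 0" "cball x0 R0 \<subseteq> \<Omega>" using open_dom x0 open_contains_cball by blast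
  define R where "R = min 1 (R0 / 3)"
  have R: "0 < R" "R \<le> 1" "cball x0 (3 * R) \<subseteq> \<Omega>" using R0 by (auto simp: R_def)
  let ?\<omega> = "measure lborel (ball (0::real^'n) 1)" and ?N = "CARD('n)"
  have \<omega>: "?\<omega> \<ge> 0" by simp
  define b where "b t = (\<Sum>j\<in>UNIV. sqrt (gnorm x0 t j)) / sqrt (t ^ ?N)" for t
  define S where "S h = (if norm h \<le> R then \<Sum>j\<in>UNIV. u (x0 + h) $ j else 0)" for h
  define A where "A = max (4 * 2 ^ ?N * sqrt ?\<omega>) (3 * E * bump_mass TYPE('n)) / ker_mass TYPE('n)"
  define Q where "Q = exp (4 / 3) * ?\<omega> * (2 * ?N + 72 + 3 * E)"
  define B where "B = CARD('k) * sqrt Q * sqrt (2 ^ ?N)"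
  have K: "ker_mass TYPE('n) > 0" by (rule ker_mass_pos)
  have A0: "0 \<le> A" unfolding A_def using K \<omega> by (simp add: le_max_iff_disj)
  have Q0: "0 \<le> Q" unfolding Q_def using E_nonneg by simp
  have B0: "0 \<le> B" unfolding B_def using Q0 by simp
  have inO: "x0 + h \<in> \<Omega>" if "norm h \<le> 3 * R" for h
    using R(3) that by (auto simp: dist_norm subset_iff)
  have comp_le: "u (x0 + h) $ i \<le> S h" if "norm h \<le> R" for h i
    using that R inO[of h] u_nonneg unfolding S_def by (auto intro!: member_le_sum)
  obtain C where C: "0 \<le> C" "\<And>r h. 0 < r \<Longrightarrow> r \<le> R / 2 \<Longrightarrow> norm h \<le> r \<Longrightarrow> S h \<le> C * r powr (1 - \<epsilon>)"
  proof (rule power_growth[of R A B \<epsilon> b S])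
    show "0 < R" "R \<le> 1" "0 \<le> A" "0 \<le> B" "0 < \<epsilon>" "\<epsilon> < 1" by fact+
    show "0 \<le> b t" for t
    proof (cases "0 \<le> t")
      case True
      then show ?thesis unfolding b_def by (intro divide_nonneg_nonneg sum_nonneg) (auto simp: gnorm_nonneg)
    next
      case False
      then have "ball x0 t = {}" by simp
      then have "gnorm x0 t j = 0" for j by (simp add: gnorm_def del: ball_eq_empty)
      then show ?thesis by (simp add: b_def)
    qed
    show "S h \<le> A * (norm h * b t + t\<^sup>2)" if t: "0 < t" "t \<le> R" and h: "norm h \<le> t / 2" for t h
    proof -
      let ?K = "ker_mass TYPE('n)"
      have "S h * ?K \<le> 4 / (t / 2) ^ ?N * norm h * (\<Sum>j\<in>UNIV. sqrt (measure lborel (ball x0 (2 * (t / 2)))) * sqrt (gnorm x0 (2 * (t / 2)) j))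
          + 3 * E * bump_mass TYPE('n) * (t / 2)\<^sup>2"
        unfolding S_def using component_sum_bound[OF R(3) z, of "t / 2" h] t h by simp
      also have "(\<Sum>j\<in>UNIV. sqrt (measure lborel (ball x0 (2 * (t / 2)))) * sqrt (gnorm x0 (2 * (t / 2)) j))
          = sqrt ?\<omega> * (t ^ ?N * b t)"
      proof -
        have "t ^ ?N * b t = sqrt (t ^ ?N) * (\<Sum>j\<in>UNIV. sqrt (gnorm x0 t j))"
          unfolding b_def using t real_sqrt_mult_self[of "t ^ ?N"] by (simp add: field_simps)
        then show ?thesis using measure_ball_scale[OF t(1), of x0] t
          by (simp add: real_sqrt_mult sum_distrib_left mult_ac)
      qed
      also have "4 / (t / 2) ^ ?N * norm h * (sqrt ?\<omega> * (t ^ ?N * b t)) = 4 * 2 ^ ?N * sqrt ?\<omega> * (norm h * b t)"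
        using t by (simp add: power_divide)
      also have "\<dots> + 3 * E * bump_mass TYPE('n) * (t / 2)\<^sup>2 \<le> (A * ?K) * (norm h * b t) + (A * ?K) * t\<^sup>2"
      proof (rule add_mono)
        have "0 \<le> norm h * b t" unfolding b_def using t gnorm_nonneg by (intro mult_nonneg_nonneg divide_nonneg_nonneg sum_nonneg) auto
        moreover have "4 * 2 ^ ?N * sqrt ?\<omega> \<le> A * ?K" using K by (simp add: A_def)
        ultimately show "4 * 2 ^ ?N * sqrt ?\<omega> * (norm h * b t) \<le> (A * ?K) * (norm h * b t)" by (rule mult_right_mono[rotated])
        have "(t / 2)\<^sup>2 \<le> t\<^sup>2" using t by (intro power_mono) auto
        moreover have "3 * E * bump_mass TYPE('n) \<le> A * ?K" using K by (simp add: A_def)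
        ultimately show "3 * E * bump_mass TYPE('n) * (t / 2)\<^sup>2 \<le> (A * ?K) * t\<^sup>2"
          using A0 K by (intro mult_mono[of "3 * E * bump_mass TYPE('n)"]) auto
      qed
      finally have "S h * ?K \<le> (A * (norm h * b t + t\<^sup>2)) * ?K" by (simp add: algebra_simps)
      then show ?thesis using K by simp
    qed
    show "b (\<rho> / 2) \<le> B * (s / \<rho> + sqrt s)"
      if \<rho>: "0 < \<rho>" "\<rho> \<le> R / 2" and s: "0 \<le> s" "\<And>h. norm h \<le> \<rho> \<Longrightarrow> S h \<le> s" for \<rho> s
    proof -
      have sub: "cball x0 \<rho> \<subseteq> \<Omega>" using \<rho> by (intro order.trans[OF _ R(3)]) auto
      have "u x $ j \<le> s" if "x \<in> ball x0 \<rho>" for x j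
        using that comp_le[of "x - x0" j] s(2)[of "x - x0"] \<rho> by (simp add: dist_norm norm_minus_commute)
      then have g: "gnorm x0 (\<rho> / 2) j \<le> Q * ((s / \<rho>)\<^sup>2 + s) * \<rho> ^ ?N" for j
        unfolding Q_def by (intro gnorm_caccioppoli[OF \<rho>(1) sub s(1)])
      have "sqrt (gnorm x0 (\<rho> / 2) j) \<le> sqrt Q * (s / \<rho> + sqrt s) * sqrt (\<rho> ^ ?N)" for j
      proof -
        have "sqrt (gnorm x0 (\<rho> / 2) j) \<le> sqrt (Q * ((s / \<rho>)\<^sup>2 + s) * \<rho> ^ ?N)" using g by simp
        also have "\<dots> = sqrt Q * sqrt ((s / \<rho>)\<^sup>2 + s) * sqrt (\<rho> ^ ?N)" by (simp add: real_sqrt_mult)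
        also have "sqrt ((s / \<rho>)\<^sup>2 + s) \<le> sqrt ((s / \<rho>)\<^sup>2) + sqrt s" using s by (intro sqrt_add_le_add_sqrt) auto
        also have "sqrt ((s / \<rho>)\<^sup>2) = s / \<rho>" using s \<rho> by simp
        finally show ?thesis using Q0 \<rho> by (simp add: mult_left_mono mult_right_mono)
      qed
      then have "(\<Sum>j\<in>UNIV. sqrt (gnorm x0 (\<rho> / 2) j)) \<le> (\<Sum>j::'k\<in>UNIV. sqrt Q * (s / \<rho> + sqrt s) * sqrt (\<rho> ^ ?N))"
        by (intro sum_mono)
      then have "b (\<rho> / 2) \<le> (CARD('k) * (sqrt Q * (s / \<rho> + sqrt s) * sqrt (\<rho> ^ ?N))) / sqrt ((\<rho> / 2) ^ ?N)"
        unfolding b_def using \<rho> by (intro divide_right_mono) auto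
      also have "\<dots> = B * (s / \<rho> + sqrt s)"
        unfolding B_def using \<rho> by (simp add: power_divide real_sqrt_divide)
      finally show ?thesis .
    qed
  next
    fix C assume "0 \<le> C" "\<And>r h. 0 < r \<Longrightarrow> r \<le> R / 2 \<Longrightarrow> norm h \<le> r \<Longrightarrow> S h \<le> C * r powr (1 - \<epsilon>)"
    then show thesis by (rule that)
  qed
  show ?thesis
  proof (rule that[of C "R / 2"])
    show "0 \<le> C" "0 < R / 2" "R / 2 \<le> 1" using C R by auto
    show "cball x0 (R / 2) \<subseteq> \<Omega>" using R by (intro order.trans[OF _ R(3)]) auto
    show "u x $ i \<le> C * r powr (1 - \<epsilon>)" if "0 < r" "r \<le> R / 2" "x \<in> cball x0 r" for r x i
      using comp_le[of "x - x0" i] C(2)[of r "x - x0"] that R by (simp add: dist_norm norm_minus_commute)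
  qed
qed

lemma local_norm_growth:
  assumes N: "2 \<le> CARD('n)" and x0: "x0 \<in> \<Omega>" and z: "u x0 = 0" and \<epsilon>: "0 < \<epsilon>" "\<epsilon> < 1"
  obtains K r2 where "0 < r2" "\<And>r. 0 < r \<Longrightarrow> r \<le> r2 \<Longrightarrow> local_norm \<Omega> u x0 r \<le> K * r powr (1 - \<epsilon>)"
proof -
  obtain C r1 where C: "0 \<le> C" "0 < r1" "r1 \<le> 1" "cball x0 r1 \<subseteq> \<Omega>"
    "\<And>r x i. 0 < r \<Longrightarrow> r \<le> r1 \<Longrightarrow> x \<in> cball x0 r \<Longrightarrow> u x $ i \<le> C * r powr (1 - \<epsilon>)"
    using growth[OF x0 z \<epsilon>] by metis
  let ?\<omega> = "measure lborel (ball (0::real^'n) 1)" and ?N = "CARD('n)"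
  define Q where "Q = exp (4 / 3) * ?\<omega> * (2 * ?N + 72 + 3 * E)"
  have Q0: "0 \<le> Q" unfolding Q_def using E_nonneg by simp
  define L where "L = Q * 2 ^ ?N * (2 * (2 * C)\<^sup>2 + 1) + ?N * ?\<omega> * (2 * C)\<^sup>2"
  have L0: "0 \<le> L" unfolding L_def using Q0 by simp
  show ?thesis
  proof (rule that[of "r1 / 2" "sqrt (CARD('k) * L)"])
    show "0 < r1 / 2" using C by simp
    fix r assume r: "0 < r" "r \<le> r1 / 2"
    let ?p = "r powr (1 - \<epsilon>)"
    define s where "s = 2 * C * ?p"
    have s0: "0 \<le> s" using C by (simp add: s_def)
    have sub2: "cball x0 (2 * r) \<subseteq> \<Omega>" using r by (intro order.trans[OF _ C(4)]) auto
    have sub: "cball x0 r \<subseteq> \<Omega>" using r by (intro order.trans[OF _ C(4)]) auto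
    have us: "u x $ i \<le> s" if "x \<in> cball x0 (2 * r)" for x i
    proof -
      have "u x $ i \<le> C * (2 * r) powr (1 - \<epsilon>)" using C(5)[of "2 * r" x i] that r by simp
      also have "(2 * r) powr (1 - \<epsilon>) \<le> 2 * ?p"
        using r \<epsilon> powr_mono[of "1 - \<epsilon>" 1 "2::real"] by (simp add: powr_mult mult_right_mono)
      finally show ?thesis using C by (simp add: s_def mult_left_mono)
    qed
    have r2p: "r\<^sup>2 \<le> ?p"
      using r C \<epsilon> powr_mono'[of "1 - \<epsilon>" 2 r] by (simp add: powr_numeral)
    have part: "1 / r ^ (?N - 2) * gnorm x0 r i + ?N / r ^ ?N * tnorm x0 r i \<le> L * ?p\<^sup>2" for i
    proof -
      have rp: "r ^ ?N = r\<^sup>2 * r ^ (?N - 2)" using N by (metis le_add_diff_inverse power_add)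
      have "gnorm x0 (2 * r / 2) i \<le> Q * ((s / (2 * r))\<^sup>2 + s) * (2 * r) ^ ?N"
        unfolding Q_def using us by (intro gnorm_caccioppoli[OF _ sub2 s0]) (use r in auto)
      then have "1 / r ^ (?N - 2) * gnorm x0 r i \<le> 1 / r ^ (?N - 2) * (Q * ((s / (2 * r))\<^sup>2 + s) * (2 * r) ^ ?N)"
        using r by (intro mult_left_mono) auto
      also have "\<dots> = Q * 2 ^ ?N * (s\<^sup>2 / 4 + s * r\<^sup>2)"
        using r unfolding power_mult_distrib rp by (simp add: field_simps power2_eq_square)
      also have "\<dots> \<le> Q * 2 ^ ?N * (2 * (2 * C)\<^sup>2 * ?p\<^sup>2 + ?p\<^sup>2)"
      proof (intro mult_left_mono)
        have "s * r\<^sup>2 \<le> s * ?p" using r2p s0 by (rule mult_left_mono)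
        also have "\<dots> \<le> s\<^sup>2 + ?p\<^sup>2"
          using sum_squares_bound[of s ?p] s0 by (simp add: mult.assoc) (smt (verit) mult_nonneg_nonneg powr_ge_zero)
        finally have "s\<^sup>2 / 4 + s * r\<^sup>2 \<le> 2 * s\<^sup>2 + ?p\<^sup>2" using zero_le_power2[of s] by linarith
        then show "s\<^sup>2 / 4 + s * r\<^sup>2 \<le> 2 * (2 * C)\<^sup>2 * ?p\<^sup>2 + ?p\<^sup>2" by (simp add: s_def power_mult_distrib)
      qed (use Q0 in simp)
      finally have 1: "1 / r ^ (?N - 2) * gnorm x0 r i \<le> Q * 2 ^ ?N * (2 * (2 * C)\<^sup>2 + 1) * ?p\<^sup>2"
        by (simp add: algebra_simps)
      have "tnorm x0 r i \<le> (LINT x|lborel. s\<^sup>2 * indicator (ball x0 r) x)"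
        unfolding tnorm_def
      proof (rule integral_mono')
        show "integrable lborel (\<lambda>x. s\<^sup>2 * indicator (ball x0 r) x)"
          using emeasure_bounded_finite[of "ball x0 r"] by simp
        fix x
        have "x0 + r *\<^sub>R sgn (x - x0) \<in> cball x0 r" by (rule on_sphere_in_cball[OF r(1)])
        moreover from this have "x0 + r *\<^sub>R sgn (x - x0) \<in> cball x0 (2 * r)" using r by auto
        ultimately have "(u (x0 + r *\<^sub>R sgn (x - x0)) $ i)\<^sup>2 \<le> s\<^sup>2"
          using us sub u_nonneg by (intro power_mono) auto
        then show "indicator (ball x0 r) x * (u (x0 + r *\<^sub>R sgn (x - x0)) $ i)\<^sup>2 \<le> s\<^sup>2 * indicator (ball x0 r) x"
          by (simp add: indicator_def)
      qed simp
      also have "\<dots> = s\<^sup>2 * (r ^ ?N * ?\<omega>)" using measure_ball_scale[OF r(1), of x0] by simp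
      finally have "?N / r ^ ?N * tnorm x0 r i \<le> ?N / r ^ ?N * (s\<^sup>2 * (r ^ ?N * ?\<omega>))"
        using r by (intro mult_left_mono) auto
      also have "\<dots> = ?N * ?\<omega> * (2 * C)\<^sup>2 * ?p\<^sup>2" using r by (simp add: s_def power_mult_distrib)
      finally show ?thesis using 1 by (simp add: L_def algebra_simps)
    qed
    have "(local_norm \<Omega> u x0 r)\<^sup>2 \<le> (\<Sum>i::'k\<in>UNIV. L * ?p\<^sup>2)"
      unfolding local_norm_sq_parts[OF r(1) sub] by (intro sum_mono part)
    also have "\<dots> = (sqrt (CARD('k) * L) * ?p)\<^sup>2" using L0 by (simp add: power_mult_distrib)
    finally show "local_norm \<Omega> u x0 r \<le> sqrt (CARD('k) * L) * ?p"
      by (rule power2_le_imp_le) (use L0 in simp)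
  qed
qed


lemma two_nondegenerate:
  assumes "2 \<le> CARD('n)" "bounded \<Omega>"
  shows "two_nondegenerate \<Omega> u"
  unfolding two_nondegenerate_def
proof
  fix x0 assume "x0 \<in> nodal_set \<Omega> u"
  then have "x0 \<in> \<Omega>" by (simp add: nodal_set_def)
  then obtain \<delta> r0 where \<delta>: "\<delta> > 0" "r0 > 0" "\<And>r. 0 < r \<Longrightarrow> r < r0 \<Longrightarrow> \<delta> * r\<^sup>2 \<le> local_norm \<Omega> u x0 r"
    using nondegenerate[OF assms] by metis
  have "\<forall>\<^sub>F r in at_right 0. ereal \<delta> \<le> ereal (local_norm \<Omega> u x0 r / r\<^sup>2)"
    unfolding eventually_at_right_field using \<delta>(2,3) by (intro exI[of _ r0]) (simp add: pos_le_divide_eq)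
  then have "ereal \<delta> \<le> Liminf (at_right 0) (\<lambda>r. ereal (local_norm \<Omega> u x0 r / r\<^sup>2))"
    by (rule Liminf_bounded)
  then show "0 < Liminf (at_right 0) (\<lambda>r. ereal (local_norm \<Omega> u x0 r / r\<^sup>2))"
    using \<delta>(1) by (metis ereal_less(2) less_le_trans)
qed

lemma vanishing_order_ge_1:
  assumes N: "2 \<le> CARD('n)" and x0: "x0 \<in> nodal_set \<Omega> u"
  shows "1 \<le> vanishing_order \<Omega> u x0"
proof (rule dense_le_bounded[of 0])
  fix w :: ereal assume w: "0 < w" "w < 1"
  then obtain \<gamma> where \<gamma>: "w = ereal \<gamma>" "0 < \<gamma>" "\<gamma> < 1" by (cases w) auto
  obtain K r2 where K: "0 < r2" "\<And>r. 0 < r \<Longrightarrow> r \<le> r2 \<Longrightarrow> local_norm \<Omega> u x0 r \<le> K * r powr (1 - (1 - \<gamma>))"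
    by (rule local_norm_growth[OF N, of x0 "1 - \<gamma>"]) (use x0 \<gamma> in \<open>auto simp: nodal_set_def\<close>)
  have "\<forall>\<^sub>F r in at_right 0. ereal (local_norm \<Omega> u x0 r / r powr \<gamma>) \<le> ereal K"
    unfolding eventually_at_right_field using K by (intro exI[of _ r2]) (simp add: pos_divide_le_eq)
  then have "Limsup (at_right 0) (\<lambda>r. ereal (local_norm \<Omega> u x0 r / r powr \<gamma>)) \<le> ereal K"
    by (rule Limsup_bounded)
  also have "\<dots> < \<infinity>" by simp
  finally show "w \<le> vanishing_order \<Omega> u x0"
    unfolding vanishing_order_def using \<gamma> by (intro Sup_upper) blast
qed simp

lemma vanishing_order_le_2:
  assumes N: "2 \<le> CARD('n)" "bounded \<Omega>" and x0: "x0 \<in> nodal_set \<Omega> u"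
  shows "vanishing_order \<Omega> u x0 \<le> 2"
  unfolding vanishing_order_def
proof (rule Sup_least)
  fix w assume "w \<in> {ereal \<gamma> | \<gamma>. \<gamma> > 0 \<and> Limsup (at_right 0) (\<lambda>r. ereal (local_norm \<Omega> u x0 r / r powr \<gamma>)) < \<infinity>}"
  then obtain \<gamma> where \<gamma>: "w = ereal \<gamma>" "\<gamma> > 0" "Limsup (at_right 0) (\<lambda>r. ereal (local_norm \<Omega> u x0 r / r powr \<gamma>)) < \<infinity>"
    by blast
  have "x0 \<in> \<Omega>" using x0 by (simp add: nodal_set_def)
  then obtain \<delta> r0 where \<delta>: "\<delta> > 0" "r0 > 0" "\<And>r. 0 < r \<Longrightarrow> r < r0 \<Longrightarrow> \<delta> * r\<^sup>2 \<le> local_norm \<Omega> u x0 r"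
    using nondegenerate[OF N] by metis
  obtain K :: real where K: "Limsup (at_right 0) (\<lambda>r. ereal (local_norm \<Omega> u x0 r / r powr \<gamma>)) < ereal K"
    using \<gamma>(3) less_PInf_Ex_of_nat by (metis ereal_dense2)
  have "\<gamma> \<le> 2"
  proof (rule ccontr)
    assume "\<not> \<gamma> \<le> 2"
    then have g: "\<gamma> - 2 > 0" by simp
    have "\<forall>\<^sub>F r in at_right 0. ereal (local_norm \<Omega> u x0 r / r powr \<gamma>) < ereal K"
      by (rule Limsup_lessD[OF K])
    moreover have "\<forall>\<^sub>F r in at_right 0. 0 < r \<and> r < r0"
      unfolding eventually_at_right_field using \<delta>(2) by (intro exI[of _ r0]) simp
    ultimately have "\<forall>\<^sub>F r in at_right 0. \<delta> \<le> K * r powr (\<gamma> - 2)"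
    proof eventually_elim
      case (elim r)
      have "\<delta> * r\<^sup>2 \<le> K * r powr \<gamma>" using elim \<delta>(3)[of r] by (simp add: pos_divide_less_eq)
      also have "\<dots> = K * r powr (\<gamma> - 2) * r\<^sup>2"
        using elim powr_add[of r "\<gamma> - 2" 2] by (simp add: powr_numeral)
      finally show ?case using elim by simp
    qed
    moreover have "((\<lambda>r. K * r powr (\<gamma> - 2)) \<longlongrightarrow> K * 0) (at_right 0)"
    proof (intro tendsto_intros)
      show "((\<lambda>r::real. r powr (\<gamma> - 2)) \<longlongrightarrow> 0) (at_right 0)"
        using tendsto_powr'[of "\<lambda>r. r" 0 "at_right 0" "\<lambda>r. \<gamma> - 2" "\<gamma> - 2"] g
        by (auto simp: eventually_at_filter intro!: tendsto_intros)
    qed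
    ultimately have "\<delta> \<le> K * 0" by (intro tendsto_lowerbound[where F="at_right (0::real)"]) auto
    then show False using \<delta>(1) by simp
  qed
  then show "w \<le> 2" using \<gamma>(1) by simp
qed

lemma interior_nodal_set:
  assumes N: "2 \<le> CARD('n)" "bounded \<Omega>"
  shows "interior (nodal_set \<Omega> u) = {}"
proof (rule ccontr)
  assume "interior (nodal_set \<Omega> u) \<noteq> {}"
  then obtain x0 where x0: "x0 \<in> interior (nodal_set \<Omega> u)" by blast
  then obtain R where R: "R > 0" "cball x0 R \<subseteq> nodal_set \<Omega> u" unfolding mem_interior_cball by blast
  then have sub: "cball x0 R \<subseteq> \<Omega>" and z: "\<And>x. x \<in> cball x0 R \<Longrightarrow> u x = 0" by (auto simp: nodal_set_def)
  have "x0 \<in> \<Omega>" using sub R(1) by auto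
  then obtain \<delta> r0 where \<delta>: "\<delta> > 0" "r0 > 0" "\<And>r. 0 < r \<Longrightarrow> r < r0 \<Longrightarrow> \<delta> * r\<^sup>2 \<le> local_norm \<Omega> u x0 r"
    using nondegenerate[OF N] by metis
  define r where "r = min R r0 / 4"
  have r: "0 < r" "2 * r \<le> R" "r < r0" using R(1) \<delta>(2) by (auto simp: r_def)
  have sub2: "cball x0 (2 * r) \<subseteq> \<Omega>" using r by (intro order.trans[OF _ sub]) auto
  have g: "gnorm x0 r i = 0" for i
  proof -
    have "gnorm x0 (2 * r / 2) i \<le>
      exp (4 / 3) * measure lborel (ball (0::real^'n) 1) * (2 * CARD('n) + 72 + 3 * E) * ((0 / (2 * r))\<^sup>2 + 0) * (2 * r) ^ CARD('n)"
      using r z by (intro gnorm_caccioppoli[OF _ sub2]) auto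
    then show ?thesis using gnorm_nonneg[of x0 r i] by simp
  qed
  have "u (x0 + r *\<^sub>R sgn (x - x0)) = 0" for x
    using on_sphere_in_cball[OF r(1), of x0 x] r by (intro z) auto
  then have t: "tnorm x0 r i = 0" for i by (simp add: tnorm_def)
  have "cball x0 r \<subseteq> \<Omega>" using r by (intro order.trans[OF _ sub]) auto
  then have "(local_norm \<Omega> u x0 r)\<^sup>2 = 0" using local_norm_sq_parts[OF r(1)] g t by simp
  then have "\<delta> * r\<^sup>2 \<le> 0" using \<delta>(3)[OF r(1,3)] by simp
  moreover have "0 < \<delta> * r\<^sup>2" using \<delta>(1) r(1) by simp
  ultimately show False by linarith
qed

lemma nodal_set_eq_free_boundary:
  assumes N: "2 \<le> CARD('n)" "bounded \<Omega>"
  shows "nodal_set \<Omega> u = free_boundary \<Omega> u"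
proof -
  let ?P = "\<lambda>i. {x \<in> \<Omega>. u x $ i > 0}"
  have op: "open (?P i)" for i
  proof -
    have "open (\<Omega> \<inter> (\<lambda>x. u x $ i) -` {0<..})"
      using cont_nth open_dom by (auto intro: continuous_open_preimage)
    moreover have "\<Omega> \<inter> (\<lambda>x. u x $ i) -` {0<..} = ?P i" by auto
    ultimately show ?thesis by simp
  qed
  have "x \<in> free_boundary \<Omega> u" if x: "x \<in> nodal_set \<Omega> u" for x
  proof -
    have xO: "x \<in> \<Omega>" "u x = 0" using x by (auto simp: nodal_set_def)
    have "x \<in> closure (\<Union>i. ?P i)"
      unfolding closure_approachable
    proof (intro allI impI)
      fix e :: real assume e: "e > 0"
      obtain d where d: "d > 0" "ball x d \<subseteq> \<Omega>" using open_dom xO open_contains_ball by blast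
      have "\<not> ball x (min d e) \<subseteq> nodal_set \<Omega> u"
        using interior_nodal_set[OF N] interior_maximal[of "ball x (min d e)" "nodal_set \<Omega> u"] d e by auto
      then obtain y where "y \<in> ball x (min d e)" and y': "y \<notin> nodal_set \<Omega> u" by blast
      then have y: "dist x y < d" "dist x y < e" by auto
      then have yO: "y \<in> \<Omega>" using d(2) by auto
      then obtain i where "u y $ i \<noteq> 0" using y' by (auto simp: nodal_set_def vec_eq_iff)
      then have "y \<in> ?P i" using u_nonneg[OF yO, of i] yO by simp
      then show "\<exists>y\<in>(\<Union>i. ?P i). dist y x < e" using y(2) by (intro bexI[of _ y] UN_I) (auto simp: dist_commute)
    qed
    moreover have "closure (\<Union>i. ?P i) \<subseteq> (\<Union>i. closure (?P i))"
      by (intro closure_minimal UN_mono closure_subset closed_UN closed_closure) auto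
    ultimately have "x \<in> (\<Union>i. closure (?P i))" by blast
    then obtain i where "x \<in> closure (?P i)" by blast
    moreover have "x \<notin> ?P i" using xO by simp
    ultimately have "x \<in> frontier (?P i)" using interior_subset[of "?P i"] unfolding frontier_def by blast
    then show ?thesis using xO unfolding free_boundary_def by blast
  qed
  moreover have "x \<in> nodal_set \<Omega> u" if x: "x \<in> free_boundary \<Omega> u" for x
  proof -
    obtain i where i: "x \<in> frontier (?P i)" and xO: "x \<in> \<Omega>" using x unfolding free_boundary_def by blast
    have c: "x \<in> closure (?P i)" and n: "x \<notin> ?P i"
      using i op[of i] by (auto simp: frontier_def interior_open)
    have "u x $ j = 0" for j
    proof (rule ccontr)
      assume "u x $ j \<noteq> 0"
      then have pj: "x \<in> ?P j" using u_nonneg[OF xO, of j] xO by simp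
      then have "j \<noteq> i" using n by blast
      have "?P j \<inter> ?P i \<noteq> {}"
        using open_Int_closure_eq_empty[OF op, of j "?P i"] c pj by blast
      then obtain y where "y \<in> \<Omega>" "u y $ j > 0" "u y $ i > 0" by blast
      then show False using u_disjoint[of y i j] \<open>j \<noteq> i\<close> by auto
    qed
    then show ?thesis using xO by (simp add: nodal_set_def vec_eq_iff)
  qed
  ultimately show ?thesis by blast
qed

end

theorem theorem1p5:
  fixes \<Omega> :: "(real^'n::finite) set" and u :: "real^'n \<Rightarrow> real^'k::finite"
  assumes "CARD('n) \<ge> 2"
    and "bounded_smooth_domain \<Omega>"
    and "minimizer \<Omega> u"
    and "continuous_on \<Omega> u"
  shows "two_nondegenerate \<Omega> u \<and>
         (\<forall>x0\<in>nodal_set \<Omega> u. vanishing_order \<Omega> u x0 \<in> {1..2}) \<and>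
         interior (nodal_set \<Omega> u) = {} \<and>
         nodal_set \<Omega> u = free_boundary \<Omega> u"
proof -
  have o: "open \<Omega>" and b: "bounded \<Omega>" using assms(2) by (auto simp: bounded_smooth_domain_def)
  have "(\<lambda>x. u x $ i) \<in> H10 \<Omega>" for i
    using assms(3) by (simp add: minimizer_def admissible_def H10_Sigma_def)
  then have "\<exists>G. sob \<Omega> (\<lambda>x. u x $ i) G" for i
    using H10_imp_sob[OF o] by metis
  then obtain G where "\<And>i. sob \<Omega> (\<lambda>x. u x $ i) (G i)" by metis
  then interpret segregated_minimizer \<Omega> u G
    using o assms(3,4) by unfold_locales
  show ?thesis
    using two_nondegenerate interior_nodal_set nodal_set_eq_free_boundary vanishing_order_ge_1 vanishing_order_le_2
      assms(1) b by auto
qed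

end
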